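(* Let $\mathcal{A}$ be a $C^*$-algebra and let $\mathcal{I}$ be a closed (two-sided) ideal of $\mathcal{A}$. Let $\hat{\mathcal{A}}^{\mathcal{I}}=\{[\pi]\in\hat{\mathcal{A}} : \pi(\mathcal{I})\neq 0\}$. Then: (a) The uniform Kähler bundle $(\mathcal{P}(\mathcal{I}),p_{\mathcal{I}},\hat{\mathcal{I}})$ of $\mathcal{I}$ is uniformly Kähler isomorphic to the restriction $(\mathcal{P}(\mathcal{A}),p_{\mathcal{A}},\hat{\mathcal{A}})_{\hat{\mathcal{A}}^{\mathcal{I}}}$ of the uniform Kähler bundle of $\mathcal{A}$ to $\hat{\mathcal{A}}^{\mathcal{I}}$. (b) The uniform Kähler bundle $(\mathcal{P}(\mathcal{A}/\mathcal{I}),p_{\mathcal{A}/\mathcal{I}},\widehat{\mathcal{A}/\mathcal{I}})$ of the quotient $C^*$-algebra $\mathcal{A}/\mathcal{I}$ is uniformly Kähler isomorphic to the restriction $(\mathcal{P}(\mathcal{A}),p_{\mathcal{A}},\hat{\mathcal{A}})_{\hat{\mathcal{A}}\setminus\hat{\mathcal{A}}^{\mathcal{I}}}$.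
   Context: Hilbert spaces are complex, with inner product $\langle\cdot|\cdot\rangle$ conjugate-linear in the first variable. For a Hilbert space $\mathcal{H}$, $\mathcal{P}_{\mathcal{H}}$ is its projective space, whose elements are written $[x]$ with $x$ a unit vector; it is a Kähler (Hilbert) manifold with charts, for each unit vector $\xi$: $\mathcal{V}_\xi=\{[x]:\langle\xi|x\rangle\ne0\}$, $b_\xi([x])=x/\langle\xi|x\rangle-\xi\in\mathcal{H}_\xi:=\{\xi\}^\perp$, and with the Fubini–Study metric normalized so that the Kähler distance is $d_{\mathcal{H}}([x],[y])=\sqrt2\arccos|\langle x|y\rangle|$. For a $C^*$-algebra $\mathcal{A}$, $\mathcal{P}(\mathcal{A})$ is the set of pure states with the $w^*$-topology; $\hat{\mathcal{A}}$ is the spectrum (unitary equivalence classes $[\pi]$ of nonzero irreducible representations $\pi:\mathcal{A}\to\mathcal{L}(\mathcal{H}_\pi)$) with the Jacobson topology; $p_{\mathcal{A}}:\mathcal{P}(\mathcal{A})\to\hat{\mathcal{A}}$ sends a pure state to the class of its GNS representation. The fiber $\mathcal{P}_{\mathcal{A},[\pi]}:=p_{\mathcal{A}}^{-1}([\pi])$ carries the Kähler manifold structure making the bijection $\Phi_{\mathcal{A},[\pi]}:\mathcal{P}_{\mathcal{A},[\pi]}\to\mathcal{P}_{\mathcal{H}_\pi}$, $\omega\mapsto[x_\omega]$, a Kähler isomorphism, where $x_\omega\in\mathcal{H}_\pi$ is a unit vector with $\omega(a)=\langle x_\omega|\pi(a)x_\omega\rangle$ for all $a\in\mathcal{A}$.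 The triple $(\mathcal{P}(\mathcal{A}),p_{\mathcal{A}},\hat{\mathcal{A}})$ is the uniform Kähler bundle (UKB) of $\mathcal{A}$. For a bundle $(\mathcal{E},p,\mathcal{X})$ and $\mathcal{U}\subseteq\mathcal{X}$, the restriction $(\mathcal{E},p,\mathcal{X})_{\mathcal{U}}$ is the bundle $(p^{-1}(\mathcal{U}),p|_{p^{-1}(\mathcal{U})},\mathcal{U})$ (with subspace topologies and the same fibers). A uniform Kähler isomorphism between $(\mathcal{E},p,\mathcal{X})$ and $(\mathcal{E}',p',\mathcal{X}')$ is a pair of homeomorphisms $\psi:\mathcal{E}\to\mathcal{E}'$, $\phi:\mathcal{X}\to\mathcal{X}'$ with $p'\circ\psi=\phi\circ p$ and such that for every $x\in\mathcal{X}$ the restriction $\psi|_{p^{-1}(x)}:p^{-1}(x)\to(p')^{-1}(\phi(x))$ is a holomorphic Kähler isometry. *)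

theory Defs
  imports "HOL-Analysis.Analysis"
begin

section \<open>Complex vector spaces and Hilbert spaces with explicit carriers\<close>

text \<open>
  Ideals, quotients and the varying representation spaces are all needed at once, so the linear
  structures are records with a carrier set. Operations are only meaningful on the carrier.
\<close>

record 'a cspace =
  carr :: "'a set"
  vadd :: "'a \<Rightarrow> 'a \<Rightarrow> 'a"
  vzero :: 'a
  smul :: "complex \<Rightarrow> 'a \<Rightarrow> 'a"

definition vdiff :: "('a, 'm) cspace_scheme \<Rightarrow> 'a \<Rightarrow> 'a \<Rightarrow> 'a" where
  "vdiff V x y = vadd V x (smul V (-1) y)"

locale complex_vector_space =
  fixes V :: "('a, 'm) cspace_scheme"
  assumes add_closed: "\<lbrakk>x \<in> carr V; y \<in> carr V\<rbrakk> \<Longrightarrow> vadd V x y \<in> carr V"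
    and zero_closed: "vzero V \<in> carr V"
    and smul_closed: "x \<in> carr V \<Longrightarrow> smul V c x \<in> carr V"
    and add_assoc: "\<lbrakk>x \<in> carr V; y \<in> carr V; z \<in> carr V\<rbrakk>
          \<Longrightarrow> vadd V (vadd V x y) z = vadd V x (vadd V y z)"
    and add_commute: "\<lbrakk>x \<in> carr V; y \<in> carr V\<rbrakk> \<Longrightarrow> vadd V x y = vadd V y x"
    and add_zero: "x \<in> carr V \<Longrightarrow> vadd V x (vzero V) = x"
    and add_neg: "x \<in> carr V \<Longrightarrow> vadd V x (smul V (-1) x) = vzero V"
    and smul_add_right: "\<lbrakk>x \<in> carr V; y \<in> carr V\<rbrakk>
          \<Longrightarrow> smul V c (vadd V x y) = vadd V (smul V c x) (smul V c y)"
    and smul_add_left: "x \<in> carr V \<Longrightarrow> smul V (c + d) x = vadd V (smul V c x) (smul V d x)"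
    and smul_smul: "x \<in> carr V \<Longrightarrow> smul V c (smul V d x) = smul V (c * d) x"
    and smul_one: "x \<in> carr V \<Longrightarrow> smul V 1 x = x"

definition subspace_of :: "('a, 'm) cspace_scheme \<Rightarrow> 'a set \<Rightarrow> bool" where
  "subspace_of V W \<longleftrightarrow> W \<subseteq> carr V \<and> vzero V \<in> W \<and>
     (\<forall>x\<in>W. \<forall>y\<in>W. vadd V x y \<in> W) \<and> (\<forall>c. \<forall>x\<in>W. smul V c x \<in> W)"

definition linear_map :: "('a, 'm) cspace_scheme \<Rightarrow> ('b, 'n) cspace_scheme \<Rightarrow> ('a \<Rightarrow> 'b) \<Rightarrow> bool" where
  "linear_map V W f \<longleftrightarrow> (\<forall>x\<in>carr V. f x \<in> carr W) \<and>
     (\<forall>x\<in>carr V. \<forall>y\<in>carr V. f (vadd V x y) = vadd W (f x) (f y)) \<and>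
     (\<forall>c. \<forall>x\<in>carr V. f (smul V c x) = smul W c (f x))"

text \<open>
  The metric of a norm \<open>n\<close> on \<open>V\<close>; it is cut off outside the carrier because
  \<open>Metric_space\<close> requires symmetry and nonnegativity on the whole type.
\<close>

definition norm_dist :: "('a, 'm) cspace_scheme \<Rightarrow> ('a \<Rightarrow> real) \<Rightarrow> 'a \<Rightarrow> 'a \<Rightarrow> real" where
  "norm_dist V n x y = (if x \<in> carr V \<and> y \<in> carr V then n (vdiff V x y) else 0)"

definition norm_topology :: "('a, 'm) cspace_scheme \<Rightarrow> ('a \<Rightarrow> real) \<Rightarrow> 'a topology" where
  "norm_topology V n = Metric_space.mtopology (carr V) (norm_dist V n)"

definition norm_complete :: "('a, 'm) cspace_scheme \<Rightarrow> ('a \<Rightarrow> real) \<Rightarrow> bool" where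
  "norm_complete V n \<longleftrightarrow> Metric_space.mcomplete (carr V) (norm_dist V n)"

record 'h hilbert = "'h cspace" +
  inn :: "'h \<Rightarrow> 'h \<Rightarrow> complex"

definition hnorm :: "('h, 'm) hilbert_scheme \<Rightarrow> 'h \<Rightarrow> real" where
  "hnorm H x = sqrt (Re (inn H x x))"

locale hilbert_space = complex_vector_space H for H :: "'h hilbert" +
  assumes inn_add_right: "\<lbrakk>x \<in> carr H; y \<in> carr H; z \<in> carr H\<rbrakk>
          \<Longrightarrow> inn H x (vadd H y z) = inn H x y + inn H x z"
    and inn_smul_right: "\<lbrakk>x \<in> carr H; y \<in> carr H\<rbrakk> \<Longrightarrow> inn H x (smul H c y) = c * inn H x y"
    and inn_commute: "\<lbrakk>x \<in> carr H; y \<in> carr H\<rbrakk> \<Longrightarrow> inn H y x = cnj (inn H x y)"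
    and inn_nonneg: "x \<in> carr H \<Longrightarrow> 0 \<le> Re (inn H x x)"
    and inn_definite: "\<lbrakk>x \<in> carr H; inn H x x = 0\<rbrakk> \<Longrightarrow> x = vzero H"
    and complete: "norm_complete H (hnorm H)"

definition bounded_linear_map :: "'h hilbert \<Rightarrow> 'k hilbert \<Rightarrow> ('h \<Rightarrow> 'k) \<Rightarrow> bool" where
  "bounded_linear_map H K f \<longleftrightarrow> linear_map H K f \<and>
     (\<exists>B. \<forall>x\<in>carr H. hnorm K (f x) \<le> B * hnorm H x)"

definition unitary_map :: "'h hilbert \<Rightarrow> 'k hilbert \<Rightarrow> ('h \<Rightarrow> 'k) \<Rightarrow> bool" where
  "unitary_map H K u \<longleftrightarrow> linear_map H K u \<and> bij_betw u (carr H) (carr K) \<and>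
     (\<forall>x\<in>carr H. \<forall>y\<in>carr H. inn K (u x) (u y) = inn H x y)"

definition orth_compl :: "'h hilbert \<Rightarrow> 'h \<Rightarrow> 'h hilbert" where
  "orth_compl H \<xi> = H\<lparr>carr := {v \<in> carr H. inn H \<xi> v = 0}\<rparr>"


section \<open>C*-algebras, closed ideals and quotients\<close>

record 'a cstar = "'a cspace" +
  mul :: "'a \<Rightarrow> 'a \<Rightarrow> 'a"
  star :: "'a \<Rightarrow> 'a"
  nrm :: "'a \<Rightarrow> real"

text \<open>No unit is required, and the zero algebra is allowed.\<close>

locale cstar_algebra = complex_vector_space A for A :: "'a cstar" +
  assumes mul_closed: "\<lbrakk>x \<in> carr A; y \<in> carr A\<rbrakk> \<Longrightarrow> mul A x y \<in> carr A"
    and mul_assoc: "\<lbrakk>x \<in> carr A; y \<in> carr A; z \<in> carr A\<rbrakk>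
          \<Longrightarrow> mul A (mul A x y) z = mul A x (mul A y z)"
    and mul_add_left: "\<lbrakk>x \<in> carr A; y \<in> carr A; z \<in> carr A\<rbrakk>
          \<Longrightarrow> mul A (vadd A x y) z = vadd A (mul A x z) (mul A y z)"
    and mul_add_right: "\<lbrakk>x \<in> carr A; y \<in> carr A; z \<in> carr A\<rbrakk>
          \<Longrightarrow> mul A x (vadd A y z) = vadd A (mul A x y) (mul A x z)"
    and mul_smul_left: "\<lbrakk>x \<in> carr A; y \<in> carr A\<rbrakk> \<Longrightarrow> mul A (smul A c x) y = smul A c (mul A x y)"
    and mul_smul_right: "\<lbrakk>x \<in> carr A; y \<in> carr A\<rbrakk> \<Longrightarrow> mul A x (smul A c y) = smul A c (mul A x y)"
    and star_closed: "x \<in> carr A \<Longrightarrow> star A x \<in> carr A"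
    and star_star: "x \<in> carr A \<Longrightarrow> star A (star A x) = x"
    and star_add: "\<lbrakk>x \<in> carr A; y \<in> carr A\<rbrakk> \<Longrightarrow> star A (vadd A x y) = vadd A (star A x) (star A y)"
    and star_smul: "x \<in> carr A \<Longrightarrow> star A (smul A c x) = smul A (cnj c) (star A x)"
    and star_mul: "\<lbrakk>x \<in> carr A; y \<in> carr A\<rbrakk> \<Longrightarrow> star A (mul A x y) = mul A (star A y) (star A x)"
    and nrm_nonneg: "x \<in> carr A \<Longrightarrow> 0 \<le> nrm A x"
    and nrm_eq_0: "x \<in> carr A \<Longrightarrow> nrm A x = 0 \<longleftrightarrow> x = vzero A"
    and nrm_triangle: "\<lbrakk>x \<in> carr A; y \<in> carr A\<rbrakk> \<Longrightarrow> nrm A (vadd A x y) \<le> nrm A x + nrm A y"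
    and nrm_smul: "x \<in> carr A \<Longrightarrow> nrm A (smul A c x) = cmod c * nrm A x"
    and nrm_mul: "\<lbrakk>x \<in> carr A; y \<in> carr A\<rbrakk> \<Longrightarrow> nrm A (mul A x y) \<le> nrm A x * nrm A y"
    and nrm_cstar: "x \<in> carr A \<Longrightarrow> nrm A (mul A (star A x) x) = (nrm A x)\<^sup>2"
    and complete: "norm_complete A (nrm A)"

definition closed_ideal :: "'a cstar \<Rightarrow> 'a set \<Rightarrow> bool" where
  "closed_ideal A I \<longleftrightarrow> subspace_of A I \<and> closedin (norm_topology A (nrm A)) I \<and>
     (\<forall>a\<in>carr A. \<forall>x\<in>I. mul A a x \<in> I \<and> mul A x a \<in> I)"

definition ideal_algebra :: "'a cstar \<Rightarrow> 'a set \<Rightarrow> 'a cstar" where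
  "ideal_algebra A I = A\<lparr>carr := I\<rparr>"

definition coset :: "'a cstar \<Rightarrow> 'a set \<Rightarrow> 'a \<Rightarrow> 'a set" where
  "coset A I a = (\<lambda>i. vadd A a i) ` I"

text \<open>
  The operations are written as unions of cosets over all representatives, so that no
  representative has to be chosen; the norm is the quotient norm.
\<close>

definition quotient_algebra :: "'a cstar \<Rightarrow> 'a set \<Rightarrow> 'a set cstar" where
  "quotient_algebra A I = \<lparr>
     carr = coset A I ` carr A,
     vadd = (\<lambda>X Y. \<Union>x\<in>X. \<Union>y\<in>Y. coset A I (vadd A x y)),
     vzero = coset A I (vzero A),
     smul = (\<lambda>c X. \<Union>x\<in>X. coset A I (smul A c x)),
     mul = (\<lambda>X Y. \<Union>x\<in>X. \<Union>y\<in>Y. coset A I (mul A x y)),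
     star = (\<lambda>X. \<Union>x\<in>X. coset A I (star A x)),
     nrm = (\<lambda>X. INF x\<in>X. nrm A x)\<rparr>"


section \<open>Representations and the spectrum\<close>

record ('a, 'h) rep =
  rspace :: "'h hilbert"
  rop :: "'a \<Rightarrow> 'h \<Rightarrow> 'h"

definition representation :: "'a cstar \<Rightarrow> ('a, 'h) rep \<Rightarrow> bool" where
  "representation A \<pi> \<longleftrightarrow> hilbert_space (rspace \<pi>) \<and>
     (\<forall>a\<in>carr A. bounded_linear_map (rspace \<pi>) (rspace \<pi>) (rop \<pi> a)) \<and>
     (\<forall>a\<in>carr A. \<forall>b\<in>carr A. \<forall>x\<in>carr (rspace \<pi>).
        rop \<pi> (vadd A a b) x = vadd (rspace \<pi>) (rop \<pi> a x) (rop \<pi> b x)) \<and>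
     (\<forall>c. \<forall>a\<in>carr A. \<forall>x\<in>carr (rspace \<pi>).
        rop \<pi> (smul A c a) x = smul (rspace \<pi>) c (rop \<pi> a x)) \<and>
     (\<forall>a\<in>carr A. \<forall>b\<in>carr A. \<forall>x\<in>carr (rspace \<pi>).
        rop \<pi> (mul A a b) x = rop \<pi> a (rop \<pi> b x)) \<and>
     (\<forall>a\<in>carr A. \<forall>x\<in>carr (rspace \<pi>). \<forall>y\<in>carr (rspace \<pi>).
        inn (rspace \<pi>) (rop \<pi> (star A a) x) y = inn (rspace \<pi>) x (rop \<pi> a y))"

definition nonzero_on :: "'a set \<Rightarrow> ('a, 'h) rep \<Rightarrow> bool" where
  "nonzero_on S \<pi> \<longleftrightarrow> (\<exists>a\<in>S. \<exists>x\<in>carr (rspace \<pi>). rop \<pi> a x \<noteq> vzero (rspace \<pi>))"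

definition irreducible_rep :: "'a cstar \<Rightarrow> ('a, 'h) rep \<Rightarrow> bool" where
  "irreducible_rep A \<pi> \<longleftrightarrow> representation A \<pi> \<and> nonzero_on (carr A) \<pi> \<and>
     (\<forall>W. subspace_of (rspace \<pi>) W \<and>
          closedin (norm_topology (rspace \<pi>) (hnorm (rspace \<pi>))) W \<and>
          (\<forall>a\<in>carr A. rop \<pi> a ` W \<subseteq> W)
        \<longrightarrow> W = {vzero (rspace \<pi>)} \<or> W = carr (rspace \<pi>))"

definition unitarily_equivalent :: "'a cstar \<Rightarrow> ('a, 'h) rep \<Rightarrow> ('a, 'k) rep \<Rightarrow> bool" where
  "unitarily_equivalent A \<pi> \<sigma> \<longleftrightarrow>
     (\<exists>u. unitary_map (rspace \<pi>) (rspace \<sigma>) u \<and>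
          (\<forall>a\<in>carr A. \<forall>x\<in>carr (rspace \<pi>). u (rop \<pi> a x) = rop \<sigma> a (u x)))"

definition irrep_class :: "'a cstar \<Rightarrow> ('a, 'h) rep \<Rightarrow> ('a, 'h) rep set" where
  "irrep_class A \<pi> = {\<sigma>. irreducible_rep A \<sigma> \<and> unitarily_equivalent A \<pi> \<sigma>}"

text \<open>
  Representation spaces have to be taken from a fixed type that is large enough. For a C*-algebra
  with elements in \<open>'a\<close> the Hilbert spaces carried by subsets of \<open>'a \<Rightarrow> complex\<close> suffice: if \<open>\<xi>\<close>
  is a cyclic vector of \<open>\<pi>\<close>, then the linear map sending \<open>x\<close> to the function
  \<open>a \<mapsto> \<langle>\<pi>(a)\<xi>|x\<rangle>\<close> is injective, and transporting the structure along it gives a unitarily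
  equivalent representation in this type. Hence no irreducible or GNS representation is lost.
\<close>

type_synonym 'a std_rep = "('a, 'a \<Rightarrow> complex) rep"

definition spectrum :: "'a cstar \<Rightarrow> 'a std_rep set set" where
  "spectrum A = {irrep_class A \<pi> |\<pi>. irreducible_rep A \<pi>}"

definition spectrum_supp :: "'a cstar \<Rightarrow> 'a set \<Rightarrow> 'a std_rep set set" where
  "spectrum_supp A I = {irrep_class A \<pi> |\<pi>. irreducible_rep A \<pi> \<and> nonzero_on I \<pi>}"

definition rep_ker :: "'a cstar \<Rightarrow> ('a, 'h) rep \<Rightarrow> 'a set" where
  "rep_ker A \<pi> = {a \<in> carr A. \<forall>x\<in>carr (rspace \<pi>). rop \<pi> a x = vzero (rspace \<pi>)}"

definition class_ker :: "'a cstar \<Rightarrow> ('a, 'h) rep set \<Rightarrow> 'a set" where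
  "class_ker A c = rep_ker A (SOME \<pi>. \<pi> \<in> c)"

definition primitive_ideals :: "'a cstar \<Rightarrow> 'a set set" where
  "primitive_ideals A = {rep_ker A \<pi> |\<pi> :: 'a std_rep. irreducible_rep A \<pi>}"

text \<open>
  The closed sets of the hull-kernel topology are the hulls \<open>{P. S \<subseteq> P}\<close>; the Jacobson topology
  on the spectrum is the inverse image under \<open>[\<pi>] \<mapsto> ker \<pi>\<close>.
\<close>

definition hull_kernel_topology :: "'a cstar \<Rightarrow> 'a set topology" where
  "hull_kernel_topology A =
     topology_generated_by {primitive_ideals A - {P \<in> primitive_ideals A. S \<subseteq> P} |S. S \<subseteq> carr A}"

definition jacobson_topology :: "'a cstar \<Rightarrow> 'a std_rep set topology" where
  "jacobson_topology A = pullback_topology (spectrum A) (class_ker A) (hull_kernel_topology A)"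


section \<open>Pure states\<close>

text \<open>
  Functionals are extensional functions on the carrier, so that equality of functionals is
  equality of functions.
\<close>

definition state :: "'a cstar \<Rightarrow> ('a \<Rightarrow> complex) \<Rightarrow> bool" where
  "state A \<omega> \<longleftrightarrow> \<omega> \<in> extensional (carr A) \<and>
     (\<forall>a\<in>carr A. \<forall>b\<in>carr A. \<omega> (vadd A a b) = \<omega> a + \<omega> b) \<and>
     (\<forall>c. \<forall>a\<in>carr A. \<omega> (smul A c a) = c * \<omega> a) \<and>
     (\<forall>a\<in>carr A. \<omega> (mul A (star A a) a) \<in> \<real>\<^sub>\<ge>\<^sub>0) \<and>
     bdd_above {cmod (\<omega> a) |a. a \<in> carr A \<and> nrm A a \<le> 1} \<and>
     Sup {cmod (\<omega> a) |a. a \<in> carr A \<and> nrm A a \<le> 1} = 1"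

definition pure_states :: "'a cstar \<Rightarrow> ('a \<Rightarrow> complex) set" where
  "pure_states A = {\<omega>. state A \<omega> \<and>
     (\<forall>\<phi> \<psi> t. state A \<phi> \<and> state A \<psi> \<and> 0 < t \<and> t < (1::real) \<and>
        (\<forall>a\<in>carr A. \<omega> a = of_real t * \<phi> a + of_real (1 - t) * \<psi> a) \<longrightarrow> \<phi> = \<omega> \<and> \<psi> = \<omega>)}"

text \<open>The w*-topology is the topology of pointwise convergence on the algebra.\<close>

definition pure_state_topology :: "'a cstar \<Rightarrow> ('a \<Rightarrow> complex) topology" where
  "pure_state_topology A =
     subtopology (product_topology (\<lambda>a. euclidean) (carr A)) (pure_states A)"

text \<open>
  The GNS construction: the space is a completion of the quotient of \<open>A\<close> by the left kernel of
  \<open>\<omega>\<close>, with \<open>\<Lambda>\<close> the canonical map from \<open>A\<close>, and \<open>A\<close> acts by left multiplication. (The kernel of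
  \<open>\<Lambda>\<close> is the left kernel of \<open>\<omega>\<close> by the inner product formula.)
\<close>

definition gns_rep :: "'a cstar \<Rightarrow> ('a \<Rightarrow> complex) \<Rightarrow> ('a, 'h) rep \<Rightarrow> bool" where
  "gns_rep A \<omega> \<pi> \<longleftrightarrow> representation A \<pi> \<and>
     (\<exists>\<Lambda>. linear_map A (rspace \<pi>) \<Lambda> \<and>
        norm_topology (rspace \<pi>) (hnorm (rspace \<pi>)) closure_of (\<Lambda> ` carr A) = carr (rspace \<pi>) \<and>
        (\<forall>a\<in>carr A. \<forall>b\<in>carr A. inn (rspace \<pi>) (\<Lambda> a) (\<Lambda> b) = \<omega> (mul A (star A a) b)) \<and>
        (\<forall>a\<in>carr A. \<forall>b\<in>carr A. rop \<pi> a (\<Lambda> b) = \<Lambda> (mul A a b)))"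

definition gns_class :: "'a cstar \<Rightarrow> ('a \<Rightarrow> complex) \<Rightarrow> 'a std_rep set" where
  "gns_class A \<omega> = irrep_class A (SOME \<pi>. gns_rep A \<omega> \<pi>)"


section \<open>Kaehler manifolds and their isometries\<close>

text \<open>
  A Kaehler (Hilbert) manifold is given by its points and an atlas. A chart maps its domain onto an
  open subset of a model Hilbert space and carries the coordinate expression of the hermitian metric:
  \<open>cmetric c z v w\<close> is the value at the point with coordinate \<open>z\<close> on the tangent vectors \<open>v\<close>, \<open>w\<close>,
  conjugate-linear in \<open>v\<close>. Its real part is the Riemannian metric and its imaginary part the
  Kaehler form.
\<close>

record ('p, 'h) chart =
  cdom :: "'p set"
  cmap :: "'p \<Rightarrow> 'h"
  cmodel :: "'h hilbert"
  cmetric :: "'h \<Rightarrow> 'h \<Rightarrow> 'h \<Rightarrow> complex"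

record ('p, 'h) kaehler_manifold =
  points :: "'p set"
  atlas :: "('p, 'h) chart set"

text \<open>
  \<open>L\<close> is the complex Frechet derivative at \<open>cmap c p\<close> of the coordinate expression of \<open>f\<close>
  with respect to the charts \<open>c\<close> and \<open>d\<close>.
\<close>

definition chart_derivative ::
  "('p, 'h) chart \<Rightarrow> ('q, 'k) chart \<Rightarrow> ('p \<Rightarrow> 'q) \<Rightarrow> 'p \<Rightarrow> ('h \<Rightarrow> 'k) \<Rightarrow> bool" where
  "chart_derivative c d f p L \<longleftrightarrow> bounded_linear_map (cmodel c) (cmodel d) L \<and>
     (\<forall>\<epsilon>>0. \<exists>\<delta>>0. \<forall>h\<in>carr (cmodel c). hnorm (cmodel c) h < \<delta> \<longrightarrow>
        (\<exists>q\<in>cdom c. f q \<in> cdom d \<and> cmap c q = vadd (cmodel c) (cmap c p) h \<and>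
           hnorm (cmodel d) (vdiff (cmodel d) (vdiff (cmodel d) (cmap d (f q)) (cmap d (f p))) (L h))
             \<le> \<epsilon> * hnorm (cmodel c) h))"

definition holomorphic_map ::
  "('p, 'h) kaehler_manifold \<Rightarrow> ('q, 'k) kaehler_manifold \<Rightarrow> ('p \<Rightarrow> 'q) \<Rightarrow> bool" where
  "holomorphic_map M N f \<longleftrightarrow> (\<forall>p\<in>points M. f p \<in> points N \<and>
     (\<forall>c\<in>atlas M. \<forall>d\<in>atlas N. p \<in> cdom c \<and> f p \<in> cdom d \<longrightarrow> (\<exists>L. chart_derivative c d f p L)))"

definition holomorphic_kaehler_isometry ::
  "('p, 'h) kaehler_manifold \<Rightarrow> ('q, 'k) kaehler_manifold \<Rightarrow> ('p \<Rightarrow> 'q) \<Rightarrow> bool" where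
  "holomorphic_kaehler_isometry M N f \<longleftrightarrow>
     bij_betw f (points M) (points N) \<and>
     holomorphic_map M N f \<and> holomorphic_map N M (inv_into (points M) f) \<and>
     (\<forall>p\<in>points M. \<forall>c\<in>atlas M. \<forall>d\<in>atlas N. \<forall>L. p \<in> cdom c \<and> f p \<in> cdom d \<and> chart_derivative c d f p L \<longrightarrow>
        (\<forall>v\<in>carr (cmodel c). \<forall>w\<in>carr (cmodel c).
           cmetric d (cmap d (f p)) (L v) (L w) = cmetric c (cmap c p) v w))"


section \<open>Projective Hilbert space\<close>

definition unit_vectors :: "'h hilbert \<Rightarrow> 'h set" where
  "unit_vectors H = {x \<in> carr H. hnorm H x = 1}"

definition ray :: "'h hilbert \<Rightarrow> 'h \<Rightarrow> 'h set" where
  "ray H x = {smul H c x |c. cmod c = 1}"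

definition proj_chart_map :: "'h hilbert \<Rightarrow> 'h \<Rightarrow> 'h set \<Rightarrow> 'h" where
  "proj_chart_map H \<xi> r = (let x = (SOME x. x \<in> r) in vdiff H (smul H (inverse (inn H \<xi> x)) x) \<xi>)"

text \<open>
  The Fubini-Study metric in the chart \<open>b_\<xi>\<close>. At the centre \<open>z = 0\<close> it is \<open>2\<langle>v|w\<rangle>\<close>; the
  factor 2 makes the Kaehler distance \<open>\<surd>2 arccos |\<langle>x|y\<rangle>|\<close>, without it the
  distance is \<open>arccos |\<langle>x|y\<rangle>|\<close>.
\<close>

definition fubini_study :: "'h hilbert \<Rightarrow> 'h \<Rightarrow> 'h \<Rightarrow> 'h \<Rightarrow> complex" where
  "fubini_study H z v w =
     2 * (inn H v w / of_real (1 + (hnorm H z)\<^sup>2)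
          - inn H v z * inn H z w / of_real ((1 + (hnorm H z)\<^sup>2)\<^sup>2))"

definition proj_chart :: "'h hilbert \<Rightarrow> 'h \<Rightarrow> ('h set, 'h) chart" where
  "proj_chart H \<xi> = \<lparr>
     cdom = {ray H x |x. x \<in> unit_vectors H \<and> inn H \<xi> x \<noteq> 0},
     cmap = proj_chart_map H \<xi>,
     cmodel = orth_compl H \<xi>,
     cmetric = fubini_study H\<rparr>"

definition projective_space :: "'h hilbert \<Rightarrow> ('h set, 'h) kaehler_manifold" where
  "projective_space H = \<lparr>
     points = ray H ` unit_vectors H,
     atlas = proj_chart H ` unit_vectors H\<rparr>"


section \<open>The uniform Kaehler bundle of a C*-algebra\<close>

record ('e, 'x, 'h) kaehler_bundle =
  total :: "'e topology"
  base :: "'x topology"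
  proj :: "'e \<Rightarrow> 'x"
  fiber :: "'x \<Rightarrow> ('e, 'h) kaehler_manifold"

definition restrict_bundle :: "('e, 'x, 'h) kaehler_bundle \<Rightarrow> 'x set \<Rightarrow> ('e, 'x, 'h) kaehler_bundle" where
  "restrict_bundle B U = \<lparr>
     total = subtopology (total B) {e \<in> topspace (total B). proj B e \<in> U},
     base = subtopology (base B) U,
     proj = proj B,
     fiber = fiber B\<rparr>"

definition uniform_kaehler_isomorphism ::
  "('e, 'x, 'h) kaehler_bundle \<Rightarrow> ('f, 'y, 'k) kaehler_bundle \<Rightarrow> ('e \<Rightarrow> 'f) \<Rightarrow> ('x \<Rightarrow> 'y) \<Rightarrow> bool" where
  "uniform_kaehler_isomorphism B C \<psi> \<phi> \<longleftrightarrow>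
     homeomorphic_map (total B) (total C) \<psi> \<and>
     homeomorphic_map (base B) (base C) \<phi> \<and>
     (\<forall>e\<in>topspace (total B). proj C (\<psi> e) = \<phi> (proj B e)) \<and>
     (\<forall>x\<in>topspace (base B). holomorphic_kaehler_isometry (fiber B x) (fiber C (\<phi> x)) \<psi>)"

definition uniformly_kaehler_isomorphic ::
  "('e, 'x, 'h) kaehler_bundle \<Rightarrow> ('f, 'y, 'k) kaehler_bundle \<Rightarrow> bool" where
  "uniformly_kaehler_isomorphic B C \<longleftrightarrow> (\<exists>\<psi> \<phi>. uniform_kaehler_isomorphism B C \<psi> \<phi>)"

definition ray_of_state :: "'a cstar \<Rightarrow> ('a, 'h) rep \<Rightarrow> ('a \<Rightarrow> complex) \<Rightarrow> 'h set" where
  "ray_of_state A \<pi> \<omega> = ray (rspace \<pi>)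
     (SOME x. x \<in> unit_vectors (rspace \<pi>) \<and> (\<forall>a\<in>carr A. \<omega> a = inn (rspace \<pi>) x (rop \<pi> a x)))"

text \<open>
  The atlas of the fiber over \<open>c = [\<pi>]\<close> is the pull-back of the atlas of projective space along
  \<open>ray_of_state A \<pi>\<close>. The resulting Kaehler structure does not depend on the representative \<open>\<pi>\<close>
  of \<open>c\<close>; the charts coming from all representatives are collected instead of choosing one.
\<close>

definition pure_state_fiber ::
  "'a cstar \<Rightarrow> 'a std_rep set \<Rightarrow> ('a \<Rightarrow> complex, 'a \<Rightarrow> complex) kaehler_manifold" where
  "pure_state_fiber A c =
     (let F = {\<omega> \<in> pure_states A. gns_class A \<omega> = c} in \<lparr>
       points = F,
       atlas = {\<lparr>cdom = {\<omega> \<in> F. ray_of_state A \<pi> \<omega> \<in> cdom b},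
                 cmap = cmap b \<circ> ray_of_state A \<pi>,
                 cmodel = cmodel b,
                 cmetric = cmetric b\<rparr> |\<pi> b. \<pi> \<in> c \<and> b \<in> atlas (projective_space (rspace \<pi>))}\<rparr>)"

definition ukb ::
  "'a cstar \<Rightarrow> ('a \<Rightarrow> complex, 'a std_rep set, 'a \<Rightarrow> complex) kaehler_bundle" where
  "ukb A = \<lparr>
     total = pure_state_topology A,
     base = jacobson_topology A,
     proj = gns_class A,
     fiber = pure_state_fiber A\<rparr>"

end

theory Submission
  imports Defs
begin

text \<open>
  Every pure state is a vector state of an irreducible representation, unique up to unitary
  equivalence and the choice of a unit vector in a ray. An irreducible representation of \<open>A\<close> that does
  not vanish on \<open>I\<close> restricts to an irreducible representation of \<open>I\<close> on the same space, and every
  irreducible representation of \<open>I\<close> extends to \<open>A\<close>; the irreducible representations that vanish on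
  \<open>I\<close> are those of the quotient. As the representation spaces do not change, vector states
  correspond to vector states over the same rays, and in the charts of projective space the
  correspondence of fibers is a unitary map followed by a change of chart. For the ideal,
  w*-continuity of the extension of states is the one point that is not formal: if \<open>\<omega>(e)\<close> is close to 1
  for some \<open>e\<close> in the unit ball of \<open>I\<close>, then \<open>\<omega>(a)\<close> is close to \<open>\<omega>(ae)\<close> for all
  \<open>a\<close> in the unit ball of \<open>A\<close>, and \<open>ae\<close> lies in \<open>I\<close>.
\<close>

section \<open>Vectors, norms and Hilbert spaces\<close>

text \<open>Two devices take the place of functional calculus; no unit is adjoined and no spectrum
  of an element is formed. Left multiplication by 1 + ch, with \<open>h\<close> self-adjoint and
  \<open>c\<close> imaginary, is inverted by continuation in \<open>c\<close>; this yields one-sided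
  approximate units and the self-adjointness of closed ideals. The iteration for 1 - sqrt (1 - X)
  yields |S|, hence Schur's lemma, and writes the defect of a contraction as
  \<open>mul A (star A d) d\<close>, hence the contractivity of positive functionals and of
  representations.

  Extension by continuity from dense subspaces is avoided as well: unitaries, adjoints and extended
  operators are defined weakly through the Riesz theorem and compared on sets with trivial
  orthogonal complement.

  The quotient is handled through \<open>A\<close>: its pure states and irreducible representations
  are those of \<open>A\<close> that vanish on \<open>I\<close>, and this supplies the interface
  \<open>pure_state_alg\<close>. As representations of the quotient have spaces of another type, the
  correspondence of representations carries a unitary instead of an equality of spaces.\<close>

context complex_vector_space
begin

lemma diff_closed: "\<lbrakk>x \<in> carr V; y \<in> carr V\<rbrakk> \<Longrightarrow> vdiff V x y \<in> carr V"
  by (simp add: vdiff_def add_closed smul_closed)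

lemmas closed [simp, intro] = add_closed zero_closed smul_closed diff_closed

lemma zero_add: "x \<in> carr V \<Longrightarrow> vadd V (vzero V) x = x"
  by (metis add_commute add_zero zero_closed)

lemma add_left_commute:
  "\<lbrakk>x \<in> carr V; y \<in> carr V; z \<in> carr V\<rbrakk> \<Longrightarrow> vadd V x (vadd V y z) = vadd V y (vadd V x z)"
  by (metis add_assoc add_commute)

lemma smul_0_left: "x \<in> carr V \<Longrightarrow> smul V 0 x = vzero V"
  using smul_add_left[of x 1 "-1"] by (simp add: smul_one add_neg)

lemma smul_0_right: "smul V c (vzero V) = vzero V"
  by (metis smul_0_left smul_smul mult_zero_right zero_closed)

lemmas zero_simps [simp] = add_zero zero_add smul_0_left smul_0_right smul_one

lemma diff_self [simp]: "x \<in> carr V \<Longrightarrow> vdiff V x x = vzero V"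
  by (simp add: vdiff_def add_neg)

lemma diff_zero [simp]: "x \<in> carr V \<Longrightarrow> vdiff V x (vzero V) = x"
  by (simp add: vdiff_def)

lemma add_neg_left:
  "\<lbrakk>x \<in> carr V; y \<in> carr V\<rbrakk> \<Longrightarrow> vadd V x (vadd V (smul V (-1) x) y) = y"
  by (simp add: add_assoc[symmetric] add_neg)

lemma diff_add_cancel [simp]: "\<lbrakk>x \<in> carr V; y \<in> carr V\<rbrakk> \<Longrightarrow> vadd V (vdiff V x y) y = x"
  by (metis vdiff_def add_commute add_neg_left add_left_commute smul_closed add_closed)

lemma add_diff_cancel [simp]: "\<lbrakk>x \<in> carr V; y \<in> carr V\<rbrakk> \<Longrightarrow> vdiff V (vadd V x y) y = x"
  by (simp add: vdiff_def add_assoc add_neg)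

lemma add_diff_cancel_left [simp]: "\<lbrakk>x \<in> carr V; y \<in> carr V\<rbrakk> \<Longrightarrow> vdiff V (vadd V x y) x = y"
  by (metis add_diff_cancel add_commute)

lemma diff_eq_zero: "\<lbrakk>x \<in> carr V; y \<in> carr V\<rbrakk> \<Longrightarrow> vdiff V x y = vzero V \<longleftrightarrow> x = y"
  by (metis diff_add_cancel diff_self zero_add)

lemma diff_eq_iff: "\<lbrakk>x \<in> carr V; y \<in> carr V; z \<in> carr V\<rbrakk> \<Longrightarrow> vdiff V x y = z \<longleftrightarrow> x = vadd V z y"
  by auto

lemma neg_diff: "\<lbrakk>x \<in> carr V; y \<in> carr V\<rbrakk> \<Longrightarrow> smul V (-1) (vdiff V x y) = vdiff V y x"
  by (simp add: vdiff_def smul_add_right smul_smul add_commute)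

lemma diff_diff_add:
  "\<lbrakk>x \<in> carr V; y \<in> carr V; z \<in> carr V\<rbrakk> \<Longrightarrow> vadd V (vdiff V x y) (vdiff V y z) = vdiff V x z"
  by (metis diff_add_cancel diff_closed add_assoc diff_eq_iff add_closed)

lemma diff_add_add:
  "\<lbrakk>x \<in> carr V; y \<in> carr V; x' \<in> carr V; y' \<in> carr V\<rbrakk> \<Longrightarrow>
   vdiff V (vadd V x y) (vadd V x' y') = vadd V (vdiff V x x') (vdiff V y y')"
  by (simp add: vdiff_def smul_add_right add_assoc add_left_commute)

lemma diff_diff_cancel_left:
  "\<lbrakk>a \<in> carr V; x \<in> carr V; y \<in> carr V\<rbrakk> \<Longrightarrow> vdiff V (vdiff V a x) (vdiff V a y) = vdiff V y x"
  using diff_add_add[of a "smul V (-1) x" a "smul V (-1) y"]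
  by (simp add: vdiff_def[of V a] vdiff_def[of V "smul V (- 1) x"] smul_smul)
    (simp add: vdiff_def add_commute add_neg)

lemma smul_diff: "\<lbrakk>x \<in> carr V; y \<in> carr V\<rbrakk> \<Longrightarrow> smul V c (vdiff V x y) = vdiff V (smul V c x) (smul V c y)"
  by (simp add: vdiff_def smul_add_right smul_smul)

end

lemma linear_map_closed: "\<lbrakk>linear_map V W f; x \<in> carr V\<rbrakk> \<Longrightarrow> f x \<in> carr W"
  and linear_map_add: "\<lbrakk>linear_map V W f; x \<in> carr V; y \<in> carr V\<rbrakk> \<Longrightarrow> f (vadd V x y) = vadd W (f x) (f y)"
  and linear_map_smul: "\<lbrakk>linear_map V W f; x \<in> carr V\<rbrakk> \<Longrightarrow> f (smul V c x) = smul W c (f x)"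
  by (auto simp: linear_map_def)

lemma linear_map_diff:
  "\<lbrakk>complex_vector_space V; linear_map V W f; x \<in> carr V; y \<in> carr V\<rbrakk>
   \<Longrightarrow> f (vdiff V x y) = vdiff W (f x) (f y)"
  by (simp add: vdiff_def linear_map_add linear_map_smul complex_vector_space.smul_closed)

lemma linear_map_zero:
  "\<lbrakk>complex_vector_space V; complex_vector_space W; linear_map V W f\<rbrakk> \<Longrightarrow> f (vzero V) = vzero W"
  by (metis complex_vector_space.smul_0_left complex_vector_space.zero_closed linear_map_closed linear_map_smul)

lemma subspace_vector_space:
  assumes "complex_vector_space V" "subspace_of V W"
  shows "complex_vector_space (V\<lparr>carr := W\<rparr>)"
proof -
  interpret complex_vector_space V by fact
  show ?thesis
    using assms(2)
    by unfold_locales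
      (auto simp: subspace_of_def subset_iff add_assoc add_neg smul_add_right
        smul_add_left smul_smul intro: add_commute)
qed

text \<open>Instantiated by algebra norms, Hilbert norms and the completion of a semi-inner product,
  so that sequential closedness, the square root iteration and the contraction principle are each
  argued once.\<close>

locale normed_cspace = complex_vector_space V for V :: "('a, 'm) cspace_scheme" +
  fixes n :: "'a \<Rightarrow> real"
  assumes n_nonneg: "x \<in> carr V \<Longrightarrow> 0 \<le> n x"
    and n_eq_0: "x \<in> carr V \<Longrightarrow> n x = 0 \<longleftrightarrow> x = vzero V"
    and n_triangle: "\<lbrakk>x \<in> carr V; y \<in> carr V\<rbrakk> \<Longrightarrow> n (vadd V x y) \<le> n x + n y"
    and n_smul: "x \<in> carr V \<Longrightarrow> n (smul V c x) = cmod c * n x"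
begin

lemma n_zero [simp]: "n (vzero V) = 0"
  using n_eq_0 by blast

lemma n_diff_commute: "\<lbrakk>x \<in> carr V; y \<in> carr V\<rbrakk> \<Longrightarrow> n (vdiff V x y) = n (vdiff V y x)"
  using n_smul[of "vdiff V x y" "-1"] by (simp add: neg_diff)

lemma n_diff_triangle:
  "\<lbrakk>x \<in> carr V; y \<in> carr V; z \<in> carr V\<rbrakk> \<Longrightarrow> n (vdiff V x z) \<le> n (vdiff V x y) + n (vdiff V y z)"
  using n_triangle[of "vdiff V x y" "vdiff V y z"] by (simp add: diff_diff_add)

lemma n_diff_le: "\<lbrakk>x \<in> carr V; y \<in> carr V\<rbrakk> \<Longrightarrow> n (vdiff V x y) \<le> n x + n y"
  using n_triangle[of x "smul V (-1) y"] by (simp add: vdiff_def n_smul)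

lemma n_le_diff: "\<lbrakk>x \<in> carr V; y \<in> carr V\<rbrakk> \<Longrightarrow> n x \<le> n y + n (vdiff V x y)"
  using n_triangle[of "vdiff V x y" y] by simp

lemma n_diff_eq_0: "\<lbrakk>x \<in> carr V; y \<in> carr V\<rbrakk> \<Longrightarrow> n (vdiff V x y) = 0 \<longleftrightarrow> x = y"
  by (simp add: n_eq_0 diff_eq_zero)

lemma eq_by_small:
  assumes "x \<in> carr V" "y \<in> carr V" "\<And>e. e > 0 \<Longrightarrow> n (vdiff V x y) \<le> e"
  shows "x = y"
  using assms n_diff_eq_0[of x y] n_nonneg[of "vdiff V x y"]
  by (metis diff_closed field_le_epsilon add.left_neutral antisym)

lemma metric: "Metric_space (carr V) (norm_dist V n)"
  by unfold_locales
    (auto simp: norm_dist_def n_nonneg n_diff_commute n_diff_eq_0 n_diff_triangle)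

sublocale Metric_space "carr V" "norm_dist V n"
  by (rule metric)

lemma limitin_iff:
  assumes "\<And>k. x k \<in> carr V"
  shows "limitin mtopology x l sequentially \<longleftrightarrow> l \<in> carr V \<and> (\<lambda>k. n (vdiff V (x k) l)) \<longlonglongrightarrow> 0"
  using assms by (auto simp: limitin_metric_dist_null norm_dist_def)

lemma complete_lim:
  assumes "norm_complete V n" "\<And>k. x k \<in> carr V"
    and "\<And>e. e > 0 \<Longrightarrow> \<exists>N. \<forall>i\<ge>N. \<forall>j\<ge>N. n (vdiff V (x i) (x j)) < e"
  shows "\<exists>l\<in>carr V. (\<lambda>k. n (vdiff V (x k) l)) \<longlonglongrightarrow> 0"
proof -
  have "MCauchy x"
    using assms(2,3) by (auto simp: MCauchy_def norm_dist_def)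
  then show ?thesis
    using assms(1) limitin_iff[of x, OF assms(2)] unfolding norm_complete_def mcomplete_def by blast
qed

lemma completeI:
  assumes "\<And>x. \<lbrakk>\<And>k. x k \<in> carr V; \<And>e. e > 0 \<Longrightarrow> \<exists>N. \<forall>i\<ge>N. \<forall>j\<ge>N. n (vdiff V (x i) (x j)) < e\<rbrakk>
     \<Longrightarrow> \<exists>l\<in>carr V. (\<lambda>k. n (vdiff V (x k) l)) \<longlonglongrightarrow> 0"
  shows "norm_complete V n"
  unfolding norm_complete_def mcomplete_def
proof (intro allI impI)
  fix x assume x: "MCauchy x"
  then have c: "x k \<in> carr V" for k
    by (auto simp: MCauchy_def)
  have "\<exists>l\<in>carr V. (\<lambda>k. n (vdiff V (x k) l)) \<longlonglongrightarrow> 0"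
    using x by (intro assms c) (auto simp: MCauchy_def norm_dist_def c)
  then show "\<exists>l. limitin mtopology x l sequentially"
    using limitin_iff[of x] c by auto
qed

lemma closedin_iff_seq:
  "closedin (norm_topology V n) W \<longleftrightarrow> W \<subseteq> carr V \<and>
     (\<forall>x l. (\<forall>k. x k \<in> W) \<and> l \<in> carr V \<and> (\<lambda>k. n (vdiff V (x k) l)) \<longlonglongrightarrow> 0 \<longrightarrow> l \<in> W)"
proof -
  have *: "range x \<subseteq> W \<and> limitin mtopology x l sequentially \<longleftrightarrow>
      (\<forall>k. x k \<in> W) \<and> l \<in> carr V \<and> (\<lambda>k. n (vdiff V (x k) l)) \<longlonglongrightarrow> 0" if "W \<subseteq> carr V" for x l
    using limitin_iff[of x l] that by (auto simp: image_subset_iff subset_iff)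
  show ?thesis
    unfolding norm_topology_def metric_closedin_iff_sequentially_closed
    using * by blast
qed

lemma closure_of_iff:
  assumes "S \<subseteq> carr V"
  shows "norm_topology V n closure_of S = {x \<in> carr V. \<forall>e>0. \<exists>y\<in>S. n (vdiff V x y) < e}"
  using assms
  by (force simp: norm_topology_def metric_closure_of norm_dist_def subset_iff)

lemma closed_approx:
  assumes "closedin (norm_topology V n) W" "x \<in> carr V" "\<And>e. e > 0 \<Longrightarrow> \<exists>y\<in>W. n (vdiff V x y) < e"
  shows "x \<in> W"
proof -
  have "W \<subseteq> carr V" using assms(1) closedin_iff_seq by blast
  then show ?thesis
    using closure_of_iff[of W] assms closure_of_closedin[OF assms(1)] by blast
qed

lemma closed_complete:
  assumes "norm_complete V n" "closedin (norm_topology V n) W" "subspace_of V W"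
  shows "norm_complete (V\<lparr>carr := W\<rparr>) n"
proof -
  interpret W: normed_cspace "V\<lparr>carr := W\<rparr>" n
    using subspace_vector_space[OF complex_vector_space_axioms assms(3)] assms(3)
    by (auto simp: normed_cspace_def normed_cspace_axioms_def subspace_of_def subset_iff
        n_nonneg n_eq_0 n_triangle n_smul)
  have sub: "W \<subseteq> carr V" using assms(3) by (simp add: subspace_of_def)
  have d: "vdiff (V\<lparr>carr := W\<rparr>) = vdiff V" by (simp add: vdiff_def fun_eq_iff)
  show ?thesis
  proof (rule W.completeI)
    fix x :: "nat \<Rightarrow> 'a" assume x: "\<And>k. x k \<in> carr (V\<lparr>carr := W\<rparr>)"
      and c: "\<And>e. e > 0 \<Longrightarrow> \<exists>N. \<forall>i\<ge>N. \<forall>j\<ge>N. n (vdiff (V\<lparr>carr := W\<rparr>) (x i) (x j)) < e"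
    have "x k \<in> carr V" for k using x sub by auto
    with c obtain l where "l \<in> carr V" "(\<lambda>k. n (vdiff V (x k) l)) \<longlonglongrightarrow> 0"
      using complete_lim[OF assms(1), of x] unfolding d by blast
    moreover then have "l \<in> W"
      using assms(2) x by (auto simp: closedin_iff_seq)
    ultimately show "\<exists>l\<in>carr (V\<lparr>carr := W\<rparr>). (\<lambda>k. n (vdiff (V\<lparr>carr := W\<rparr>) (x k) l)) \<longlonglongrightarrow> 0"
      by (auto simp: d)
  qed
qed

end

text \<open>Degenerate forms are the point: besides inner products this covers
  \<open>\<omega> (mul A (star A a) b)\<close> for a state and \<open>inn H v (X w)\<close> for a
  positive operator \<open>X\<close>, and several arguments below are Cauchy-Schwarz for one of
  these.\<close>

locale psd_form = complex_vector_space V for V :: "('a, 'm) cspace_scheme" +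
  fixes s :: "'a \<Rightarrow> 'a \<Rightarrow> complex"
  assumes s_add_right: "\<lbrakk>x \<in> carr V; y \<in> carr V; z \<in> carr V\<rbrakk> \<Longrightarrow> s x (vadd V y z) = s x y + s x z"
    and s_smul_right: "\<lbrakk>x \<in> carr V; y \<in> carr V\<rbrakk> \<Longrightarrow> s x (smul V c y) = c * s x y"
    and s_commute: "\<lbrakk>x \<in> carr V; y \<in> carr V\<rbrakk> \<Longrightarrow> s y x = cnj (s x y)"
    and s_nonneg: "x \<in> carr V \<Longrightarrow> 0 \<le> Re (s x x)"
begin

lemma s_add_left: "\<lbrakk>x \<in> carr V; y \<in> carr V; z \<in> carr V\<rbrakk> \<Longrightarrow> s (vadd V y z) x = s y x + s z x"
  using s_commute[of x "vadd V y z"] s_commute[of x y] s_commute[of x z]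
  by (simp add: s_add_right)

lemma s_smul_left: "\<lbrakk>x \<in> carr V; y \<in> carr V\<rbrakk> \<Longrightarrow> s (smul V c y) x = cnj c * s y x"
  using s_commute[of x "smul V c y"] s_commute[of x y] by (simp add: s_smul_right)

lemma s_diff_right: "\<lbrakk>x \<in> carr V; y \<in> carr V; z \<in> carr V\<rbrakk> \<Longrightarrow> s x (vdiff V y z) = s x y - s x z"
  by (simp add: vdiff_def s_add_right s_smul_right)

lemma s_diff_left: "\<lbrakk>x \<in> carr V; y \<in> carr V; z \<in> carr V\<rbrakk> \<Longrightarrow> s (vdiff V y z) x = s y x - s z x"
  by (simp add: vdiff_def s_add_left s_smul_left)

lemmas s_simps = s_add_right s_smul_right s_add_left s_smul_left s_diff_right s_diff_left

lemma s_zero [simp]: "x \<in> carr V \<Longrightarrow> s x (vzero V) = 0" "x \<in> carr V \<Longrightarrow> s (vzero V) x = 0"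
  using s_diff_right[of x x x] s_diff_left[of x x x] by auto

lemma s_real: "x \<in> carr V \<Longrightarrow> s x x = of_real (Re (s x x))"
  using s_commute[of x x] by (simp add: complex_eq_iff)

definition sn :: "'a \<Rightarrow> real" where "sn x = sqrt (Re (s x x))"

lemma sn_nonneg: "x \<in> carr V \<Longrightarrow> 0 \<le> sn x"
  by (simp add: sn_def s_nonneg)

lemma sn_sq: "x \<in> carr V \<Longrightarrow> (sn x)\<^sup>2 = Re (s x x)"
  by (simp add: sn_def s_nonneg)

lemma s_self: "x \<in> carr V \<Longrightarrow> s x x = of_real ((sn x)\<^sup>2)"
  using s_real by (simp add: sn_sq)

lemma cauchy_schwarz_sq:
  assumes "x \<in> carr V" "y \<in> carr V"
  shows "(cmod (s x y))\<^sup>2 \<le> Re (s x x) * Re (s y y)"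
proof -
  let ?b = "s x y"
  \<comment> \<open>Nonnegativity of the form at x - t cnj(b) y with b = \<open>s x y\<close>; the
    factor cnj(b) absorbs the phase, so that a real parameter t remains.\<close>
  have key: "0 \<le> Re (s x x) - 2 * t * (cmod ?b)\<^sup>2 + t\<^sup>2 * (cmod ?b)\<^sup>2 * Re (s y y)" for t :: real
  proof -
    let ?z = "vadd V x (smul V (- of_real t * cnj ?b) y)"
    have "s ?z ?z = s x x - of_real t * cnj ?b * ?b - of_real t * ?b * s y x + of_real (t\<^sup>2) * (?b * cnj ?b) * s y y"
      using assms by (simp add: s_simps algebra_simps power2_eq_square)
    also have "\<dots> = s x x - of_real (2 * t * (cmod ?b)\<^sup>2) + of_real (t\<^sup>2 * (cmod ?b)\<^sup>2) * s y y"
      using assms by (simp add: s_commute[of x y] complex_norm_square[symmetric] algebra_simps)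
    finally have "Re (s ?z ?z) = Re (s x x) - 2 * t * (cmod ?b)\<^sup>2 + t\<^sup>2 * (cmod ?b)\<^sup>2 * Re (s y y)"
      by simp
    then show ?thesis
      using s_nonneg[of ?z] assms by simp
  qed
  show ?thesis
  proof (cases "Re (s y y) = 0")
    \<comment> \<open>The bound is now affine in t, so b must vanish; otherwise a large t would make
      it negative.\<close>
    case True
    then have *: "0 \<le> Re (s x x) - 2 * t * (cmod ?b)\<^sup>2" for t
      using key[of t] by simp
    have "cmod ?b = 0"
    proof (rule ccontr)
      assume "cmod ?b \<noteq> 0"
      then have "(cmod ?b)\<^sup>2 > 0" by simp
      then show False
        using *[of "(Re (s x x) + 1) / (cmod ?b)\<^sup>2"] s_nonneg[of x] assms by simp
    qed
    then show ?thesis using True by simp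
  next
    case False
    then have "Re (s y y) > 0" using s_nonneg[of y] assms by simp
    \<comment> \<open>The value t = 1 / \<open>Re (s y y)\<close> minimises the quadratic.\<close>
    then show ?thesis
      using key[of "1 / Re (s y y)"] by (simp add: field_simps power2_eq_square)
  qed
qed

lemma cauchy_schwarz: "\<lbrakk>x \<in> carr V; y \<in> carr V\<rbrakk> \<Longrightarrow> cmod (s x y) \<le> sn x * sn y"
  using real_sqrt_le_mono[OF cauchy_schwarz_sq[of x y]] by (simp add: sn_def real_sqrt_mult)

lemma sn_smul:
  assumes "x \<in> carr V"
  shows "sn (smul V c x) = cmod c * sn x"
proof -
  have "s (smul V c x) (smul V c x) = (c * cnj c) * s x x"
    using assms by (simp add: s_simps)
  also have "\<dots> = of_real ((cmod c)\<^sup>2) * s x x"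
    by (simp only: complex_norm_square)
  finally show ?thesis
    by (simp add: sn_def real_sqrt_mult del: of_real_power)
qed

lemma sn_triangle:
  assumes "x \<in> carr V" "y \<in> carr V"
  shows "sn (vadd V x y) \<le> sn x + sn y"
proof -
  have "(sn (vadd V x y))\<^sup>2 = (sn x)\<^sup>2 + (sn y)\<^sup>2 + 2 * Re (s x y)"
    using assms by (simp add: sn_sq s_simps s_commute[of x y])
  also have "\<dots> \<le> (sn x)\<^sup>2 + (sn y)\<^sup>2 + 2 * (sn x * sn y)"
    using cauchy_schwarz[OF assms] complex_Re_le_cmod[of "s x y"] by simp
  also have "\<dots> = (sn x + sn y)\<^sup>2"
    by (simp add: power2_sum)
  finally show ?thesis
    using assms by (metis power2_le_imp_le sn_nonneg add_nonneg_nonneg)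
qed

lemma sn_zero [simp]: "sn (vzero V) = 0"
  by (simp add: sn_def)

end

context hilbert_space
begin

sublocale form: psd_form H "inn H"
  rewrites "psd_form.sn (inn H) = hnorm H"
proof -
  show *: "psd_form H (inn H)"
    by unfold_locales (auto simp: inn_add_right inn_smul_right intro: inn_commute inn_nonneg)
  show "psd_form.sn (inn H) = hnorm H"
    by (simp add: fun_eq_iff psd_form.sn_def[OF *] hnorm_def)
qed

lemmas inn_simps [simp] = form.s_simps

sublocale normed_cspace H "hnorm H"
proof unfold_locales
  fix x assume x: "x \<in> carr H"
  show "hnorm H x = 0 \<longleftrightarrow> x = vzero H"
    using x form.s_real[of x] by (auto simp: hnorm_def inn_definite)
qed (simp_all add: form.sn_nonneg form.sn_triangle form.sn_smul)

lemma inn_ext: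
  assumes "x \<in> carr H" "y \<in> carr H" "\<And>z. z \<in> carr H \<Longrightarrow> inn H z x = inn H z y"
  shows "x = y"
proof -
  have "inn H (vdiff H x y) (vdiff H x y) = 0"
    using assms by simp
  then show ?thesis
    using inn_definite[of "vdiff H x y"] assms diff_eq_zero by auto
qed

lemma inn_cont_right:
  assumes "x \<in> carr H" "y \<in> carr H" "\<And>k. z k \<in> carr H" "(\<lambda>k. hnorm H (vdiff H (z k) y)) \<longlonglongrightarrow> 0"
  shows "(\<lambda>k. inn H x (z k)) \<longlonglongrightarrow> inn H x y"
proof -
  have "(\<lambda>k. inn H x (z k) - inn H x y) \<longlonglongrightarrow> 0"
  proof (rule Lim_null_comparison)
    show "\<forall>\<^sub>F k in sequentially. norm (inn H x (z k) - inn H x y) \<le> hnorm H x * hnorm H (vdiff H (z k) y)"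
      using assms form.cauchy_schwarz[of x "vdiff H (z _) y"] by (simp add: always_eventually)
    show "(\<lambda>k. hnorm H x * hnorm H (vdiff H (z k) y)) \<longlonglongrightarrow> 0"
      using tendsto_mult_right_zero[OF assms(4)] by simp
  qed
  then show ?thesis by (simp add: LIM_zero_iff)
qed

lemma inn_cont_left:
  assumes "x \<in> carr H" "y \<in> carr H" "\<And>k. z k \<in> carr H" "(\<lambda>k. hnorm H (vdiff H (z k) y)) \<longlonglongrightarrow> 0"
  shows "(\<lambda>k. inn H (z k) x) \<longlonglongrightarrow> inn H y x"
  using tendsto_cnj[OF inn_cont_right[OF assms]] assms(1-3) by (simp add: inn_commute[symmetric])

lemma hnorm_sq: "x \<in> carr H \<Longrightarrow> (hnorm H x)\<^sup>2 = Re (inn H x x)"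
  by (rule form.sn_sq)

text \<open>The vector is the limit of \<open>L a\<close> along a sequence minimising the squared
  norm of \<open>L a\<close> minus 2 Re \<open>f a\<close>. The functional lives on \<open>V\<close>
  and is controlled only through \<open>L\<close>. The second conclusion places \<open>v\<close> in
  the closure of the range of \<open>L\<close>; projections, norm bounds and density arguments all
  draw on it.\<close>

lemma riesz:
  assumes V: "complex_vector_space V" and L: "linear_map V H L"
    and f_add: "\<And>a b. \<lbrakk>a \<in> carr V; b \<in> carr V\<rbrakk> \<Longrightarrow> f (vadd V a b) = f a + f b"
    and f_smul: "\<And>c a. a \<in> carr V \<Longrightarrow> f (smul V c a) = c * f a"
    and bd: "\<And>a. a \<in> carr V \<Longrightarrow> cmod (f a) \<le> C * hnorm H (L a)"
  shows "\<exists>v\<in>carr H. (\<forall>a\<in>carr V. f a = inn H v (L a)) \<and>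
           (\<forall>e>0. \<exists>a\<in>carr V. hnorm H (vdiff H v (L a)) < e)"
proof -
  interpret V: complex_vector_space V by fact
  note Lc [simp] = linear_map_closed[OF L] and La = linear_map_add[OF L] and Ls = linear_map_smul[OF L]
  define F where "F a = (hnorm H (L a))\<^sup>2 - 2 * Re (f a)" for a
  have "F a \<ge> - C\<^sup>2" if "a \<in> carr V" for a
  proof -
    have "0 \<le> (hnorm H (L a) - C)\<^sup>2" by simp
    moreover have "Re (f a) \<le> C * hnorm H (L a)"
      using bd[OF that] complex_Re_le_cmod[of "f a"] by linarith
    ultimately show ?thesis by (simp add: F_def power2_diff algebra_simps)
  qed
  then have bb: "bdd_below (F ` carr V)"
    by (auto simp: bdd_below_def)
  define m where "m = Inf (F ` carr V)"
  have m_le: "m \<le> F a" if "a \<in> carr V" for a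
    unfolding m_def using bb that by (simp add: cInf_lower)
  have "\<exists>a\<in>carr V. F a < m + 1 / (real k + 1)" for k :: nat
  proof -
    have "Inf (F ` carr V) < m + 1 / (real k + 1)" by (simp add: m_def)
    then show ?thesis
      using cInf_lessD[of "F ` carr V"] V.zero_closed unfolding m_def by blast
  qed
  then obtain a where a [simp]: "\<And>k. a k \<in> carr V" and aF: "\<And>k. F (a k) < m + 1 / (real k + 1)"
    by metis
  \<comment> \<open>Parallelogram law: the linear part of \<open>F\<close> cancels because
    \<open>f\<close> is additive. The midpoint value is at least \<open>m\<close>, so a minimising
    sequence is Cauchy.\<close>
  have par: "(hnorm H (vdiff H (L x) (L y)))\<^sup>2 = 2 * F x + 2 * F y - 4 * F (smul V (1/2) (vadd V x y))"
    if "x \<in> carr V" "y \<in> carr V" for x y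
    using that unfolding F_def
    by (simp add: hnorm_sq La Ls f_add f_smul inn_commute[of "L x" "L y"] algebra_simps)
  have sq: "(hnorm H (vdiff H (L (a i)) (L (a j))))\<^sup>2 \<le> 2 / (real i + 1) + 2 / (real j + 1)" for i j
    using par[of "a i" "a j"] aF[of i] aF[of j] m_le[of "smul V (1/2) (vadd V (a i) (a j))"]
    by simp
  have "\<exists>l\<in>carr H. (\<lambda>k. hnorm H (vdiff H (L (a k)) l)) \<longlonglongrightarrow> 0"
  proof (rule complete_lim[OF complete])
    fix e :: real assume e: "e > 0"
    obtain N :: nat where N: "real N > 4 / e\<^sup>2"
      using reals_Archimedean2 by blast
    have "hnorm H (vdiff H (L (a i)) (L (a j))) < e" if "i \<ge> N" "j \<ge> N" for i j
    proof -
      have "2 / (real i + 1) \<le> 2 / (real N + 1)" "2 / (real j + 1) \<le> 2 / (real N + 1)"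
        using that by (auto simp: field_simps)
      then have "(hnorm H (vdiff H (L (a i)) (L (a j))))\<^sup>2 \<le> 4 / (real N + 1)"
        using sq[of i j] by simp
      also have "\<dots> < e\<^sup>2"
        using N e by (simp add: field_simps)
          (smt (verit, best) zero_less_power)
      finally show ?thesis
        using e by (simp add: power_less_imp_less_base)
    qed
    then show "\<exists>N. \<forall>i\<ge>N. \<forall>j\<ge>N. hnorm H (vdiff H (L (a i)) (L (a j))) < e" by blast
  qed simp
  then obtain v where v [simp]: "v \<in> carr H" and lim: "(\<lambda>k. hnorm H (vdiff H (L (a k)) v)) \<longlonglongrightarrow> 0"
    by blast
  have "f b = inn H v (L b)" if b [simp]: "b \<in> carr V" for b
  proof -
    let ?g = "inn H v (L b) - f b"
    \<comment> \<open>First variation: \<open>a k\<close> is perturbed by a multiple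
      \<open>c\<close> of \<open>b\<close>, and the defect 1 / (k + 1) of minimality disappears in
      the limit.\<close>
    have ineq: "0 \<le> 2 * Re (c * ?g) + (cmod c)\<^sup>2 * (hnorm H (L b))\<^sup>2" for c
    proof (rule LIMSEQ_le)
      show "(\<lambda>k. - 1 / (real k + 1)) \<longlonglongrightarrow> 0"
        using tendsto_minus[OF LIMSEQ_inverse_real_of_nat] by (simp add: inverse_eq_divide add.commute)
      show "(\<lambda>k. 2 * Re (c * (inn H (L (a k)) (L b) - f b)) + (cmod c)\<^sup>2 * (hnorm H (L b))\<^sup>2)
         \<longlonglongrightarrow> 2 * Re (c * ?g) + (cmod c)\<^sup>2 * (hnorm H (L b))\<^sup>2"
        by (intro tendsto_intros inn_cont_left lim) simp_all
      show "\<exists>N. \<forall>k\<ge>N. - 1 / (real k + 1) \<le> 2 * Re (c * (inn H (L (a k)) (L b) - f b)) + (cmod c)\<^sup>2 * (hnorm H (L b))\<^sup>2"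
      proof (intro exI allI impI)
        fix k :: nat
        have "m \<le> F (vadd V (a k) (smul V c b))" by (simp add: m_le)
        also have "\<dots> = F (a k) + 2 * Re (c * (inn H (L (a k)) (L b) - f b)) + (hnorm H (smul H c (L b)))\<^sup>2"
          unfolding F_def
          by (simp add: hnorm_sq La Ls f_add f_smul inn_commute[of "L (a k)" "L b"] algebra_simps)
        also have "(hnorm H (smul H c (L b)))\<^sup>2 = (cmod c)\<^sup>2 * (hnorm H (L b))\<^sup>2"
          by (simp add: n_smul power_mult_distrib)
        finally show "- 1 / (real k + 1) \<le> 2 * Re (c * (inn H (L (a k)) (L b) - f b)) + (cmod c)\<^sup>2 * (hnorm H (L b))\<^sup>2"
          using aF[of k] by simp
      qed
    qed
    \<comment> \<open>With c = - t cnj(g) the linear term is - 2 t |g|^2, while the quadratic term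
      is at most t |g|^2; hence g = 0.\<close>
    define t where "t = 1 / ((hnorm H (L b))\<^sup>2 + 1)"
    have t: "t > 0" "t * (hnorm H (L b))\<^sup>2 < 1"
      by (auto simp: t_def field_simps add_pos_nonneg)
    define g where "g = ?g"
    have "0 \<le> 2 * Re (- of_real t * cnj g * g) + (cmod (- of_real t * cnj g))\<^sup>2 * (hnorm H (L b))\<^sup>2"
      using ineq[of "- of_real t * cnj g"] unfolding g_def by blast
    also have "- of_real t * cnj g * g = of_real (- (t * (cmod g)\<^sup>2))"
      using complex_norm_square[of g] by (simp add: mult.commute)
    also have "(cmod (- of_real t * cnj g))\<^sup>2 = t\<^sup>2 * (cmod g)\<^sup>2"
      by (simp add: norm_mult power_mult_distrib)
    also have "2 * Re (of_real (- (t * (cmod g)\<^sup>2))) + t\<^sup>2 * (cmod g)\<^sup>2 * (hnorm H (L b))\<^sup>2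
       = - (t * (cmod g)\<^sup>2) * (2 - t * (hnorm H (L b))\<^sup>2)"
      by (simp add: algebra_simps power2_eq_square)
    finally have "t * (cmod g)\<^sup>2 * (2 - t * (hnorm H (L b))\<^sup>2) \<le> 0" by simp
    then have "(cmod g)\<^sup>2 \<le> 0"
      using t by (simp add: mult_le_0_iff)
    then show ?thesis by (simp add: g_def)
  qed
  moreover have "\<exists>a\<in>carr V. hnorm H (vdiff H v (L a)) < e" if "e > 0" for e
  proof -
    have "\<forall>\<^sub>F k in sequentially. hnorm H (vdiff H (L (a k)) v) < e"
      using order_tendstoD(2)[OF lim that] .
    then obtain k where "hnorm H (vdiff H (L (a k)) v) < e"
      by (auto simp: eventually_sequentially)
    then show ?thesis
      using n_diff_commute[of "L (a k)" v] by (intro bexI[of _ "a k"]) auto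
  qed
  ultimately show ?thesis by auto
qed

end

section \<open>Orthogonal projections, unitary maps and square roots\<close>

definition perp :: "'h hilbert \<Rightarrow> 'h set \<Rightarrow> 'h set" where
  "perp H S = {v \<in> carr H. \<forall>w\<in>S. inn H w v = 0}"

context hilbert_space
begin

lemma perp_subspace: "S \<subseteq> carr H \<Longrightarrow> subspace_of H (perp H S)"
  by (auto simp: subspace_of_def perp_def subset_iff)

lemma perp_closed:
  assumes "S \<subseteq> carr H"
  shows "closedin (norm_topology H (hnorm H)) (perp H S)"
  unfolding closedin_iff_seq
proof (intro conjI allI impI)
  fix x l assume *: "(\<forall>k. x k \<in> perp H S) \<and> l \<in> carr H \<and> (\<lambda>k. hnorm H (vdiff H (x k) l)) \<longlonglongrightarrow> 0"
  have "inn H w l = 0" if w: "w \<in> S" for w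
  proof -
    have "(\<lambda>k. inn H w (x k)) \<longlonglongrightarrow> inn H w l"
      using * w assms by (intro inn_cont_right) (auto simp: perp_def)
    moreover have "(\<lambda>k. inn H w (x k)) = (\<lambda>k. 0)"
      using * w by (auto simp: perp_def)
    ultimately show ?thesis by (simp add: LIMSEQ_const_iff)
  qed
  then show "l \<in> perp H S" using * by (simp add: perp_def)
qed (auto simp: perp_def)

text \<open>Since \<open>v\<close> is a limit of vectors \<open>L a\<close>, its squared norm is
  approximated by \<open>f a\<close>, and this is bounded by \<open>C\<close> times the norm of
  \<open>L a\<close>, which tends to that of \<open>v\<close>.\<close>

lemma riesz_bounded:
  assumes V: "complex_vector_space V" and L: "linear_map V H L"
    and f_add: "\<And>a b. \<lbrakk>a \<in> carr V; b \<in> carr V\<rbrakk> \<Longrightarrow> f (vadd V a b) = f a + f b"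
    and f_smul: "\<And>c a. a \<in> carr V \<Longrightarrow> f (smul V c a) = c * f a"
    and bd: "\<And>a. a \<in> carr V \<Longrightarrow> cmod (f a) \<le> C * hnorm H (L a)" and C: "C \<ge> 0"
  shows "\<exists>v\<in>carr H. (\<forall>a\<in>carr V. inn H v (L a) = f a) \<and> hnorm H v \<le> C"
proof -
  obtain v where v: "v \<in> carr H" "\<And>a. a \<in> carr V \<Longrightarrow> f a = inn H v (L a)"
    and ap: "\<And>e. e > 0 \<Longrightarrow> \<exists>a\<in>carr V. hnorm H (vdiff H v (L a)) < e"
    using riesz[OF V L f_add f_smul bd] by metis
  have "(hnorm H v)\<^sup>2 \<le> C * hnorm H v + e" if "e > 0" for e
  proof -
    \<comment> \<open>The error terms add up to \<open>hnorm H v\<close> + C times the approximation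
      error; this choice keeps them below \<open>e\<close>.\<close>
    define e' where "e' = e / (hnorm H v + C + 1)"
    have pos: "hnorm H v + C + 1 > 0" using n_nonneg[of v] v C by simp
    then have "e' > 0" using that by (simp add: e'_def)
    then obtain a where a: "a \<in> carr V" "hnorm H (vdiff H v (L a)) < e'" using ap by blast
    have La: "L a \<in> carr H" using linear_map_closed[OF L a(1)] .
    have "(hnorm H v)\<^sup>2 = Re (inn H v (vdiff H v (L a))) + Re (f a)"
      using v a La by (simp add: hnorm_sq)
    also have "\<dots> \<le> hnorm H v * hnorm H (vdiff H v (L a)) + C * hnorm H (L a)"
      using form.cauchy_schwarz[of v "vdiff H v (L a)"] bd[OF a(1)] v La
        complex_Re_le_cmod[of "inn H v (vdiff H v (L a))"] complex_Re_le_cmod[of "f a"]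
      by (simp del: inn_simps)
    also have "hnorm H (L a) \<le> hnorm H v + hnorm H (vdiff H v (L a))"
      using n_le_diff[of "L a" v] v La n_diff_commute[of v "L a"] by simp
    then have "hnorm H v * hnorm H (vdiff H v (L a)) + C * hnorm H (L a)
        \<le> C * hnorm H v + (hnorm H v + C) * hnorm H (vdiff H v (L a))"
      using mult_left_mono[OF _ C] by (fastforce simp: algebra_simps)
    also have "(hnorm H v + C) * hnorm H (vdiff H v (L a)) \<le> (hnorm H v + C + 1) * e'"
      using a v C La n_nonneg by (intro mult_mono) auto
    also have "\<dots> = e" using pos by (simp add: e'_def)
    finally show ?thesis by simp
  qed
  then have "(hnorm H v)\<^sup>2 \<le> C * hnorm H v" by (rule field_le_epsilon)
  then have "hnorm H v \<le> C"
    using n_nonneg[OF v(1)] C by (cases "hnorm H v = 0") (auto simp: power2_eq_square)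
  then show ?thesis using v by metis
qed

text \<open>The Riesz vector of \<langle>x|a\<rangle> as a functional of \<open>a\<close> in
  \<open>W\<close> lies in the closure of \<open>W\<close>, hence in \<open>W\<close>.\<close>

lemma projection:
  assumes W: "subspace_of H W" "closedin (norm_topology H (hnorm H)) W" and x: "x \<in> carr H"
  shows "\<exists>p\<in>W. vdiff H x p \<in> perp H W"
proof -
  have sub: "W \<subseteq> carr H" using W by (simp add: subspace_of_def)
  have "linear_map (H\<lparr>carr := W\<rparr>) H (\<lambda>v. v)"
    using sub by (auto simp: linear_map_def)
  then have "\<exists>v\<in>carr H. (\<forall>a\<in>carr (H\<lparr>carr := W\<rparr>). inn H x a = inn H v a) \<and>
      (\<forall>e>0. \<exists>a\<in>carr (H\<lparr>carr := W\<rparr>). hnorm H (vdiff H v a) < e)"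
    using sub x form.cauchy_schwarz[OF x]
    by (intro riesz[OF subspace_vector_space[OF complex_vector_space_axioms W(1)], where C = "hnorm H x"])
      (auto simp: subset_iff)
  then obtain v where v: "v \<in> carr H" "\<And>a. a \<in> W \<Longrightarrow> inn H x a = inn H v a"
    and "\<And>e. e > 0 \<Longrightarrow> \<exists>a\<in>W. hnorm H (vdiff H v a) < e"
    by auto
  then have "v \<in> W" using closed_approx[OF W(2)] by blast
  moreover have "vdiff H x v \<in> perp H W"
  proof -
    have "inn H a (vdiff H x v) = 0" if "a \<in> W" for a
      using v(2)[OF that] that sub x v(1) inn_commute[of x a] inn_commute[of v a]
      by (auto simp: subset_iff)
    then show ?thesis using x v(1) by (simp add: perp_def del: inn_simps)
  qed
  ultimately show ?thesis by blast
qed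

text \<open>Trivial complement instead of density: for ranges of linear maps the two agree
  (\<open>dense_iff_total\<close>), but this also makes sense for sets without linear structure,
  such as all vectors \<open>rop \<pi> a w\<close>, and equality of vectors can be tested on such a
  set directly.\<close>

definition total :: "'h set \<Rightarrow> bool" where
  "total S \<longleftrightarrow> perp H S = {vzero H}"

lemma totalI: "(\<And>v. \<lbrakk>v \<in> carr H; \<And>w. w \<in> S \<Longrightarrow> inn H w v = 0\<rbrakk> \<Longrightarrow> v = vzero H) \<Longrightarrow> S \<subseteq> carr H \<Longrightarrow> total S"
  by (auto simp: total_def perp_def subset_iff)

lemma total_ext:
  assumes "total S" "S \<subseteq> carr H" "x \<in> carr H" "y \<in> carr H" "\<And>w. w \<in> S \<Longrightarrow> inn H w x = inn H w y"
  shows "x = y"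
proof -
  have "inn H w (vdiff H x y) = 0" if "w \<in> S" for w
  proof -
    have "w \<in> carr H" using that assms(2) by blast
    then show ?thesis using assms(3-5) that by simp
  qed
  then have "vdiff H x y \<in> perp H S" using assms(3,4) by (simp add: perp_def del: inn_simps)
  then show ?thesis using assms(1,3,4) by (simp add: total_def diff_eq_zero)
qed

text \<open>\<open>x\<close> and the Riesz vector of \<langle>x|L a\<rangle> have the same products
  with the total range, so they coincide; and a Riesz vector is a limit of values of
  \<open>L\<close>.\<close>

lemma total_approx:
  assumes V: "complex_vector_space V" and L: "linear_map V H L" and t: "total (L ` carr V)"
    and x: "x \<in> carr H" and e: "e > 0"
  shows "\<exists>a\<in>carr V. hnorm H (vdiff H x (L a)) < e"
proof -
  note Lc = linear_map_closed[OF L]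
  have "\<exists>v\<in>carr H. (\<forall>a\<in>carr V. inn H x (L a) = inn H v (L a)) \<and>
      (\<forall>e>0. \<exists>a\<in>carr V. hnorm H (vdiff H v (L a)) < e)"
    using x form.cauchy_schwarz[OF x] linear_map_add[OF L] linear_map_smul[OF L]
    by (intro riesz[OF V L, where C = "hnorm H x"]) (auto simp: Lc)
  then obtain v where v: "v \<in> carr H" "\<And>a. a \<in> carr V \<Longrightarrow> inn H x (L a) = inn H v (L a)"
    and ap: "\<And>e. e > 0 \<Longrightarrow> \<exists>a\<in>carr V. hnorm H (vdiff H v (L a)) < e"
    by metis
  have "x = v"
  proof (rule total_ext[OF t])
    fix w assume "w \<in> L ` carr V"
    then show "inn H w x = inn H w v"
      using v x Lc by (metis imageE inn_commute)
  qed (use x v Lc in auto)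
  then show ?thesis using ap e by blast
qed

lemma dense_iff_total:
  assumes V: "complex_vector_space V" and L: "linear_map V H L"
  shows "norm_topology H (hnorm H) closure_of (L ` carr V) = carr H \<longleftrightarrow> total (L ` carr V)"
proof
  have sub: "L ` carr V \<subseteq> carr H" using linear_map_closed[OF L] by auto
  show "norm_topology H (hnorm H) closure_of (L ` carr V) = carr H" if "total (L ` carr V)"
    using total_approx[OF V L that] by (auto simp: closure_of_iff[OF sub])
  assume d: "norm_topology H (hnorm H) closure_of (L ` carr V) = carr H"
  show "total (L ` carr V)"
  proof (rule totalI[OF _ sub])
    fix v assume v: "v \<in> carr H" "\<And>w. w \<in> L ` carr V \<Longrightarrow> inn H w v = 0"
    \<comment> \<open>The orthogonal complement of \<open>v\<close> is closed and contains the dense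
      range, so it contains \<open>v\<close> itself.\<close>
    have "v \<in> perp H {v}"
    proof (rule closed_approx[OF perp_closed])
      fix e :: real assume "e > 0"
      then obtain y where "y \<in> L ` carr V" "hnorm H (vdiff H v y) < e"
        using d v(1) closure_of_iff[OF sub] by blast
      moreover then have "y \<in> perp H {v}"
        using v sub inn_commute[of y v] by (auto simp: perp_def)
      ultimately show "\<exists>y\<in>perp H {v}. hnorm H (vdiff H v y) < e" by blast
    qed (use v in auto)
    then show "v = vzero H" using v(1) by (auto simp: perp_def inn_definite)
  qed
qed

lemma kernel_closed_subspace:
  assumes G: "linear_map H H G" and bd: "\<And>v. v \<in> carr H \<Longrightarrow> hnorm H (G v) \<le> C * hnorm H v"
  shows "subspace_of H {v \<in> carr H. G v = vzero H}"
    and "closedin (norm_topology H (hnorm H)) {v \<in> carr H. G v = vzero H}"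
proof -
  note [simp] = linear_map_closed[OF G] linear_map_add[OF G] linear_map_smul[OF G]
    linear_map_diff[OF complex_vector_space_axioms G]
    linear_map_zero[OF complex_vector_space_axioms complex_vector_space_axioms G]
  show "subspace_of H {v \<in> carr H. G v = vzero H}"
    by (auto simp: subspace_of_def)
  show "closedin (norm_topology H (hnorm H)) {v \<in> carr H. G v = vzero H}"
    unfolding closedin_iff_seq
  proof (intro conjI allI impI)
    fix x l assume *: "(\<forall>k. x k \<in> {v \<in> carr H. G v = vzero H}) \<and> l \<in> carr H \<and>
      (\<lambda>k. hnorm H (vdiff H (x k) l)) \<longlonglongrightarrow> 0"
    then have l: "l \<in> carr H" and x: "\<And>k. x k \<in> carr H" "\<And>k. G (x k) = vzero H" by auto
    have "hnorm H (G l) \<le> C * hnorm H (vdiff H (x k) l)" for k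
    proof -
      have "G (vdiff H (x k) l) = smul H (-1) (G l)"
        using x l by (simp add: vdiff_def)
      then have "hnorm H (G (vdiff H (x k) l)) = hnorm H (G l)" using l by (simp add: n_smul)
      then show ?thesis using bd[of "vdiff H (x k) l"] x l by simp
    qed
    moreover have "(\<lambda>k. C * hnorm H (vdiff H (x k) l)) \<longlonglongrightarrow> 0"
      using tendsto_mult_right_zero * by blast
    ultimately have "hnorm H (G l) \<le> 0"
      using LIMSEQ_le_const by blast
    then show "l \<in> {v \<in> carr H. G v = vzero H}"
      using l n_nonneg[of "G l"] n_eq_0[of "G l"] by simp
  qed auto
qed

end

section \<open>Unitary maps between Hilbert spaces\<close>

lemma unitary_closed: "\<lbrakk>unitary_map H K u; x \<in> carr H\<rbrakk> \<Longrightarrow> u x \<in> carr K"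
  and unitary_add: "\<lbrakk>unitary_map H K u; x \<in> carr H; y \<in> carr H\<rbrakk> \<Longrightarrow> u (vadd H x y) = vadd K (u x) (u y)"
  and unitary_smul: "\<lbrakk>unitary_map H K u; x \<in> carr H\<rbrakk> \<Longrightarrow> u (smul H c x) = smul K c (u x)"
  and unitary_inn: "\<lbrakk>unitary_map H K u; x \<in> carr H; y \<in> carr H\<rbrakk> \<Longrightarrow> inn K (u x) (u y) = inn H x y"
  and unitary_bij: "unitary_map H K u \<Longrightarrow> bij_betw u (carr H) (carr K)"
  and unitary_linear: "unitary_map H K u \<Longrightarrow> linear_map H K u"
  by (auto simp: unitary_map_def linear_map_def)

lemma unitary_hnorm: "\<lbrakk>unitary_map H K u; x \<in> carr H\<rbrakk> \<Longrightarrow> hnorm K (u x) = hnorm H x"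
  by (simp add: hnorm_def unitary_inn)

lemma unitary_id: "hilbert_space H \<Longrightarrow> unitary_map H H (\<lambda>x. x)"
  by (auto simp: unitary_map_def linear_map_def bij_betw_def)

lemma unitary_comp:
  assumes u: "unitary_map H K u" and w: "unitary_map K M w"
  shows "unitary_map H M (\<lambda>x. w (u x))"
proof -
  have "bij_betw (\<lambda>x. w (u x)) (carr H) (carr M)"
    using bij_betw_trans[OF unitary_bij[OF u] unitary_bij[OF w]] by (simp add: comp_def)
  then show ?thesis
    by (auto simp: unitary_map_def linear_map_def unitary_closed[OF u] unitary_closed[OF w]
        unitary_add[OF u] unitary_add[OF w] unitary_smul[OF u] unitary_smul[OF w]
        unitary_inn[OF u] unitary_inn[OF w])
qed

lemma unitary_inv_into:
  assumes u: "unitary_map H K u" and H: "hilbert_space H"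
  defines "w \<equiv> inv_into (carr H) u"
  shows "unitary_map K H w" "\<And>x. x \<in> carr H \<Longrightarrow> w (u x) = x" "\<And>y. y \<in> carr K \<Longrightarrow> u (w y) = y"
    "\<And>x y. \<lbrakk>x \<in> carr H; y \<in> carr K\<rbrakk> \<Longrightarrow> inn K (u x) y = inn H x (w y)"
proof -
  interpret H: hilbert_space H by fact
  note b = unitary_bij[OF u]
  show wu [simp]: "\<And>x. x \<in> carr H \<Longrightarrow> w (u x) = x"
    using b by (simp add: w_def bij_betw_inv_into_left)
  show uw [simp]: "\<And>y. y \<in> carr K \<Longrightarrow> u (w y) = y"
    using b by (simp add: w_def bij_betw_inv_into_right)
  have wb: "bij_betw w (carr K) (carr H)" unfolding w_def using b by (rule bij_betw_inv_into)
  then have wc [simp]: "\<And>y. y \<in> carr K \<Longrightarrow> w y \<in> carr H" by (auto simp: bij_betw_def)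
  show "\<And>x y. \<lbrakk>x \<in> carr H; y \<in> carr K\<rbrakk> \<Longrightarrow> inn K (u x) y = inn H x (w y)"
    using unitary_inn[OF u] by (metis uw wc)
  have "w (vadd K x y) = vadd H (w x) (w y)" if "x \<in> carr K" "y \<in> carr K" for x y
  proof -
    have "w (vadd K x y) = w (u (vadd H (w x) (w y)))"
      using that by (simp add: unitary_add[OF u])
    then show ?thesis using that by simp
  qed
  moreover have "w (smul K c x) = smul H c (w x)" if "x \<in> carr K" for x c
  proof -
    have "w (smul K c x) = w (u (smul H c (w x)))"
      using that by (simp add: unitary_smul[OF u])
    then show ?thesis using that by simp
  qed
  moreover have "inn H (w x) (w y) = inn K x y" if "x \<in> carr K" "y \<in> carr K" for x y
    using that unitary_inn[OF u, of "w x" "w y"] by simp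
  ultimately show "unitary_map K H w"
    using wb by (auto simp: unitary_map_def linear_map_def)
qed

lemma unitary_vdiff:
  "\<lbrakk>unitary_map H K u; hilbert_space H; x \<in> carr H; y \<in> carr H\<rbrakk> \<Longrightarrow> u (vdiff H x y) = vdiff K (u x) (u y)"
  by (simp add: hilbert_space_def linear_map_diff unitary_linear)

lemma unitary_zero:
  "\<lbrakk>unitary_map H K u; hilbert_space H; hilbert_space K\<rbrakk> \<Longrightarrow> u (vzero H) = vzero K"
  by (simp add: hilbert_space_def linear_map_zero unitary_linear)

text \<open>\<open>u v\<close> is defined weakly, as the vector whose product with
  \<open>L2 b\<close> is \<langle>v|L1 b\<rangle>, and \<open>u'\<close> symmetrically. Equal Gram
  matrices provide both Riesz bounds, and totality yields linearity and mutual inverseness.\<close>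

lemma unitary_of_total_pair:
  assumes V: "complex_vector_space V" and H: "hilbert_space H" and K: "hilbert_space K"
    and L1: "linear_map V H L1" and L2: "linear_map V K L2"
    and t1: "hilbert_space.total H (L1 ` carr V)" and t2: "hilbert_space.total K (L2 ` carr V)"
    and eq: "\<And>a b. \<lbrakk>a \<in> carr V; b \<in> carr V\<rbrakk> \<Longrightarrow> inn H (L1 a) (L1 b) = inn K (L2 a) (L2 b)"
  shows "\<exists>u. unitary_map H K u \<and> (\<forall>a\<in>carr V. u (L1 a) = L2 a)"
proof -
  interpret V: complex_vector_space V by fact
  interpret H: hilbert_space H by fact
  interpret K: hilbert_space K by fact
  note l1 [simp] = linear_map_closed[OF L1] and l2 [simp] = linear_map_closed[OF L2]
  note l1a = linear_map_add[OF L1] linear_map_smul[OF L1]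
    and l2a = linear_map_add[OF L2] linear_map_smul[OF L2]
  have hn: "hnorm H (L1 a) = hnorm K (L2 a)" if "a \<in> carr V" for a
    using eq[OF that that] by (simp add: hnorm_def)
  have "\<exists>w\<in>carr K. (\<forall>b\<in>carr V. inn K w (L2 b) = inn H v (L1 b)) \<and> hnorm K w \<le> hnorm H v"
    if "v \<in> carr H" for v
    using that H.form.cauchy_schwarz[OF that]
    by (intro K.riesz_bounded[OF V L2]) (auto simp: l1a hn[symmetric] H.n_nonneg)
  then obtain u where uc [simp]: "\<And>v. v \<in> carr H \<Longrightarrow> u v \<in> carr K"
    and u: "\<And>v b. \<lbrakk>v \<in> carr H; b \<in> carr V\<rbrakk> \<Longrightarrow> inn K (u v) (L2 b) = inn H v (L1 b)"
    by metis
  have "\<exists>w\<in>carr H. (\<forall>b\<in>carr V. inn H w (L1 b) = inn K v (L2 b)) \<and> hnorm H w \<le> hnorm K v"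
    if "v \<in> carr K" for v
    using that K.form.cauchy_schwarz[OF that]
    by (intro H.riesz_bounded[OF V L1]) (auto simp: l2a hn K.n_nonneg)
  then obtain u' where uc' [simp]: "\<And>v. v \<in> carr K \<Longrightarrow> u' v \<in> carr H"
    and u': "\<And>v b. \<lbrakk>v \<in> carr K; b \<in> carr V\<rbrakk> \<Longrightarrow> inn H (u' v) (L1 b) = inn K v (L2 b)"
    and un': "\<And>v. v \<in> carr K \<Longrightarrow> hnorm H (u' v) \<le> hnorm K v"
    by metis
  have ext1: "x = y" if "x \<in> carr H" "y \<in> carr H" "\<And>b. b \<in> carr V \<Longrightarrow> inn H x (L1 b) = inn H y (L1 b)" for x y
  proof (rule H.total_ext[OF t1])
    fix w assume "w \<in> L1 ` carr V"
    then obtain b where b: "b \<in> carr V" "w = L1 b" by auto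
    then show "inn H w x = inn H w y"
      using that H.inn_commute[of x w] H.inn_commute[of y w] by simp
  qed (use that in auto)
  have ext2: "x = y" if "x \<in> carr K" "y \<in> carr K" "\<And>b. b \<in> carr V \<Longrightarrow> inn K x (L2 b) = inn K y (L2 b)" for x y
  proof (rule K.total_ext[OF t2])
    fix w assume "w \<in> L2 ` carr V"
    then obtain b where b: "b \<in> carr V" "w = L2 b" by auto
    then show "inn K w x = inn K w y"
      using that K.inn_commute[of x w] K.inn_commute[of y w] by simp
  qed (use that in auto)
  have uL: "u (L1 a) = L2 a" if "a \<in> carr V" for a
    by (rule ext2) (use that in \<open>auto simp: u eq\<close>)
  have uL': "u' (L2 a) = L1 a" if "a \<in> carr V" for a
    by (rule ext1) (use that in \<open>auto simp: u' eq\<close>)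
  have u'u [simp]: "u' (u v) = v" if "v \<in> carr H" for v
    by (rule ext1) (use that in \<open>auto simp: u u'\<close>)
  have uu' [simp]: "u (u' v) = v" if "v \<in> carr K" for v
    by (rule ext2) (use that in \<open>auto simp: u u'\<close>)
  have bij: "bij_betw u (carr H) (carr K)"
    by (rule bij_betw_byWitness[of _ u']) auto
  have lin: "linear_map H K u"
    unfolding linear_map_def
  proof (intro conjI ballI allI)
    fix x y assume "x \<in> carr H" "y \<in> carr H"
    then show "u (vadd H x y) = vadd K (u x) (u y)"
      by (intro ext2) (auto simp: u)
  next
    fix c x assume "x \<in> carr H"
    then show "u (smul H c x) = smul K c (u x)"
      by (intro ext2) (auto simp: u)
  qed auto
  have lin': "linear_map K H u'"
    unfolding linear_map_def
  proof (intro conjI ballI allI)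
    fix x y assume "x \<in> carr K" "y \<in> carr K"
    then show "u' (vadd K x y) = vadd H (u' x) (u' y)"
      by (intro ext1) (auto simp: u')
  next
    fix c x assume "x \<in> carr K"
    then show "u' (smul K c x) = smul H c (u' x)"
      by (intro ext1) (auto simp: u')
  qed auto
  \<comment> \<open>Preservation of inner products amounts to adjointness of \<open>u\<close> and
    its inverse: the Riesz vector of \<langle>v|u' k\<rangle> agrees with \<open>u v\<close> on the
    total range of \<open>L2\<close>.\<close>
  have adj: "inn K (u v) k = inn H v (u' k)" if v: "v \<in> carr H" and k: "k \<in> carr K" for v k
  proof -
    have "\<exists>w\<in>carr K. (\<forall>k\<in>carr K. inn K w k = inn H v (u' k)) \<and> hnorm K w \<le> hnorm H v"
    proof (rule K.riesz_bounded[OF K.complex_vector_space_axioms, where L = "\<lambda>x. x"])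
      show "linear_map K K (\<lambda>x. x)" by (simp add: linear_map_def)
      show "cmod (inn H v (u' a)) \<le> hnorm H v * hnorm K a" if "a \<in> carr K" for a
        using H.form.cauchy_schwarz[OF v, of "u' a"] un'[OF that] that v
          mult_left_mono[OF un'[OF that] H.n_nonneg[OF v]] by fastforce
    qed (use v H.n_nonneg in \<open>auto simp: linear_map_add[OF lin'] linear_map_smul[OF lin']\<close>)
    then obtain w where w: "w \<in> carr K" "\<And>k. k \<in> carr K \<Longrightarrow> inn K w k = inn H v (u' k)" by blast
    have "w = u v"
      by (rule ext2) (use w v in \<open>auto simp: u uL'\<close>)
    then show ?thesis using w k by blast
  qed
  have "unitary_map H K u"
    using lin bij by (auto simp: unitary_map_def adj)
  then show ?thesis using uL by blast
qed

lemma hilbert_transport: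
  assumes H: "hilbert_space H" and j: "inj_on j (carr H)"
  shows "\<exists>K. hilbert_space K \<and> unitary_map H K j"
proof -
  interpret H: hilbert_space H by fact
  define i where "i = inv_into (carr H) j"
  define K where "K = \<lparr>carr = j ` carr H, vadd = (\<lambda>x y. j (vadd H (i x) (i y))),
     vzero = j (vzero H), smul = (\<lambda>c x. j (smul H c (i x))), inn = (\<lambda>x y. inn H (i x) (i y))\<rparr>"
  have ij [simp]: "i (j x) = x" if "x \<in> carr H" for x using that j by (simp add: i_def)
  have sel: "carr K = j ` carr H" "\<And>x y. vadd K x y = j (vadd H (i x) (i y))" "vzero K = j (vzero H)"
    "\<And>c x. smul K c x = j (smul H c (i x))" "\<And>x y. inn K x y = inn H (i x) (i y)"
    by (simp_all add: K_def)
  have KV: "complex_vector_space K"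
    by unfold_locales (auto simp: sel H.add_assoc H.add_left_commute H.add_commute H.add_neg
        H.smul_add_right H.smul_add_left H.smul_smul)
  have hn: "hnorm K (j x) = hnorm H x" if "x \<in> carr H" for x
    using that by (simp add: hnorm_def sel)
  have d: "vdiff K (j x) (j y) = j (vdiff H x y)" if "x \<in> carr H" "y \<in> carr H" for x y
    using that by (simp add: vdiff_def sel)
  interpret K: normed_cspace K "hnorm K"
    using KV by (auto simp: normed_cspace_def normed_cspace_axioms_def sel hn H.n_nonneg
        H.n_triangle H.n_smul H.n_eq_0 inj_on_eq_iff[OF j])
  have "norm_complete K (hnorm K)"
  proof (rule K.completeI)
    fix x :: "nat \<Rightarrow> _" assume x: "\<And>k. x k \<in> carr K"
      and c: "\<And>e. e > 0 \<Longrightarrow> \<exists>N. \<forall>m\<ge>N. \<forall>n\<ge>N. hnorm K (vdiff K (x m) (x n)) < e"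
    have xi: "i (x k) \<in> carr H" "x k = j (i (x k))" for k using x[of k] by (auto simp: sel)
    have "hnorm K (vdiff K (x m) (x n)) = hnorm H (vdiff H (i (x m)) (i (x n)))" for m n
      using xi[of m] xi[of n] d hn by (metis H.diff_closed)
    then obtain l where l: "l \<in> carr H" "(\<lambda>k. hnorm H (vdiff H (i (x k)) l)) \<longlonglongrightarrow> 0"
      using H.complete_lim[OF H.complete, of "\<lambda>k. i (x k)"] xi(1) c by auto
    have "hnorm K (vdiff K (x k) (j l)) = hnorm H (vdiff H (i (x k)) l)" for k
      using xi[of k] l(1) d hn by (metis H.diff_closed)
    then show "\<exists>l\<in>carr K. (\<lambda>k. hnorm K (vdiff K (x k) l)) \<longlonglongrightarrow> 0"
      using l by (intro bexI[of _ "j l"]) (auto simp: sel)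
  qed
  then have "hilbert_space K"
    using KV by (auto simp: hilbert_space_def hilbert_space_axioms_def sel H.inn_nonneg
        intro: H.inn_commute arg_cong[of _ _ j, OF H.inn_definite])
  moreover have "unitary_map H K j"
    using j by (auto simp: unitary_map_def linear_map_def sel bij_betw_def)
  ultimately show ?thesis by blast
qed

section \<open>Square roots by iteration\<close>

primrec sqrt_iter :: "('a, 'm) cspace_scheme \<Rightarrow> ('a \<Rightarrow> 'a) \<Rightarrow> nat \<Rightarrow> 'a \<Rightarrow> 'a" where
  "sqrt_iter V X 0 = (\<lambda>v. vzero V)"
| "sqrt_iter V X (Suc k) =
     (\<lambda>v. smul V (1/2) (vadd V (X v) (sqrt_iter V X k (sqrt_iter V X k v))))"

primrec sqrt_scalar :: "nat \<Rightarrow> real" where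
  "sqrt_scalar 0 = 0"
| "sqrt_scalar (Suc k) = (1 + (sqrt_scalar k)\<^sup>2) / 2"

lemma sqrt_scalar_bounds: "0 \<le> sqrt_scalar k" "sqrt_scalar k \<le> 1"
proof -
  have "0 \<le> sqrt_scalar k \<and> sqrt_scalar k \<le> 1"
    by (induction k) (auto simp: power_le_one)
  then show "0 \<le> sqrt_scalar k" "sqrt_scalar k \<le> 1" by auto
qed

lemma sqrt_scalar_mono: "i \<le> j \<Longrightarrow> sqrt_scalar i \<le> sqrt_scalar j"
proof (rule lift_Suc_mono_le[of sqrt_scalar])
  show "sqrt_scalar k \<le> sqrt_scalar (Suc k)" for k
    using zero_le_power2[of "sqrt_scalar k - 1"] by (simp add: power2_diff)
qed

text \<open>
  The iteration for \<open>1 - sqrt (1 - X)\<close>: all iterates are polynomials in \<open>X\<close> with nonnegative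
  coefficients, so their increments are dominated by those of the scalar iteration at \<open>X = 1\<close>.
\<close>

lemma (in normed_cspace) sqrt_operator:
  assumes cp: "norm_complete V n" and X: "linear_map V V X"
    and Xn: "\<And>v. v \<in> carr V \<Longrightarrow> n (X v) \<le> n v"
  shows "\<exists>Y e. linear_map V V Y \<and> (\<forall>v\<in>carr V. n (Y v) \<le> n v) \<and>
     (\<forall>v\<in>carr V. smul V 2 (Y v) = vadd V (X v) (Y (Y v))) \<and>
     e \<longlonglongrightarrow> (0::real) \<and> (\<forall>k. \<forall>v\<in>carr V. n (vdiff V (Y v) (sqrt_iter V X k v)) \<le> e k * n v)"
proof -
  let ?Y = "sqrt_iter V X" and ?y = sqrt_scalar
  note [simp] = linear_map_closed[OF X]
  have lin: "linear_map V V (?Y k)" for k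
  proof (induction k)
    case (Suc k)
    note I = linear_map_closed[OF Suc] linear_map_add[OF Suc] linear_map_smul[OF Suc]
    show ?case
      by (auto simp: linear_map_def I linear_map_add[OF X] linear_map_smul[OF X] smul_add_right
          smul_smul add_assoc add_left_commute mult.commute)
  qed (simp add: linear_map_def)
  note Yc [simp] = linear_map_closed[OF lin]
  have bd: "n (?Y k v) \<le> ?y k * n v" if "v \<in> carr V" for k v
    using that
  proof (induction k arbitrary: v)
    case (Suc k)
    have "n (?Y k (?Y k v)) \<le> ?y k * n (?Y k v)" using Suc by simp
    also have "\<dots> \<le> ?y k * (?y k * n v)"
      using Suc by (intro mult_left_mono) (auto simp: sqrt_scalar_bounds)
    finally have "n (?Y k (?Y k v)) \<le> (?y k)\<^sup>2 * n v" by (simp add: power2_eq_square)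
    then show ?case
      using Xn[of v] n_triangle[of "X v" "?Y k (?Y k v)"] Suc.prems
      by (simp add: n_smul field_simps)
  qed simp
  \<comment> \<open>Consecutive iterates differ by half the difference of the preceding squares,
    split as Y'(Y' - Y) + (Y' - Y)Y. The scalar increments satisfy the same recursion with equality,
    so they majorise.\<close>
  have step: "n (vdiff V (?Y (Suc k) v) (?Y k v)) \<le> (?y (Suc k) - ?y k) * n v" if "v \<in> carr V" for k v
    using that
  proof (induction k arbitrary: v)
    case 0
    then show ?case using Xn[of v] by (simp add: n_smul)
  next
    case (Suc k)
    note [simp] = Suc.prems
    let ?d = "?y (Suc k) - ?y k"
    have Yd: "?Y j (vdiff V x y) = vdiff V (?Y j x) (?Y j y)" if "x \<in> carr V" "y \<in> carr V" for j x y
      using linear_map_diff[OF complex_vector_space_axioms lin that] .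
    have Ys: "?Y (Suc j) x = smul V (1/2) (vadd V (X x) (?Y j (?Y j x)))" for j x by simp
    have "vdiff V (?Y (Suc (Suc k)) v) (?Y (Suc k) v) =
        smul V (1/2) (vdiff V (?Y (Suc k) (?Y (Suc k) v)) (?Y k (?Y k v)))"
      unfolding Ys[of "Suc k" v] Ys[of k v]
      by (simp add: smul_diff[symmetric] diff_add_add del: sqrt_iter.simps)
    then have "n (vdiff V (?Y (Suc (Suc k)) v) (?Y (Suc k) v)) =
        (1/2) * n (vdiff V (?Y (Suc k) (?Y (Suc k) v)) (?Y k (?Y k v)))"
      by (simp add: n_smul del: sqrt_iter.simps)
    also have "n (vdiff V (?Y (Suc k) (?Y (Suc k) v)) (?Y k (?Y k v)))
       \<le> n (?Y (Suc k) (vdiff V (?Y (Suc k) v) (?Y k v))) + n (vdiff V (?Y (Suc k) (?Y k v)) (?Y k (?Y k v)))"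
      using n_diff_triangle[of "?Y (Suc k) (?Y (Suc k) v)" "?Y (Suc k) (?Y k v)" "?Y k (?Y k v)"]
      by (simp add: Yd del: sqrt_iter.simps)
    also have "n (?Y (Suc k) (vdiff V (?Y (Suc k) v) (?Y k v))) \<le> ?y (Suc k) * n (vdiff V (?Y (Suc k) v) (?Y k v))"
      by (rule bd) (simp del: sqrt_iter.simps)
    also have "\<dots> \<le> ?y (Suc k) * (?d * n v)"
      using Suc.IH[of v] by (intro mult_left_mono) (simp_all add: sqrt_scalar_bounds del: sqrt_iter.simps sqrt_scalar.simps)
    also have "n (vdiff V (?Y (Suc k) (?Y k v)) (?Y k (?Y k v))) \<le> ?d * n (?Y k v)"
      by (rule Suc.IH) simp
    also have "\<dots> \<le> ?d * (?y k * n v)"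
      using bd[of v k] sqrt_scalar_mono[of k "Suc k"]
      by (intro mult_left_mono) (simp_all del: sqrt_scalar.simps)
    finally have "n (vdiff V (?Y (Suc (Suc k)) v) (?Y (Suc k) v)) \<le>
       (1/2) * (?y (Suc k) * (?d * n v) + ?d * (?y k * n v))" by simp
    also have "\<dots> = (((?y (Suc k))\<^sup>2 - (?y k)\<^sup>2) / 2) * n v"
      by (simp add: power2_eq_square algebra_simps del: sqrt_scalar.simps)
    also have "((?y (Suc k))\<^sup>2 - (?y k)\<^sup>2) / 2 = ?y (Suc (Suc k)) - ?y (Suc k)"
      by (simp add: field_simps)
    finally show ?case .
  qed
  have diff: "n (vdiff V (?Y (i + k) v) (?Y i v)) \<le> (?y (i + k) - ?y i) * n v" if "v \<in> carr V" for i k v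
  proof (induction k)
    case (Suc k)
    have "n (vdiff V (?Y (i + Suc k) v) (?Y i v)) \<le>
        n (vdiff V (?Y (Suc (i + k)) v) (?Y (i + k) v)) + n (vdiff V (?Y (i + k) v) (?Y i v))"
      using n_diff_triangle[of "?Y (Suc (i + k)) v" "?Y (i + k) v" "?Y i v"] that
      by (simp del: sqrt_iter.simps)
    then show ?case
      using step[OF that, of "i + k"] Suc by (simp add: algebra_simps del: sqrt_iter.simps sqrt_scalar.simps)
  qed (use that in simp)
  \<comment> \<open>The scalar limit serves to bound tails: \<open>l - sqrt_scalar k\<close> is the
    error \<open>e k\<close> of the conclusion, and \<open>l \<le> 1\<close> gives the contraction
    bound for \<open>Y\<close>.\<close>
  define l where "l = lim ?y"
  have "convergent ?y"
    using Bseq_mono_convergent[of ?y] sqrt_scalar_bounds sqrt_scalar_mono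
    by (intro Bseq_mono_convergent BseqI'[where K = 1]) (auto simp: abs_le_iff le_minus_iff intro: order_trans[of _ 0])
  then have lim: "?y \<longlonglongrightarrow> l" by (simp add: l_def convergent_LIMSEQ_iff)
  have yl: "?y k \<le> l" for k
    by (rule incseq_le[OF _ lim]) (auto simp: incseq_def sqrt_scalar_mono)
  have l1: "l \<le> 1" using LIMSEQ_le_const2[OF lim] sqrt_scalar_bounds by blast
  have pw: "n (vdiff V (?Y j v) (?Y i v)) \<le> (l - ?y i) * n v" if v: "v \<in> carr V" and ij: "i \<le> j" for i j v
  proof -
    obtain k where "j = i + k" using le_Suc_ex[OF ij] by blast
    then show ?thesis
      using diff[OF v, of i k] mult_right_mono[OF yl[of "i + k"] n_nonneg[OF v]]
      by (simp add: algebra_simps)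
  qed
  have e0: "(\<lambda>k. (l - ?y k) * c) \<longlonglongrightarrow> 0" for c
    using tendsto_mult_right[OF tendsto_diff[OF tendsto_const[of l] lim], of c] by simp
  have "\<exists>w\<in>carr V. (\<lambda>k. n (vdiff V (?Y k v) w)) \<longlonglongrightarrow> 0" if v: "v \<in> carr V" for v
  proof (rule complete_lim[OF cp])
    fix e :: real assume "e > 0"
    then obtain N where N: "(l - ?y N) * n v < e / 2"
      using order_tendstoD(2)[OF e0[of "n v"], of "e / 2"] by (auto simp: eventually_sequentially)
    have "n (vdiff V (?Y i v) (?Y j v)) < e" if ij: "N \<le> i" "N \<le> j" for i j
      using n_diff_triangle[of "?Y i v" "?Y N v" "?Y j v"] n_diff_commute[of "?Y N v" "?Y j v"]
        pw[OF v ij(1)] pw[OF v ij(2)] N v by simp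
    then show "\<exists>N. \<forall>i\<ge>N. \<forall>j\<ge>N. n (vdiff V (?Y i v) (?Y j v)) < e" by blast
  qed (use v in simp)
  then obtain Y where Y [simp]: "\<And>v. v \<in> carr V \<Longrightarrow> Y v \<in> carr V"
    and Ylim: "\<And>v. v \<in> carr V \<Longrightarrow> (\<lambda>k. n (vdiff V (?Y k v) (Y v))) \<longlonglongrightarrow> 0"
    by metis
  have est: "n (vdiff V (Y v) (?Y k v)) \<le> (l - ?y k) * n v" if v: "v \<in> carr V" for v k
  proof (rule field_le_epsilon)
    fix e :: real assume "e > 0"
    then obtain N where "\<And>j. j \<ge> N \<Longrightarrow> n (vdiff V (?Y j v) (Y v)) < e"
      using order_tendstoD(2)[OF Ylim[OF v]] by (auto simp: eventually_sequentially)
    then have "n (vdiff V (?Y (max N k) v) (Y v)) < e" by simp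
    then show "n (vdiff V (Y v) (?Y k v)) \<le> (l - ?y k) * n v + e"
      using n_diff_triangle[of "Y v" "?Y (max N k) v" "?Y k v"] pw[OF v, of k "max N k"]
        n_diff_commute[of "Y v" "?Y (max N k) v"] v by simp
  qed
  have est': "n (vdiff V (?Y k v) (Y v)) \<le> (l - ?y k) * n v" if v: "v \<in> carr V" for v k
    using est[OF v, of k] n_diff_commute[of "Y v" "?Y k v"] v by simp
  have Ybd: "n (Y v) \<le> n v" if v: "v \<in> carr V" for v
  proof -
    have "n (Y v) \<le> ?y 0 * n v + (l - ?y 0) * n v"
      using n_le_diff[of "Y v" "?Y 0 v"] est[OF v, of 0] bd[OF v, of 0] v by simp
    also have "\<dots> \<le> n v"
      using mult_right_mono[OF l1 n_nonneg[OF v]] by simp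
    finally show ?thesis .
  qed
  have small: "x = y" if "x \<in> carr V" "y \<in> carr V" "\<And>k. n (vdiff V x y) \<le> (l - ?y k) * c" for x y c
  proof (rule eq_by_small)
    fix e :: real assume "e > 0"
    then obtain N where "(l - ?y N) * c < e"
      using order_tendstoD(2)[OF e0[of c]] by (auto simp: eventually_sequentially)
    then show "n (vdiff V x y) \<le> e" using that(3)[of N] by simp
  qed (use that in auto)
  have "linear_map V V Y"
    unfolding linear_map_def
  proof (intro conjI ballI allI)
    fix x y assume x [simp]: "x \<in> carr V" and y [simp]: "y \<in> carr V"
    show "Y (vadd V x y) = vadd V (Y x) (Y y)"
    proof (rule small[of _ _ "n (vadd V x y) + n x + n y"])
      fix k
      have "n (vdiff V (Y (vadd V x y)) (vadd V (Y x) (Y y))) \<le>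
         n (vdiff V (Y (vadd V x y)) (?Y k (vadd V x y))) + n (vdiff V (vadd V (?Y k x) (?Y k y)) (vadd V (Y x) (Y y)))"
        using n_diff_triangle[of "Y (vadd V x y)" "?Y k (vadd V x y)" "vadd V (Y x) (Y y)"]
        by (simp add: linear_map_add[OF lin])
      also have "\<dots> \<le> n (vdiff V (Y (vadd V x y)) (?Y k (vadd V x y))) + (n (vdiff V (?Y k x) (Y x)) + n (vdiff V (?Y k y) (Y y)))"
        by (simp add: diff_add_add n_triangle)
      finally show "n (vdiff V (Y (vadd V x y)) (vadd V (Y x) (Y y))) \<le> (l - ?y k) * (n (vadd V x y) + n x + n y)"
        using est[of "vadd V x y" k] est'[OF x, of k] est'[OF y, of k] by (simp add: algebra_simps)
    qed auto
  next
    fix c x assume x [simp]: "x \<in> carr V"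
    show "Y (smul V c x) = smul V c (Y x)"
    proof (rule small[of _ _ "n (smul V c x) + cmod c * n x"])
      fix k
      have "n (vdiff V (Y (smul V c x)) (smul V c (Y x))) \<le>
         n (vdiff V (Y (smul V c x)) (?Y k (smul V c x))) + n (vdiff V (smul V c (?Y k x)) (smul V c (Y x)))"
        using n_diff_triangle[of "Y (smul V c x)" "?Y k (smul V c x)" "smul V c (Y x)"]
        by (simp add: linear_map_smul[OF lin])
      also have "n (vdiff V (smul V c (?Y k x)) (smul V c (Y x))) = cmod c * n (vdiff V (?Y k x) (Y x))"
        by (simp add: smul_diff[symmetric] n_smul)
      finally show "n (vdiff V (Y (smul V c x)) (smul V c (Y x))) \<le> (l - ?y k) * (n (smul V c x) + cmod c * n x)"
        using est[of "smul V c x" k] mult_left_mono[OF est'[OF x, of k], of "cmod c"]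
        by (simp add: algebra_simps)
    qed auto
  qed auto
  moreover have "smul V 2 (Y v) = vadd V (X v) (Y (Y v))" if v [simp]: "v \<in> carr V" for v
  proof (rule small[of _ _ "2 * n v + n v + n v"])
    fix k
    have A: "n (vdiff V (smul V 2 (Y v)) (smul V 2 (?Y (Suc k) v))) \<le> 2 * ((l - ?y k) * n v)"
    proof -
      have "n (vdiff V (smul V 2 (Y v)) (smul V 2 (?Y (Suc k) v))) = 2 * n (vdiff V (Y v) (?Y (Suc k) v))"
        by (simp add: smul_diff[symmetric] n_smul del: sqrt_iter.simps)
      also have "\<dots> \<le> 2 * ((l - ?y k) * n v)"
        using est[OF v, of "Suc k"] sqrt_scalar_mono[of k "Suc k"]
          mult_right_mono[of "l - ?y (Suc k)" "l - ?y k" "n v"] n_nonneg[OF v]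
        by (simp del: sqrt_iter.simps sqrt_scalar.simps)
      finally show ?thesis .
    qed
    have B: "n (vdiff V (?Y k (?Y k v)) (Y (Y v))) \<le> (l - ?y k) * n v + (l - ?y k) * n v"
    proof -
      have "n (vdiff V (?Y k (?Y k v)) (?Y k (Y v))) \<le> ?y k * n (vdiff V (?Y k v) (Y v))"
        using bd[of "vdiff V (?Y k v) (Y v)" k] linear_map_diff[OF complex_vector_space_axioms lin, of "?Y k v" "Y v" k]
        by simp
      also have "\<dots> \<le> 1 * n (vdiff V (?Y k v) (Y v))"
        by (intro mult_right_mono n_nonneg) (auto simp: sqrt_scalar_bounds)
      also have "\<dots> \<le> (l - ?y k) * n v" using est'[OF v] by simp
      finally have 1: "n (vdiff V (?Y k (?Y k v)) (?Y k (Y v))) \<le> (l - ?y k) * n v" .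
      have "n (vdiff V (?Y k (Y v)) (Y (Y v))) \<le> (l - ?y k) * n (Y v)" using est'[of "Y v"] by simp
      also have "\<dots> \<le> (l - ?y k) * n v"
        using Ybd[OF v] yl[of k] by (intro mult_left_mono) auto
      finally show ?thesis
        using 1 n_diff_triangle[of "?Y k (?Y k v)" "?Y k (Y v)" "Y (Y v)"] v
        unfolding add.assoc[symmetric] by (smt (verit) Y Yc)
    qed
    have "smul V 2 (?Y (Suc k) v) = vadd V (X v) (?Y k (?Y k v))"
      by (simp add: smul_smul)
    then have "n (vdiff V (smul V 2 (Y v)) (vadd V (X v) (Y (Y v)))) \<le>
       n (vdiff V (smul V 2 (Y v)) (smul V 2 (?Y (Suc k) v))) + n (vdiff V (?Y k (?Y k v)) (Y (Y v)))"
      using n_diff_triangle[of "smul V 2 (Y v)" "smul V 2 (?Y (Suc k) v)" "vadd V (X v) (Y (Y v))"]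
      by (simp add: diff_add_add del: sqrt_iter.simps)
    then show "n (vdiff V (smul V 2 (Y v)) (vadd V (X v) (Y (Y v)))) \<le> (l - ?y k) * (2 * n v + n v + n v)"
      using A B by (simp add: algebra_simps)
  qed auto
  moreover have "(\<lambda>k. l - ?y k) \<longlonglongrightarrow> 0" using e0[of 1] by simp
  ultimately show ?thesis
    using Ybd est by (intro exI[of _ Y] exI[of _ "\<lambda>k. l - ?y k"]) simp
qed

section \<open>Absolute values and Schur's lemma\<close>

text \<open>What survives of \<open>N\<close> being a limit of polynomials in \<open>S\<close>. It
  is applied with d = S, to make \<open>N\<close> and \<open>S\<close> commute, and with the members
  of an irreducible family.\<close>

definition in_bicommutant :: "'h hilbert \<Rightarrow> ('h \<Rightarrow> 'h) \<Rightarrow> ('h \<Rightarrow> 'h) \<Rightarrow> bool" where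
  "in_bicommutant H S N \<longleftrightarrow> (\<forall>d. bounded_linear_map H H d \<and> (\<forall>v\<in>carr H. d (S v) = S (d v)) \<longrightarrow>
     (\<forall>v\<in>carr H. d (N v) = N (d v)))"

context hilbert_space
begin

lemma norm_complete_H: "norm_complete H (hnorm H)"
  by (rule complete)

text \<open>An adjoint forces linearity, because both sides have the same products with every
  vector.\<close>

lemma adjoint_pair_linear:
  assumes "\<And>v. v \<in> carr H \<Longrightarrow> T v \<in> carr H"
    and "\<And>v w. \<lbrakk>v \<in> carr H; w \<in> carr H\<rbrakk> \<Longrightarrow> inn H (T v) w = inn H v (S w)"
    and "\<And>w. w \<in> carr H \<Longrightarrow> S w \<in> carr H"
  shows "linear_map H H T"
  unfolding linear_map_def
proof (intro conjI ballI allI)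
  note [simp] = assms(1,3)
  have T: "inn H z (T v) = inn H (S z) v" if "v \<in> carr H" "z \<in> carr H" for v z
    using assms(2)[OF that] inn_commute[of "T v" z] inn_commute[of v "S z"] that by simp
  fix x y assume "x \<in> carr H" "y \<in> carr H"
  then show "T (vadd H x y) = vadd H (T x) (T y)"
    by (intro inn_ext) (simp_all add: T)
next
  note [simp] = assms(1,3)
  have T: "inn H z (T v) = inn H (S z) v" if "v \<in> carr H" "z \<in> carr H" for v z
    using assms(2)[OF that] inn_commute[of "T v" z] inn_commute[of v "S z"] that by simp
  fix c x assume "x \<in> carr H"
  then show "T (smul H c x) = smul H c (T x)"
    by (intro inn_ext) (simp_all add: T)
qed (use assms(1) in blast)

text \<open>Here \<open>N = |S|\<close>.\<close>

lemma abs_contraction: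
  assumes S: "linear_map H H S" and Sb: "\<And>v. v \<in> carr H \<Longrightarrow> hnorm H (S v) \<le> hnorm H v"
    and sym: "\<And>v w. \<lbrakk>v \<in> carr H; w \<in> carr H\<rbrakk> \<Longrightarrow> inn H (S v) w = inn H v (S w)"
  shows "\<exists>N. linear_map H H N \<and> (\<forall>v\<in>carr H. hnorm H (N v) \<le> 2 * hnorm H v) \<and>
    (\<forall>v\<in>carr H. 0 \<le> Re (inn H v (N v))) \<and> (\<forall>v\<in>carr H. N (N v) = S (S v)) \<and>
    in_bicommutant H S N"
proof -
  note Sc [simp] = linear_map_closed[OF S]
  note Sa = linear_map_add[OF S] linear_map_smul[OF S] linear_map_diff[OF complex_vector_space_axioms S]
  \<comment> \<open>X = 1 - S^2, so that with Y = 1 - sqrt (1 - X) the operator N = 1 - Y is the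
    positive square root of S^2.\<close>
  define X where "X v = vdiff H v (S (S v))" for v
  have Xc [simp]: "X v \<in> carr H" if "v \<in> carr H" for v using that by (simp add: X_def)
  have Xsym: "inn H (X v) w = inn H v (X w)" if "v \<in> carr H" "w \<in> carr H" for v w
    using that by (simp add: X_def sym)
  then have X: "linear_map H H X"
    by (intro adjoint_pair_linear[where S = X]) auto
  interpret P: psd_form H "\<lambda>v w. inn H v (X w)"
  proof unfold_locales
    fix x y assume xy: "x \<in> carr H" "y \<in> carr H"
    show "inn H y (X x) = cnj (inn H x (X y))"
      using xy inn_commute[of x "X y"] by (simp add: X_def sym)
  next
    fix x assume x: "x \<in> carr H"
    have "Re (inn H x (X x)) = (hnorm H x)\<^sup>2 - (hnorm H (S x))\<^sup>2"
      using x by (simp add: X_def hnorm_sq sym)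
    then show "0 \<le> Re (inn H x (X x))"
      using Sb[OF x] x by (simp add: power_mono n_nonneg)
  qed (simp_all add: linear_map_add[OF X] linear_map_smul[OF X])
  have XX: "Re (inn H x (X x)) \<le> (hnorm H x)\<^sup>2" if "x \<in> carr H" for x
    using that inn_nonneg[of "S x"] sym[of x "S x"] by (simp add: X_def hnorm_sq)
  \<comment> \<open>From 0 \<le> X \<le> 1 by Cauchy-Schwarz for the form \<langle>v|Xw\<rangle>:
    |Xv|^4 \<le> \<langle>Xv|XXv\<rangle>\<langle>v|Xv\<rangle> \<le> |Xv|^2 |v|^2.\<close>
  have Xb: "hnorm H (X v) \<le> hnorm H v" if v: "v \<in> carr H" for v
  proof -
    have "cmod (inn H (X v) (X v)) = (hnorm H (X v))\<^sup>2"
      using v by (subst form.s_self) (simp_all add: norm_power n_nonneg)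
    then have "((hnorm H (X v))\<^sup>2)\<^sup>2 \<le> Re (inn H (X v) (X (X v))) * Re (inn H v (X v))"
      using P.cauchy_schwarz_sq[of "X v" v] v by simp
    also have "\<dots> \<le> (hnorm H (X v))\<^sup>2 * (hnorm H v)\<^sup>2"
      using v XX[of v] XX[of "X v"] P.s_nonneg[of v] by (intro mult_mono) auto
    finally have *: "(hnorm H (X v))\<^sup>2 * (hnorm H (X v))\<^sup>2 \<le> (hnorm H (X v))\<^sup>2 * (hnorm H v)\<^sup>2"
      by (simp only: power2_eq_square[of "(hnorm H (X v))\<^sup>2"])
    show ?thesis
    proof (cases "hnorm H (X v) = 0")
      case False
      then have "(hnorm H (X v))\<^sup>2 > 0" by simp
      then have "(hnorm H (X v))\<^sup>2 \<le> (hnorm H v)\<^sup>2" using * mult_le_cancel_left_pos by blast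
      then show ?thesis using n_nonneg[OF v] by (rule power2_le_imp_le)
    qed (use n_nonneg[OF v] in simp)
  qed
  obtain Y e where Y: "linear_map H H Y" and Yb: "\<And>v. v \<in> carr H \<Longrightarrow> hnorm H (Y v) \<le> hnorm H v"
    and YY: "\<And>v. v \<in> carr H \<Longrightarrow> smul H 2 (Y v) = vadd H (X v) (Y (Y v))"
    and e: "e \<longlonglongrightarrow> (0::real)"
    and est: "\<And>k v. v \<in> carr H \<Longrightarrow> hnorm H (vdiff H (Y v) (sqrt_iter H X k v)) \<le> e k * hnorm H v"
    using sqrt_operator[OF norm_complete_H X Xb] by metis
  let ?Y = "sqrt_iter H X"
  note Yc [simp] = linear_map_closed[OF Y]
  note Yl = linear_map_add[OF Y] linear_map_smul[OF Y] linear_map_diff[OF complex_vector_space_axioms Y]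
  have Ykc [simp]: "?Y k v \<in> carr H" if "v \<in> carr H" for k v
    using that by (induction k arbitrary: v) auto
  have sym_k: "inn H (?Y k v) w = inn H v (?Y k w)" if "v \<in> carr H" "w \<in> carr H" for k v w
    using that
  proof (induction k arbitrary: v w)
    case (Suc k)
    then show ?case by (simp add: Xsym)
  qed simp
  have Ysym: "inn H (Y v) w = inn H v (Y w)" if v: "v \<in> carr H" and w: "w \<in> carr H" for v w
  proof -
    have "cmod (inn H (Y v) w - inn H v (Y w)) \<le> e k * (2 * hnorm H v * hnorm H w)" for k
    proof -
      have "inn H (Y v) w - inn H v (Y w) = inn H (vdiff H (Y v) (?Y k v)) w - inn H v (vdiff H (Y w) (?Y k w))"
        using v w by (simp add: sym_k)
      also have "cmod \<dots> \<le> cmod (inn H (vdiff H (Y v) (?Y k v)) w) + cmod (inn H v (vdiff H (Y w) (?Y k w)))"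
        by (rule norm_triangle_ineq4)
      also have "\<dots> \<le> hnorm H (vdiff H (Y v) (?Y k v)) * hnorm H w + hnorm H v * hnorm H (vdiff H (Y w) (?Y k w))"
        using v w by (intro add_mono form.cauchy_schwarz) auto
      also have "\<dots> \<le> (e k * hnorm H v) * hnorm H w + hnorm H v * (e k * hnorm H w)"
        using v w by (intro add_mono mult_right_mono mult_left_mono est n_nonneg) auto
      finally show ?thesis by (simp add: algebra_simps)
    qed
    moreover have "(\<lambda>k. e k * (2 * hnorm H v * hnorm H w)) \<longlonglongrightarrow> 0"
      using tendsto_mult_left_zero[OF e] by blast
    ultimately have "cmod (inn H (Y v) w - inn H v (Y w)) \<le> 0"
      using LIMSEQ_le_const by blast
    then show ?thesis by simp
  qed
  define N where "N v = vdiff H v (Y v)" for v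
  have Nc [simp]: "N v \<in> carr H" if "v \<in> carr H" for v using that by (simp add: N_def)
  have "linear_map H H N"
  proof (rule adjoint_pair_linear)
    show "inn H (N v) w = inn H v (N w)" if "v \<in> carr H" "w \<in> carr H" for v w
      using that by (simp add: N_def Ysym)
  qed auto
  moreover have "hnorm H (N v) \<le> 2 * hnorm H v" if "v \<in> carr H" for v
    using n_diff_le[of v "Y v"] Yb[of v] that by (simp add: N_def)
  moreover have "0 \<le> Re (inn H v (N v))" if v: "v \<in> carr H" for v
  proof -
    have "Re (inn H v (Y v)) \<le> hnorm H v * hnorm H (Y v)"
      using form.cauchy_schwarz[of v "Y v"] v complex_Re_le_cmod[of "inn H v (Y v)"] by simp
    also have "\<dots> \<le> hnorm H v * hnorm H v"
      using v by (intro mult_left_mono Yb n_nonneg)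
    finally show ?thesis
      using v hnorm_sq[OF v] by (simp add: N_def power2_eq_square)
  qed
  \<comment> \<open>(1 - Y)^2 = 1 - 2Y + Y^2 = 1 - X by the fixed point equation of
    \<open>Y\<close>.\<close>
  moreover have "N (N v) = S (S v)" if v: "v \<in> carr H" for v
  proof (rule inn_ext)
    fix z assume z: "z \<in> carr H"
    have "2 * inn H z (Y v) = inn H z v - inn H z (S (S v)) + inn H z (Y (Y v))"
      using arg_cong[OF YY[OF v], of "inn H z"] v z by (simp add: X_def)
    then show "inn H z (N (N v)) = inn H z (S (S v))"
      using v z by (simp add: N_def Yl algebra_simps)
  qed (use v in auto)
  moreover have "d (N v) = N (d v)"
    if bl: "bounded_linear_map H H d"
      and dS: "\<And>v. v \<in> carr H \<Longrightarrow> d (S v) = S (d v)" and v: "v \<in> carr H" for d v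
  proof -
    obtain C where d: "linear_map H H d" and db: "\<And>v. v \<in> carr H \<Longrightarrow> hnorm H (d v) \<le> C * hnorm H v"
      using bl by (auto simp: bounded_linear_map_def)
    note dc [simp] = linear_map_closed[OF d]
    note dl = linear_map_add[OF d] linear_map_smul[OF d] linear_map_diff[OF complex_vector_space_axioms d]
      linear_map_zero[OF complex_vector_space_axioms complex_vector_space_axioms d]
    have dX: "d (X w) = X (d w)" if "w \<in> carr H" for w
      using that by (simp add: X_def dl dS)
    have dk: "d (?Y k w) = ?Y k (d w)" if "w \<in> carr H" for k w
      using that
    proof (induction k arbitrary: w)
      case (Suc k)
      then show ?case by (simp add: dl dX)
    qed (simp add: dl)
    have C: "hnorm H (d w) \<le> \<bar>C\<bar> * hnorm H w" if "w \<in> carr H" for w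
      using db[OF that] mult_right_mono[OF abs_ge_self n_nonneg[OF that], of C] by linarith
    have "hnorm H (vdiff H (d (Y v)) (Y (d v))) \<le> e k * (\<bar>C\<bar> * hnorm H v + hnorm H (d v))" for k
    proof -
      have "hnorm H (vdiff H (d (Y v)) (Y (d v))) \<le>
        hnorm H (vdiff H (d (Y v)) (d (?Y k v))) + hnorm H (vdiff H (?Y k (d v)) (Y (d v)))"
        using n_diff_triangle[of "d (Y v)" "d (?Y k v)" "Y (d v)"] v dk by simp
      also have "hnorm H (vdiff H (d (Y v)) (d (?Y k v))) \<le> \<bar>C\<bar> * hnorm H (vdiff H (Y v) (?Y k v))"
        using C[of "vdiff H (Y v) (?Y k v)"] v by (simp add: dl)
      also have "\<dots> \<le> \<bar>C\<bar> * (e k * hnorm H v)"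
        using v by (intro mult_left_mono est) auto
      also have "hnorm H (vdiff H (?Y k (d v)) (Y (d v))) \<le> e k * hnorm H (d v)"
        using est[of "d v" k] n_diff_commute[of "Y (d v)" "?Y k (d v)"] v by simp
      finally show ?thesis by (simp add: algebra_simps)
    qed
    moreover have "(\<lambda>k. e k * (\<bar>C\<bar> * hnorm H v + hnorm H (d v))) \<longlonglongrightarrow> 0"
      using tendsto_mult_left_zero[OF e] by blast
    ultimately have "hnorm H (vdiff H (d (Y v)) (Y (d v))) \<le> 0"
      using LIMSEQ_le_const by blast
    then have "d (Y v) = Y (d v)"
      using n_diff_eq_0[of "d (Y v)" "Y (d v)"] n_nonneg[of "vdiff H (d (Y v)) (Y (d v))"] v by simp
    then show ?thesis using v by (simp add: N_def dl)
  qed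
  then have "in_bicommutant H S N" unfolding in_bicommutant_def by blast
  ultimately show ?thesis by (intro exI[of _ N]) blast
qed

lemma abs_bounded:
  assumes S: "linear_map H H S" and Sb: "\<And>v. v \<in> carr H \<Longrightarrow> hnorm H (S v) \<le> C * hnorm H v"
    and C: "C > 0"
    and sym: "\<And>v w. \<lbrakk>v \<in> carr H; w \<in> carr H\<rbrakk> \<Longrightarrow> inn H (S v) w = inn H v (S w)"
  shows "\<exists>N B. linear_map H H N \<and> (\<forall>v\<in>carr H. hnorm H (N v) \<le> B * hnorm H v) \<and>
    (\<forall>v\<in>carr H. 0 \<le> Re (inn H v (N v))) \<and> (\<forall>v\<in>carr H. N (N v) = S (S v)) \<and>
    in_bicommutant H S N"
proof -
  note Sc [simp] = linear_map_closed[OF S]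
  note Sl = linear_map_add[OF S] linear_map_smul[OF S]
  define S' where "S' v = smul H (1/C) (S v)" for v
  have S': "linear_map H H S'"
    by (auto simp: linear_map_def S'_def Sl smul_add_right smul_smul mult.commute)
  have "hnorm H (S' v) \<le> hnorm H v" if "v \<in> carr H" for v
    using Sb[OF that] C that by (simp add: S'_def n_smul norm_divide field_simps)
  moreover have "inn H (S' v) w = inn H v (S' w)" if "v \<in> carr H" "w \<in> carr H" for v w
    using that by (simp add: S'_def sym)
  ultimately obtain N where N: "linear_map H H N"
    and Nb: "\<And>v. v \<in> carr H \<Longrightarrow> hnorm H (N v) \<le> 2 * hnorm H v"
    and pos: "\<And>v. v \<in> carr H \<Longrightarrow> 0 \<le> Re (inn H v (N v))"
    and NN: "\<And>v. v \<in> carr H \<Longrightarrow> N (N v) = S' (S' v)"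
    and com: "in_bicommutant H S' N"
    using abs_contraction[OF S'] by metis
  note Nc [simp] = linear_map_closed[OF N] and Nl = linear_map_add[OF N] linear_map_smul[OF N]
  define M where "M v = smul H C (N v)" for v
  have "linear_map H H M"
    by (auto simp: linear_map_def M_def Nl smul_add_right smul_smul mult.commute)
  moreover have "hnorm H (M v) \<le> (2 * C) * hnorm H v" if "v \<in> carr H" for v
    using Nb[OF that] C that by (simp add: M_def n_smul)
  moreover have "0 \<le> Re (inn H v (M v))" if "v \<in> carr H" for v
    using pos[OF that] C that by (simp add: M_def)
  moreover have "M (M v) = S (S v)" if "v \<in> carr H" for v
    using that C by (simp add: M_def Nl NN S'_def Sl smul_smul)
  moreover have "d (M v) = M (d v)"
    if d: "bounded_linear_map H H d" "\<And>v. v \<in> carr H \<Longrightarrow> d (S v) = S (d v)"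
      and v: "v \<in> carr H" for d v
  proof -
    have dl: "\<And>c x. x \<in> carr H \<Longrightarrow> d (smul H c x) = smul H c (d x)"
      and dc [simp]: "\<And>x. x \<in> carr H \<Longrightarrow> d x \<in> carr H"
      using d(1) by (auto simp: bounded_linear_map_def linear_map_def)
    have "\<forall>v\<in>carr H. d (S' v) = S' (d v)" using d(2) by (simp add: S'_def dl)
    then have "d (N v) = N (d v)" using com d(1) v unfolding in_bicommutant_def by blast
    then show ?thesis using v by (simp add: M_def dl)
  qed
  then have "in_bicommutant H S M" unfolding in_bicommutant_def by blast
  ultimately show ?thesis by (intro exI[of _ M] exI[of _ "2 * C"]) blast
qed

text \<open>
  Schur's lemma for self-adjoint intertwiners. With \<open>N = |T - \<lambda>|\<close> one has
  \<open>(T - \<lambda> + N) (T - \<lambda> - N) = 0\<close>, so irreducibility forces \<open>T \<le> \<lambda>\<close> or \<open>T \<ge> \<lambda>\<close>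
  for every real \<open>\<lambda>\<close>; the cut determines the scalar.
\<close>

lemma schur:
  fixes D :: "('h \<Rightarrow> 'h) set"
  assumes irr: "\<And>W. \<lbrakk>subspace_of H W; closedin (norm_topology H (hnorm H)) W;
        \<And>d. d \<in> D \<Longrightarrow> d ` W \<subseteq> W\<rbrakk> \<Longrightarrow> W = {vzero H} \<or> W = carr H"
    and D: "\<And>d. d \<in> D \<Longrightarrow> bounded_linear_map H H d"
    and T: "linear_map H H T" and Tb: "\<And>v. v \<in> carr H \<Longrightarrow> hnorm H (T v) \<le> C * hnorm H v"
    and sym: "\<And>v w. \<lbrakk>v \<in> carr H; w \<in> carr H\<rbrakk> \<Longrightarrow> inn H (T v) w = inn H v (T w)"
    and com: "\<And>d v. \<lbrakk>d \<in> D; v \<in> carr H\<rbrakk> \<Longrightarrow> d (T v) = T (d v)"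
  shows "\<exists>l::real. \<forall>v\<in>carr H. T v = smul H l v"
proof (cases "carr H = {vzero H}")
  case True
  then show ?thesis
    using linear_map_closed[OF T zero_closed] by auto
next
  case False
  note Tc [simp] = linear_map_closed[OF T]
  note Tl = linear_map_add[OF T] linear_map_smul[OF T]
  let ?q = "\<lambda>v. Re (inn H v (T v))"
  have Tsc: "inn H v (T v) = of_real (?q v)" if "v \<in> carr H" for v
    using sym[OF that that] inn_commute[of v "T v"] that by (simp add: complex_eq_iff)
  have cut: "(\<forall>v\<in>carr H. l * (hnorm H v)\<^sup>2 \<le> ?q v) \<or> (\<forall>v\<in>carr H. ?q v \<le> l * (hnorm H v)\<^sup>2)" for l :: real
  proof -
    define S where "S v = vdiff H (T v) (smul H l v)" for v
    have Sc [simp]: "S v \<in> carr H" if "v \<in> carr H" for v using that by (simp add: S_def)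
    have Ssym: "inn H (S v) w = inn H v (S w)" if "v \<in> carr H" "w \<in> carr H" for v w
      using that by (simp add: S_def sym)
    have S: "linear_map H H S"
      by (rule adjoint_pair_linear[where S = S]) (auto simp: Ssym)
    note Sl = linear_map_add[OF S] linear_map_diff[OF complex_vector_space_axioms S]
    have Sb: "hnorm H (S v) \<le> (\<bar>C\<bar> + \<bar>l\<bar> + 1) * hnorm H v" if "v \<in> carr H" for v
    proof -
      have "hnorm H (S v) \<le> hnorm H (T v) + \<bar>l\<bar> * hnorm H v"
        using n_diff_le[of "T v" "smul H l v"] that by (simp add: S_def n_smul)
      moreover have "hnorm H (T v) \<le> \<bar>C\<bar> * hnorm H v"
        using Tb[OF that] mult_right_mono[OF abs_ge_self n_nonneg[OF that], of C] by linarith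
      ultimately show ?thesis using n_nonneg[OF that] by (simp add: algebra_simps)
    qed
    obtain N B where N: "linear_map H H N"
      and Nb: "\<And>v. v \<in> carr H \<Longrightarrow> hnorm H (N v) \<le> B * hnorm H v"
      and pos: "\<And>v. v \<in> carr H \<Longrightarrow> 0 \<le> Re (inn H v (N v))"
      and NN: "\<And>v. v \<in> carr H \<Longrightarrow> N (N v) = S (S v)"
      and "in_bicommutant H S N"
    proof -
      have "\<bar>C\<bar> + \<bar>l\<bar> + 1 > 0" by linarith
      then show thesis using abs_bounded[OF S Sb _ Ssym] that by metis
    qed
    then have Ncom: "d (N v) = N (d v)" if "bounded_linear_map H H d"
        "\<And>v. v \<in> carr H \<Longrightarrow> d (S v) = S (d v)" "v \<in> carr H" for d v
      using that unfolding in_bicommutant_def by blast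
    note Nc [simp] = linear_map_closed[OF N]
    note Nl = linear_map_add[OF N] linear_map_diff[OF complex_vector_space_axioms N]
    have SN: "S (N v) = N (S v)" if "v \<in> carr H" for v
      using S Sb by (intro Ncom that) (auto simp: bounded_linear_map_def)
    define G where "G v = vadd H (S v) (N v)" for v
    have G: "linear_map H H G"
      by (auto simp: linear_map_def G_def Sl Nl linear_map_smul[OF S] linear_map_smul[OF N]
          smul_add_right add_assoc add_left_commute)
    have Gb: "hnorm H (G v) \<le> (\<bar>C\<bar> + \<bar>l\<bar> + 1 + B) * hnorm H v" if "v \<in> carr H" for v
      using n_triangle[of "S v" "N v"] Sb[OF that] Nb[OF that] that by (simp add: G_def algebra_simps)
    let ?W = "{v \<in> carr H. G v = vzero H}"
    have "?W = {vzero H} \<or> ?W = carr H"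
    proof (rule irr[OF kernel_closed_subspace[OF G Gb]])
      fix d assume d: "d \<in> D"
      have dl: "linear_map H H d" using D[OF d] by (simp add: bounded_linear_map_def)
      have dS: "d (S v) = S (d v)" if "v \<in> carr H" for v
        using that linear_map_closed[OF dl] com[OF d]
        by (simp add: S_def linear_map_diff[OF complex_vector_space_axioms dl] linear_map_smul[OF dl])
      have "d (G v) = G (d v)" if "v \<in> carr H" for v
        using that Ncom[OF D[OF d] dS that] dS by (simp add: G_def linear_map_add[OF dl])
      then show "d ` ?W \<subseteq> ?W"
        using linear_map_closed[OF dl]
          linear_map_zero[OF complex_vector_space_axioms complex_vector_space_axioms dl]
        by (smt (verit, ccfv_SIG) image_subset_iff mem_Collect_eq)
    qed
    then show ?thesis
    proof
      assume W: "?W = {vzero H}"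
      \<comment> \<open>(S + N)(S - N) = S^2 - N^2 = 0 because \<open>N\<close> commutes with
        \<open>S\<close>; as S + N is injective here, S = N.\<close>
      have "S v = N v" if v: "v \<in> carr H" for v
      proof -
        have "G (vdiff H (S v) (N v)) = vzero H"
          by (rule inn_ext) (use v in \<open>simp_all add: G_def Sl Nl NN SN\<close>)
        then have "vdiff H (S v) (N v) \<in> ?W" using v by simp
        then show ?thesis using W v by (simp add: diff_eq_zero)
      qed
      then have "0 \<le> Re (inn H v (S v))" if "v \<in> carr H" for v
        using pos that by simp
      then show ?thesis
        by (auto simp: S_def hnorm_sq)
    next
      \<comment> \<open>Now S = - N, so the quadratic form of \<open>S\<close> is
        nonpositive.\<close>
      assume W: "?W = carr H"
      have "Re (inn H v (S v)) \<le> 0" if v: "v \<in> carr H" for v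
      proof -
        have "G v = vzero H" using W v by blast
        then have "inn H v (G v) = 0" using v by simp
        then have "inn H v (S v) = - inn H v (N v)"
          using v by (simp add: G_def eq_neg_iff_add_eq_0)
        then show ?thesis using pos[OF v] by simp
      qed
      then show ?thesis
        by (auto simp: S_def hnorm_sq)
    qed
  qed
  obtain x where x: "x \<in> carr H" "x \<noteq> vzero H"
    using False zero_closed by blast
  then have hx: "hnorm H x > 0"
    using n_nonneg n_eq_0 by (metis less_eq_real_def)
  have qb: "\<bar>?q v\<bar> \<le> \<bar>C\<bar> * (hnorm H v)\<^sup>2" if v: "v \<in> carr H" for v
  proof -
    have "\<bar>?q v\<bar> \<le> hnorm H v * hnorm H (T v)"
      using form.cauchy_schwarz[of v "T v"] v abs_Re_le_cmod[of "inn H v (T v)"] by simp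
    also have "\<dots> \<le> hnorm H v * (\<bar>C\<bar> * hnorm H v)"
      using Tb[OF v] mult_right_mono[OF abs_ge_self n_nonneg[OF v], of C] v
      by (intro mult_left_mono n_nonneg) auto
    finally show ?thesis by (simp add: power2_eq_square algebra_simps)
  qed
  \<comment> \<open>The lower bounds of \<open>T\<close>. By \<open>cut\<close> every real number
    above the supremum of \<open>P\<close> is an upper bound, so the supremum is the scalar.\<close>
  define P where "P = {l. \<forall>v\<in>carr H. l * (hnorm H v)\<^sup>2 \<le> ?q v}"
  have P0: "- \<bar>C\<bar> \<in> P" using qb by (fastforce simp: P_def abs_le_iff)
  have Pb: "l \<le> \<bar>C\<bar>" if "l \<in> P" for l
  proof -
    have "l * (hnorm H x)\<^sup>2 \<le> \<bar>C\<bar> * (hnorm H x)\<^sup>2"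
      using that qb[OF x(1)] x(1) by (force simp: P_def abs_le_iff)
    then show ?thesis using hx by simp
  qed
  then have bdd: "bdd_above P" by (auto simp: bdd_above_def)
  define l where "l = Sup P"
  have low: "l * (hnorm H v)\<^sup>2 \<le> ?q v" if v: "v \<in> carr H" for v
  proof (cases "hnorm H v = 0")
    case False
    then have h: "(hnorm H v)\<^sup>2 > 0" by simp
    have "l \<le> ?q v / (hnorm H v)\<^sup>2"
      unfolding l_def
    proof (rule cSup_least)
      show "k \<le> ?q v / (hnorm H v)\<^sup>2" if "k \<in> P" for k
        using that v h by (simp add: P_def pos_le_divide_eq)
    qed (use P0 in auto)
    then show ?thesis using h by (simp add: pos_le_divide_eq)
  qed (use v n_eq_0 in simp)
  have high: "?q v \<le> l * (hnorm H v)\<^sup>2" if v: "v \<in> carr H" for v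
  proof (rule field_le_epsilon)
    fix e :: real assume e: "e > 0"
    define t where "t = e / ((hnorm H v)\<^sup>2 + 1)"
    have t: "t > 0" using e by (simp add: t_def add_nonneg_pos)
    then have "l + t \<notin> P" using cSup_upper[OF _ bdd] unfolding l_def by force
    then have "?q v \<le> (l + t) * (hnorm H v)\<^sup>2"
      using cut[of "l + t"] v by (auto simp: P_def)
    also have "\<dots> \<le> l * (hnorm H v)\<^sup>2 + t * ((hnorm H v)\<^sup>2 + 1)"
      using t by (simp add: algebra_simps)
    also have "t * ((hnorm H v)\<^sup>2 + 1) = e"
      using add_nonneg_pos[of "(hnorm H v)\<^sup>2" 1] by (simp add: t_def)
    finally show "?q v \<le> l * (hnorm H v)\<^sup>2 + e" .
  qed
  define S where "S v = vdiff H (T v) (smul H l v)" for v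
  have Sc [simp]: "S v \<in> carr H" if "v \<in> carr H" for v using that by (simp add: S_def)
  have S0: "Re (inn H v (S v)) = 0" if "v \<in> carr H" for v
    using low[OF that] high[OF that] that by (simp add: S_def hnorm_sq)
  \<comment> \<open>The quadratic form of T - l vanishes; regarded as a degenerate positive form it
    satisfies Cauchy-Schwarz, which turns this into S = 0.\<close>
  interpret P: psd_form H "\<lambda>v w. inn H v (S w)"
  proof unfold_locales
    show "inn H y (S x) = cnj (inn H x (S y))" if "x \<in> carr H" "y \<in> carr H" for x y
      using that inn_commute[of x "S y"] by (simp add: S_def sym)
    show "0 \<le> Re (inn H x (S x))" if "x \<in> carr H" for x
      using S0[OF that] by simp
  qed (simp_all add: S_def Tl algebra_simps)
  have "T v = smul H l v" if v: "v \<in> carr H" for v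
  proof -
    have "inn H (S v) (S v) = 0"
      using P.cauchy_schwarz_sq[of "S v" v] S0[OF v] v by simp
    then have "S v = vzero H" using v inn_definite by simp
    then show ?thesis using v by (simp add: S_def diff_eq_zero)
  qed
  then show ?thesis by blast
qed

end

section \<open>Representations of star algebras\<close>

text \<open>The structure on which the representation theory below rests. It is instantiated by
  C*-algebras and by the quotient, whose norm enters only through its states.\<close>

locale star_alg = complex_vector_space B for B :: "'b cstar" +
  assumes mul_closed [simp, intro]: "\<lbrakk>x \<in> carr B; y \<in> carr B\<rbrakk> \<Longrightarrow> mul B x y \<in> carr B"
    and star_closed [simp, intro]: "x \<in> carr B \<Longrightarrow> star B x \<in> carr B"
    and star_star [simp]: "x \<in> carr B \<Longrightarrow> star B (star B x) = x"

definition intertwines :: "'a cstar \<Rightarrow> ('a, 'h) rep \<Rightarrow> ('a, 'k) rep \<Rightarrow> ('h \<Rightarrow> 'k) \<Rightarrow> bool" where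
  "intertwines B \<pi> \<sigma> u \<longleftrightarrow> unitary_map (rspace \<pi>) (rspace \<sigma>) u \<and>
     (\<forall>a\<in>carr B. \<forall>x\<in>carr (rspace \<pi>). u (rop \<pi> a x) = rop \<sigma> a (u x))"

lemma unitarily_equivalent_iff: "unitarily_equivalent B \<pi> \<sigma> \<longleftrightarrow> (\<exists>u. intertwines B \<pi> \<sigma> u)"
  by (simp add: unitarily_equivalent_def intertwines_def)

definition vecstate :: "'a cstar \<Rightarrow> ('a, 'h) rep \<Rightarrow> 'h \<Rightarrow> 'a \<Rightarrow> complex" where
  "vecstate B \<pi> x = (\<lambda>a\<in>carr B. inn (rspace \<pi>) x (rop \<pi> a x))"

lemma rep_hilbert: "representation B \<pi> \<Longrightarrow> hilbert_space (rspace \<pi>)"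
  and rep_bounded: "\<lbrakk>representation B \<pi>; a \<in> carr B\<rbrakk> \<Longrightarrow> bounded_linear_map (rspace \<pi>) (rspace \<pi>) (rop \<pi> a)"
  and rep_add: "\<lbrakk>representation B \<pi>; a \<in> carr B; b \<in> carr B; x \<in> carr (rspace \<pi>)\<rbrakk> \<Longrightarrow>
    rop \<pi> (vadd B a b) x = vadd (rspace \<pi>) (rop \<pi> a x) (rop \<pi> b x)"
  and rep_smul: "\<lbrakk>representation B \<pi>; a \<in> carr B; x \<in> carr (rspace \<pi>)\<rbrakk> \<Longrightarrow>
    rop \<pi> (smul B c a) x = smul (rspace \<pi>) c (rop \<pi> a x)"
  and rep_mul: "\<lbrakk>representation B \<pi>; a \<in> carr B; b \<in> carr B; x \<in> carr (rspace \<pi>)\<rbrakk> \<Longrightarrow>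
    rop \<pi> (mul B a b) x = rop \<pi> a (rop \<pi> b x)"
  and rep_star: "\<lbrakk>representation B \<pi>; a \<in> carr B; x \<in> carr (rspace \<pi>); y \<in> carr (rspace \<pi>)\<rbrakk> \<Longrightarrow>
    inn (rspace \<pi>) (rop \<pi> (star B a) x) y = inn (rspace \<pi>) x (rop \<pi> a y)"
  by (simp_all add: representation_def)

lemma rep_linear: "\<lbrakk>representation B \<pi>; a \<in> carr B\<rbrakk> \<Longrightarrow> linear_map (rspace \<pi>) (rspace \<pi>) (rop \<pi> a)"
  using rep_bounded[of B \<pi> a] by (simp add: bounded_linear_map_def)

lemma rep_closed: "\<lbrakk>representation B \<pi>; a \<in> carr B; x \<in> carr (rspace \<pi>)\<rbrakk> \<Longrightarrow> rop \<pi> a x \<in> carr (rspace \<pi>)"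
  using linear_map_closed[OF rep_linear] .

lemma rep_vec_linear:
  "\<lbrakk>representation B \<pi>; x \<in> carr (rspace \<pi>)\<rbrakk> \<Longrightarrow> linear_map B (rspace \<pi>) (\<lambda>a. rop \<pi> a x)"
  by (simp add: linear_map_def rep_closed rep_add rep_smul)

lemmas rep_vec_add = linear_map_add[OF rep_linear]
  and rep_vec_smul = linear_map_smul[OF rep_linear]

lemma irr_rep: "irreducible_rep B \<pi> \<Longrightarrow> representation B \<pi>"
  and irr_nonzero: "irreducible_rep B \<pi> \<Longrightarrow> nonzero_on (carr B) \<pi>"
  by (auto simp: irreducible_rep_def)

lemma irr_dichotomy:
  "\<lbrakk>irreducible_rep B \<pi>; subspace_of (rspace \<pi>) W;
    closedin (norm_topology (rspace \<pi>) (hnorm (rspace \<pi>))) W;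
    \<And>a. a \<in> carr B \<Longrightarrow> rop \<pi> a ` W \<subseteq> W\<rbrakk> \<Longrightarrow> W = {vzero (rspace \<pi>)} \<or> W = carr (rspace \<pi>)"
  by (auto simp: irreducible_rep_def)

context star_alg
begin

lemma rep_adjoint:
  "\<lbrakk>representation B \<pi>; a \<in> carr B; x \<in> carr (rspace \<pi>); y \<in> carr (rspace \<pi>)\<rbrakk> \<Longrightarrow>
   inn (rspace \<pi>) (rop \<pi> a x) y = inn (rspace \<pi>) x (rop \<pi> (star B a) y)"
  using rep_star[of B \<pi> "star B a" x y] by simp

text \<open>The complement of these vectors is a closed invariant subspace, and it is not everything
  because the representation does not vanish.\<close>

lemma rep_range_total:
  assumes irr: "irreducible_rep B \<pi>"
  shows "hilbert_space.total (rspace \<pi>) {rop \<pi> a w |a w. a \<in> carr B \<and> w \<in> carr (rspace \<pi>)}"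
proof -
  let ?H = "rspace \<pi>" and ?S = "{rop \<pi> a w |a w. a \<in> carr B \<and> w \<in> carr (rspace \<pi>)}"
  note r = irr_rep[OF irr]
  interpret H: hilbert_space ?H by (rule rep_hilbert[OF r])
  note [simp] = rep_closed[OF r]
  have sub: "?S \<subseteq> carr ?H" by auto
  have inv: "rop \<pi> b ` perp ?H ?S \<subseteq> perp ?H ?S" if b: "b \<in> carr B" for b
  proof
    fix y assume "y \<in> rop \<pi> b ` perp ?H ?S"
    then obtain v where v: "v \<in> carr ?H" and y: "y = rop \<pi> b v"
      and p: "\<And>a w. \<lbrakk>a \<in> carr B; w \<in> carr ?H\<rbrakk> \<Longrightarrow> inn ?H (rop \<pi> a w) v = 0"
      by (auto simp: perp_def)
    have "inn ?H (rop \<pi> a w) y = 0" if "a \<in> carr B" "w \<in> carr ?H" for a w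
      using rep_star[OF r b, of "rop \<pi> a w" v] rep_mul[OF r, of "star B b" a w] p[of "mul B (star B b) a" w]
        that b v y by simp
    then show "y \<in> perp ?H ?S" using v b y by (auto simp: perp_def)
  qed
  have "perp ?H ?S \<noteq> carr ?H"
  proof
    assume *: "perp ?H ?S = carr ?H"
    obtain a w where aw: "a \<in> carr B" "w \<in> carr ?H" "rop \<pi> a w \<noteq> vzero ?H"
      using irr_nonzero[OF irr] by (auto simp: nonzero_on_def)
    then have "rop \<pi> a w \<in> perp ?H ?S" using * by simp
    then have "inn ?H (rop \<pi> a w) (rop \<pi> a w) = 0" using aw by (auto simp: perp_def)
    then show False using aw H.inn_definite by simp
  qed
  then show ?thesis
    using irr_dichotomy[OF irr H.perp_subspace[OF sub] H.perp_closed[OF sub] inv]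
    by (auto simp: H.total_def)
qed

text \<open>Such a vector is orthogonal to all \<open>rop \<pi> a w\<close>, which form a total
  set.\<close>

lemma rep_null_vector:
  assumes irr: "irreducible_rep B \<pi>" and x: "x \<in> carr (rspace \<pi>)"
    and "\<And>a. a \<in> carr B \<Longrightarrow> rop \<pi> a x = vzero (rspace \<pi>)"
  shows "x = vzero (rspace \<pi>)"
proof -
  note r = irr_rep[OF irr]
  interpret H: hilbert_space "rspace \<pi>" by (rule rep_hilbert[OF r])
  show ?thesis
    by (rule H.total_ext[OF rep_range_total[OF irr]])
      (use x assms(3) in \<open>auto simp: rep_closed[OF r] rep_adjoint[OF r]\<close>)
qed

text \<open>The complement of the orbit of \<open>x\<close> is closed and invariant. If it were
  everything, the orbit would be zero, contrary to \<open>rep_null_vector\<close>.\<close>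

lemma rep_cyclic:
  assumes irr: "irreducible_rep B \<pi>" and x: "x \<in> carr (rspace \<pi>)" "x \<noteq> vzero (rspace \<pi>)"
  shows "hilbert_space.total (rspace \<pi>) ((\<lambda>a. rop \<pi> a x) ` carr B)"
proof -
  let ?H = "rspace \<pi>" and ?S = "(\<lambda>a. rop \<pi> a x) ` carr B"
  note r = irr_rep[OF irr]
  interpret H: hilbert_space ?H by (rule rep_hilbert[OF r])
  note [simp] = rep_closed[OF r] x(1)
  have sub: "?S \<subseteq> carr ?H" by auto
  have inv: "rop \<pi> b ` perp ?H ?S \<subseteq> perp ?H ?S" if b: "b \<in> carr B" for b
  proof
    fix y assume "y \<in> rop \<pi> b ` perp ?H ?S"
    then obtain v where v: "v \<in> carr ?H" and y: "y = rop \<pi> b v"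
      and p: "\<And>a. a \<in> carr B \<Longrightarrow> inn ?H (rop \<pi> a x) v = 0"
      by (auto simp: perp_def)
    have "inn ?H (rop \<pi> a x) y = 0" if "a \<in> carr B" for a
      using rep_star[OF r b, of "rop \<pi> a x" v] rep_mul[OF r, of "star B b" a x] p[of "mul B (star B b) a"]
        that b v y by simp
    then show "y \<in> perp ?H ?S" using v b y by (auto simp: perp_def)
  qed
  have "perp ?H ?S \<noteq> carr ?H"
  proof
    assume *: "perp ?H ?S = carr ?H"
    have "rop \<pi> a x = vzero ?H" if a: "a \<in> carr B" for a
    proof -
      have "rop \<pi> a x \<in> perp ?H ?S" using * a by simp
      then have "inn ?H (rop \<pi> a x) (rop \<pi> a x) = 0" using a by (auto simp: perp_def)
      then show ?thesis using a H.inn_definite by simp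
    qed
    then show False using rep_null_vector[OF irr x(1)] x(2) by blast
  qed
  then show ?thesis
    using irr_dichotomy[OF irr H.perp_subspace[OF sub] H.perp_closed[OF sub] inv]
    by (auto simp: H.total_def)
qed

lemma irr_nontrivial:
  assumes irr: "irreducible_rep B \<pi>"
  shows "unit_vectors (rspace \<pi>) \<noteq> {}"
proof -
  note r = irr_rep[OF irr]
  interpret H: hilbert_space "rspace \<pi>" by (rule rep_hilbert[OF r])
  obtain a w where aw: "a \<in> carr B" "w \<in> carr (rspace \<pi>)" "rop \<pi> a w \<noteq> vzero (rspace \<pi>)"
    using irr_nonzero[OF irr] by (auto simp: nonzero_on_def)
  let ?y = "rop \<pi> a w"
  have y: "?y \<in> carr (rspace \<pi>)" using rep_closed[OF r] aw by simp
  then have "hnorm (rspace \<pi>) ?y > 0"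
    using H.n_nonneg H.n_eq_0 aw(3) by (metis less_eq_real_def)
  then have "smul (rspace \<pi>) (1 / hnorm (rspace \<pi>) ?y) ?y \<in> unit_vectors (rspace \<pi>)"
    using y by (simp add: unit_vectors_def H.n_smul norm_divide)
  then show ?thesis by blast
qed

end

section \<open>Intertwiners and unitary equivalence\<close>

lemma intertwines_unitary: "intertwines B \<pi> \<sigma> u \<Longrightarrow> unitary_map (rspace \<pi>) (rspace \<sigma>) u"
  and intertwines_rop: "\<lbrakk>intertwines B \<pi> \<sigma> u; a \<in> carr B; x \<in> carr (rspace \<pi>)\<rbrakk> \<Longrightarrow>
    u (rop \<pi> a x) = rop \<sigma> a (u x)"
  by (auto simp: intertwines_def)

lemma intertwines_id: "representation B \<pi> \<Longrightarrow> intertwines B \<pi> \<pi> (\<lambda>x. x)"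
  by (simp add: intertwines_def unitary_id rep_hilbert)

lemma intertwines_comp:
  "\<lbrakk>intertwines B \<pi> \<sigma> u; intertwines B \<sigma> \<tau> w\<rbrakk> \<Longrightarrow> intertwines B \<pi> \<tau> (\<lambda>x. w (u x))"
  unfolding intertwines_def
proof (elim conjE, intro conjI ballI)
  fix a x assume u: "unitary_map (rspace \<pi>) (rspace \<sigma>) u" and x: "x \<in> carr (rspace \<pi>)" and "a \<in> carr B"
    and "\<forall>a\<in>carr B. \<forall>x\<in>carr (rspace \<pi>). u (rop \<pi> a x) = rop \<sigma> a (u x)"
    and "\<forall>a\<in>carr B. \<forall>x\<in>carr (rspace \<sigma>). w (rop \<sigma> a x) = rop \<tau> a (w x)"
  then show "w (u (rop \<pi> a x)) = rop \<tau> a (w (u x))" using unitary_closed[OF u x] by simp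
qed (rule unitary_comp)

lemma intertwines_inv:
  assumes "intertwines B \<pi> \<sigma> u" "representation B \<pi>"
  shows "intertwines B \<sigma> \<pi> (inv_into (carr (rspace \<pi>)) u)"
proof -
  note u = intertwines_unitary[OF assms(1)] and H = rep_hilbert[OF assms(2)]
  note I = unitary_inv_into[OF u H]
  have "inv_into (carr (rspace \<pi>)) u (rop \<sigma> a x) = rop \<pi> a (inv_into (carr (rspace \<pi>)) u x)"
    if "a \<in> carr B" "x \<in> carr (rspace \<sigma>)" for a x
    using intertwines_rop[OF assms(1) that(1), of "inv_into (carr (rspace \<pi>)) u x"] that I
      unitary_closed[OF I(1)] rep_closed[OF assms(2)] by metis
  then show ?thesis using I(1) by (simp add: intertwines_def)
qed

lemma equiv_refl: "representation B \<pi> \<Longrightarrow> unitarily_equivalent B \<pi> \<pi>"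
  and equiv_sym: "\<lbrakk>unitarily_equivalent B \<pi> \<sigma>; representation B \<pi>\<rbrakk> \<Longrightarrow> unitarily_equivalent B \<sigma> \<pi>"
  and equiv_trans: "\<lbrakk>unitarily_equivalent B \<pi> \<sigma>; unitarily_equivalent B \<sigma> \<tau>\<rbrakk> \<Longrightarrow> unitarily_equivalent B \<pi> \<tau>"
  unfolding unitarily_equivalent_iff
  by (blast intro: intertwines_id intertwines_inv intertwines_comp)+

lemma intertwines_vecstate:
  assumes "intertwines B \<pi> \<sigma> u" "representation B \<pi>" "x \<in> carr (rspace \<pi>)"
  shows "vecstate B \<sigma> (u x) = vecstate B \<pi> x"
  using assms by (auto simp: vecstate_def fun_eq_iff restrict_def intertwines_rop[symmetric]
      unitary_inn[OF intertwines_unitary] rep_closed)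

lemma irreducible_equiv:
  assumes eq: "unitarily_equivalent B \<pi> \<sigma>" and irr: "irreducible_rep B \<pi>" and s: "representation B \<sigma>"
  shows "irreducible_rep B \<sigma>"
proof -
  let ?H = "rspace \<pi>" and ?K = "rspace \<sigma>"
  obtain u where iu: "intertwines B \<pi> \<sigma> u" using eq by (auto simp: unitarily_equivalent_iff)
  note u = intertwines_unitary[OF iu] and uop = intertwines_rop[OF iu] and r = irr_rep[OF irr]
  interpret H: hilbert_space ?H by (rule rep_hilbert[OF r])
  interpret K: hilbert_space ?K by (rule rep_hilbert[OF s])
  note [simp] = unitary_closed[OF u]
  note uz = unitary_zero[OF u H.hilbert_space_axioms K.hilbert_space_axioms]
  note ub = unitary_bij[OF u]
  have "nonzero_on (carr B) \<sigma>"
  proof -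
    obtain a w where aw: "a \<in> carr B" "w \<in> carr ?H" "rop \<pi> a w \<noteq> vzero ?H"
      using irr_nonzero[OF irr] by (auto simp: nonzero_on_def)
    then have "u (rop \<pi> a w) \<noteq> u (vzero ?H)"
      using ub rep_closed[OF r] by (metis H.zero_closed bij_betw_imp_inj_on inj_onD)
    then have "rop \<sigma> a (u w) \<noteq> vzero ?K" using uop[OF aw(1,2)] uz by simp
    moreover have "u w \<in> carr ?K" using aw by simp
    ultimately show ?thesis
      unfolding nonzero_on_def by (intro bexI[of _ a] bexI[of _ "u w"] aw(1))
  qed
  moreover have "W = {vzero ?K} \<or> W = carr ?K"
    if W: "subspace_of ?K W" "closedin (norm_topology ?K (hnorm ?K)) W"
      "\<And>a. a \<in> carr B \<Longrightarrow> rop \<sigma> a ` W \<subseteq> W" for W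
  proof -
    define V where "V = {v \<in> carr ?H. u v \<in> W}"
    have "subspace_of ?H V"
      using W(1) by (auto simp: subspace_of_def V_def uz unitary_add[OF u] unitary_smul[OF u])
    moreover have "closedin (norm_topology ?H (hnorm ?H)) V"
      unfolding H.closedin_iff_seq
    proof (intro conjI allI impI)
      fix x l assume *: "(\<forall>k. x k \<in> V) \<and> l \<in> carr ?H \<and> (\<lambda>k. hnorm ?H (vdiff ?H (x k) l)) \<longlonglongrightarrow> 0"
      have "hnorm ?K (vdiff ?K (u (x k)) (u l)) = hnorm ?H (vdiff ?H (x k) l)" for k
        using * unitary_vdiff[OF u H.hilbert_space_axioms, of "x k" l] unitary_hnorm[OF u, of "vdiff ?H (x k) l"]
        by (auto simp: V_def)
      then have "(\<lambda>k. hnorm ?K (vdiff ?K (u (x k)) (u l))) \<longlonglongrightarrow> 0" using * by simp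
      moreover have "\<forall>k. u (x k) \<in> W" "u l \<in> carr ?K" using * by (auto simp: V_def)
      ultimately have "u l \<in> W"
        using W(2)[unfolded K.closedin_iff_seq, THEN conjunct2, rule_format, of "\<lambda>k. u (x k)" "u l"] by simp
      then show "l \<in> V" using * by (simp add: V_def)
    qed (auto simp: V_def)
    moreover have "rop \<pi> a ` V \<subseteq> V" if "a \<in> carr B" for a
      using W(3)[OF that] that by (auto simp: V_def rep_closed[OF r] uop image_subset_iff)
    ultimately have "V = {vzero ?H} \<or> V = carr ?H"
      by (rule irr_dichotomy[OF irr])
    moreover have "W = u ` V"
    proof
      have "W \<subseteq> u ` carr ?H" using W(1) ub by (simp add: subspace_of_def bij_betw_def)
      then show "W \<subseteq> u ` V" by (auto simp: V_def)
    qed (auto simp: V_def)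
    moreover have "u ` carr ?H = carr ?K" using ub by (simp add: bij_betw_def)
    ultimately show ?thesis using uz by fastforce
  qed
  ultimately show ?thesis using s unfolding irreducible_rep_def by (simp add: image_subset_iff)
qed

lemma rep_transport:
  assumes star: "\<And>a. a \<in> carr B \<Longrightarrow> star B a \<in> carr B" and r: "representation B \<pi>" and u: "unitary_map (rspace \<pi>) K u" and K: "hilbert_space K"
  shows "\<exists>\<sigma>. rspace \<sigma> = K \<and> representation B \<sigma> \<and> intertwines B \<pi> \<sigma> u"
proof -
  let ?H = "rspace \<pi>"
  interpret H: hilbert_space ?H by (rule rep_hilbert[OF r])
  interpret K: hilbert_space K by fact
  define w where "w = inv_into (carr ?H) u"
  note I = unitary_inv_into[OF u H.hilbert_space_axioms, folded w_def]
  note [simp] = unitary_closed[OF u] unitary_closed[OF I(1)] I(2,3) rep_closed[OF r]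
  define \<sigma> where "\<sigma> = \<lparr>rspace = K, rop = (\<lambda>a y. u (rop \<pi> a (w y)))\<rparr>"
  have "bounded_linear_map K K (\<lambda>y. u (rop \<pi> a (w y)))" if a: "a \<in> carr B" for a
  proof -
    obtain C where C: "\<And>x. x \<in> carr ?H \<Longrightarrow> hnorm ?H (rop \<pi> a x) \<le> C * hnorm ?H x"
      using rep_bounded[OF r a] by (auto simp: bounded_linear_map_def)
    have "hnorm K (u (rop \<pi> a (w y))) \<le> C * hnorm K y" if "y \<in> carr K" for y
      using C[of "w y"] that a by (simp add: unitary_hnorm[OF u] unitary_hnorm[OF I(1)])
    then show ?thesis
      using a by (auto simp: bounded_linear_map_def linear_map_def unitary_add[OF I(1)] unitary_add[OF u]
          unitary_smul[OF I(1)] unitary_smul[OF u] rep_vec_add[OF r] rep_vec_smul[OF r])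
  qed
  moreover have "inn K (u (rop \<pi> (star B a) (w x))) y = inn K x (u (rop \<pi> a (w y)))"
    if a: "a \<in> carr B" "star B a \<in> carr B" and x: "x \<in> carr K" and y: "y \<in> carr K" for a x y
  proof -
    have "inn K (u (rop \<pi> (star B a) (w x))) y = inn ?H (w x) (rop \<pi> a (w y))"
      using a x y by (simp add: I(4) rep_star[OF r])
    also have "\<dots> = inn K (u (w x)) (u (rop \<pi> a (w y)))"
      using a x y by (simp only: unitary_inn[OF u] unitary_closed[OF I(1)] rep_closed[OF r])
    finally show ?thesis using x by simp
  qed
  ultimately have "representation B \<sigma>"
    unfolding representation_def using K star
    by (simp add: \<sigma>_def rep_add[OF r] rep_smul[OF r] rep_mul[OF r] unitary_add[OF u] unitary_smul[OF u])
  moreover have "intertwines B \<pi> \<sigma> u"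
    using u by (simp add: intertwines_def \<sigma>_def)
  ultimately show ?thesis by (intro exI[of _ \<sigma>]) (simp add: \<sigma>_def)
qed

context star_alg
begin

text \<open>
  A representation with a cyclic vector \<open>\<xi>\<close> moves to the standard type along
  \<open>x \<mapsto> (a \<mapsto> \<langle>\<pi>(a)\<xi>|x\<rangle>)\<close>.
\<close>

lemma std_rep_exists:
  fixes \<pi> :: "('b, 'h) rep"
  assumes irr: "irreducible_rep B \<pi>"
  shows "\<exists>\<sigma> :: 'b std_rep. irreducible_rep B \<sigma> \<and> unitarily_equivalent B \<pi> \<sigma>"
proof -
  let ?H = "rspace \<pi>"
  note r = irr_rep[OF irr]
  interpret H: hilbert_space ?H by (rule rep_hilbert[OF r])
  obtain \<xi> where xi: "\<xi> \<in> unit_vectors ?H" using irr_nontrivial[OF irr] by blast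
  then have xc: "\<xi> \<in> carr ?H" and xn: "\<xi> \<noteq> vzero ?H"
    by (auto simp: unit_vectors_def)
  define j where "j x = (\<lambda>a. if a \<in> carr B then inn ?H (rop \<pi> a \<xi>) x else 0)" for x
  have "inj_on j (carr ?H)"
  proof (rule inj_onI)
    fix x y assume xy: "x \<in> carr ?H" "y \<in> carr ?H" "j x = j y"
    then have "inn ?H (rop \<pi> a \<xi>) x = inn ?H (rop \<pi> a \<xi>) y" if "a \<in> carr B" for a
      using fun_cong[OF xy(3), unfolded j_def, of a] that by simp
    then show "x = y"
      using xy by (intro H.total_ext[OF rep_cyclic[OF irr xc xn]]) (auto simp: rep_closed[OF r] xc)
  qed
  then obtain K :: "('b \<Rightarrow> complex) hilbert" where K: "hilbert_space K" "unitary_map ?H K j"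
    using hilbert_transport[OF H.hilbert_space_axioms] by blast
  obtain \<sigma> where "representation B \<sigma>" "intertwines B \<pi> \<sigma> j"
    using rep_transport[OF star_closed r K(2,1)] by blast
  then show ?thesis
    using irreducible_equiv[OF _ irr] by (auto simp: unitarily_equivalent_iff)
qed

lemma irrep_class_eqI:
  assumes "unitarily_equivalent B \<pi> \<sigma>" "unitarily_equivalent B \<sigma> \<pi>"
  shows "irrep_class B \<pi> = irrep_class B \<sigma>"
  using equiv_trans[OF assms(1)] equiv_trans[OF assms(2)] unfolding irrep_class_def by blast

lemma irrep_class_eq_iff:
  assumes "irreducible_rep B \<pi>" "irreducible_rep B \<sigma>"
  shows "irrep_class B \<pi> = irrep_class B \<sigma> \<longleftrightarrow> unitarily_equivalent B \<pi> \<sigma>"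
proof
  assume "irrep_class B \<pi> = irrep_class B \<sigma>"
  moreover have "\<sigma> \<in> irrep_class B \<sigma>"
    using assms(2) by (simp add: irrep_class_def equiv_refl irr_rep)
  ultimately have "\<sigma> \<in> irrep_class B \<pi>" by blast
  then show "unitarily_equivalent B \<pi> \<sigma>" by (simp add: irrep_class_def)
next
  assume "unitarily_equivalent B \<pi> \<sigma>"
  then show "irrep_class B \<pi> = irrep_class B \<sigma>"
    using irrep_class_eqI[OF _ equiv_sym[OF _ irr_rep[OF assms(1)]]] by blast
qed

text \<open>Taking products with \<open>S\<close> moves the operator to the other side as its
  adjoint; this is why the hypothesis on \<open>S\<close> concerns \<open>star B a\<close>.\<close>

lemma intertwine_on_total:
  assumes r: "representation B \<pi>" and s: "representation B \<sigma>"
    and u: "unitary_map (rspace \<pi>) (rspace \<sigma>) u"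
    and S: "hilbert_space.total (rspace \<pi>) S" "S \<subseteq> carr (rspace \<pi>)" and a: "a \<in> carr B"
    and eq: "\<And>v. v \<in> S \<Longrightarrow> u (rop \<pi> (star B a) v) = rop \<sigma> (star B a) (u v)"
    and x: "x \<in> carr (rspace \<pi>)"
  shows "u (rop \<pi> a x) = rop \<sigma> a (u x)"
proof -
  let ?H = "rspace \<pi>" and ?K = "rspace \<sigma>"
  interpret H: hilbert_space ?H by (rule rep_hilbert[OF r])
  interpret K: hilbert_space ?K by (rule rep_hilbert[OF s])
  define w where "w = inv_into (carr ?H) u"
  note I = unitary_inv_into[OF u H.hilbert_space_axioms, folded w_def]
  note [simp] = unitary_closed[OF u] unitary_closed[OF I(1)] I(2,3) rep_closed[OF r] rep_closed[OF s]
  have "rop \<pi> a x = w (rop \<sigma> a (u x))"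
  proof (rule H.total_ext[OF S])
    fix v assume v: "v \<in> S"
    then have vc: "v \<in> carr ?H" using S(2) by blast
    have "inn ?H v (w (rop \<sigma> a (u x))) = inn ?K (u v) (rop \<sigma> a (u x))"
      using I(4)[OF vc] a x by simp
    also have "\<dots> = inn ?K (u (rop \<pi> (star B a) v)) (u x)"
      using rep_star[OF s a, of "u v" "u x"] vc x eq[OF v] by simp
    also have "\<dots> = inn ?H v (rop \<pi> a x)"
      using a vc x by (simp add: unitary_inn[OF u] rep_star[OF r])
    finally show "inn ?H v (rop \<pi> a x) = inn ?H v (w (rop \<sigma> a (u x)))" by simp
  qed (use a x in auto)
  then show ?thesis using a x by simp
qed

lemma gns_unique:
  assumes g: "gns_rep B \<omega> \<pi>" and g': "gns_rep B \<omega> \<sigma>"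
  shows "unitarily_equivalent B \<pi> \<sigma>"
proof -
  let ?H = "rspace \<pi>" and ?K = "rspace \<sigma>"
  note V = complex_vector_space_axioms
  have r: "representation B \<pi>" and s: "representation B \<sigma>" using g g' by (auto simp: gns_rep_def)
  interpret H: hilbert_space ?H by (rule rep_hilbert[OF r])
  interpret K: hilbert_space ?K by (rule rep_hilbert[OF s])
  obtain L1 where L1: "linear_map B ?H L1"
    and d1: "norm_topology ?H (hnorm ?H) closure_of (L1 ` carr B) = carr ?H"
    and i1: "\<And>a b. \<lbrakk>a \<in> carr B; b \<in> carr B\<rbrakk> \<Longrightarrow> inn ?H (L1 a) (L1 b) = \<omega> (mul B (star B a) b)"
    and m1: "\<And>a b. \<lbrakk>a \<in> carr B; b \<in> carr B\<rbrakk> \<Longrightarrow> rop \<pi> a (L1 b) = L1 (mul B a b)"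
    using g by (auto simp: gns_rep_def)
  obtain L2 where L2: "linear_map B ?K L2"
    and d2: "norm_topology ?K (hnorm ?K) closure_of (L2 ` carr B) = carr ?K"
    and i2: "\<And>a b. \<lbrakk>a \<in> carr B; b \<in> carr B\<rbrakk> \<Longrightarrow> inn ?K (L2 a) (L2 b) = \<omega> (mul B (star B a) b)"
    and m2: "\<And>a b. \<lbrakk>a \<in> carr B; b \<in> carr B\<rbrakk> \<Longrightarrow> rop \<sigma> a (L2 b) = L2 (mul B a b)"
    using g' by (auto simp: gns_rep_def)
  have t1: "H.total (L1 ` carr B)" using H.dense_iff_total[OF V L1] d1 by blast
  have t2: "K.total (L2 ` carr B)" using K.dense_iff_total[OF V L2] d2 by blast
  obtain u where u: "unitary_map ?H ?K u" "\<And>a. a \<in> carr B \<Longrightarrow> u (L1 a) = L2 a"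
    using unitary_of_total_pair[OF V H.hilbert_space_axioms K.hilbert_space_axioms L1 L2 t1 t2]
    by (auto simp: i1 i2)
  have "u (rop \<pi> a x) = rop \<sigma> a (u x)" if "a \<in> carr B" "x \<in> carr ?H" for a x
    by (rule intertwine_on_total[OF r s u(1) t1])
      (use that linear_map_closed[OF L1] in \<open>auto simp: m1 m2 u(2)\<close>)
  then show ?thesis using u(1) by (auto simp: unitarily_equivalent_def)
qed

text \<open>Removes the choice in \<open>gns_class\<close>: by \<open>gns_unique\<close> every GNS
  representation gives the same class.\<close>

lemma gns_class_eq:
  assumes "gns_rep B \<omega> (\<pi> :: 'b std_rep)"
  shows "gns_class B \<omega> = irrep_class B \<pi>"
proof -
  define \<sigma> where "\<sigma> = (SOME \<pi> :: 'b std_rep. gns_rep B \<omega> \<pi>)"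
  have s: "gns_rep B \<omega> \<sigma>" unfolding \<sigma>_def using assms by (rule someI)
  have "representation B \<pi>" "representation B \<sigma>" using assms s by (auto simp: gns_rep_def)
  then have "irrep_class B \<sigma> = irrep_class B \<pi>"
    using irrep_class_eqI[OF gns_unique[OF s assms] gns_unique[OF assms s]] by blast
  then show ?thesis by (simp add: gns_class_def \<sigma>_def)
qed

lemma gns_rep_vecstate:
  assumes r: "representation B \<pi>" and x: "x \<in> carr (rspace \<pi>)"
    and t: "hilbert_space.total (rspace \<pi>) ((\<lambda>a. rop \<pi> a x) ` carr B)"
  shows "gns_rep B (vecstate B \<pi> x) \<pi>"
proof -
  interpret H: hilbert_space "rspace \<pi>" by (rule rep_hilbert[OF r])
  note L = rep_vec_linear[OF r x]
  show ?thesis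
    unfolding gns_rep_def
    using r t L H.dense_iff_total[OF complex_vector_space_axioms L] x
    by (intro conjI exI[of _ "\<lambda>a. rop \<pi> a x"])
      (auto simp: vecstate_def rep_mul[OF r] rep_adjoint[OF r] rep_closed[OF r])
qed

lemma gns_class_vecstate:
  assumes irr: "irreducible_rep B (\<pi> :: 'b std_rep)" and x: "x \<in> unit_vectors (rspace \<pi>)"
  shows "gns_class B (vecstate B \<pi> x) = irrep_class B \<pi>"
proof -
  interpret H: hilbert_space "rspace \<pi>" by (rule rep_hilbert[OF irr_rep[OF irr]])
  have "x \<in> carr (rspace \<pi>)" "x \<noteq> vzero (rspace \<pi>)" using x by (auto simp: unit_vectors_def)
  then show ?thesis
    using gns_class_eq[OF gns_rep_vecstate[OF irr_rep[OF irr] _ rep_cyclic[OF irr]]] by blast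
qed

text \<open>Equal vector states mean that the orbits of \<open>x\<close> and \<open>y\<close> have
  equal Gram matrices, so matching the two orbits is isometric.\<close>

lemma vecstate_intertwiner:
  assumes r: "representation B \<pi>" and s: "representation B \<sigma>"
    and x: "x \<in> carr (rspace \<pi>)" and y: "y \<in> carr (rspace \<sigma>)"
    and t1: "hilbert_space.total (rspace \<pi>) ((\<lambda>a. rop \<pi> a x) ` carr B)"
    and t2: "hilbert_space.total (rspace \<sigma>) ((\<lambda>a. rop \<sigma> a y) ` carr B)"
    and eq: "vecstate B \<pi> x = vecstate B \<sigma> y"
  shows "\<exists>u. intertwines B \<pi> \<sigma> u \<and> u x = y"
proof -
  let ?H = "rspace \<pi>" and ?K = "rspace \<sigma>"
  note V = complex_vector_space_axioms
  interpret H: hilbert_space ?H by (rule rep_hilbert[OF r])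
  interpret K: hilbert_space ?K by (rule rep_hilbert[OF s])
  note [simp] = rep_closed[OF r] rep_closed[OF s] x y
  have e: "inn ?H x (rop \<pi> a x) = inn ?K y (rop \<sigma> a y)" if "a \<in> carr B" for a
    using fun_cong[OF eq, of a] that by (simp add: vecstate_def)
  obtain u where u: "unitary_map ?H ?K u" "\<And>a. a \<in> carr B \<Longrightarrow> u (rop \<pi> a x) = rop \<sigma> a y"
  proof -
    have "inn ?H (rop \<pi> a x) (rop \<pi> b x) = inn ?K (rop \<sigma> a y) (rop \<sigma> b y)"
      if "a \<in> carr B" "b \<in> carr B" for a b
      using e[of "mul B (star B a) b"] that
      by (simp add: rep_adjoint[OF r] rep_adjoint[OF s] rep_mul[OF r] rep_mul[OF s])
    then show thesis
      using unitary_of_total_pair[OF V H.hilbert_space_axioms K.hilbert_space_axioms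
          rep_vec_linear[OF r x] rep_vec_linear[OF s y] t1 t2] that by blast
  qed
  have "u (rop \<pi> a z) = rop \<sigma> a (u z)" if "a \<in> carr B" "z \<in> carr ?H" for a z
    by (rule intertwine_on_total[OF r s u(1) t1])
      (use that in \<open>auto simp: u(2) rep_mul[OF r, symmetric] rep_mul[OF s, symmetric]\<close>)
  \<comment> \<open>In the absence of a unit \<open>x\<close> need not be a value
    \<open>rop \<pi> a x\<close>, so the products with the orbit of \<open>y\<close> have to
    decide.\<close>
  moreover have "u x = y"
  proof (rule K.total_ext[OF t2])
    fix w assume "w \<in> (\<lambda>a. rop \<sigma> a y) ` carr B"
    then obtain a where a: "a \<in> carr B" "w = rop \<sigma> a y" by auto
    have "inn ?K w (u x) = inn ?H (rop \<pi> a x) x"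
      using a u(2)[OF a(1)] unitary_inn[OF u(1), of "rop \<pi> a x" x] by simp
    then show "inn ?K w (u x) = inn ?K w y"
      using a e[of "star B a"] by (simp add: rep_adjoint[OF r] rep_adjoint[OF s])
  qed (auto simp: unitary_closed[OF u(1)])
  ultimately show ?thesis using u(1) by (auto simp: intertwines_def)
qed

text \<open>\<open>schur\<close> speaks of self-adjoint operators, so it is applied to u + w and
  \<i>u - \<i>w, where w is the inverse and hence the adjoint of u; the two scalars determine
  u.\<close>

lemma intertwiner_scalar:
  assumes irr: "irreducible_rep B \<pi>" and iu: "intertwines B \<pi> \<pi> u"
  shows "\<exists>c. \<forall>v\<in>carr (rspace \<pi>). u v = smul (rspace \<pi>) c v"
proof -
  let ?H = "rspace \<pi>"
  note r = irr_rep[OF irr]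
  interpret H: hilbert_space ?H by (rule rep_hilbert[OF r])
  define w where "w = inv_into (carr ?H) u"
  note u = intertwines_unitary[OF iu]
  note I = unitary_inv_into[OF u H.hilbert_space_axioms, folded w_def]
  have iw: "intertwines B \<pi> \<pi> w" unfolding w_def by (rule intertwines_inv[OF iu r])
  note [simp] = unitary_closed[OF u] unitary_closed[OF I(1)] I(2,3) rep_closed[OF r]
  have I5: "inn ?H (w x) y = inn ?H x (u y)" if "x \<in> carr ?H" "y \<in> carr ?H" for x y
    using I(4)[of y x] that H.inn_commute[of "u y" x] H.inn_commute[of y "w x"] by simp
  have key: "\<exists>l::real. \<forall>v\<in>carr ?H. vadd ?H (smul ?H c (u v)) (smul ?H (cnj c) (w v)) = smul ?H l v"
    if c: "cmod c = 1" for c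
  proof -
    let ?T = "\<lambda>v. vadd ?H (smul ?H c (u v)) (smul ?H (cnj c) (w v))"
    have sym: "inn ?H (?T v) z = inn ?H v (?T z)" if "v \<in> carr ?H" "z \<in> carr ?H" for v z
      using that I(4) I5 by (simp add: algebra_simps)
    have "linear_map ?H ?H ?T"
      by (rule H.adjoint_pair_linear[where S = ?T, OF _ sym]) auto
    moreover have "hnorm ?H (?T v) \<le> 2 * hnorm ?H v" if "v \<in> carr ?H" for v
      using H.n_triangle[of "smul ?H c (u v)" "smul ?H (cnj c) (w v)"] that c
      by (simp add: H.n_smul unitary_hnorm[OF u] unitary_hnorm[OF I(1)])
    moreover have "rop \<pi> a (?T v) = ?T (rop \<pi> a v)" if "a \<in> carr B" "v \<in> carr ?H" for a v
      using that by (simp add: rep_vec_add[OF r] rep_vec_smul[OF r] intertwines_rop[OF iu] intertwines_rop[OF iw])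
    ultimately show ?thesis
      using irr_dichotomy[OF irr] rep_bounded[OF r]
      by (intro H.schur[where D = "rop \<pi> ` carr B" and C = 2] sym) auto
  qed
  obtain l1 :: real where l1: "\<And>v. v \<in> carr ?H \<Longrightarrow> vadd ?H (smul ?H 1 (u v)) (smul ?H 1 (w v)) = smul ?H l1 v"
    using key[of 1] by auto
  obtain l2 :: real where l2: "\<And>v. v \<in> carr ?H \<Longrightarrow> vadd ?H (smul ?H \<i> (u v)) (smul ?H (-\<i>) (w v)) = smul ?H l2 v"
    using key[of "\<i>"] by auto
  have "u v = smul ?H ((l1 - \<i> * l2) / 2) v" if v: "v \<in> carr ?H" for v
  proof (rule H.inn_ext)
    fix z assume z: "z \<in> carr ?H"
    have "inn ?H z (u v) + inn ?H z (w v) = l1 * inn ?H z v"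
      using arg_cong[OF l1[OF v], of "inn ?H z"] v z by simp
    moreover have e2: "\<i> * inn ?H z (u v) - \<i> * inn ?H z (w v) = l2 * inn ?H z v"
      using arg_cong[OF l2[OF v], of "inn ?H z"] v z by simp
    have "inn ?H z (w v) - inn ?H z (u v) = \<i> * (l2 * inn ?H z v)"
      unfolding e2[symmetric] by (simp add: right_diff_distrib mult.assoc[symmetric])
    ultimately have "2 * inn ?H z (u v) = (l1 - \<i> * l2) * inn ?H z v"
      by (simp add: algebra_simps)
    then show "inn ?H z (u v) = inn ?H z (smul ?H ((l1 - \<i> * l2) / 2) v)"
      using v z by (simp add: mult.commute)
  qed (use v in auto)
  then show ?thesis by blast
qed

text \<open>An intertwiner of \<pi> with itself carries \<open>x\<close> to \<open>y\<close>, and it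
  is a scalar. This makes the ray of a state in a given irreducible representation well
  defined.\<close>

lemma vecstate_ray:
  assumes irr: "irreducible_rep B \<pi>" and x: "x \<in> unit_vectors (rspace \<pi>)" and y: "y \<in> unit_vectors (rspace \<pi>)"
    and eq: "vecstate B \<pi> x = vecstate B \<pi> y"
  shows "\<exists>c. cmod c = 1 \<and> y = smul (rspace \<pi>) c x"
proof -
  note r = irr_rep[OF irr]
  interpret H: hilbert_space "rspace \<pi>" by (rule rep_hilbert[OF r])
  have xy: "x \<in> carr (rspace \<pi>)" "x \<noteq> vzero (rspace \<pi>)" "y \<in> carr (rspace \<pi>)" "y \<noteq> vzero (rspace \<pi>)"
    using x y by (auto simp: unit_vectors_def)
  obtain u where u: "intertwines B \<pi> \<pi> u" "u x = y"
    using vecstate_intertwiner[OF r r xy(1,3) rep_cyclic[OF irr xy(1,2)] rep_cyclic[OF irr xy(3,4)] eq]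
    by blast
  then obtain c where "y = smul (rspace \<pi>) c x"
    using intertwiner_scalar[OF irr u(1)] xy by blast
  moreover then have "cmod c = 1"
    using x y by (simp add: unit_vectors_def H.n_smul)
  ultimately show ?thesis by blast
qed

end

section \<open>C*-algebras and their closed ideals\<close>

lemma (in normed_cspace) fixed_point:
  assumes cp: "norm_complete V n" and F: "\<And>x. x \<in> carr V \<Longrightarrow> F x \<in> carr V"
    and contr: "\<And>x y. \<lbrakk>x \<in> carr V; y \<in> carr V\<rbrakk> \<Longrightarrow> n (vdiff V (F x) (F y)) \<le> n (vdiff V x y) / 2"
  shows "\<exists>x\<in>carr V. F x = x"
proof -
  define x where "x k = (F ^^ k) (vzero V)" for k
  have xS: "x (Suc k) = F (x k)" for k by (simp add: x_def)
  have xc [simp]: "x k \<in> carr V" for k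
    by (induction k) (auto simp: x_def F)
  \<comment> \<open>Geometric weights: \<open>w k - w (Suc k)\<close> is (1/2)^k times the length of
    the first step, so the increments telescope against \<open>w\<close>.\<close>
  define w where "w k = 2 * n (vdiff V (x 1) (x 0)) * (1/2)^k" for k :: nat
  have wS: "w (Suc k) = w k / 2" for k by (simp add: w_def)
  have w0: "w k \<ge> 0" for k using n_nonneg by (simp add: w_def)
  have step: "n (vdiff V (x (Suc k)) (x k)) \<le> w k - w (Suc k)" for k
  proof (induction k)
    case (Suc k)
    then show ?case using contr[OF xc xc, of "Suc k" k] by (simp add: xS wS)
  qed (simp add: w_def)
  have diff: "n (vdiff V (x (i + k)) (x i)) \<le> w i - w (i + k)" for i k
  proof (induction k)
    case (Suc k)
    then show ?case
      using n_diff_triangle[of "x (Suc (i + k))" "x (i + k)" "x i"] step[of "i + k"] by simp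
  qed simp
  have pw: "n (vdiff V (x j) (x i)) \<le> w i" if ij: "i \<le> j" for i j
  proof -
    obtain k where "j = i + k" using le_Suc_ex[OF ij] by blast
    then show ?thesis using diff[of i k] w0[of "i + k"] by simp
  qed
  have "(\<lambda>k. (1/2::real)^k) \<longlonglongrightarrow> 0" by (rule LIMSEQ_realpow_zero) auto
  then have wlim: "w \<longlonglongrightarrow> 0" unfolding w_def using tendsto_mult_right_zero by blast
  have "\<exists>l\<in>carr V. (\<lambda>k. n (vdiff V (x k) l)) \<longlonglongrightarrow> 0"
  proof (rule complete_lim[OF cp])
    fix e :: real assume "e > 0"
    then obtain N where N: "w N < e / 2"
      using order_tendstoD(2)[OF wlim, of "e / 2"] by (auto simp: eventually_sequentially)
    have "n (vdiff V (x i) (x j)) < e" if ij: "N \<le> i" "N \<le> j" for i j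
      using n_diff_triangle[of "x i" "x N" "x j"] n_diff_commute[of "x N" "x j"]
        pw[OF ij(1)] pw[OF ij(2)] N by simp
    then show "\<exists>N. \<forall>i\<ge>N. \<forall>j\<ge>N. n (vdiff V (x i) (x j)) < e" by blast
  qed simp
  then obtain l where l: "l \<in> carr V" and lim: "(\<lambda>k. n (vdiff V (x k) l)) \<longlonglongrightarrow> 0" by blast
  have "F l = l"
  proof (rule eq_by_small)
    fix e :: real assume "e > 0"
    then obtain N where N: "\<And>k. k \<ge> N \<Longrightarrow> n (vdiff V (x k) l) < e / 2"
      using order_tendstoD(2)[OF lim, of "e / 2"] by (auto simp: eventually_sequentially)
    have "n (vdiff V (F l) l) \<le> n (vdiff V (F l) (F (x N))) + n (vdiff V (x (Suc N)) l)"
      using n_diff_triangle[of "F l" "F (x N)" l] l F by (simp add: xS)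
    also have "n (vdiff V (F l) (F (x N))) \<le> n (vdiff V (x N) l) / 2"
      using contr[of l "x N"] n_diff_commute[of l "x N"] l by simp
    finally show "n (vdiff V (F l) l) \<le> e"
      using N[of N] N[of "Suc N"] n_nonneg[of "vdiff V (x N) l"] l by simp
  qed (use l F in auto)
  then show ?thesis using l by blast
qed

section \<open>One-sided resolvents and approximate units\<close>

context cstar_algebra
begin

sublocale star_alg A
  by unfold_locales (simp_all add: mul_closed star_closed star_star)

sublocale normed_cspace A "nrm A"
  by unfold_locales (simp_all add: nrm_nonneg nrm_eq_0 nrm_triangle nrm_smul)

lemmas alg_simps = mul_add_left mul_add_right mul_smul_left mul_smul_right star_add star_smul star_mul
  mul_closed star_closed star_star

lemma mul_diff_left: "\<lbrakk>x \<in> carr A; y \<in> carr A; z \<in> carr A\<rbrakk> \<Longrightarrow> mul A (vdiff A x y) z = vdiff A (mul A x z) (mul A y z)"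
  and mul_diff_right: "\<lbrakk>x \<in> carr A; y \<in> carr A; z \<in> carr A\<rbrakk> \<Longrightarrow> mul A z (vdiff A x y) = vdiff A (mul A z x) (mul A z y)"
  and star_diff: "\<lbrakk>x \<in> carr A; y \<in> carr A\<rbrakk> \<Longrightarrow> star A (vdiff A x y) = vdiff A (star A x) (star A y)"
  by (simp_all add: vdiff_def alg_simps)

lemma mul_zero [simp]: "x \<in> carr A \<Longrightarrow> mul A x (vzero A) = vzero A" "x \<in> carr A \<Longrightarrow> mul A (vzero A) x = vzero A"
  using mul_diff_right[of x x x] mul_diff_left[of x x x] by simp_all

lemma star_zero [simp]: "star A (vzero A) = vzero A"
  using star_diff[of "vzero A" "vzero A"] by simp

lemma nrm_star [simp]: "x \<in> carr A \<Longrightarrow> nrm A (star A x) = nrm A x"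
proof -
  have "nrm A x \<le> nrm A (star A x)" if x: "x \<in> carr A" for x
  proof -
    have "nrm A x * nrm A x \<le> nrm A (star A x) * nrm A x"
      using nrm_cstar[OF x] nrm_mul[of "star A x" x] x by (simp add: power2_eq_square)
    then show ?thesis
      using nrm_nonneg[OF x] nrm_nonneg[of "star A x"] x by (cases "nrm A x = 0") auto
  qed
  then show "x \<in> carr A \<Longrightarrow> nrm A (star A x) = nrm A x"
    by (metis antisym star_closed star_star)
qed

lemma nrm_mul_star: "x \<in> carr A \<Longrightarrow> nrm A (mul A x (star A x)) = (nrm A x)\<^sup>2"
  using nrm_cstar[of "star A x"] by simp

text \<open>Left multiplication by 1 + ch, written without a unit.\<close>

definition affine :: "'a \<Rightarrow> complex \<Rightarrow> 'a \<Rightarrow> 'a" where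
  "affine h c y = vadd A y (smul A c (mul A h y))"

lemma affine_closed [simp]: "\<lbrakk>h \<in> carr A; y \<in> carr A\<rbrakk> \<Longrightarrow> affine h c y \<in> carr A"
  by (simp add: affine_def)

lemma affine_diff: "\<lbrakk>h \<in> carr A; y \<in> carr A; z \<in> carr A\<rbrakk> \<Longrightarrow> affine h c (vdiff A y z) = vdiff A (affine h c y) (affine h c z)"
  by (simp add: affine_def mul_diff_right smul_diff diff_add_add)

text \<open>
  For self-adjoint \<open>h\<close> and imaginary \<open>c\<close>, the elements \<open>(1 + ch)y\<close> and \<open>(1 - ch)y\<close> have the
  same norm (Cayley transform), because \<open>((1 \<plusminus> ch)y)\<^sup>*(1 \<plusminus> ch)y = y\<^sup>*y + |c|\<^sup>2 y\<^sup>*h\<^sup>2y\<close>.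
\<close>

lemma affine_norm:
  assumes h: "h \<in> carr A" "star A h = h" and c: "cnj c = - c" and y: "y \<in> carr A"
  shows "nrm A (affine h (- c) y) = nrm A (affine h c y)"
proof -
  have *: "mul A (star A (affine h d y)) (affine h d y) =
      vadd A (mul A (star A y) y) (smul A (d * cnj d) (mul A (star A y) (mul A h (mul A h y))))"
    if d: "cnj d = - d" for d
  proof -
    let ?q = "mul A (star A y) (mul A h y)"
    have "mul A (star A (affine h d y)) (affine h d y) =
      vadd A (vadd A (mul A (star A y) y) (smul A (d * cnj d) (mul A (star A y) (mul A h (mul A h y)))))
        (vadd A (smul A d ?q) (smul A (cnj d) ?q))"
      using h y by (simp add: affine_def alg_simps smul_smul mul_assoc smul_add_right add_assoc
          add_left_commute add_commute mult.commute)
    also have "vadd A (smul A d ?q) (smul A (cnj d) ?q) = vzero A"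
      using h y d by (simp add: smul_add_left[symmetric])
    finally show ?thesis using h y by simp
  qed
  have "(nrm A (affine h (- c) y))\<^sup>2 = (nrm A (affine h c y))\<^sup>2"
    using *[of c] *[of "- c"] c h y by (simp add: nrm_cstar[symmetric])
  then show ?thesis using nrm_nonneg h y by simp
qed

text \<open>2y and 2chy are the sum and the difference of (1 + ch)y and (1 - ch)y, which have equal
  norms.\<close>

lemma affine_bounds:
  assumes h: "h \<in> carr A" "star A h = h" and c: "cnj c = - c" and y: "y \<in> carr A"
  shows "nrm A y \<le> nrm A (affine h c y)" "cmod c * nrm A (mul A h y) \<le> nrm A (affine h c y)"
proof -
  let ?q = "mul A h y"
  have c0: "vadd A (smul A c ?q) (smul A (- c) ?q) = vzero A"
    using h y by (simp add: smul_add_left[symmetric])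
  have "smul A (1 + 1) y = vadd A (affine h c y) (affine h (- c) y)"
  proof -
    have "vadd A (affine h c y) (affine h (- c) y) = vadd A (vadd A y y) (vadd A (smul A c ?q) (smul A (- c) ?q))"
      using h y by (simp add: affine_def add_assoc add_left_commute)
    then show ?thesis using h y by (simp only: c0 smul_add_left smul_one add_zero closed)
  qed
  then have "2 * nrm A y \<le> nrm A (affine h c y) + nrm A (affine h (- c) y)"
    using n_smul[OF y, of 2] n_triangle[of "affine h c y" "affine h (- c) y"] h y by simp
  then show "nrm A y \<le> nrm A (affine h c y)" using affine_norm[OF assms] by simp
  have "smul A (c + c) ?q = vdiff A (affine h c y) (affine h (- c) y)"
  proof -
    have "vdiff A (affine h c y) (affine h (- c) y) = vdiff A (smul A c ?q) (smul A (- c) ?q)"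
      using h y by (simp add: affine_def diff_add_add)
    also have "\<dots> = vadd A (smul A c ?q) (smul A c ?q)"
      using h y by (simp add: vdiff_def smul_smul)
    finally show ?thesis using h y by (simp only: smul_add_left mul_closed)
  qed
  then have "cmod (c + c) * nrm A ?q \<le> nrm A (affine h c y) + nrm A (affine h (- c) y)"
    using n_smul[of ?q "c + c"] n_diff_le[of "affine h c y" "affine h (- c) y"] h y by simp
  moreover have "cmod (c + c) = 2 * cmod c" by (simp add: mult_2[symmetric] norm_mult)
  ultimately show "cmod c * nrm A ?q \<le> nrm A (affine h c y)" using affine_norm[OF assms] by simp
qed

lemma affine_inj:
  assumes h: "h \<in> carr A" "star A h = h" and c: "cnj c = - c" and "y \<in> carr A" "z \<in> carr A"
    and "affine h c y = affine h c z"
  shows "y = z"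
proof -
  have "nrm A (vdiff A y z) \<le> nrm A (affine h c (vdiff A y z))"
    using assms by (intro affine_bounds) auto
  also have "affine h c (vdiff A y z) = vzero A"
    using assms affine_diff[of h y z c] by simp
  finally have "nrm A (vdiff A y z) \<le> 0" by simp
  then show ?thesis using assms n_diff_eq_0[of y z] n_nonneg[of "vdiff A y z"] by simp
qed

text \<open>Solves (1 + ch)y = a - (c' - c)hy by contraction. By \<open>affine_bounds\<close> the
  inverse of 1 + ch does not increase norms for any imaginary c, so the admissible step length does
  not shrink along a continuation.\<close>

lemma affine_surj_step:
  assumes h: "h \<in> carr A" "star A h = h" and c: "cnj c = - c"
    and surj: "\<And>a. a \<in> carr A \<Longrightarrow> \<exists>y\<in>carr A. affine h c y = a"
    and c': "cmod (c' - c) * nrm A h \<le> 1/2" and a: "a \<in> carr A"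
  shows "\<exists>y\<in>carr A. affine h c' y = a"
proof -
  obtain S where S [simp]: "\<And>a. a \<in> carr A \<Longrightarrow> S a \<in> carr A"
    and AS: "\<And>a. a \<in> carr A \<Longrightarrow> affine h c (S a) = a"
    using surj by metis
  let ?F = "\<lambda>y. S (vdiff A a (smul A (c' - c) (mul A h y)))"
  have "\<exists>y\<in>carr A. ?F y = y"
  proof (rule fixed_point[OF complete])
    fix x y assume x: "x \<in> carr A" and y: "y \<in> carr A"
    let ?u = "vdiff A a (smul A (c' - c) (mul A h x))" and ?v = "vdiff A a (smul A (c' - c) (mul A h y))"
    have "nrm A (vdiff A (S ?u) (S ?v)) \<le> nrm A (affine h c (vdiff A (S ?u) (S ?v)))"
      using a h c x y by (intro affine_bounds) auto
    also have "affine h c (vdiff A (S ?u) (S ?v)) = vdiff A ?u ?v"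
      using a h x y by (simp add: affine_diff AS)
    also have "\<dots> = smul A (c' - c) (mul A h (vdiff A y x))"
      using a h x y by (simp add: diff_diff_cancel_left smul_diff mul_diff_right)
    also have "nrm A \<dots> \<le> cmod (c' - c) * (nrm A h * nrm A (vdiff A y x))"
      using h x y by (simp only: n_smul mul_closed closed) (intro mult_left_mono nrm_mul, auto)
    also have "nrm A (vdiff A y x) = nrm A (vdiff A x y)"
      using x y by (rule n_diff_commute[symmetric])
    also have "cmod (c' - c) * (nrm A h * nrm A (vdiff A x y)) \<le> nrm A (vdiff A x y) / 2"
      using mult_right_mono[OF c' n_nonneg[of "vdiff A x y"]] x y by (simp add: mult.assoc)
    finally show "nrm A (vdiff A (S ?u) (S ?v)) \<le> nrm A (vdiff A x y) / 2" .
  qed (use a h in auto)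
  then obtain y where y: "y \<in> carr A" "?F y = y" by blast
  have "affine h c y = vdiff A a (smul A (c' - c) (mul A h y))"
    using AS[of "vdiff A a (smul A (c' - c) (mul A h y))"] y h a by simp
  then have "a = vadd A (affine h c y) (smul A (c' - c) (mul A h y))"
    using y h a by simp
  also have "\<dots> = vadd A y (smul A (c + (c' - c)) (mul A h y))"
    using y h by (simp only: affine_def add_assoc smul_add_left mul_closed closed)
  finally have "affine h c' y = a" by (simp add: affine_def)
  then show ?thesis using y by blast
qed

text \<open>Continuation in equal steps from c = 0, where the map is the identity.\<close>

lemma affine_surj:
  assumes h: "h \<in> carr A" "star A h = h" and c: "cnj c = - c" and a: "a \<in> carr A"
  shows "\<exists>y\<in>carr A. affine h c y = a"
proof -
  \<comment> \<open>So many steps make |c| / N times the norm of \<open>h\<close> at most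
    1/2.\<close>
  obtain N :: nat where N: "real N > 2 * (cmod c * nrm A h)" using reals_Archimedean2 by blast
  moreover have "cmod c * nrm A h \<ge> 0" using h n_nonneg by simp
  ultimately have N0: "N > 0" by (metis gr0I mult_nonneg_nonneg not_less of_nat_0 zero_le_numeral)
  have "\<forall>a\<in>carr A. \<exists>y\<in>carr A. affine h (of_real (real k / real N) * c) y = a" for k
  proof (induction k)
    case 0
    then show ?case using h by (auto simp: affine_def)
  next
    case (Suc k)
    show ?case
    proof
      fix a assume a: "a \<in> carr A"
      have "of_real (real (Suc k) / real N) * c - of_real (real k / real N) * c = c / of_nat N"
        by (simp add: field_simps add_divide_distrib)
      then have "cmod (of_real (real (Suc k) / real N) * c - of_real (real k / real N) * c) * nrm A h \<le> 1/2"
        using N N0 by (simp add: norm_divide field_simps)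
      then show "\<exists>y\<in>carr A. affine h (of_real (real (Suc k) / real N) * c) y = a"
        using Suc c by (intro affine_surj_step[OF h _ _ _ a, of "of_real (real k / real N) * c"]) auto
    qed
  qed
  from this[of N] show ?thesis using a N0 by simp
qed

text \<open>With h the product of \<open>a\<close> and \<open>star A a\<close> and c = \<i>s, take d
  = (1 + ch)^-1 a and p = (1 + ch)^-1 h. The element \<i>sp then acts as an approximate left unit on
  \<open>a\<close> with error d, and a - d is a multiple of hd.\<close>

lemma resolvent:
  assumes a: "a \<in> carr A" and s: "s > 0"
  shows "\<exists>d\<in>carr A. \<exists>p\<in>carr A. a = vadd A d (smul A (\<i> * of_real s) (mul A (mul A a (star A a)) d)) \<and>
     (nrm A d)\<^sup>2 \<le> 1 / s \<and> nrm A p \<le> 1 / s \<and> d = vdiff A a (smul A (\<i> * of_real s) (mul A p a))"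
proof -
  define c where "c = \<i> * of_real s"
  have c: "cnj c = - c" "cmod c = s" using s by (auto simp: c_def norm_mult)
  define h where "h = mul A a (star A a)"
  have h: "h \<in> carr A" "star A h = h" using a by (auto simp: h_def star_mul)
  obtain d where d [simp]: "d \<in> carr A" "affine h c d = a"
    using affine_surj[OF h c(1) a] by blast
  obtain p where p [simp]: "p \<in> carr A" "affine h c p = h"
    using affine_surj[OF h c(1) h(1)] by blast
  have affine_mul: "affine h c (mul A x b) = mul A (affine h c x) b" if "x \<in> carr A" "b \<in> carr A" for x b
    using that h by (simp add: affine_def alg_simps mul_assoc)
  \<comment> \<open>The inverse commutes with \<open>h\<close>, so pb = h(1 + ch)^-1 b, and the
    second bound of \<open>affine_bounds\<close> applies.\<close>
  have pb: "s * nrm A (mul A p b) \<le> nrm A b" if b: "b \<in> carr A" for b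
  proof -
    obtain y where y: "y \<in> carr A" "affine h c y = b"
      using affine_surj[OF h c(1) b] by blast
    have "affine h c (mul A h y) = mul A h (affine h c y)"
      using y(1) h by (simp add: affine_def alg_simps)
    then have "affine h c (mul A p b) = affine h c (mul A h y)"
      using affine_mul[OF p(1) b] y by simp
    then have "mul A p b = mul A h y"
      using affine_inj[OF h c(1)] b y h by simp
    then show ?thesis using affine_bounds(2)[OF h c(1) y(1)] y c by simp
  qed
  \<comment> \<open>Taking b = \<open>star A p\<close>, the C*-identity turns the bound on left
    multiplication by p into a bound on the norm of p.\<close>
  have pn: "nrm A p \<le> 1 / s"
  proof -
    have "s * (nrm A p)\<^sup>2 \<le> nrm A p"
      using pb[of "star A p"] by (simp add: nrm_mul_star)
    then have "nrm A p * (s * nrm A p) \<le> nrm A p * 1"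
      by (simp add: power2_eq_square mult.left_commute)
    then have "nrm A p = 0 \<or> s * nrm A p \<le> 1"
      using nrm_nonneg[OF p(1)] mult_le_cancel_left_pos[of "nrm A p"] by (metis less_eq_real_def)
    then show ?thesis using s by (auto simp: field_simps)
  qed
  have "affine h c (mul A d (star A a)) = affine h c p"
    using affine_mul[OF d(1) star_closed[OF a]] by (simp only: d(2) p(2) h_def[symmetric])
  then have da: "mul A d (star A a) = p"
    using affine_inj[OF h c(1)] a by simp
  \<comment> \<open>Applying 1 + ch to \<open>mul A d (star A d)\<close> gives
    \<open>mul A a (star A d)\<close>, the adjoint of \<open>mul A d (star A a)\<close>, which is
    p.\<close>
  have "nrm A (mul A d (star A d)) \<le> nrm A (affine h c (mul A d (star A d)))"
    by (rule affine_bounds(1)[OF h c(1)]) simp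
  also have "affine h c (mul A d (star A d)) = star A (mul A d (star A a))"
    using affine_mul[of d "star A d"] a by (simp add: star_mul)
  also have "nrm A \<dots> \<le> 1 / s" using da pn by simp
  finally have dn: "(nrm A d)\<^sup>2 \<le> 1 / s" by (simp add: nrm_mul_star)
  have "affine h c (vdiff A a (smul A c (mul A p a))) = affine h c d"
  proof -
    have "affine h c (smul A c (mul A p a)) = smul A c (mul A (affine h c p) a)"
      using a h by (simp add: affine_def alg_simps mul_assoc smul_add_right smul_smul)
    then have "affine h c (vdiff A a (smul A c (mul A p a))) = vdiff A (affine h c a) (smul A c (mul A h a))"
      using a h by (simp add: affine_diff)
    then show ?thesis using a h by (simp add: affine_def[of h c a])
  qed
  then have "vdiff A a (smul A c (mul A p a)) = d"
    using affine_inj[OF h c(1)] a by simp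
  then have 3: "d = vdiff A a (smul A c (mul A p a))" by (rule sym)
  have "a = vadd A d (smul A c (mul A h d))" using d(2) by (simp add: affine_def)
  then show ?thesis
    unfolding c_def[symmetric] h_def[symmetric]
    by (intro bexI[of _ d] bexI[of _ p] conjI dn pn 3 d(1) p(1))
qed

text \<open>The unit is e = \<i>sp from \<open>resolvent\<close>, for which a - ea = d has norm at
  most s^(-1/2) = \<epsilon>/2.\<close>

lemma left_unit:
  assumes a: "a \<in> carr A" and e: "\<epsilon> > 0"
  shows "\<exists>e\<in>carr A. nrm A e \<le> 1 \<and> nrm A (vdiff A a (mul A e a)) < \<epsilon>"
proof -
  define s where "s = 4 / \<epsilon>\<^sup>2"
  have s: "s > 0" using e by (simp add: s_def)
  obtain d p where d: "d \<in> carr A" "(nrm A d)\<^sup>2 \<le> 1 / s" and p: "p \<in> carr A" "nrm A p \<le> 1 / s"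
    and eq: "d = vdiff A a (smul A (\<i> * of_real s) (mul A p a))"
    using resolvent[OF a s] by blast
  have "(nrm A d)\<^sup>2 \<le> \<epsilon>\<^sup>2 / 4" "\<epsilon>\<^sup>2 > 0" using d(2) e by (simp_all add: s_def)
  then have "(nrm A d)\<^sup>2 < \<epsilon>\<^sup>2" by linarith
  then have "nrm A d < \<epsilon>" using e by (simp add: power_less_imp_less_base)
  moreover have "nrm A (smul A (\<i> * of_real s) p) \<le> 1"
    using p s by (simp add: n_smul norm_mult field_simps)
  ultimately show ?thesis
    using p a eq by (intro bexI[of _ "smul A (\<i> * of_real s) p"]) (auto simp: mul_smul_left)
qed

section \<open>Closed ideals are self-adjoint and are C*-algebras\<close>

lemma ideal_carr: "\<lbrakk>closed_ideal A I; x \<in> I\<rbrakk> \<Longrightarrow> x \<in> carr A"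
  by (auto simp: closed_ideal_def subspace_of_def)

text \<open>From a = d + chd with h in \<open>I\<close>, the adjoint of \<open>a\<close> is that of
  \<open>d\<close> plus a multiple of \<open>mul A (star A d) h\<close>. The latter lies in
  \<open>I\<close>, and \<open>d\<close> is arbitrarily small, so closedness applies.\<close>

lemma ideal_star:
  assumes I: "closed_ideal A I" and a: "a \<in> I"
  shows "star A a \<in> I"
proof -
  have ac: "a \<in> carr A" by (rule ideal_carr[OF I a])
  have cl: "closedin (norm_topology A (nrm A)) I" using I by (simp add: closed_ideal_def)
  show ?thesis
  proof (rule closed_approx[OF cl])
    fix e :: real assume e: "e > 0"
    define s where "s = 4 / e\<^sup>2"
    have s: "s > 0" using e by (simp add: s_def)
    define h where "h = mul A a (star A a)"
    have h: "h \<in> I" "h \<in> carr A" "star A h = h"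
      using I a ac by (auto simp: h_def closed_ideal_def star_mul)
    obtain d where d: "d \<in> carr A" "(nrm A d)\<^sup>2 \<le> 1 / s"
      and eq: "a = vadd A d (smul A (\<i> * of_real s) (mul A h d))"
      using resolvent[OF ac s] unfolding h_def by blast
    let ?y = "smul A (cnj (\<i> * of_real s)) (mul A (star A d) h)"
    have "mul A (star A d) h \<in> I" using I d h by (simp add: closed_ideal_def)
    then have y: "?y \<in> I" using I by (simp add: closed_ideal_def subspace_of_def)
    have "star A a = vadd A (star A d) ?y"
      using h d by (subst eq) (simp add: alg_simps)
    then have "vdiff A (star A a) ?y = star A d" using d h by simp
    moreover have "(nrm A d)\<^sup>2 \<le> e\<^sup>2 / 4" "e\<^sup>2 > 0" using d(2) e by (simp_all add: s_def)
    then have "(nrm A d)\<^sup>2 < e\<^sup>2" by linarith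
    then have "nrm A d < e" using e by (simp add: power_less_imp_less_base)
    ultimately show "\<exists>y\<in>I. nrm A (vdiff A (star A a) y) < e" using y d by (intro bexI[of _ ?y]) auto
  qed (use ac in simp)
qed

lemma ideal_cstar:
  assumes I: "closed_ideal A I"
  shows "cstar_algebra (ideal_algebra A I)"
proof -
  have sub: "subspace_of A I" and cl: "closedin (norm_topology A (nrm A)) I"
    and m: "\<And>a x. \<lbrakk>a \<in> carr A; x \<in> I\<rbrakk> \<Longrightarrow> mul A a x \<in> I"
    using I by (auto simp: closed_ideal_def)
  have V: "complex_vector_space (ideal_algebra A I)"
    using subspace_vector_space[OF complex_vector_space_axioms sub] by (simp add: ideal_algebra_def)
  have "norm_complete (ideal_algebra A I) (nrm A)"
    using closed_complete[OF complete cl sub] by (simp add: ideal_algebra_def)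
  then show ?thesis
    using V ideal_star[OF I] m ideal_carr[OF I]
    by (auto simp: cstar_algebra_def cstar_algebra_axioms_def ideal_algebra_def mul_assoc mul_add_left
        mul_add_right mul_smul_left mul_smul_right star_add star_smul star_mul nrm_nonneg nrm_eq_0
        nrm_triangle nrm_smul nrm_mul nrm_cstar)
qed

text \<open>
  With \<open>Y = 1 - sqrt (1 - a\<^sup>*a)\<close> acting by left multiplication, \<open>d = c - Yc\<close> satisfies
  \<open>d\<^sup>*d = c\<^sup>*c - c\<^sup>*a\<^sup>*ac\<close>.
\<close>

lemma contraction_defect:
  assumes a: "a \<in> carr A" "nrm A a \<le> 1" and c: "c \<in> carr A"
  shows "\<exists>d\<in>carr A. vadd A (mul A (star A (mul A a c)) (mul A a c)) (mul A (star A d) d) = mul A (star A c) c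
     \<and> (\<forall>J. closed_ideal A J \<and> c \<in> J \<longrightarrow> d \<in> J)"
proof -
  define X where "X v = mul A (mul A (star A a) a) v" for v
  have Xc [simp]: "X v \<in> carr A" if "v \<in> carr A" for v using that a by (simp add: X_def)
  have X: "linear_map A A X"
    using a by (auto simp: linear_map_def X_def alg_simps)
  have Xn: "nrm A (X v) \<le> nrm A v" if v: "v \<in> carr A" for v
  proof -
    have "nrm A (X v) \<le> (nrm A a)\<^sup>2 * nrm A v"
      using nrm_mul[of "mul A (star A a) a" v] a v by (simp add: X_def nrm_cstar)
    also have "\<dots> \<le> 1 * nrm A v"
      using a v nrm_nonneg by (intro mult_right_mono) (auto simp: power_le_one)
    finally show ?thesis by simp
  qed
  have Xsym: "mul A (star A (X v)) w = mul A (star A v) (X w)" if "v \<in> carr A" "w \<in> carr A" for v w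
    using that a by (simp add: X_def alg_simps mul_assoc)
  obtain Y e where Y: "linear_map A A Y"
    and YY: "\<And>v. v \<in> carr A \<Longrightarrow> smul A 2 (Y v) = vadd A (X v) (Y (Y v))"
    and e: "e \<longlonglongrightarrow> (0::real)"
    and est: "\<And>k v. v \<in> carr A \<Longrightarrow> nrm A (vdiff A (Y v) (sqrt_iter A X k v)) \<le> e k * nrm A v"
    using sqrt_operator[OF complete X Xn] by metis
  let ?Y = "sqrt_iter A X"
  note Yc [simp] = linear_map_closed[OF Y]
  have Ykc [simp]: "?Y k v \<in> carr A" if "v \<in> carr A" for k v
    using that by (induction k arbitrary: v) auto
  have sym_k: "mul A (star A (?Y k v)) w = mul A (star A v) (?Y k w)" if "v \<in> carr A" "w \<in> carr A" for k v w
    using that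
  proof (induction k arbitrary: v w)
    case (Suc k)
    then show ?case by (simp add: alg_simps Xsym)
  qed simp
  have Ysym: "mul A (star A (Y v)) w = mul A (star A v) (Y w)" if v: "v \<in> carr A" and w: "w \<in> carr A" for v w
  proof -
    have "nrm A (vdiff A (mul A (star A (Y v)) w) (mul A (star A v) (Y w))) \<le> e k * (2 * nrm A v * nrm A w)" for k
    proof -
      have "nrm A (vdiff A (mul A (star A (Y v)) w) (mul A (star A v) (Y w))) \<le>
         nrm A (vdiff A (mul A (star A (Y v)) w) (mul A (star A (?Y k v)) w)) +
         nrm A (vdiff A (mul A (star A v) (?Y k w)) (mul A (star A v) (Y w)))"
        using n_diff_triangle[of "mul A (star A (Y v)) w" "mul A (star A (?Y k v)) w" "mul A (star A v) (Y w)"]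
          v w by (simp add: sym_k)
      also have "\<dots> = nrm A (mul A (star A (vdiff A (Y v) (?Y k v))) w) + nrm A (mul A (star A v) (vdiff A (?Y k w) (Y w)))"
        using v w by (simp add: mul_diff_left mul_diff_right star_diff)
      also have "\<dots> \<le> nrm A (star A (vdiff A (Y v) (?Y k v))) * nrm A w + nrm A (star A v) * nrm A (vdiff A (?Y k w) (Y w))"
        using v w by (intro add_mono nrm_mul) auto
      also have "\<dots> = nrm A (vdiff A (Y v) (?Y k v)) * nrm A w + nrm A v * nrm A (vdiff A (Y w) (?Y k w))"
        using v w n_diff_commute[of "?Y k w" "Y w"] by simp
      also have "\<dots> \<le> (e k * nrm A v) * nrm A w + nrm A v * (e k * nrm A w)"
        using v w by (intro add_mono mult_right_mono mult_left_mono est n_nonneg) auto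
      finally show ?thesis by (simp add: algebra_simps)
    qed
    moreover have "(\<lambda>k. e k * (2 * nrm A v * nrm A w)) \<longlonglongrightarrow> 0"
      using tendsto_mult_left_zero[OF e] by blast
    ultimately have "nrm A (vdiff A (mul A (star A (Y v)) w) (mul A (star A v) (Y w))) \<le> 0"
      using LIMSEQ_le_const by blast
    then show ?thesis
      using n_diff_eq_0[of "mul A (star A (Y v)) w" "mul A (star A v) (Y w)"]
        n_nonneg[of "vdiff A (mul A (star A (Y v)) w) (mul A (star A v) (Y w))"] v w by simp
  qed
  let ?d = "vdiff A c (Y c)" and ?p = "mul A (star A c) c" and ?q = "mul A (star A c) (Y c)"
    and ?r = "mul A (star A c) (Y (Y c))" and ?x = "mul A (star A (mul A a c)) (mul A a c)"
  have x: "?x = mul A (star A c) (X c)"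
    using a c by (simp add: X_def alg_simps mul_assoc)
  have "smul A 2 ?q = vadd A ?x ?r"
    using arg_cong[OF YY[OF c], of "mul A (star A c)"] c by (simp add: alg_simps x)
  then have qx: "vadd A ?q ?q = vadd A ?x ?r"
    using smul_add_left[of ?q 1 1] c by simp
  have "mul A (star A ?d) ?d = vdiff A (vdiff A ?p ?q) (vdiff A ?q ?r)"
    using c by (simp add: star_diff mul_diff_left mul_diff_right Ysym)
  also have "\<dots> = vadd A (vadd A ?p ?r) (smul A (-1) (vadd A ?q ?q))"
    using c by (simp add: vdiff_def smul_add_right smul_smul add_assoc add_left_commute add_commute)
  also have "\<dots> = vdiff A (vadd A ?p ?r) (vadd A ?x ?r)"
    by (simp add: vdiff_def qx)
  also have "\<dots> = vdiff A ?p ?x"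
    using c a by (simp add: diff_add_add)
  finally have "vadd A ?x (mul A (star A ?d) ?d) = ?p"
    using a c add_commute[of ?x "vdiff A ?p ?x"] by simp
  \<comment> \<open>Iterates started at \<open>c\<close> in \<open>J\<close> stay in
    \<open>J\<close> and converge to \<open>Y c\<close> in norm. This keeps the identity usable for
    functionals that are known on \<open>J\<close> only.\<close>
  moreover have "?d \<in> J" if J: "closed_ideal A J" "c \<in> J" for J
  proof -
    have sJ: "subspace_of A J" and cl: "closedin (norm_topology A (nrm A)) J"
      using J by (auto simp: closed_ideal_def)
    have "?Y k v \<in> J" if "v \<in> J" for k v
      using that
    proof (induction k arbitrary: v)
      case (Suc k)
      then show ?case
        using J sJ a by (auto simp: subspace_of_def X_def closed_ideal_def)
    qed (use sJ in \<open>simp add: subspace_of_def\<close>)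
    moreover have "(\<lambda>k. nrm A (vdiff A (?Y k c) (Y c))) \<longlonglongrightarrow> 0"
    proof (rule Lim_null_comparison)
      show "\<forall>\<^sub>F k in sequentially. norm (nrm A (vdiff A (?Y k c) (Y c))) \<le> e k * nrm A c"
        using est[OF c] n_diff_commute[of "Y c" "?Y _ c"] c n_nonneg by (intro always_eventually) simp
      show "(\<lambda>k. e k * nrm A c) \<longlonglongrightarrow> 0" using tendsto_mult_left_zero[OF e] by blast
    qed
    ultimately have "Y c \<in> J"
      using cl[unfolded closedin_iff_seq, THEN conjunct2, rule_format, of "\<lambda>k. ?Y k c" "Y c"] J c by simp
    then show ?thesis using sJ J by (simp add: subspace_of_def vdiff_def)
  qed
  ultimately show ?thesis using c by (intro bexI[of _ ?d]) auto
qed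

end

section \<open>Completion of a semi-inner product\<close>

context psd_form
begin

definition cauchy_seq :: "(nat \<Rightarrow> 'a) \<Rightarrow> bool" where
  "cauchy_seq b \<longleftrightarrow> (\<forall>k. b k \<in> carr V) \<and> (\<forall>e>0. \<exists>N. \<forall>i\<ge>N. \<forall>j\<ge>N. sn (vdiff V (b i) (b j)) < e)"

lemma cauchy_seq_carr: "cauchy_seq b \<Longrightarrow> b k \<in> carr V"
  by (simp add: cauchy_seq_def)

lemma cauchy_seq_bounded:
  assumes b: "cauchy_seq b"
  shows "\<exists>M>0. \<forall>k. sn (b k) \<le> M"
proof -
  note [simp] = cauchy_seq_carr[OF b]
  obtain N where N: "\<And>i j. \<lbrakk>i \<ge> N; j \<ge> N\<rbrakk> \<Longrightarrow> sn (vdiff V (b i) (b j)) < 1"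
    using b unfolding cauchy_seq_def by (metis zero_less_one)
  define M where "M = (\<Sum>k\<le>N. sn (b k)) + 1"
  have le: "sn (b k) \<le> M - 1" if "k \<le> N" for k
    unfolding M_def using that member_le_sum[of k "{..N}" "\<lambda>k. sn (b k)"] by (simp add: sn_nonneg)
  have "sn (b k) \<le> M" for k
  proof (cases "k \<le> N")
    case False
    then have "sn (b k) \<le> sn (vdiff V (b k) (b N)) + sn (b N)"
      using sn_triangle[of "vdiff V (b k) (b N)" "b N"] by simp
    moreover have "sn (vdiff V (b k) (b N)) < 1" using N[of k N] False by simp
    ultimately show ?thesis using le[OF order_refl] by linarith
  next
    case True
    then show ?thesis using le[of k] by linarith
  qed
  moreover have "M > 0" using le[of 0] sn_nonneg[of "b 0"] by simp
  ultimately show ?thesis by blast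
qed

lemma cauchy_seq_const: "a \<in> carr V \<Longrightarrow> cauchy_seq (\<lambda>k. a)"
  by (auto simp: cauchy_seq_def)

lemma cauchy_seq_add:
  assumes b: "cauchy_seq b" and c: "cauchy_seq c"
  shows "cauchy_seq (\<lambda>k. vadd V (b k) (c k))"
  unfolding cauchy_seq_def
proof (intro conjI allI impI)
  note [simp] = cauchy_seq_carr[OF b] cauchy_seq_carr[OF c]
  fix e :: real assume "e > 0"
  then have e: "e / 2 > 0" by simp
  obtain N1 where N1: "\<And>i j. \<lbrakk>i \<ge> N1; j \<ge> N1\<rbrakk> \<Longrightarrow> sn (vdiff V (b i) (b j)) < e / 2"
    using b e unfolding cauchy_seq_def by metis
  obtain N2 where N2: "\<And>i j. \<lbrakk>i \<ge> N2; j \<ge> N2\<rbrakk> \<Longrightarrow> sn (vdiff V (c i) (c j)) < e / 2"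
    using c e unfolding cauchy_seq_def by metis
  have "sn (vdiff V (vadd V (b i) (c i)) (vadd V (b j) (c j))) < e" if "i \<ge> max N1 N2" "j \<ge> max N1 N2" for i j
    using sn_triangle[of "vdiff V (b i) (b j)" "vdiff V (c i) (c j)"] N1[of i j] N2[of i j] that
    by (simp add: diff_add_add)
  then show "\<exists>N. \<forall>i\<ge>N. \<forall>j\<ge>N. sn (vdiff V (vadd V (b i) (c i)) (vadd V (b j) (c j))) < e" by blast
qed (simp add: cauchy_seq_carr[OF b] cauchy_seq_carr[OF c])

lemma cauchy_seq_smul:
  assumes b: "cauchy_seq b"
  shows "cauchy_seq (\<lambda>k. smul V c (b k))"
  unfolding cauchy_seq_def
proof (intro conjI allI impI)
  note [simp] = cauchy_seq_carr[OF b]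
  fix e :: real assume "e > 0"
  then have e: "e / (cmod c + 1) > 0" by (simp add: add_nonneg_pos)
  obtain N where N: "\<And>i j. \<lbrakk>i \<ge> N; j \<ge> N\<rbrakk> \<Longrightarrow> sn (vdiff V (b i) (b j)) < e / (cmod c + 1)"
    using b e unfolding cauchy_seq_def by metis
  have "sn (vdiff V (smul V c (b i)) (smul V c (b j))) < e" if "i \<ge> N" "j \<ge> N" for i j
  proof -
    have "sn (vdiff V (smul V c (b i)) (smul V c (b j))) = cmod c * sn (vdiff V (b i) (b j))"
      by (simp add: smul_diff[symmetric] sn_smul)
    also have "\<dots> \<le> cmod c * (e / (cmod c + 1))"
      using N[OF that] by (intro mult_left_mono) auto
    also have "\<dots> = e * (cmod c / (cmod c + 1))" by simp
    also have "\<dots> < e * 1"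
      using \<open>e > 0\<close> by (intro mult_strict_left_mono) (simp_all add: divide_less_eq add_nonneg_pos)
    also have "\<dots> = e" by simp
    finally show ?thesis .
  qed
  then show "\<exists>N. \<forall>i\<ge>N. \<forall>j\<ge>N. sn (vdiff V (smul V c (b i)) (smul V c (b j))) < e" by blast
qed (simp add: cauchy_seq_carr[OF b])

lemma cauchy_seq_diff: "\<lbrakk>cauchy_seq b; cauchy_seq c\<rbrakk> \<Longrightarrow> cauchy_seq (\<lambda>k. vdiff V (b k) (c k))"
  unfolding vdiff_def by (intro cauchy_seq_add cauchy_seq_smul)

definition lim_form :: "(nat \<Rightarrow> 'a) \<Rightarrow> (nat \<Rightarrow> 'a) \<Rightarrow> complex" where
  "lim_form b c = lim (\<lambda>k. s (b k) (c k))"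

lemma lim_form:
  assumes b: "cauchy_seq b" and c: "cauchy_seq c"
  shows "(\<lambda>k. s (b k) (c k)) \<longlonglongrightarrow> lim_form b c"
proof -
  note [simp] = cauchy_seq_carr[OF b] cauchy_seq_carr[OF c]
  obtain M1 where M1: "M1 > 0" "\<And>k. sn (b k) \<le> M1" using cauchy_seq_bounded[OF b] by blast
  obtain M2 where M2: "M2 > 0" "\<And>k. sn (c k) \<le> M2" using cauchy_seq_bounded[OF c] by blast
  have "Cauchy (\<lambda>k. s (b k) (c k))"
  proof (rule CauchyI)
    fix e :: real assume e: "e > 0"
    obtain N1 where N1: "\<And>i j. \<lbrakk>i \<ge> N1; j \<ge> N1\<rbrakk> \<Longrightarrow> sn (vdiff V (b i) (b j)) < e / (2 * M2)"
      using b e M2(1) unfolding cauchy_seq_def by (metis divide_pos_pos mult_pos_pos zero_less_numeral)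
    obtain N2 where N2: "\<And>i j. \<lbrakk>i \<ge> N2; j \<ge> N2\<rbrakk> \<Longrightarrow> sn (vdiff V (c i) (c j)) < e / (2 * M1)"
      using c e M1(1) unfolding cauchy_seq_def by (metis divide_pos_pos mult_pos_pos zero_less_numeral)
    have "norm (s (b i) (c i) - s (b j) (c j)) < e" if i: "i \<ge> max N1 N2" and j: "j \<ge> max N1 N2" for i j
    proof -
      have "s (b i) (c i) - s (b j) (c j) = s (vdiff V (b i) (b j)) (c i) + s (b j) (vdiff V (c i) (c j))"
        by (simp add: s_simps)
      also have "norm \<dots> \<le> sn (vdiff V (b i) (b j)) * sn (c i) + sn (b j) * sn (vdiff V (c i) (c j))"
        by (intro order_trans[OF norm_triangle_ineq] add_mono cauchy_schwarz) auto
      also have "\<dots> \<le> sn (vdiff V (b i) (b j)) * M2 + M1 * sn (vdiff V (c i) (c j))"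
        using M1 M2 by (intro add_mono mult_left_mono mult_right_mono sn_nonneg) auto
      also have "\<dots> < e / (2 * M2) * M2 + M1 * (e / (2 * M1))"
        using N1[of i j] N2[of i j] i j M1(1) M2(1)
        by (intro add_strict_mono mult_strict_right_mono mult_strict_left_mono) auto
      also have "\<dots> = e" using M1(1) M2(1) by simp
      finally show ?thesis .
    qed
    then show "\<exists>M. \<forall>m\<ge>M. \<forall>n\<ge>M. norm (s (b m) (c m) - s (b n) (c n)) < e" by blast
  qed
  then show ?thesis
    unfolding lim_form_def using Cauchy_convergent convergent_LIMSEQ_iff by blast
qed

text \<open>The point of the completion given by a Cauchy sequence is represented by its
  conjugate-linear pairing with \<open>V\<close>. This avoids a quotient by null sequences and
  places the completion in \<open>'a \<Rightarrow> complex\<close>, the type used by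
  \<open>std_rep\<close>.\<close>

definition evaluation :: "(nat \<Rightarrow> 'a) \<Rightarrow> 'a \<Rightarrow> complex" where
  "evaluation b a = (if a \<in> carr V then lim_form (\<lambda>k. a) b else 0)"

lemma evaluation_lim: "\<lbrakk>cauchy_seq b; a \<in> carr V\<rbrakk> \<Longrightarrow> (\<lambda>k. s a (b k)) \<longlonglongrightarrow> evaluation b a"
  using lim_form[OF cauchy_seq_const[of a], of b] by (simp add: evaluation_def)

lemma sn_lim: "cauchy_seq b \<Longrightarrow> (\<lambda>k. sn (b k)) \<longlonglongrightarrow> sqrt (Re (lim_form b b))"
  unfolding sn_def by (intro tendsto_intros lim_form)

text \<open>Split s(d_k, d_k) = s(d_k - d_N, d_k) + s(d_N, d_k): the first term is small by the
  Cauchy property, the second tends to \<open>evaluation d (d N)\<close>. So the evaluation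
  determines a Cauchy sequence up to null sequences.\<close>

lemma null_seq:
  assumes d: "cauchy_seq d" and 0: "\<And>a. a \<in> carr V \<Longrightarrow> evaluation d a = 0"
  shows "lim_form d d = 0"
proof -
  note [simp] = cauchy_seq_carr[OF d]
  obtain M where M: "M > 0" "\<And>k. sn (d k) \<le> M" using cauchy_seq_bounded[OF d] by blast
  have "cmod (lim_form d d) \<le> e" if e: "e > 0" for e
  proof -
    obtain N where N: "\<And>i j. \<lbrakk>i \<ge> N; j \<ge> N\<rbrakk> \<Longrightarrow> sn (vdiff V (d i) (d j)) < e / M"
      using d e M(1) unfolding cauchy_seq_def by (metis divide_pos_pos)
    have "(\<lambda>k. cmod (s (d k) (d k))) \<longlonglongrightarrow> cmod (lim_form d d)"
      by (intro tendsto_norm lim_form d)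
    moreover have "(\<lambda>k. e + cmod (s (d N) (d k))) \<longlonglongrightarrow> e + cmod 0"
      using evaluation_lim[OF d, of "d N"] 0 by (intro tendsto_intros) auto
    moreover have "cmod (s (d k) (d k)) \<le> e + cmod (s (d N) (d k))" if "k \<ge> N" for k
    proof -
      have "s (d k) (d k) = s (vdiff V (d k) (d N)) (d k) + s (d N) (d k)"
        by (simp add: s_simps)
      then have "cmod (s (d k) (d k)) \<le> sn (vdiff V (d k) (d N)) * sn (d k) + cmod (s (d N) (d k))"
        using norm_triangle_ineq[of "s (vdiff V (d k) (d N)) (d k)" "s (d N) (d k)"]
          cauchy_schwarz[of "vdiff V (d k) (d N)" "d k"] by simp
      also have "sn (vdiff V (d k) (d N)) * sn (d k) \<le> (e / M) * M"
        using N[OF that order_refl] M e by (intro mult_mono sn_nonneg) auto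
      finally show ?thesis using M by simp
    qed
    ultimately show ?thesis
      using LIMSEQ_le[of "\<lambda>k. cmod (s (d k) (d k))" _ "\<lambda>k. e + cmod (s (d N) (d k))"] by auto
  qed
  then have "cmod (lim_form d d) \<le> 0" using field_le_epsilon[of "cmod (lim_form d d)" 0] by simp
  then show ?thesis by simp
qed

lemma evaluation_add:
  "\<lbrakk>cauchy_seq b; cauchy_seq c\<rbrakk> \<Longrightarrow> evaluation (\<lambda>k. vadd V (b k) (c k)) = (\<lambda>a. evaluation b a + evaluation c a)"
proof
  fix a assume b: "cauchy_seq b" and c: "cauchy_seq c"
  show "evaluation (\<lambda>k. vadd V (b k) (c k)) a = evaluation b a + evaluation c a"
  proof (cases "a \<in> carr V")
    case a: True
    have "(\<lambda>k. s a (vadd V (b k) (c k))) \<longlonglongrightarrow> evaluation b a + evaluation c a"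
      using tendsto_add[OF evaluation_lim[OF b a] evaluation_lim[OF c a]] a
      by (simp add: s_simps cauchy_seq_carr[OF b] cauchy_seq_carr[OF c])
    then show ?thesis
      using evaluation_lim[OF cauchy_seq_add[OF b c] a] LIMSEQ_unique by blast
  qed (simp add: evaluation_def)
qed

lemma evaluation_smul:
  "cauchy_seq b \<Longrightarrow> evaluation (\<lambda>k. smul V c (b k)) = (\<lambda>a. c * evaluation b a)"
proof
  fix a assume b: "cauchy_seq b"
  show "evaluation (\<lambda>k. smul V c (b k)) a = c * evaluation b a"
  proof (cases "a \<in> carr V")
    case a: True
    have "(\<lambda>k. s a (smul V c (b k))) \<longlonglongrightarrow> c * evaluation b a"
      using tendsto_mult[OF tendsto_const evaluation_lim[OF b a]] a
      by (simp add: s_simps cauchy_seq_carr[OF b])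
    then show ?thesis
      using evaluation_lim[OF cauchy_seq_smul[OF b] a] LIMSEQ_unique by blast
  qed (simp add: evaluation_def)
qed

lemma evaluation_diff:
  "\<lbrakk>cauchy_seq b; cauchy_seq c\<rbrakk> \<Longrightarrow> evaluation (\<lambda>k. vdiff V (b k) (c k)) = (\<lambda>a. evaluation b a - evaluation c a)"
  unfolding vdiff_def by (simp add: evaluation_add evaluation_smul cauchy_seq_smul)

lemma lim_form_commute:
  assumes b: "cauchy_seq b" and c: "cauchy_seq c"
  shows "lim_form c b = cnj (lim_form b c)"
proof -
  have "(\<lambda>k. s (c k) (b k)) \<longlonglongrightarrow> cnj (lim_form b c)"
    using tendsto_cnj[OF lim_form[OF b c]]
    by (simp add: s_commute[symmetric] cauchy_seq_carr[OF b] cauchy_seq_carr[OF c])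
  then show ?thesis using lim_form[OF c b] LIMSEQ_unique by blast
qed

lemma lim_form_add:
  assumes a: "cauchy_seq a" and b: "cauchy_seq b" and c: "cauchy_seq c"
  shows "lim_form a (\<lambda>k. vadd V (b k) (c k)) = lim_form a b + lim_form a c"
proof -
  have "(\<lambda>k. s (a k) (vadd V (b k) (c k))) \<longlonglongrightarrow> lim_form a b + lim_form a c"
    using tendsto_add[OF lim_form[OF a b] lim_form[OF a c]]
    by (simp add: s_simps cauchy_seq_carr[OF a] cauchy_seq_carr[OF b] cauchy_seq_carr[OF c])
  then show ?thesis using lim_form[OF a cauchy_seq_add[OF b c]] LIMSEQ_unique by blast
qed

lemma lim_form_smul:
  assumes a: "cauchy_seq a" and b: "cauchy_seq b"
  shows "lim_form a (\<lambda>k. smul V x (b k)) = x * lim_form a b"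
proof -
  have "(\<lambda>k. s (a k) (smul V x (b k))) \<longlonglongrightarrow> x * lim_form a b"
    using tendsto_mult[OF tendsto_const lim_form[OF a b]]
    by (simp add: s_simps cauchy_seq_carr[OF a] cauchy_seq_carr[OF b])
  then show ?thesis using lim_form[OF a cauchy_seq_smul[OF b]] LIMSEQ_unique by blast
qed

lemma lim_form_nonneg: "cauchy_seq b \<Longrightarrow> 0 \<le> Re (lim_form b b)"
  using LIMSEQ_le_const[OF tendsto_Re[OF lim_form[of b b]], of 0] s_nonneg cauchy_seq_carr[of b] by blast

lemma lim_form_cauchy_schwarz:
  assumes b: "cauchy_seq b" and c: "cauchy_seq c"
  shows "cmod (lim_form b c) \<le> sqrt (Re (lim_form b b)) * sqrt (Re (lim_form c c))"
  by (rule LIMSEQ_le[OF tendsto_norm[OF lim_form[OF b c]] tendsto_mult[OF sn_lim[OF b] sn_lim[OF c]]])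
    (use cauchy_schwarz cauchy_seq_carr[OF b] cauchy_seq_carr[OF c] in auto)

text \<open>Legitimises the choice of Cauchy sequences in the inner product of
  \<open>completion\<close>.\<close>

lemma lim_form_cong:
  assumes b: "cauchy_seq b" and b': "cauchy_seq b'" and c: "cauchy_seq c" and eq: "evaluation b = evaluation b'"
  shows "lim_form c b = lim_form c b'"
proof -
  let ?d = "\<lambda>k. vdiff V (b k) (b' k)"
  have d: "cauchy_seq ?d" using b b' by (rule cauchy_seq_diff)
  have "lim_form ?d ?d = 0"
    using eq by (intro null_seq[OF d]) (simp add: evaluation_diff[OF b b'])
  then have "cmod (lim_form c ?d) \<le> 0" using lim_form_cauchy_schwarz[OF c d] by simp
  then have "lim_form c ?d = 0" by simp
  moreover have "lim_form c ?d = lim_form c b - lim_form c b'"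
    unfolding vdiff_def by (simp add: lim_form_add lim_form_smul cauchy_seq_smul b b' c)
  ultimately show ?thesis by simp
qed

definition completion :: "('a \<Rightarrow> complex) hilbert" where
  "completion = \<lparr>carr = evaluation ` Collect cauchy_seq, vadd = (\<lambda>f g a. f a + g a), vzero = (\<lambda>a. 0),
     smul = (\<lambda>c f a. c * f a),
     inn = (\<lambda>f g. lim_form (SOME b. cauchy_seq b \<and> evaluation b = f) (SOME b. cauchy_seq b \<and> evaluation b = g))\<rparr>"

lemma completion_sel:
  "carr completion = evaluation ` Collect cauchy_seq"
  "vadd completion f g = (\<lambda>a. f a + g a)" "vzero completion = (\<lambda>a. 0)" "smul completion c f = (\<lambda>a. c * f a)"
  by (simp_all add: completion_def)

lemma completion_inn:
  assumes b: "cauchy_seq b" and c: "cauchy_seq c"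
  shows "inn completion (evaluation b) (evaluation c) = lim_form b c"
proof -
  define b' where "b' = (SOME x. cauchy_seq x \<and> evaluation x = evaluation b)"
  define c' where "c' = (SOME x. cauchy_seq x \<and> evaluation x = evaluation c)"
  have b': "cauchy_seq b' \<and> evaluation b' = evaluation b"
    unfolding b'_def by (rule someI[where x = b]) (simp add: b)
  have c': "cauchy_seq c' \<and> evaluation c' = evaluation c"
    unfolding c'_def by (rule someI[where x = c]) (simp add: c)
  have "lim_form b' c' = lim_form b' c" using c' b' c by (intro lim_form_cong) auto
  also have "\<dots> = cnj (lim_form c b')" using b' c by (intro lim_form_commute) auto
  also have "lim_form c b' = lim_form c b" using b' c b by (intro lim_form_cong) auto
  also have "cnj (lim_form c b) = lim_form b c" using b c by (intro lim_form_commute[symmetric]) auto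
  finally show ?thesis by (simp add: completion_def b'_def[symmetric] c'_def[symmetric])
qed

lemma completion_vs: "complex_vector_space completion"
proof unfold_locales
  fix x y c assume "x \<in> carr completion" "y \<in> carr completion"
  then obtain b b' where b: "cauchy_seq b" "x = evaluation b" and b': "cauchy_seq b'" "y = evaluation b'"
    by (auto simp: completion_sel)
  show "vadd completion x y \<in> carr completion"
    using b b' cauchy_seq_add[OF b(1) b'(1)]
    by (auto simp: completion_sel evaluation_add[OF b(1) b'(1), symmetric])
next
  fix x c assume "x \<in> carr completion"
  then obtain b where b: "cauchy_seq b" "x = evaluation b"
    by (auto simp: completion_sel)
  show "smul completion c x \<in> carr completion"
    using b cauchy_seq_smul[OF b(1)]
    by (auto simp: completion_sel evaluation_smul[OF b(1), symmetric])
next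
  have "evaluation (\<lambda>k. vzero V) = vzero completion"
    using evaluation_diff[of "\<lambda>k. vzero V" "\<lambda>k. vzero V"] cauchy_seq_const[of "vzero V"]
    by (simp add: completion_sel)
  then show "vzero completion \<in> carr completion"
    using cauchy_seq_const[of "vzero V"] image_eqI[of "vzero completion" evaluation "\<lambda>k. vzero V"]
    by (simp add: completion_sel)
qed (auto simp: completion_sel algebra_simps)

lemma completion_form: "psd_form completion (inn completion)"
proof -
  interpret C: complex_vector_space completion by (rule completion_vs)
  show ?thesis
  proof unfold_locales
    fix x y z assume "x \<in> carr completion" "y \<in> carr completion" "z \<in> carr completion"
    then obtain a b c where a: "cauchy_seq a" "x = evaluation a" and b: "cauchy_seq b" "y = evaluation b"
      and c: "cauchy_seq c" "z = evaluation c"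
      by (auto simp: completion_sel)
    have "vadd completion y z = evaluation (\<lambda>k. vadd V (b k) (c k))"
      using b c by (simp add: completion_sel evaluation_add)
    then show "inn completion x (vadd completion y z) = inn completion x y + inn completion x z"
      using a b c by (simp add: completion_inn cauchy_seq_add lim_form_add)
  next
    fix x y c assume "x \<in> carr completion" "y \<in> carr completion"
    then obtain a b where a: "cauchy_seq a" "x = evaluation a" and b: "cauchy_seq b" "y = evaluation b"
      by (auto simp: completion_sel)
    have "smul completion c y = evaluation (\<lambda>k. smul V c (b k))"
      using b by (simp add: completion_sel evaluation_smul)
    then show "inn completion x (smul completion c y) = c * inn completion x y"
      using a b by (simp add: completion_inn cauchy_seq_smul lim_form_smul)
  qed (auto simp: completion_sel completion_inn lim_form_nonneg intro: lim_form_commute)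
qed

lemma completion_definite:
  assumes "x \<in> carr completion" "inn completion x x = 0"
  shows "x = vzero completion"
proof -
  obtain b where b: "cauchy_seq b" "x = evaluation b"
    using assms by (auto simp: completion_sel)
  have "evaluation b a = 0" for a
  proof (cases "a \<in> carr V")
    case a: True
    have "lim_form (\<lambda>k. a) b = 0"
      using lim_form_cauchy_schwarz[OF cauchy_seq_const[OF a] b(1)] assms(2) b by (simp add: completion_inn)
    then show ?thesis by (simp add: evaluation_def)
  qed (simp add: evaluation_def)
  then show ?thesis using b by (auto simp: completion_sel)
qed

definition embed :: "'a \<Rightarrow> 'a \<Rightarrow> complex" where
  "embed a = evaluation (\<lambda>k. a)"

lemma embed_inn: "\<lbrakk>a \<in> carr V; b \<in> carr V\<rbrakk> \<Longrightarrow> inn completion (embed a) (embed b) = s a b"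
  by (simp add: embed_def completion_inn cauchy_seq_const lim_form_def)

text \<open>Reproducing property: the completion is the reproducing kernel space of
  \<open>s\<close>.\<close>

lemma embed_inn_right:
  "\<lbrakk>a \<in> carr V; f \<in> carr completion\<rbrakk> \<Longrightarrow> inn completion (embed a) f = f a"
  by (auto simp: embed_def completion_sel completion_inn cauchy_seq_const evaluation_def)

lemma embed_linear: "linear_map V completion embed"
  by (auto simp: linear_map_def embed_def completion_sel cauchy_seq_const
      evaluation_add[of "\<lambda>k. _" "\<lambda>k. _"] evaluation_smul[of "\<lambda>k. _"])

lemma completion_normed: "normed_cspace completion (hnorm completion)"
proof -
  interpret C: psd_form completion "inn completion" by (rule completion_form)
  have hn: "hnorm completion = C.sn" by (simp add: fun_eq_iff hnorm_def C.sn_def)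
  show ?thesis
  proof unfold_locales
    fix x assume "x \<in> carr completion"
    then show "hnorm completion x = 0 \<longleftrightarrow> x = vzero completion"
      using completion_definite[of x] C.s_self[of x] by (auto simp: hn)
  qed (simp_all add: hn C.sn_nonneg C.sn_triangle C.sn_smul)
qed

lemma embed_approx:
  assumes f: "f \<in> carr completion" and e: "e > 0"
  shows "\<exists>a\<in>carr V. hnorm completion (vdiff completion f (embed a)) < e"
proof -
  interpret C: psd_form completion "inn completion" by (rule completion_form)
  obtain b where b: "cauchy_seq b" "f = evaluation b"
    using f by (auto simp: completion_sel)
  note [simp] = cauchy_seq_carr[OF b(1)]
  obtain N where N: "\<And>i j. \<lbrakk>i \<ge> N; j \<ge> N\<rbrakk> \<Longrightarrow> sn (vdiff V (b i) (b j)) < e / 2"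
    using b(1) e unfolding cauchy_seq_def by (metis half_gt_zero)
  let ?d = "\<lambda>k. vdiff V (b k) (b N)"
  have cN: "cauchy_seq (\<lambda>k. b N)" by (rule cauchy_seq_const) simp
  have d: "cauchy_seq ?d" by (rule cauchy_seq_diff[OF b(1) cN])
  have eq: "vdiff completion f (embed (b N)) = evaluation ?d"
    by (simp add: vdiff_def[of completion] completion_sel embed_def b(2) evaluation_diff[OF b(1) cN])
  have "hnorm completion (vdiff completion f (embed (b N))) = sqrt (Re (lim_form ?d ?d))"
    unfolding eq hnorm_def by (simp add: completion_inn d)
  also have "\<dots> \<le> e / 2"
    using N by (intro LIMSEQ_le_const2[OF sn_lim[OF d]] exI[of _ N]) (auto intro: less_imp_le)
  also have "\<dots> < e" using e by simp
  finally show ?thesis by (intro bexI[of _ "b N"]) auto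
qed

text \<open>For completeness, the members of a Cauchy sequence are replaced by embedded vectors at
  distance below 1 / (k + 1). These come from a Cauchy sequence of \<open>V\<close>, whose
  evaluation is the limit.\<close>

lemma completion_hilbert: "hilbert_space completion"
proof -
  interpret N: normed_cspace completion "hnorm completion" by (rule completion_normed)
  interpret C: psd_form completion "inn completion" by (rule completion_form)
  have ed: "hnorm completion (vdiff completion (embed a) (embed b)) = sn (vdiff V a b)"
    if "a \<in> carr V" "b \<in> carr V" for a b
  proof -
    have "vdiff completion (embed a) (embed b) = embed (vdiff V a b)"
      using linear_map_diff[OF complex_vector_space_axioms embed_linear that] by simp
    then show ?thesis using that by (simp add: hnorm_def embed_inn sn_def)
  qed
  have ec [simp]: "embed a \<in> carr completion" if "a \<in> carr V" for a
    using linear_map_closed[OF embed_linear that] .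
  have "norm_complete completion (hnorm completion)"
  proof (rule N.completeI)
    fix F assume F [simp]: "\<And>k::nat. F k \<in> carr completion"
      and FC: "\<And>e. e > 0 \<Longrightarrow> \<exists>N. \<forall>i\<ge>N. \<forall>j\<ge>N. hnorm completion (vdiff completion (F i) (F j)) < e"
    have "\<exists>a\<in>carr V. hnorm completion (vdiff completion (F k) (embed a)) < 1 / (real k + 1)" for k
      by (rule embed_approx) auto
    then obtain a where a [simp]: "\<And>k. a k \<in> carr V"
      and aF: "\<And>k. hnorm completion (vdiff completion (F k) (embed (a k))) < 1 / (real k + 1)"
      by metis
    have lim0: "(\<lambda>k. 1 / (real k + 1)) \<longlonglongrightarrow> 0"
      using LIMSEQ_inverse_real_of_nat by (simp add: inverse_eq_divide add.commute)
    have ac: "cauchy_seq a"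
      unfolding cauchy_seq_def
    proof (intro conjI allI impI)
      fix e :: real assume "e > 0"
      then have e: "e / 3 > 0" by simp
      obtain N1 where N1: "\<And>i j. \<lbrakk>i \<ge> N1; j \<ge> N1\<rbrakk> \<Longrightarrow> hnorm completion (vdiff completion (F i) (F j)) < e / 3"
        using FC[OF e] by blast
      obtain N2 where N2: "\<And>i. i \<ge> N2 \<Longrightarrow> 1 / (real i + 1) < e / 3"
        using order_tendstoD(2)[OF lim0 e] by (auto simp: eventually_sequentially)
      have "sn (vdiff V (a i) (a j)) < e" if "i \<ge> max N1 N2" "j \<ge> max N1 N2" for i j
        using N.n_diff_triangle[of "embed (a i)" "F i" "embed (a j)"]
          N.n_diff_triangle[of "F i" "F j" "embed (a j)"]
          N.n_diff_commute[of "embed (a i)" "F i"] ed[of "a i" "a j"] aF[of i] aF[of j] N1[of i j]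
          N2[of i] N2[of j] that by simp
      then show "\<exists>N. \<forall>i\<ge>N. \<forall>j\<ge>N. sn (vdiff V (a i) (a j)) < e" by blast
    qed simp
    let ?f = "evaluation a"
    have f: "?f \<in> carr completion" using ac by (auto simp: completion_sel)
    have "(\<lambda>k. hnorm completion (vdiff completion (F k) ?f)) \<longlonglongrightarrow> 0"
    proof (rule LIMSEQ_I)
      fix e :: real assume "e > 0"
      then have e: "e / 3 > 0" by simp
      obtain N1 where N1: "\<And>i j. \<lbrakk>i \<ge> N1; j \<ge> N1\<rbrakk> \<Longrightarrow> sn (vdiff V (a i) (a j)) < e / 3"
        using ac e unfolding cauchy_seq_def by metis
      obtain N2 where N2: "\<And>i. i \<ge> N2 \<Longrightarrow> 1 / (real i + 1) < e / 3"
        using order_tendstoD(2)[OF lim0 e] by (auto simp: eventually_sequentially)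
      have "norm (hnorm completion (vdiff completion (F k) ?f) - 0) < e" if k: "k \<ge> max N1 N2" for k
      proof -
        let ?d = "\<lambda>j. vdiff V (a k) (a j)"
        have ck: "cauchy_seq (\<lambda>j. a k)" by (rule cauchy_seq_const) simp
        have d: "cauchy_seq ?d" by (rule cauchy_seq_diff[OF ck ac])
        have eq: "vdiff completion (embed (a k)) ?f = evaluation ?d"
          by (simp add: vdiff_def[of completion] completion_sel embed_def evaluation_diff[OF ck ac])
        have "hnorm completion (vdiff completion (embed (a k)) ?f) = sqrt (Re (lim_form ?d ?d))"
          unfolding eq hnorm_def by (simp add: completion_inn d)
        also have "\<dots> \<le> e / 3"
          using N1 k by (intro LIMSEQ_le_const2[OF sn_lim[OF d]] exI[of _ N1]) (auto intro: less_imp_le)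
        finally show ?thesis
          using N.n_diff_triangle[of "F k" "embed (a k)" ?f] f aF[of k] N2[of k] k
            N.n_nonneg[of "vdiff completion (F k) ?f"] e by simp
      qed
      then show "\<exists>no. \<forall>n\<ge>no. norm (hnorm completion (vdiff completion (F n) ?f) - 0) < e" by blast
    qed
    then show "\<exists>l\<in>carr completion. (\<lambda>k. hnorm completion (vdiff completion (F k) l)) \<longlonglongrightarrow> 0"
      using f by blast
  qed
  then show ?thesis
    using completion_vs completion_definite
    by (auto simp: hilbert_space_def hilbert_space_axioms_def C.s_add_right C.s_smul_right C.s_nonneg
        intro: C.s_commute)
qed

lemma embed_total: "hilbert_space.total completion (embed ` carr V)"
proof -
  interpret H: hilbert_space completion by (rule completion_hilbert)
  show ?thesis
  proof (rule H.totalI)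
    fix f assume f: "f \<in> carr completion" "\<And>w. w \<in> embed ` carr V \<Longrightarrow> inn completion w f = 0"
    then have "f a = 0" if "a \<in> carr V" for a
      using embed_inn_right[OF that f(1)] that by auto
    moreover have "f a = 0" if "a \<notin> carr V" for a
      using f(1) that by (auto simp: completion_sel evaluation_def)
    ultimately show "f = vzero completion" by (auto simp: completion_sel)
  qed (use linear_map_closed[OF embed_linear] in auto)
qed

end

section \<open>Contractivity of representations, states and the GNS construction\<close>

lemma ideal_algebra_sel [simp]:
  "carr (ideal_algebra A I) = I" "vadd (ideal_algebra A I) = vadd A" "vzero (ideal_algebra A I) = vzero A"
  "smul (ideal_algebra A I) = smul A" "mul (ideal_algebra A I) = mul A" "star (ideal_algebra A I) = star A"
  "nrm (ideal_algebra A I) = nrm A"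
  by (simp_all add: ideal_algebra_def)

lemma ideal_algebra_carr [simp]: "ideal_algebra A (carr A) = A"
  by (simp add: ideal_algebra_def)

context cstar_algebra
begin

lemma closed_ideal_carr: "closed_ideal A (carr A)"
proof -
  have "closedin (norm_topology A (nrm A)) (carr A)"
    unfolding closedin_iff_seq by blast
  then show ?thesis by (simp add: closed_ideal_def subspace_of_def)
qed

text \<open>Relative to a set because \<open>module_rep\<close> applies it to functionals known on
  an ideal only. The bounds needed there come from \<open>positive_contraction\<close>.\<close>

definition positive_on :: "'a set \<Rightarrow> ('a \<Rightarrow> complex) \<Rightarrow> bool" where
  "positive_on J f \<longleftrightarrow> (\<forall>a\<in>J. \<forall>b\<in>J. f (vadd A a b) = f a + f b) \<and>
     (\<forall>c. \<forall>a\<in>J. f (smul A c a) = c * f a) \<and> (\<forall>a\<in>J. f (mul A (star A a) a) \<in> \<real>\<^sub>\<ge>\<^sub>0)"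

text \<open>For \<open>nrm A b \<le> 1\<close> the defect in \<open>contraction_defect\<close> has
  the form \<open>mul A (star A d) d\<close> with \<open>d\<close> in \<open>J\<close>, so
  \<open>f\<close> is nonnegative on it; the general case follows by scaling.\<close>

lemma positive_contraction:
  assumes J: "closed_ideal A J" and f: "positive_on J f" and a: "a \<in> carr A" and c: "c \<in> J"
  shows "Re (f (mul A (star A (mul A a c)) (mul A a c))) \<le> (nrm A a)\<^sup>2 * Re (f (mul A (star A c) c))"
proof -
  note JA = ideal_carr[OF J]
  have Jm: "mul A x y \<in> J" if "x \<in> carr A" "y \<in> J" for x y
    using J that unfolding closed_ideal_def by blast
  have fa: "f (vadd A x y) = f x + f y" if "x \<in> J" "y \<in> J" for x y
    using f that unfolding positive_on_def by blast
  have fs: "f (smul A z x) = z * f x" if "x \<in> J" for x z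
    using f that unfolding positive_on_def by blast
  have fp: "f (mul A (star A x) x) \<in> \<real>\<^sub>\<ge>\<^sub>0" if "x \<in> J" for x
    using f that unfolding positive_on_def by blast
  have unit: "Re (f (mul A (star A (mul A b c)) (mul A b c))) \<le> Re (f (mul A (star A c) c))"
    if b: "b \<in> carr A" "nrm A b \<le> 1" for b
  proof -
    obtain d where d: "d \<in> carr A" "d \<in> J"
      and eq: "vadd A (mul A (star A (mul A b c)) (mul A b c)) (mul A (star A d) d) = mul A (star A c) c"
      using contraction_defect[OF b JA[OF c]] J c by blast
    have "f (mul A (star A c) c) = f (mul A (star A (mul A b c)) (mul A b c)) + f (mul A (star A d) d)"
      unfolding eq[symmetric] using b c d JA[OF c] by (intro fa Jm) auto
    moreover have "f (mul A (star A d) d) \<in> \<real>\<^sub>\<ge>\<^sub>0" using d(2) by (rule fp)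
    ultimately show ?thesis by (auto simp: complex_nonneg_Reals_iff)
  qed
  show ?thesis
  proof (cases "nrm A a = 0")
    case True
    then have "a = vzero A" using a n_eq_0 by simp
    moreover have "f (vzero A) = 0"
      using fs[OF c, of 0] JA[OF c] by simp
    ultimately show ?thesis using JA[OF c] by simp
  next
    case False
    then have p: "nrm A a > 0" using n_nonneg[OF a] by simp
    let ?b = "smul A (of_real (1 / nrm A a)) a"
    have b: "?b \<in> carr A" "nrm A ?b \<le> 1" using a p by (simp_all add: n_smul norm_divide)
    have cA: "c \<in> carr A" using JA[OF c] .
    have "mul A a c = smul A (of_real (nrm A a)) (mul A ?b c)"
      using a cA p by (simp add: alg_simps smul_smul)
    then have "mul A (star A (mul A a c)) (mul A a c) =
       smul A (of_real ((nrm A a)\<^sup>2)) (mul A (star A (mul A ?b c)) (mul A ?b c))"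
      using b cA by (simp add: mul_smul_left mul_smul_right star_smul smul_smul power2_eq_square)
    moreover have "mul A (star A (mul A ?b c)) (mul A ?b c) \<in> J"
      using Jm[OF _ Jm[OF b(1) c]] b cA by simp
    ultimately have "f (mul A (star A (mul A a c)) (mul A a c)) =
        of_real ((nrm A a)\<^sup>2) * f (mul A (star A (mul A ?b c)) (mul A ?b c))"
      using fs by simp
    then show ?thesis using unit[OF b] by (simp add: mult_left_mono del: of_real_power)
  qed
qed

lemma rep_positive:
  assumes r: "representation A \<pi>" and v: "v \<in> carr (rspace \<pi>)"
  shows "positive_on (carr A) (\<lambda>a. inn (rspace \<pi>) v (rop \<pi> a v))"
proof -
  interpret H: hilbert_space "rspace \<pi>" by (rule rep_hilbert[OF r])
  note [simp] = rep_closed[OF r] v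
  have "inn (rspace \<pi>) v (rop \<pi> (mul A (star A a) a) v) = inn (rspace \<pi>) (rop \<pi> a v) (rop \<pi> a v)" if "a \<in> carr A" for a
    using that by (simp add: rep_mul[OF r] rep_adjoint[OF r])
  moreover have "inn (rspace \<pi>) (rop \<pi> a v) (rop \<pi> a v) \<in> \<real>\<^sub>\<ge>\<^sub>0" if "a \<in> carr A" for a
    using that by (subst H.form.s_self) (auto simp del: of_real_power)
  ultimately show ?thesis
    by (auto simp: positive_on_def rep_add[OF r] rep_smul[OF r])
qed

text \<open>For lack of a unit, positivity yields the bound only on vectors of the form
  \<open>rop \<pi> c w\<close>. A general \<open>v\<close> is reached through the vector
  \<open>rop \<pi> h v\<close> with h = \<open>mul A (star A a) a\<close>.\<close>

lemma rep_contraction: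
  assumes r: "representation A \<pi>" and a: "a \<in> carr A" and v: "v \<in> carr (rspace \<pi>)"
  shows "hnorm (rspace \<pi>) (rop \<pi> a v) \<le> nrm A a * hnorm (rspace \<pi>) v"
proof -
  let ?H = "rspace \<pi>"
  interpret H: hilbert_space ?H by (rule rep_hilbert[OF r])
  note [simp] = rep_closed[OF r]
  have sq: "(hnorm ?H (rop \<pi> b w))\<^sup>2 = Re (inn ?H w (rop \<pi> (mul A (star A b) b) w))"
    if "b \<in> carr A" "w \<in> carr ?H" for b w
    using that by (simp add: H.hnorm_sq rep_mul[OF r] rep_adjoint[OF r])
  have comp: "hnorm ?H (rop \<pi> b (rop \<pi> c w)) \<le> nrm A b * hnorm ?H (rop \<pi> c w)"
    if b: "b \<in> carr A" and c: "c \<in> carr A" and w: "w \<in> carr ?H" for b c w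
  proof -
    have "(hnorm ?H (rop \<pi> (mul A b c) w))\<^sup>2 \<le> (nrm A b)\<^sup>2 * (hnorm ?H (rop \<pi> c w))\<^sup>2"
      using positive_contraction[OF closed_ideal_carr rep_positive[OF r w] b c]
      unfolding sq[OF mul_closed[OF b c] w] sq[OF c w] .
    then have "(hnorm ?H (rop \<pi> b (rop \<pi> c w)))\<^sup>2 \<le> (nrm A b * hnorm ?H (rop \<pi> c w))\<^sup>2"
      using b c w by (simp add: rep_mul[OF r] power_mult_distrib)
    then show ?thesis
      by (rule power2_le_imp_le) (use n_nonneg[OF b] H.n_nonneg[of "rop \<pi> c w"] c w in auto)
  qed
  \<comment> \<open>Since h is self-adjoint, |hv|^2 = \<langle>v|hhv\<rangle> \<le> |v| |h| |hv|,
    hence |hv| \<le> |h| |v|; then |av|^2 = \<langle>v|hv\<rangle> finishes.\<close>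
  let ?h = "mul A (star A a) a"
  let ?w = "rop \<pi> ?h v"
  have h: "?h \<in> carr A" "star A ?h = ?h" using a by (auto simp: star_mul)
  have "(hnorm ?H ?w)\<^sup>2 = Re (inn ?H v (rop \<pi> ?h ?w))"
    using sq[OF h(1) v] unfolding h(2) rep_mul[OF r h(1) h(1) v] .
  also have "\<dots> \<le> hnorm ?H v * hnorm ?H (rop \<pi> ?h ?w)"
    using H.form.cauchy_schwarz[of v "rop \<pi> ?h ?w"] complex_Re_le_cmod[of "inn ?H v (rop \<pi> ?h ?w)"] h v by simp
  also have "\<dots> \<le> hnorm ?H v * (nrm A ?h * hnorm ?H ?w)"
    using comp[OF h(1) h(1) v] v by (intro mult_left_mono H.n_nonneg) auto
  finally have "hnorm ?H ?w * hnorm ?H ?w \<le> hnorm ?H ?w * (nrm A ?h * hnorm ?H v)"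
    by (simp add: power2_eq_square algebra_simps)
  then have wb: "hnorm ?H ?w \<le> nrm A ?h * hnorm ?H v"
    using H.n_nonneg[of ?w] H.n_nonneg[of v] n_nonneg[of ?h] h v
    by (cases "hnorm ?H ?w = 0") (simp_all add: mult_le_cancel_left_pos)
  have "(hnorm ?H (rop \<pi> a v))\<^sup>2 = Re (inn ?H v ?w)" by (rule sq[OF a v])
  also have "\<dots> \<le> hnorm ?H v * hnorm ?H ?w"
    using H.form.cauchy_schwarz[of v ?w] complex_Re_le_cmod[of "inn ?H v ?w"] h v by simp
  also have "\<dots> \<le> hnorm ?H v * (nrm A ?h * hnorm ?H v)"
    using wb v by (intro mult_left_mono H.n_nonneg) auto
  also have "\<dots> = (nrm A a * hnorm ?H v)\<^sup>2"
    using a by (simp add: nrm_cstar power2_eq_square algebra_simps)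
  finally show ?thesis
    by (rule power2_le_imp_le) (use n_nonneg[OF a] H.n_nonneg[OF v] in auto)
qed

text \<open>
  The common core of the GNS construction (\<open>J = A\<close>) and of the extension of representations
  from an ideal: the operators are defined weakly through the Riesz representation.
\<close>

lemma module_rep:
  assumes J: "closed_ideal A J" and H: "hilbert_space H"
    and L: "linear_map (ideal_algebra A J) H L" and t: "hilbert_space.total H (L ` J)"
    and f: "positive_on J f"
    and Lf: "\<And>c d. \<lbrakk>c \<in> J; d \<in> J\<rbrakk> \<Longrightarrow> inn H (L c) (L d) = f (mul A (star A c) d)"
  shows "\<exists>\<pi>. rspace \<pi> = H \<and> representation A \<pi> \<and> (\<forall>a\<in>carr A. \<forall>c\<in>J. rop \<pi> a (L c) = L (mul A a c))"
proof -
  interpret H: hilbert_space H by fact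
  have sJ: "subspace_of A J" using J by (simp add: closed_ideal_def)
  have V: "complex_vector_space (ideal_algebra A J)"
    using subspace_vector_space[OF complex_vector_space_axioms sJ] by (simp add: ideal_algebra_def)
  interpret V: complex_vector_space "ideal_algebra A J" by (rule V)
  note JA [simp] = ideal_carr[OF J]
  have Jm [simp]: "mul A x y \<in> J" if "x \<in> carr A" "y \<in> J" for x y
    using J that by (simp add: closed_ideal_def)
  have Lc [simp]: "L c \<in> carr H" if "c \<in> J" for c using linear_map_closed[OF L] that by simp
  have La: "L (vadd A c d) = vadd H (L c) (L d)" if "c \<in> J" "d \<in> J" for c d
    using linear_map_add[OF L, of c d] that by simp
  have Ls: "L (smul A x c) = smul H x (L c)" if "c \<in> J" for x c
    using linear_map_smul[OF L, of c x] that by simp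
  have Ja [simp]: "vadd A c d \<in> J" "smul A x c \<in> J" if "c \<in> J" "d \<in> J" for c d x
    using sJ that by (auto simp: subspace_of_def)
  have adj: "inn H (L (mul A a c)) (L d) = inn H (L c) (L (mul A (star A a) d))"
    if "a \<in> carr A" "c \<in> J" "d \<in> J" for a c d
    using that by (simp add: Lf star_mul mul_assoc)
  have contr: "hnorm H (L (mul A a c)) \<le> nrm A a * hnorm H (L c)" if a: "a \<in> carr A" and c: "c \<in> J" for a c
  proof -
    have "(hnorm H (L (mul A a c)))\<^sup>2 \<le> (nrm A a * hnorm H (L c))\<^sup>2"
      using positive_contraction[OF J f a c] a c by (simp add: H.hnorm_sq Lf power_mult_distrib)
    then show ?thesis
      by (rule power2_le_imp_le) (use n_nonneg[OF a] H.n_nonneg[of "L c"] c in auto)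
  qed
  have "\<exists>w\<in>carr H. (\<forall>c\<in>J. inn H w (L c) = inn H v (L (mul A (star A a) c))) \<and> hnorm H w \<le> nrm A a * hnorm H v"
    if a: "a \<in> carr A" and v: "v \<in> carr H" for a v
  proof -
    have "cmod (inn H v (L (mul A (star A a) c))) \<le> nrm A a * hnorm H v * hnorm H (L c)" if c: "c \<in> J" for c
    proof -
      have "cmod (inn H v (L (mul A (star A a) c))) \<le> hnorm H v * hnorm H (L (mul A (star A a) c))"
        using a v c by (intro H.form.cauchy_schwarz) auto
      also have "\<dots> \<le> hnorm H v * (nrm A a * hnorm H (L c))"
        using contr[of "star A a" c] a v c by (intro mult_left_mono H.n_nonneg) auto
      finally show ?thesis by (simp add: algebra_simps)
    qed
    then have "\<exists>w\<in>carr H. (\<forall>c\<in>carr (ideal_algebra A J). inn H w (L c) = inn H v (L (mul A (star A a) c))) \<and>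
        hnorm H w \<le> nrm A a * hnorm H v"
      using a v n_nonneg[OF a] H.n_nonneg[OF v]
      by (intro H.riesz_bounded[OF V L]) (auto simp: alg_simps La Ls)
    then show ?thesis by simp
  qed
  then obtain op where opc [simp]: "\<And>a v. \<lbrakk>a \<in> carr A; v \<in> carr H\<rbrakk> \<Longrightarrow> op a v \<in> carr H"
    and op: "\<And>a v c. \<lbrakk>a \<in> carr A; v \<in> carr H; c \<in> J\<rbrakk> \<Longrightarrow> inn H (op a v) (L c) = inn H v (L (mul A (star A a) c))"
    and opn: "\<And>a v. \<lbrakk>a \<in> carr A; v \<in> carr H\<rbrakk> \<Longrightarrow> hnorm H (op a v) \<le> nrm A a * hnorm H v"
    by metis
  have ext: "x = y" if "x \<in> carr H" "y \<in> carr H" "\<And>c. c \<in> J \<Longrightarrow> inn H x (L c) = inn H y (L c)" for x y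
  proof (rule H.total_ext[OF t])
    fix w assume "w \<in> L ` J"
    then obtain c where "c \<in> J" "w = L c" by auto
    then show "inn H w x = inn H w y"
      using that H.inn_commute[of x w] H.inn_commute[of y w] by simp
  qed (use that in auto)
  have opL: "op a (L c) = L (mul A a c)" if "a \<in> carr A" "c \<in> J" for a c
    by (rule ext) (use that in \<open>auto simp: op adj\<close>)
  have lin: "linear_map H H (op a)" if a: "a \<in> carr A" for a
    unfolding linear_map_def
  proof (intro conjI ballI allI)
    fix x y assume "x \<in> carr H" "y \<in> carr H"
    then show "op a (vadd H x y) = vadd H (op a x) (op a y)"
      using a by (intro ext) (auto simp: op)
  next
    fix c x assume "x \<in> carr H"
    then show "op a (smul H c x) = smul H c (op a x)"
      using a by (intro ext) (auto simp: op)
  qed (use a in auto)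
  have star: "inn H (op (star A a) x) y = inn H x (op a y)"
    if a: "a \<in> carr A" and x: "x \<in> carr H" and y: "y \<in> carr H" for a x y
  proof -
    \<comment> \<open>The adjoint relation is known against the range of \<open>L\<close>; the Riesz
      vector of \<langle>x|op a y\<rangle>, as a functional of y, extends it to all of
      \<open>H\<close>.\<close>
    have "\<exists>w\<in>carr H. (\<forall>y\<in>carr H. inn H w y = inn H x (op a y)) \<and> hnorm H w \<le> hnorm H x * nrm A a"
    proof (rule H.riesz_bounded[OF H.complex_vector_space_axioms, where L = "\<lambda>y. y"])
      show "linear_map H H (\<lambda>y. y)" by (simp add: linear_map_def)
      show "cmod (inn H x (op a y)) \<le> hnorm H x * nrm A a * hnorm H y" if y: "y \<in> carr H" for y
      proof -
        have "cmod (inn H x (op a y)) \<le> hnorm H x * hnorm H (op a y)"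
          using a x y by (intro H.form.cauchy_schwarz) auto
        also have "\<dots> \<le> hnorm H x * (nrm A a * hnorm H y)"
          using a x y by (intro mult_left_mono opn H.n_nonneg)
        finally show ?thesis by simp
      qed
    qed (use a x n_nonneg[OF a] H.n_nonneg[OF x] in \<open>auto simp: linear_map_add[OF lin] linear_map_smul[OF lin]\<close>)
    then obtain w where w: "w \<in> carr H" "\<And>y. y \<in> carr H \<Longrightarrow> inn H w y = inn H x (op a y)" by blast
    have "op (star A a) x = w"
      by (rule ext) (use a x w in \<open>auto simp: op opL\<close>)
    then show ?thesis using w y by simp
  qed
  define \<pi> where "\<pi> = \<lparr>rspace = H, rop = op\<rparr>"
  have "representation A \<pi>"
    unfolding representation_def \<pi>_def rep.select_convs
  proof (intro conjI ballI allI)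
    show "bounded_linear_map H H (op a)" if "a \<in> carr A" for a
      using lin[OF that] opn[OF that] by (auto simp: bounded_linear_map_def)
    show "op (vadd A a b) x = vadd H (op a x) (op b x)" if "a \<in> carr A" "b \<in> carr A" "x \<in> carr H" for a b x
      by (rule ext) (use that in \<open>auto simp: op alg_simps La\<close>)
    show "op (smul A c a) x = smul H c (op a x)" if "a \<in> carr A" "x \<in> carr H" for a c x
      by (rule ext) (use that in \<open>auto simp: op alg_simps Ls\<close>)
    show "op (mul A a b) x = op a (op b x)" if "a \<in> carr A" "b \<in> carr A" "x \<in> carr H" for a b x
      by (rule ext) (use that in \<open>auto simp: op star_mul mul_assoc\<close>)
    show "inn H (op (star A a) x) y = inn H x (op a y)" if "a \<in> carr A" "x \<in> carr H" "y \<in> carr H" for a x y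
      using star that .
  qed (rule H)
  then show ?thesis by (intro exI[of _ \<pi>]) (simp add: \<pi>_def opL)
qed

section \<open>States and the GNS construction\<close>

lemma state_positive: "state A \<omega> \<Longrightarrow> positive_on (carr A) \<omega>"
  by (simp add: state_def positive_on_def)

lemma state_add: "\<lbrakk>state A \<omega>; a \<in> carr A; b \<in> carr A\<rbrakk> \<Longrightarrow> \<omega> (vadd A a b) = \<omega> a + \<omega> b"
  and state_smul: "\<lbrakk>state A \<omega>; a \<in> carr A\<rbrakk> \<Longrightarrow> \<omega> (smul A c a) = c * \<omega> a"
  by (simp_all add: state_def)

lemma state_diff: "\<lbrakk>state A \<omega>; a \<in> carr A; b \<in> carr A\<rbrakk> \<Longrightarrow> \<omega> (vdiff A a b) = \<omega> a - \<omega> b"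
  by (simp add: vdiff_def state_add state_smul)

lemma state_form:
  assumes w: "state A \<omega>"
  shows "psd_form A (\<lambda>a b. \<omega> (mul A (star A a) b))"
proof unfold_locales
  note add = state_add[OF w] and sm = state_smul[OF w]
  have pos: "\<omega> (mul A (star A a) a) \<in> \<real>\<^sub>\<ge>\<^sub>0" if "a \<in> carr A" for a
    using w that by (simp add: state_def)
  fix x y assume x: "x \<in> carr A" and y: "y \<in> carr A"
  let ?p = "\<omega> (mul A (star A x) y)" and ?q = "\<omega> (mul A (star A y) x)"
  have "\<omega> (mul A (star A (vadd A x (smul A c y))) (vadd A x (smul A c y))) =
      \<omega> (mul A (star A x) x) + c * ?p + cnj c * ?q + (c * cnj c) * \<omega> (mul A (star A y) y)" for c
    using x y by (simp add: alg_simps add sm algebra_simps)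
  \<comment> \<open>Polarisation: positivity makes the expression real for every c, and c = 1 and c
    = \<i> together give hermitian symmetry.\<close>
  then have "Im (\<omega> (mul A (star A x) x) + c * ?p + cnj c * ?q + (c * cnj c) * \<omega> (mul A (star A y) y)) = 0" for c
    using pos[of "vadd A x (smul A c y)"] x y by (simp add: complex_nonneg_Reals_iff)
  from this[of 1] this[of "\<i>"] show "\<omega> (mul A (star A y) x) = cnj (\<omega> (mul A (star A x) y))"
    using pos[OF x] pos[OF y] by (simp add: complex_nonneg_Reals_iff complex_eq_iff)
qed (use w in \<open>auto simp: state_def alg_simps complex_nonneg_Reals_iff\<close>)

lemma state_bound:
  assumes w: "state A \<omega>" and a: "a \<in> carr A"
  shows "cmod (\<omega> a) \<le> nrm A a"
proof (cases "nrm A a = 0")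
  case True
  then have "a = smul A 0 a" using a n_eq_0 by simp
  then have "\<omega> a = 0" using state_smul[OF w a, of 0] by simp
  then show ?thesis using True by simp
next
  case False
  then have p: "nrm A a > 0" using n_nonneg[OF a] by simp
  let ?b = "smul A (of_real (1 / nrm A a)) a"
  have "cmod (\<omega> ?b) \<in> {cmod (\<omega> a) |a. a \<in> carr A \<and> nrm A a \<le> 1}"
    using a p by (intro CollectI exI[of _ ?b]) (simp add: n_smul norm_divide)
  then have "cmod (\<omega> ?b) \<le> Sup {cmod (\<omega> a) |a. a \<in> carr A \<and> nrm A a \<le> 1}"
    using w by (intro cSup_upper) (auto simp: state_def)
  then have "cmod (\<omega> ?b) \<le> 1" using w by (simp add: state_def)
  then show ?thesis using p by (simp add: state_smul[OF w a] norm_mult norm_divide)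
qed

lemma state_approx:
  assumes w: "state A \<omega>" and e: "\<epsilon> > 0"
  shows "\<exists>e\<in>carr A. nrm A e \<le> 1 \<and> Re (\<omega> e) > 1 - \<epsilon>"
proof -
  let ?S = "{cmod (\<omega> a) |a. a \<in> carr A \<and> nrm A a \<le> 1}"
  have "cmod (\<omega> (vzero A)) \<in> ?S" by force
  moreover have "1 - \<epsilon> < Sup ?S" using w e by (simp add: state_def)
  ultimately obtain a where a: "a \<in> carr A" "nrm A a \<le> 1" "1 - \<epsilon> < cmod (\<omega> a)"
    using less_cSupD[of ?S "1 - \<epsilon>"] by blast
  obtain c where c: "cmod c = 1" "c * \<omega> a = of_real (cmod (\<omega> a))"
  proof (cases "\<omega> a = 0")
    case False
    then show thesis
      by (intro that[of "cnj (\<omega> a) / of_real (cmod (\<omega> a))"])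
        (simp_all add: norm_divide field_simps complex_norm_square[symmetric] power2_eq_square)
  qed (use that[of 1] in simp)
  then show ?thesis
    using a by (intro bexI[of _ "smul A c a"]) (auto simp: n_smul state_smul[OF w a(1)])
qed

text \<open>Where a unital algebra would use its unit as one vector in Cauchy-Schwarz, this uses the
  adjoint of a left unit \<open>e\<close> for \<open>a\<close>; the value of the state at
  \<open>mul A e (star A e)\<close> is at most 1.\<close>

lemma state_square_bound:
  assumes w: "state A \<omega>" and a: "a \<in> carr A"
  shows "(cmod (\<omega> a))\<^sup>2 \<le> Re (\<omega> (mul A (star A a) a))"
proof -
  interpret F: psd_form A "\<lambda>a b. \<omega> (mul A (star A a) b)" by (rule state_form[OF w])
  have "cmod (\<omega> a) \<le> F.sn a + \<epsilon>" if \<epsilon>: "\<epsilon> > 0" for \<epsilon>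
  proof -
    obtain e where e: "e \<in> carr A" "nrm A e \<le> 1" "nrm A (vdiff A a (mul A e a)) < \<epsilon>"
      using left_unit[OF a \<epsilon>] by blast
    have "\<omega> a = \<omega> (mul A (star A (star A e)) a) + \<omega> (vdiff A a (mul A e a))"
      using e a by (simp add: state_diff[OF w])
    then have "cmod (\<omega> a) \<le> cmod (\<omega> (mul A (star A (star A e)) a)) + cmod (\<omega> (vdiff A a (mul A e a)))"
      using norm_triangle_ineq by metis
    moreover have "cmod (\<omega> (mul A (star A (star A e)) a)) \<le> F.sn (star A e) * F.sn a"
      using e a by (intro F.cauchy_schwarz) auto
    moreover have "F.sn (star A e) \<le> 1"
    proof -
      have "Re (\<omega> (mul A (star A (star A e)) (star A e))) \<le> nrm A (mul A e (star A e))"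
        using state_bound[OF w, of "mul A e (star A e)"] complex_Re_le_cmod[of "\<omega> (mul A e (star A e))"] e by simp
      also have "\<dots> \<le> 1" using e n_nonneg[of e] by (simp add: nrm_mul_star power_le_one)
      finally show ?thesis by (simp add: F.sn_def)
    qed
    then have "F.sn (star A e) * F.sn a \<le> F.sn a"
      using F.sn_nonneg[OF a] mult_right_mono[of "F.sn (star A e)" 1 "F.sn a"] by simp
    moreover have "cmod (\<omega> (vdiff A a (mul A e a))) \<le> \<epsilon>"
      using state_bound[OF w, of "vdiff A a (mul A e a)"] e a by simp
    ultimately show ?thesis by simp
  qed
  then have "cmod (\<omega> a) \<le> F.sn a" by (rule field_le_epsilon)
  then have "(cmod (\<omega> a))\<^sup>2 \<le> (F.sn a)\<^sup>2" by (intro power_mono) auto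
  then show ?thesis using F.sn_sq[OF a] by simp
qed

text \<open>\<open>module_rep\<close> with the whole algebra as ideal, acting on the completion of
  the GNS form, which already has the standard type.\<close>

lemma gns_exists:
  assumes w: "state A \<omega>"
  shows "\<exists>\<pi> :: 'a std_rep. gns_rep A \<omega> \<pi>"
proof -
  interpret F: psd_form A "\<lambda>a b. \<omega> (mul A (star A a) b)" by (rule state_form[OF w])
  interpret H: hilbert_space F.completion by (rule F.completion_hilbert)
  have "\<exists>\<pi>. rspace \<pi> = F.completion \<and> representation A \<pi> \<and>
      (\<forall>a\<in>carr A. \<forall>c\<in>carr A. rop \<pi> a (F.embed c) = F.embed (mul A a c))"
    using F.embed_linear F.embed_total
    by (intro module_rep[OF closed_ideal_carr F.completion_hilbert _ _ state_positive[OF w]])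
      (auto simp: F.embed_inn)
  then obtain \<pi> where p: "rspace \<pi> = F.completion" "representation A \<pi>"
    "\<And>a c. \<lbrakk>a \<in> carr A; c \<in> carr A\<rbrakk> \<Longrightarrow> rop \<pi> a (F.embed c) = F.embed (mul A a c)" by blast
  have "gns_rep A \<omega> \<pi>"
    unfolding gns_rep_def p(1)
    using p(2,3) F.embed_linear H.dense_iff_total[OF complex_vector_space_axioms F.embed_linear] F.embed_total
    by (intro conjI exI[of _ F.embed]) (auto simp: F.embed_inn)
  then show ?thesis by blast
qed

text \<open>There is no unit whose class could be the cyclic vector. Instead \<open>x\<close> is the
  Riesz vector of the functional sending \<open>L a\<close> to \<open>\<omega> a\<close>, bounded by
  \<open>state_square_bound\<close>; its norm is 1 because the norm of \<omega> is.\<close>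

lemma gns_vector:
  assumes w: "state A \<omega>" and g: "gns_rep A \<omega> \<pi>"
  shows "\<exists>x\<in>unit_vectors (rspace \<pi>). \<omega> = vecstate A \<pi> x \<and>
     hilbert_space.total (rspace \<pi>) ((\<lambda>a. rop \<pi> a x) ` carr A)"
proof -
  let ?H = "rspace \<pi>"
  have r: "representation A \<pi>" using g by (auto simp: gns_rep_def)
  interpret H: hilbert_space ?H by (rule rep_hilbert[OF r])
  obtain L where L: "linear_map A ?H L"
    and d: "norm_topology ?H (hnorm ?H) closure_of (L ` carr A) = carr ?H"
    and i: "\<And>a b. \<lbrakk>a \<in> carr A; b \<in> carr A\<rbrakk> \<Longrightarrow> inn ?H (L a) (L b) = \<omega> (mul A (star A a) b)"
    and m: "\<And>a b. \<lbrakk>a \<in> carr A; b \<in> carr A\<rbrakk> \<Longrightarrow> rop \<pi> a (L b) = L (mul A a b)"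
    using g by (auto simp: gns_rep_def)
  note [simp] = linear_map_closed[OF L] rep_closed[OF r]
  have t: "H.total (L ` carr A)" using H.dense_iff_total[OF complex_vector_space_axioms L] d by blast
  have bd: "cmod (\<omega> a) \<le> 1 * hnorm ?H (L a)" if a: "a \<in> carr A" for a
    using state_square_bound[OF w a] i[OF a a] H.hnorm_sq[of "L a"] a H.n_nonneg[of "L a"]
      power2_le_imp_le[of "cmod (\<omega> a)" "hnorm ?H (L a)"] by simp
  obtain x where x [simp]: "x \<in> carr ?H" and xL: "\<And>a. a \<in> carr A \<Longrightarrow> inn ?H x (L a) = \<omega> a" and xn: "hnorm ?H x \<le> 1"
    using H.riesz_bounded[OF complex_vector_space_axioms L state_add[OF w] state_smul[OF w] bd] by auto
  have px: "rop \<pi> a x = L a" if a: "a \<in> carr A" for a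
  proof (rule H.total_ext[OF t])
    fix v assume "v \<in> L ` carr A"
    then obtain b where b: "b \<in> carr A" "v = L b" by auto
    have "inn ?H v (rop \<pi> a x) = inn ?H (L (mul A (star A a) b)) x"
      using a b by (simp add: rep_star[OF r, symmetric] m)
    also have "\<dots> = cnj (\<omega> (mul A (star A a) b))"
      using a b H.inn_commute[of x "L (mul A (star A a) b)"] by (simp add: xL)
    also have "\<dots> = cnj (inn ?H (L a) (L b))" using a b by (simp add: i)
    finally show "inn ?H v (rop \<pi> a x) = inn ?H v (L a)" using a b H.inn_commute[of "L a" "L b"] by simp
  qed (use a in auto)
  have eq: "\<omega> = vecstate A \<pi> x"
    using w by (auto simp: vecstate_def px xL state_def extensional_def fun_eq_iff restrict_def)
  have "hnorm ?H x \<ge> 1"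
  proof -
    have "1 \<le> (hnorm ?H x)\<^sup>2 + e" if e: "e > 0" for e
    proof -
      obtain a where a: "a \<in> carr A" "nrm A a \<le> 1" "Re (\<omega> a) > 1 - e"
        using state_approx[OF w e] by blast
      have "Re (\<omega> a) \<le> hnorm ?H x * hnorm ?H (rop \<pi> a x)"
        using H.form.cauchy_schwarz[of x "rop \<pi> a x"] complex_Re_le_cmod[of "\<omega> a"] a by (simp add: xL px)
      also have "\<dots> \<le> hnorm ?H x * (1 * hnorm ?H x)"
        using rep_contraction[OF r a(1) x] a mult_right_mono[OF a(2) H.n_nonneg[OF x]]
        by (intro mult_left_mono H.n_nonneg) auto
      finally show ?thesis using a(3) by (simp add: power2_eq_square)
    qed
    then have "1 \<le> (hnorm ?H x)\<^sup>2" by (rule field_le_epsilon)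
    then show ?thesis using H.n_nonneg[OF x] power2_le_imp_le[of 1 "hnorm ?H x"] by simp
  qed
  then have "x \<in> unit_vectors ?H" using xn by (simp add: unit_vectors_def)
  moreover have "(\<lambda>a. rop \<pi> a x) ` carr A = L ` carr A" using px by auto
  ultimately show ?thesis using eq t by (intro bexI[of _ x]) auto
qed

text \<open>\<open>ap\<close> says that the representation is nondegenerate at \<open>y\<close>;
  this is what brings the norm of the functional up to 1.\<close>

lemma state_vecstate:
  assumes r: "representation A \<pi>" and y: "y \<in> unit_vectors (rspace \<pi>)"
    and ap: "\<And>e. e > 0 \<Longrightarrow> \<exists>b\<in>carr A. \<exists>z\<in>carr (rspace \<pi>). hnorm (rspace \<pi>) (vdiff (rspace \<pi>) y (rop \<pi> b z)) < e"
  shows "state A (vecstate A \<pi> y)"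
proof -
  let ?H = "rspace \<pi>" and ?w = "vecstate A \<pi> y"
  interpret H: hilbert_space ?H by (rule rep_hilbert[OF r])
  have yc [simp]: "y \<in> carr ?H" and y1: "hnorm ?H y = 1" using y by (auto simp: unit_vectors_def)
  note [simp] = rep_closed[OF r]
  have le: "cmod (?w a) \<le> 1" if a: "a \<in> carr A" "nrm A a \<le> 1" for a
  proof -
    have "cmod (?w a) \<le> hnorm ?H y * hnorm ?H (rop \<pi> a y)"
      using a H.form.cauchy_schwarz[of y "rop \<pi> a y"] by (simp add: vecstate_def)
    also have "\<dots> \<le> nrm A a" using rep_contraction[OF r a(1) yc] y1 by simp
    finally show ?thesis using a by simp
  qed
  \<comment> \<open>If \<open>y\<close> is close to \<open>rop \<pi> b z\<close> and
    \<open>e\<close> is a left unit for \<open>b\<close>, then \<open>rop \<pi> e y\<close> is close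
    to \<open>y\<close>; three errors of \<epsilon>/3 add up.\<close>
  have ge: "\<exists>e\<in>carr A. nrm A e \<le> 1 \<and> cmod (?w e) > 1 - \<epsilon>" if \<epsilon>: "\<epsilon> > 0" for \<epsilon>
  proof -
    have e3: "\<epsilon> / 3 > 0" using \<epsilon> by simp
    obtain b z where b: "b \<in> carr A" and z [simp]: "z \<in> carr ?H"
      and bz: "hnorm ?H (vdiff ?H y (rop \<pi> b z)) < \<epsilon> / 3"
      using ap[OF e3] by blast
    have zp: "hnorm ?H z + 1 > 0" using H.n_nonneg[OF z] by simp
    then have e4: "\<epsilon> / 3 / (hnorm ?H z + 1) > 0" using e3 by simp
    obtain e where e: "e \<in> carr A" "nrm A e \<le> 1" "nrm A (vdiff A b (mul A e b)) < \<epsilon> / 3 / (hnorm ?H z + 1)"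
      using left_unit[OF b e4] by blast
    have 1: "hnorm ?H (vdiff ?H (rop \<pi> b z) (rop \<pi> e (rop \<pi> b z))) \<le> \<epsilon> / 3"
    proof -
      have "vdiff ?H (rop \<pi> b z) (rop \<pi> e (rop \<pi> b z)) = rop \<pi> (vdiff A b (mul A e b)) z"
        using b e by (simp add: vdiff_def rep_add[OF r] rep_smul[OF r] rep_mul[OF r])
      then have "hnorm ?H (vdiff ?H (rop \<pi> b z) (rop \<pi> e (rop \<pi> b z))) \<le> nrm A (vdiff A b (mul A e b)) * hnorm ?H z"
        using rep_contraction[OF r _ z, of "vdiff A b (mul A e b)"] b e by simp
      also have "\<dots> \<le> \<epsilon> / 3 / (hnorm ?H z + 1) * (hnorm ?H z + 1)"
        by (rule mult_mono) (use e e4 H.n_nonneg[OF z] in auto)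
      also have "\<dots> = \<epsilon> / 3" using zp by (metis less_numeral_extra(3) nonzero_divide_eq_eq)
      finally show ?thesis .
    qed
    have 2: "hnorm ?H (vdiff ?H (rop \<pi> e (rop \<pi> b z)) (rop \<pi> e y)) \<le> hnorm ?H (vdiff ?H y (rop \<pi> b z))"
    proof -
      have "vdiff ?H (rop \<pi> e (rop \<pi> b z)) (rop \<pi> e y) = rop \<pi> e (vdiff ?H (rop \<pi> b z) y)"
        using b e by (simp add: linear_map_diff[OF H.complex_vector_space_axioms rep_linear[OF r]])
      then have "hnorm ?H (vdiff ?H (rop \<pi> e (rop \<pi> b z)) (rop \<pi> e y)) \<le> nrm A e * hnorm ?H (vdiff ?H (rop \<pi> b z) y)"
        using rep_contraction[OF r e(1), of "vdiff ?H (rop \<pi> b z) y"] b by simp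
      also have "\<dots> \<le> 1 * hnorm ?H (vdiff ?H (rop \<pi> b z) y)"
        using e b by (intro mult_right_mono H.n_nonneg) auto
      finally show ?thesis using H.n_diff_commute[of y "rop \<pi> b z"] b by simp
    qed
    have "hnorm ?H (vdiff ?H y (rop \<pi> e y)) < \<epsilon>"
      using H.n_diff_triangle[of y "rop \<pi> b z" "rop \<pi> e y"]
        H.n_diff_triangle[of "rop \<pi> b z" "rop \<pi> e (rop \<pi> b z)" "rop \<pi> e y"] 1 2 bz b e by simp
    moreover have "cmod (1 - ?w e) \<le> hnorm ?H (vdiff ?H y (rop \<pi> e y))"
      using H.form.cauchy_schwarz[of y "vdiff ?H y (rop \<pi> e y)"] H.form.s_self[OF yc] y1 e
      by (simp add: vecstate_def)
    ultimately have "cmod (1 - ?w e) < \<epsilon>" by simp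
    then have "cmod (?w e) > 1 - \<epsilon>"
      using norm_triangle_ineq2[of 1 "?w e"] by simp
    then show ?thesis using e by blast
  qed
  let ?S = "{cmod (?w a) |a. a \<in> carr A \<and> nrm A a \<le> 1}"
  have bdd: "bdd_above ?S" using le by (auto simp: bdd_above_def)
  have "Sup ?S = 1"
  proof (rule antisym)
    have "cmod (?w (vzero A)) \<in> ?S" by force
    then show "Sup ?S \<le> 1" using le by (intro cSup_least) auto
    show "1 \<le> Sup ?S"
    proof (rule field_le_epsilon)
      fix \<epsilon> :: real assume "\<epsilon> > 0"
      then obtain e where e: "e \<in> carr A" "nrm A e \<le> 1" "cmod (?w e) > 1 - \<epsilon>" using ge by blast
      then have "cmod (?w e) \<le> Sup ?S" using bdd by (intro cSup_upper) auto
      then show "1 \<le> Sup ?S + \<epsilon>" using e by simp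
    qed
  qed
  moreover have "?w (mul A (star A a) a) \<in> \<real>\<^sub>\<ge>\<^sub>0" if "a \<in> carr A" for a
    using rep_positive[OF r yc] that by (simp add: positive_on_def vecstate_def)
  ultimately show ?thesis
    unfolding state_def using bdd
    by (auto simp: vecstate_def rep_add[OF r] rep_smul[OF r])
qed

lemma state_vecstate_irr:
  assumes irr: "irreducible_rep A \<pi>" and y: "y \<in> unit_vectors (rspace \<pi>)"
  shows "state A (vecstate A \<pi> y)"
proof (rule state_vecstate[OF irr_rep[OF irr] y])
  interpret H: hilbert_space "rspace \<pi>" by (rule rep_hilbert[OF irr_rep[OF irr]])
  have yc: "y \<in> carr (rspace \<pi>)" "y \<noteq> vzero (rspace \<pi>)" using y by (auto simp: unit_vectors_def)
  fix e :: real assume "e > 0"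
  then show "\<exists>b\<in>carr A. \<exists>z\<in>carr (rspace \<pi>). hnorm (rspace \<pi>) (vdiff (rspace \<pi>) y (rop \<pi> b z)) < e"
    using H.total_approx[OF complex_vector_space_axioms rep_vec_linear[OF irr_rep[OF irr] yc(1)]
        rep_cyclic[OF irr yc] yc(1)] yc(1) by blast
qed

end

section \<open>Pure states and irreducible representations\<close>

lemma (in hilbert_space) pythagoras:
  "\<lbrakk>u \<in> carr H; v \<in> carr H; inn H u v = 0\<rbrakk> \<Longrightarrow> (hnorm H (vadd H u v))\<^sup>2 = (hnorm H u)\<^sup>2 + (hnorm H v)\<^sup>2"
  using inn_commute[of u v] by (simp add: hnorm_sq)

context cstar_algebra
begin

lemma pure_state: "\<omega> \<in> pure_states A \<Longrightarrow> state A \<omega>"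
  by (simp add: pure_states_def)

lemma state_nonzero:
  assumes w: "state A \<omega>"
  shows "\<exists>a\<in>carr A. \<omega> a \<noteq> 0"
  using state_approx[OF w, of 1] by force

text \<open>A closed invariant subspace splits the cyclic vector as x = p + q' and the state as a
  convex combination of vector states. If both parts are nonzero, purity forces p = tx, which is
  incompatible with p being orthogonal to q'.\<close>

lemma gns_pure_irreducible:
  assumes pure: "\<omega> \<in> pure_states A" and g: "gns_rep A \<omega> \<pi>"
  shows "irreducible_rep A \<pi>"
proof -
  let ?H = "rspace \<pi>"
  note w = pure_state[OF pure]
  have r: "representation A \<pi>" using g by (auto simp: gns_rep_def)
  interpret H: hilbert_space ?H by (rule rep_hilbert[OF r])
  obtain x where xu: "x \<in> unit_vectors ?H" and wx: "\<omega> = vecstate A \<pi> x"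
    and t: "H.total ((\<lambda>a. rop \<pi> a x) ` carr A)"
    using gns_vector[OF w g] by blast
  have x [simp]: "x \<in> carr ?H" and x1: "hnorm ?H x = 1" using xu by (auto simp: unit_vectors_def)
  note [simp] = rep_closed[OF r]
  have wa: "\<omega> a = inn ?H x (rop \<pi> a x)" if "a \<in> carr A" for a
    using that by (simp add: wx vecstate_def)
  have sub: "(\<lambda>a. rop \<pi> a x) ` carr A \<subseteq> carr ?H" by auto
  have "nonzero_on (carr A) \<pi>"
  proof -
    obtain a where a: "a \<in> carr A" "\<omega> a \<noteq> 0" using state_nonzero[OF w] by blast
    then have "rop \<pi> a x \<noteq> vzero ?H" by (auto simp: wa)
    then show ?thesis using a(1) x unfolding nonzero_on_def by blast
  qed
  moreover have "W = {vzero ?H} \<or> W = carr ?H"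
    if W: "subspace_of ?H W" "closedin (norm_topology ?H (hnorm ?H)) W"
      and inv: "\<forall>a\<in>carr A. rop \<pi> a ` W \<subseteq> W" for W
  proof -
    have Wc: "w \<in> carr ?H" if "w \<in> W" for w using W(1) that by (auto simp: subspace_of_def)
    have Winv: "rop \<pi> a w \<in> W" if "a \<in> carr A" "w \<in> W" for a w using inv that by blast
    have Pinv: "rop \<pi> a v \<in> perp ?H W" if a: "a \<in> carr A" and v: "v \<in> perp ?H W" for a v
    proof -
      have vc: "v \<in> carr ?H" using v by (simp add: perp_def)
      have "inn ?H w (rop \<pi> a v) = 0" if wW: "w \<in> W" for w
        using rep_star[OF r a Wc[OF wW] vc] Winv[OF star_closed[OF a] wW] v by (simp add: perp_def)
      then show ?thesis using a vc by (simp add: perp_def)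
    qed
    obtain p where p: "p \<in> W" and q: "vdiff ?H x p \<in> perp ?H W"
      using H.projection[OF W x] by blast
    define q' where "q' = vdiff ?H x p"
    have pc [simp]: "p \<in> carr ?H" using Wc[OF p] .
    have qc [simp]: "q' \<in> carr ?H" by (simp add: q'_def)
    have qp: "q' \<in> perp ?H W" using q by (simp add: q'_def)
    have xpq: "x = vadd ?H p q'" using H.add_commute[of p q'] by (simp add: q'_def)
    have orth: "inn ?H w v = 0" "inn ?H v w = 0" if "w \<in> W" "v \<in> perp ?H W" for v w
      using that Wc[OF that(1)] H.inn_commute[of w v] by (auto simp: perp_def)
    have cross: "inn ?H p (rop \<pi> a q') = 0" "inn ?H q' (rop \<pi> a p) = 0" if "a \<in> carr A" for a
      using orth(1)[OF p Pinv[OF that qp]] orth(2)[OF Winv[OF that p] qp] .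
    have pa: "rop \<pi> a x = vadd ?H (rop \<pi> a p) (rop \<pi> a q')" if "a \<in> carr A" for a
      using that by (subst xpq) (simp add: rep_vec_add[OF r])
    have dec: "\<omega> a = inn ?H p (rop \<pi> a p) + inn ?H q' (rop \<pi> a q')" if a: "a \<in> carr A" for a
    proof -
      have "\<omega> a = inn ?H (vadd ?H p q') (vadd ?H (rop \<pi> a p) (rop \<pi> a q'))"
        using wa[OF a] pa[OF a] xpq by simp
      then show ?thesis using a cross[OF a] by simp
    qed
    have "(hnorm ?H x)\<^sup>2 = Re (inn ?H (vadd ?H p q') (vadd ?H p q'))" using xpq by (simp add: H.hnorm_sq)
    then have norms: "(hnorm ?H p)\<^sup>2 + (hnorm ?H q')\<^sup>2 = 1"
      using orth[OF p qp] x1 by (simp add: H.hnorm_sq)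
    consider "hnorm ?H p = 0" | "hnorm ?H q' = 0" | "hnorm ?H p > 0" "hnorm ?H q' > 0"
      using H.n_nonneg[OF pc] H.n_nonneg[OF qc] by linarith
    then show ?thesis
    proof cases
      case 1
      then have "p = vzero ?H" using H.n_eq_0 by simp
      then have xp: "x \<in> perp ?H W" using q by simp
      have "w = vzero ?H" if wW: "w \<in> W" for w
        using t Wc[OF wW] by (intro H.total_ext[OF t sub]) (auto simp: orth(2)[OF wW Pinv[OF _ xp]])
      then show ?thesis using W(1) by (auto simp: subspace_of_def)
    next
      case 2
      then have "q' = vzero ?H" using H.n_eq_0 by simp
      then have xW: "x \<in> W" using xpq p by simp
      have "z \<in> W" if z: "z \<in> carr ?H" for z
      proof -
        obtain w where wW: "w \<in> W" and rp: "vdiff ?H z w \<in> perp ?H W"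
          using H.projection[OF W z] by blast
        have "vdiff ?H z w = vzero ?H"
          using z Wc[OF wW] orth(1)[OF Winv[OF _ xW] rp]
          by (intro H.total_ext[OF t sub]) (auto simp del: H.inn_simps)
        then show ?thesis using z wW Wc[OF wW] by (simp add: H.diff_eq_zero)
      qed
      then show ?thesis using Wc by blast
    next
      case 3
      have comp_state: "state A (vecstate A \<pi> (smul ?H (of_real (1 / hnorm ?H v)) v))"
        if v: "v \<in> carr ?H" "hnorm ?H v > 0"
          and ap: "\<And>e. e > 0 \<Longrightarrow> \<exists>b\<in>carr A. hnorm ?H (vdiff ?H v (rop \<pi> b v)) < e" for v
      proof (rule state_vecstate[OF r])
        show "smul ?H (of_real (1 / hnorm ?H v)) v \<in> unit_vectors ?H"
          using v by (simp add: unit_vectors_def H.n_smul norm_divide)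
        fix e :: real assume "e > 0"
        then obtain b where b: "b \<in> carr A" "hnorm ?H (vdiff ?H v (rop \<pi> b v)) < e * hnorm ?H v"
          using ap[of "e * hnorm ?H v"] v by auto
        let ?y = "smul ?H (of_real (1 / hnorm ?H v)) v"
        have "vdiff ?H ?y (rop \<pi> b ?y) = smul ?H (of_real (1 / hnorm ?H v)) (vdiff ?H v (rop \<pi> b v))"
          using v b by (simp add: rep_vec_smul[OF r] H.smul_diff)
        then have "hnorm ?H (vdiff ?H ?y (rop \<pi> b ?y)) < e"
          using v b by (simp add: H.n_smul norm_divide field_simps)
        moreover have "?y \<in> carr ?H" using v by simp
        ultimately show "\<exists>b\<in>carr A. \<exists>z\<in>carr ?H. hnorm ?H (vdiff ?H ?y (rop \<pi> b z)) < e"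
          using b(1) by blast
      qed
      \<comment> \<open>\<open>state_vecstate\<close> requires that \<open>p\<close> and
        \<open>q'\<close> be approximated by their own orbits. The two errors are orthogonal, so by
        Pythagoras a single \<open>b\<close> that works for \<open>x\<close> works for both.\<close>
      have split: "\<exists>b\<in>carr A. hnorm ?H (vdiff ?H p (rop \<pi> b p)) < e \<and> hnorm ?H (vdiff ?H q' (rop \<pi> b q')) < e"
        if e: "e > 0" for e
      proof -
        obtain b where b: "b \<in> carr A" "hnorm ?H (vdiff ?H x (rop \<pi> b x)) < e"
          using H.total_approx[OF complex_vector_space_axioms rep_vec_linear[OF r x] t x e] by blast
        let ?u = "vdiff ?H p (rop \<pi> b p)" and ?v = "vdiff ?H q' (rop \<pi> b q')"
        have "vdiff ?H x (rop \<pi> b x) = vadd ?H ?u ?v"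
          unfolding pa[OF b(1)] using b(1) by (subst xpq) (simp add: H.diff_add_add)
        moreover have "inn ?H ?u ?v = 0"
          using b(1) orth[OF p qp] orth[OF p Pinv[OF b(1) qp]] orth[OF Winv[OF b(1) p] qp]
            orth[OF Winv[OF b(1) p] Pinv[OF b(1) qp]] by simp
        ultimately have "(hnorm ?H (vdiff ?H x (rop \<pi> b x)))\<^sup>2 = (hnorm ?H ?u)\<^sup>2 + (hnorm ?H ?v)\<^sup>2"
          using b(1) H.pythagoras[of ?u ?v] by simp
        then have "(hnorm ?H ?u)\<^sup>2 \<le> (hnorm ?H (vdiff ?H x (rop \<pi> b x)))\<^sup>2"
          "(hnorm ?H ?v)\<^sup>2 \<le> (hnorm ?H (vdiff ?H x (rop \<pi> b x)))\<^sup>2" by simp_all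
        then have "hnorm ?H ?u \<le> hnorm ?H (vdiff ?H x (rop \<pi> b x))"
          "hnorm ?H ?v \<le> hnorm ?H (vdiff ?H x (rop \<pi> b x))"
          using b(1) H.n_nonneg[of "vdiff ?H x (rop \<pi> b x)"] by (auto dest: power2_le_imp_le)
        then show ?thesis using b by (intro bexI[of _ b]) auto
      qed
      let ?t = "(hnorm ?H p)\<^sup>2"
      let ?y = "\<lambda>v. smul ?H (of_real (1 / hnorm ?H v)) v"
      have scale: "inn ?H v (rop \<pi> a v) = of_real ((hnorm ?H v)\<^sup>2) * vecstate A \<pi> (?y v) a"
        if "v \<in> carr ?H" "hnorm ?H v > 0" "a \<in> carr A" for v a
        using that by (simp add: vecstate_def rep_vec_smul[OF r] power2_eq_square)
      have s1: "state A (vecstate A \<pi> (?y p))" by (rule comp_state[OF pc 3(1)]) (use split in blast)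
      have s2: "state A (vecstate A \<pi> (?y q'))" by (rule comp_state[OF qc 3(2)]) (use split in blast)
      have t01: "0 < ?t" "?t < 1" using norms 3 by (simp_all add: power2_eq_square) (smt (verit) mult_pos_pos)
      have q1: "(hnorm ?H q')\<^sup>2 = 1 - ?t" using norms by simp
      have "\<forall>a\<in>carr A. \<omega> a = of_real ?t * vecstate A \<pi> (?y p) a + of_real (1 - ?t) * vecstate A \<pi> (?y q') a"
      proof
        fix a assume a: "a \<in> carr A"
        show "\<omega> a = of_real ?t * vecstate A \<pi> (?y p) a + of_real (1 - ?t) * vecstate A \<pi> (?y q') a"
          unfolding q1[symmetric] scale[OF pc 3(1) a, symmetric] scale[OF qc 3(2) a, symmetric] by (rule dec[OF a])
      qed
      then have eq: "vecstate A \<pi> (?y p) = \<omega>"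
        using pure s1 s2 t01 unfolding pure_states_def by blast
      \<comment> \<open>Purity identifies \<langle>p|\<pi>(a)p\<rangle> with t\<omega>(a), and
        \<pi>(a)q' is orthogonal to p; so p and tx have equal products with the orbit of x.\<close>
      have "p = smul ?H (of_real ?t) x"
      proof (rule H.total_ext[OF t sub])
        fix v assume "v \<in> (\<lambda>a. rop \<pi> a x) ` carr A"
        then obtain a where a: "a \<in> carr A" "v = rop \<pi> a x" by auto
        have "inn ?H p v = inn ?H p (rop \<pi> a p)" using a cross[OF a(1)] by (simp add: pa)
        also have "\<dots> = of_real ?t * \<omega> a" using scale[OF pc 3(1) a(1)] eq by simp
        also have "\<dots> = of_real ?t * inn ?H x v" using a by (simp add: wa)
        finally show "inn ?H v p = inn ?H v (smul ?H (of_real ?t) x)"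
          using a H.inn_commute[of p v] H.inn_commute[of x v] by simp
      qed auto
      then have "inn ?H p q' = of_real ?t * inn ?H x q'"
        by (metis H.form.s_smul_left complex_cnj_complex_of_real qc x)
      moreover have "inn ?H x q' = inn ?H p q' + inn ?H q' q'"
        by (subst xpq) simp
      ultimately have "of_real ?t * inn ?H q' q' = 0" using orth[OF p qp] by simp
      then have "inn ?H q' q' = 0" using 3 by simp
      then show ?thesis using 3 H.hnorm_sq[OF qc] by simp
    qed
  qed
  ultimately show ?thesis using r unfolding irreducible_rep_def by blast
qed

text \<open>A Radon-Nikodym argument: t\<phi> is dominated by the vector state, so
  \<open>\<phi> (mul A (star A a) b)\<close> equals \<langle>S\<pi>(a)x|\<pi>(b)x\<rangle> for a
  bounded self-adjoint \<open>S\<close> that commutes with the representation, and \<open>S\<close>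
  is a scalar by \<open>schur\<close>.\<close>

lemma dominated_by_vecstate:
  assumes irr: "irreducible_rep A \<pi>" and x: "x \<in> unit_vectors (rspace \<pi>)"
    and p: "state A \<phi>" and q: "state A \<psi>" and t: "0 < t" "t < (1::real)"
    and eq: "\<And>a. a \<in> carr A \<Longrightarrow> vecstate A \<pi> x a = of_real t * \<phi> a + of_real (1 - t) * \<psi> a"
  shows "\<phi> = vecstate A \<pi> x"
proof -
  let ?H = "rspace \<pi>" and ?w = "vecstate A \<pi> x"
  note r = irr_rep[OF irr]
  interpret H: hilbert_space ?H by (rule rep_hilbert[OF r])
  interpret F: psd_form A "\<lambda>a b. \<phi> (mul A (star A a) b)" by (rule state_form[OF p])
  have xc [simp]: "x \<in> carr ?H" and xn: "x \<noteq> vzero ?H" using x by (auto simp: unit_vectors_def)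
  note [simp] = rep_closed[OF r]
  note T = rep_cyclic[OF irr xc xn]
  have w: "state A ?w" by (rule state_vecstate_irr[OF irr x])
  define L where "L a = rop \<pi> a x" for a
  have L: "linear_map A ?H L" unfolding L_def[abs_def] by (rule rep_vec_linear[OF r xc])
  have Tt: "H.total (L ` carr A)" using T by (simp add: L_def[abs_def])
  note Lc [simp] = linear_map_closed[OF L]
  have wL: "?w (mul A (star A a) b) = inn ?H (L a) (L b)" if "a \<in> carr A" "b \<in> carr A" for a b
    using that by (simp add: vecstate_def L_def rep_mul[OF r] rep_adjoint[OF r])
  have ext: "y = z" if "y \<in> carr ?H" "z \<in> carr ?H" "\<And>c. c \<in> carr A \<Longrightarrow> inn ?H y (L c) = inn ?H z (L c)" for y z
  proof (rule H.total_ext[OF Tt])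
    fix v assume "v \<in> L ` carr A"
    then obtain c where "c \<in> carr A" "v = L c" by auto
    then show "inn ?H v y = inn ?H v z"
      using that H.inn_commute[of y v] H.inn_commute[of z v] by simp
  qed (use that in auto)
  \<comment> \<open>Domination bounds the seminorm of \<phi> by t^(-1/2) times the norm of
    \<open>L a\<close>.\<close>
  define k where "k = 1 / sqrt t"
  have k: "k > 0" "k * k = 1 / t" using t by (simp_all add: k_def)
  have sn: "F.sn a \<le> k * hnorm ?H (L a)" if a: "a \<in> carr A" for a
  proof -
    have "Re (\<psi> (mul A (star A a) a)) \<ge> 0"
      using q a by (simp add: state_def complex_nonneg_Reals_iff)
    moreover have "Re (?w (mul A (star A a) a)) = t * Re (\<phi> (mul A (star A a) a)) + (1 - t) * Re (\<psi> (mul A (star A a) a))"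
      using eq[of "mul A (star A a) a"] a by simp
    ultimately have "t * Re (\<phi> (mul A (star A a) a)) \<le> (hnorm ?H (L a))\<^sup>2"
      using t a by (simp add: wL H.hnorm_sq)
    then have "(F.sn a)\<^sup>2 \<le> (hnorm ?H (L a))\<^sup>2 / t"
      using t a by (simp add: F.sn_sq field_simps)
    also have "\<dots> = (k * hnorm ?H (L a))\<^sup>2"
      using k by (simp add: power2_eq_square mult_ac) (simp add: mult.assoc[symmetric])
    finally show ?thesis
      by (rule power2_le_imp_le) (use k a H.n_nonneg[of "L a"] in auto)
  qed
  \<comment> \<open>\<open>\<tau> a\<close> will be the value of \<open>S\<close> at
    \<open>L a\<close>. The operator \<open>S\<close> itself is obtained on all of \<open>H\<close>
    as a weak adjoint of \<open>\<tau>\<close>, so its well-definedness on the range of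
    \<open>L\<close> is not an issue.\<close>
  have "\<exists>z\<in>carr ?H. (\<forall>b\<in>carr A. inn ?H z (L b) = \<phi> (mul A (star A a) b)) \<and> hnorm ?H z \<le> k * k * hnorm ?H (L a)"
    if a: "a \<in> carr A" for a
  proof (rule H.riesz_bounded[OF complex_vector_space_axioms L])
    fix b assume b: "b \<in> carr A"
    have "cmod (\<phi> (mul A (star A a) b)) \<le> F.sn a * F.sn b" by (rule F.cauchy_schwarz[OF a b])
    also have "\<dots> \<le> (k * hnorm ?H (L a)) * (k * hnorm ?H (L b))"
      by (rule mult_mono) (use sn a b k F.sn_nonneg H.n_nonneg in auto)
    finally show "cmod (\<phi> (mul A (star A a) b)) \<le> k * k * hnorm ?H (L a) * hnorm ?H (L b)"
      by (simp add: mult_ac)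
  qed (use a k t H.n_nonneg[of "L a"] in \<open>auto simp: F.s_add_right F.s_smul_right\<close>)
  then obtain \<tau> where tc [simp]: "\<And>a. a \<in> carr A \<Longrightarrow> \<tau> a \<in> carr ?H"
    and tL: "\<And>a b. \<lbrakk>a \<in> carr A; b \<in> carr A\<rbrakk> \<Longrightarrow> inn ?H (\<tau> a) (L b) = \<phi> (mul A (star A a) b)"
    and tn: "\<And>a. a \<in> carr A \<Longrightarrow> hnorm ?H (\<tau> a) \<le> k * k * hnorm ?H (L a)"
    by metis
  have ta: "\<tau> (vadd A a b) = vadd ?H (\<tau> a) (\<tau> b)" if "a \<in> carr A" "b \<in> carr A" for a b
    by (rule ext) (use that in \<open>auto simp: tL F.s_add_left\<close>)
  have ts: "\<tau> (smul A c a) = smul ?H c (\<tau> a)" if "a \<in> carr A" for a c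
    by (rule ext) (use that in \<open>auto simp: tL F.s_smul_left\<close>)
  have tm: "\<tau> (mul A c b) = rop \<pi> c (\<tau> b)" if "b \<in> carr A" "c \<in> carr A" for b c
    by (rule ext) (use that in \<open>auto simp: tL rep_adjoint[OF r] L_def rep_mul[OF r, symmetric] star_mul mul_assoc tL[unfolded L_def]\<close>)
  have "\<exists>z\<in>carr ?H. (\<forall>b\<in>carr A. inn ?H z (L b) = inn ?H v (\<tau> b)) \<and> hnorm ?H z \<le> k * k * hnorm ?H v"
    if v: "v \<in> carr ?H" for v
  proof (rule H.riesz_bounded[OF complex_vector_space_axioms L])
    fix b assume b: "b \<in> carr A"
    have "cmod (inn ?H v (\<tau> b)) \<le> hnorm ?H v * hnorm ?H (\<tau> b)" using v b by (intro H.form.cauchy_schwarz) auto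
    also have "\<dots> \<le> hnorm ?H v * (k * k * hnorm ?H (L b))"
      using v b tn by (intro mult_left_mono H.n_nonneg) auto
    finally show "cmod (inn ?H v (\<tau> b)) \<le> k * k * hnorm ?H v * hnorm ?H (L b)" by (simp add: mult_ac)
  qed (use v k t H.n_nonneg[of v] in \<open>auto simp: ta ts\<close>)
  then obtain S where Sc [simp]: "\<And>v. v \<in> carr ?H \<Longrightarrow> S v \<in> carr ?H"
    and SL: "\<And>v b. \<lbrakk>v \<in> carr ?H; b \<in> carr A\<rbrakk> \<Longrightarrow> inn ?H (S v) (L b) = inn ?H v (\<tau> b)"
    and Sn: "\<And>v. v \<in> carr ?H \<Longrightarrow> hnorm ?H (S v) \<le> k * k * hnorm ?H v"
    by metis
  have ST: "S (L a) = \<tau> a" if a: "a \<in> carr A" for a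
  proof (rule ext)
    fix c assume c: "c \<in> carr A"
    have "inn ?H (S (L a)) (L c) = cnj (inn ?H (\<tau> c) (L a))"
      using a c H.inn_commute[of "\<tau> c" "L a"] by (simp add: SL)
    also have "\<dots> = inn ?H (\<tau> a) (L c)"
      using a c F.s_commute[of c a] by (simp add: tL)
    finally show "inn ?H (S (L a)) (L c) = inn ?H (\<tau> a) (L c)" .
  qed (use a in auto)
  have Slin: "linear_map ?H ?H S"
    unfolding linear_map_def
  proof (intro conjI ballI allI)
    fix y z assume "y \<in> carr ?H" "z \<in> carr ?H"
    then show "S (vadd ?H y z) = vadd ?H (S y) (S z)" by (intro ext) (auto simp: SL)
  next
    fix c y assume "y \<in> carr ?H"
    then show "S (smul ?H c y) = smul ?H c (S y)" by (intro ext) (auto simp: SL)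
  qed auto
  have Ssym: "inn ?H (S v) y = inn ?H v (S y)" if v: "v \<in> carr ?H" and y: "y \<in> carr ?H" for v y
  proof -
    have "\<exists>z\<in>carr ?H. (\<forall>y\<in>carr ?H. inn ?H z y = inn ?H v (S y)) \<and> hnorm ?H z \<le> k * k * hnorm ?H v"
    proof (rule H.riesz_bounded[OF H.complex_vector_space_axioms, where L = "\<lambda>y. y"])
      show "linear_map ?H ?H (\<lambda>y. y)" by (simp add: linear_map_def)
      fix y assume y: "y \<in> carr ?H"
      have "cmod (inn ?H v (S y)) \<le> hnorm ?H v * hnorm ?H (S y)"
        using v y by (intro H.form.cauchy_schwarz) auto
      also have "\<dots> \<le> hnorm ?H v * (k * k * hnorm ?H y)"
        using v y by (intro mult_left_mono Sn H.n_nonneg)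
      finally show "cmod (inn ?H v (S y)) \<le> k * k * hnorm ?H v * hnorm ?H y" by (simp add: mult_ac)
    qed (use v k t H.n_nonneg[of v] in \<open>auto simp: linear_map_add[OF Slin] linear_map_smul[OF Slin]\<close>)
    then obtain z where z: "z \<in> carr ?H" "\<And>y. y \<in> carr ?H \<Longrightarrow> inn ?H z y = inn ?H v (S y)" by blast
    have "S v = z" by (rule ext) (use v z in \<open>auto simp: SL ST\<close>)
    then show ?thesis using z y by simp
  qed
  have com: "rop \<pi> c (S v) = S (rop \<pi> c v)" if "c \<in> carr A" "v \<in> carr ?H" for c v
  proof (rule ext)
    fix b assume b: "b \<in> carr A"
    have "inn ?H (rop \<pi> c (S v)) (L b) = inn ?H (S v) (L (mul A (star A c) b))"
      using that b by (simp add: rep_adjoint[OF r] L_def rep_mul[OF r])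
    also have "\<dots> = inn ?H v (rop \<pi> (star A c) (\<tau> b))"
      using that b by (simp add: SL tm)
    also have "\<dots> = inn ?H (rop \<pi> c v) (\<tau> b)"
      using that b by (simp add: rep_adjoint[OF r])
    finally show "inn ?H (rop \<pi> c (S v)) (L b) = inn ?H (S (rop \<pi> c v)) (L b)"
      using that b by (simp add: SL)
  qed (use that in auto)
  have "\<exists>l::real. \<forall>v\<in>carr ?H. S v = smul ?H l v"
  proof (rule H.schur[where D = "rop \<pi> ` carr A", OF _ _ Slin Sn Ssym])
    fix W assume W: "subspace_of ?H W" "closedin (norm_topology ?H (hnorm ?H)) W"
      "\<And>d. d \<in> rop \<pi> ` carr A \<Longrightarrow> d ` W \<subseteq> W"
    show "W = {vzero ?H} \<or> W = carr ?H"
      by (rule irr_dichotomy[OF irr W(1,2)]) (rule W(3), simp)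
  qed (use rep_bounded[OF r] com in auto)
  then obtain l :: real where l: "\<And>v. v \<in> carr ?H \<Longrightarrow> S v = smul ?H l v" by blast
  have scal: "\<phi> (mul A (star A a) b) = of_real l * ?w (mul A (star A a) b)" if "a \<in> carr A" "b \<in> carr A" for a b
  proof -
    have "\<phi> (mul A (star A a) b) = inn ?H (S (L a)) (L b)" using that by (simp add: tL ST)
    then show ?thesis using that l[of "L a"] by (simp add: wL)
  qed
  \<comment> \<open>So far only products of the form \<open>mul A (star A a) b\<close> are covered;
    a left unit approximates every element by such products.\<close>
  have all: "\<phi> a = of_real l * ?w a" if a: "a \<in> carr A" for a
  proof -
    have small: "cmod (\<phi> a - of_real l * ?w a) \<le> e" if e: "e > 0" for e
    proof -
      have e': "e / (1 + \<bar>l\<bar>) > 0" using e by (simp add: add_pos_nonneg)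
      obtain u where u: "u \<in> carr A" "nrm A (vdiff A a (mul A u a)) < e / (1 + \<bar>l\<bar>)"
        using left_unit[OF a e'] by blast
      let ?d = "vdiff A a (mul A u a)"
      have "\<phi> (mul A u a) = of_real l * ?w (mul A u a)" using scal[of "star A u" a] u a by simp
      then have "\<phi> a - of_real l * ?w a = \<phi> ?d - of_real l * ?w ?d"
        using u a by (simp add: state_diff[OF p] state_diff[OF w] algebra_simps)
      also have "cmod \<dots> \<le> cmod (\<phi> ?d) + cmod (of_real l * ?w ?d)" by (rule norm_triangle_ineq4)
      also have "\<dots> \<le> nrm A ?d + \<bar>l\<bar> * nrm A ?d"
        using state_bound[OF p, of ?d] state_bound[OF w, of ?d] u a
        by (intro add_mono) (auto simp: norm_mult intro: mult_left_mono)
      also have "\<dots> = (1 + \<bar>l\<bar>) * nrm A ?d" by (simp add: algebra_simps)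
      also have "\<dots> \<le> (1 + \<bar>l\<bar>) * (e / (1 + \<bar>l\<bar>))" using u by (intro mult_left_mono) auto
      also have "\<dots> = e" by simp
      finally show ?thesis .
    qed
    have "cmod (\<phi> a - of_real l * ?w a) \<le> 0"
      by (rule field_le_epsilon) (unfold add_0, rule small)
    then show ?thesis by simp
  qed
  \<comment> \<open>Both functionals have norm 1, which gives |l| = 1; positivity at one element
    where the vector state is positive fixes the sign.\<close>
  have "l = 1"
  proof -
    have ge: "1 - e \<le> \<bar>l\<bar>" if e: "e > 0" for e
    proof -
      obtain u where u: "u \<in> carr A" "nrm A u \<le> 1" "Re (\<phi> u) > 1 - e" using state_approx[OF p e] by blast
      have "Re (\<phi> u) \<le> \<bar>l\<bar> * cmod (?w u)" using complex_Re_le_cmod[of "\<phi> u"] all[OF u(1)] by (simp add: norm_mult)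
      also have "\<dots> \<le> \<bar>l\<bar> * 1" using state_bound[OF w u(1)] u(2) by (intro mult_left_mono) auto
      finally show ?thesis using u by simp
    qed
    have ge1: "1 \<le> \<bar>l\<bar>" by (rule field_le_epsilon) (use ge in \<open>smt (verit)\<close>)
    have mid: "\<bar>l\<bar> * (1 - e) \<le> 1" if e: "e > 0" for e
    proof -
      obtain u where u: "u \<in> carr A" "nrm A u \<le> 1" "Re (?w u) > 1 - e" using state_approx[OF w e] by blast
      have "\<bar>l\<bar> * (1 - e) \<le> \<bar>l\<bar> * cmod (?w u)"
        using u complex_Re_le_cmod[of "?w u"] by (intro mult_left_mono) auto
      also have "\<dots> = cmod (\<phi> u)" using all[OF u(1)] by (simp add: norm_mult)
      also have "\<dots> \<le> 1" using state_bound[OF p u(1)] u(2) by simp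
      finally show ?thesis .
    qed
    have le: "\<bar>l\<bar> \<le> 1"
    proof (rule ccontr)
      assume "\<not> \<bar>l\<bar> \<le> 1"
      \<comment> \<open>With e = (|l| - 1) / (2|l|) the bound \<open>mid\<close> reads (|l| + 1) / 2
        \<le> 1, contrary to |l| > 1.\<close>
      then have "\<bar>l\<bar> * (1 - (\<bar>l\<bar> - 1) / (2 * \<bar>l\<bar>)) \<le> 1"
        by (intro mid) simp
      moreover have "\<bar>l\<bar> * (1 - (\<bar>l\<bar> - 1) / (2 * \<bar>l\<bar>)) = (\<bar>l\<bar> + 1) / 2"
        using \<open>\<not> \<bar>l\<bar> \<le> 1\<close> by (simp add: field_simps)
      ultimately show False using \<open>\<not> \<bar>l\<bar> \<le> 1\<close> by simp
    qed
    have "l \<ge> 0"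
    proof -
      obtain a where a: "a \<in> carr A" "?w a \<noteq> 0" using state_nonzero[OF w] by blast
      have "0 < (cmod (?w a))\<^sup>2" using a by simp
      also have "\<dots> \<le> Re (?w (mul A (star A a) a))" by (rule state_square_bound[OF w a(1)])
      finally have pos: "0 < Re (?w (mul A (star A a) a))" .
      have "0 \<le> Re (\<phi> (mul A (star A a) a))" using F.s_nonneg[OF a(1)] .
      also have "\<dots> = l * Re (?w (mul A (star A a) a))" using all[of "mul A (star A a) a"] a by simp
      finally show ?thesis using pos by (simp add: zero_le_mult_iff)
    qed
    then show ?thesis using le ge1 by linarith
  qed
  moreover have "\<phi> \<in> extensional (carr A)" using p by (simp add: state_def)
  ultimately show ?thesis
    using all by (auto simp: fun_eq_iff vecstate_def extensional_def restrict_def)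
qed

lemma irreducible_vecstate_pure:
  assumes irr: "irreducible_rep A \<pi>" and x: "x \<in> unit_vectors (rspace \<pi>)"
  shows "vecstate A \<pi> x \<in> pure_states A"
  unfolding pure_states_def
proof (intro CollectI conjI allI impI; (elim conjE)?)
  show "state A (vecstate A \<pi> x)" by (rule state_vecstate_irr[OF irr x])
  fix \<phi> \<psi> t assume p: "state A \<phi>" and q: "state A \<psi>" and t: "0 < t" "t < (1::real)"
    and eq: "\<forall>a\<in>carr A. vecstate A \<pi> x a = of_real t * \<phi> a + of_real (1 - t) * \<psi> a"
  show "\<phi> = vecstate A \<pi> x"
    by (rule dominated_by_vecstate[OF irr x p q t]) (use eq in blast)
  have "1 - (1 - t) = t" by simp
  then show "\<psi> = vecstate A \<pi> x"
    using t eq by (intro dominated_by_vecstate[OF irr x q p, of "1 - t"]) (auto simp: add.commute)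
qed

lemma pure_state_vector:
  assumes "\<omega> \<in> pure_states A"
  shows "\<exists>(\<pi> :: 'a std_rep) x. irreducible_rep A \<pi> \<and> x \<in> unit_vectors (rspace \<pi>) \<and> \<omega> = vecstate A \<pi> x"
proof -
  obtain \<pi> :: "'a std_rep" where g: "gns_rep A \<omega> \<pi>" using gns_exists[OF pure_state[OF assms]] by blast
  then show ?thesis
    using gns_pure_irreducible[OF assms g] gns_vector[OF pure_state[OF assms] g] by blast
qed

end

section \<open>Unitary maps in the charts of projective space\<close>

lemma orth_compl_sel [simp]:
  "carr (orth_compl H \<xi>) = {v \<in> carr H. inn H \<xi> v = 0}" "vadd (orth_compl H \<xi>) = vadd H"
  "smul (orth_compl H \<xi>) = smul H" "inn (orth_compl H \<xi>) = inn H"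
  "vdiff (orth_compl H \<xi>) = vdiff H" "hnorm (orth_compl H \<xi>) = hnorm H"
  by (simp_all add: orth_compl_def vdiff_def hnorm_def fun_eq_iff)

context hilbert_space
begin

lemma ray_smul: "\<lbrakk>x \<in> carr H; cmod c = 1\<rbrakk> \<Longrightarrow> ray H (smul H c x) = ray H x"
proof -
  assume x: "x \<in> carr H" and c: "cmod c = 1"
  have "smul H d x = smul H (d / c) (smul H c x) \<and> cmod (d / c) = 1" if "cmod d = 1" for d
    using that x c by (auto simp: smul_smul norm_divide)
  moreover have "smul H d (smul H c x) = smul H (d * c) x \<and> cmod (d * c) = 1" if "cmod d = 1" for d
    using that x c by (simp add: smul_smul norm_mult)
  ultimately show ?thesis unfolding ray_def by blast
qed

lemma ray_self: "x \<in> carr H \<Longrightarrow> x \<in> ray H x"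
  unfolding ray_def by (rule CollectI, rule exI[of _ 1]) simp

lemma ray_eqD: "\<lbrakk>ray H x = ray H y; x \<in> carr H\<rbrakk> \<Longrightarrow> \<exists>c. cmod c = 1 \<and> x = smul H c y"
  using ray_self[of x] unfolding ray_def by blast

text \<open>The phase of the representative cancels in x / \<langle>\<xi>|x\<rangle>, so the choice
  in \<open>proj_chart_map\<close> is immaterial.\<close>

lemma proj_chart_map_ray:
  assumes x: "x \<in> carr H" and xi: "\<xi> \<in> carr H"
  shows "proj_chart_map H \<xi> (ray H x) = vdiff H (smul H (inverse (inn H \<xi> x)) x) \<xi>"
proof -
  define y where "y = (SOME y. y \<in> ray H x)"
  have "y \<in> ray H x" unfolding y_def by (rule someI[of _ x]) (rule ray_self[OF x])
  then obtain c where c: "cmod c = 1" "y = smul H c x" by (auto simp: ray_def)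
  then have "inverse (inn H \<xi> y) * c = inverse (inn H \<xi> x)"
    using x xi by (auto simp: field_simps)
  then have "smul H (inverse (inn H \<xi> y)) y = smul H (inverse (inn H \<xi> x)) x"
    using x c(2) smul_smul by metis
  then show ?thesis by (simp add: proj_chart_map_def y_def[symmetric] Let_def)
qed

lemma ray_in_chart_iff:
  assumes x: "x \<in> unit_vectors H" and xi: "\<xi> \<in> carr H"
  shows "ray H x \<in> cdom (proj_chart H \<xi>) \<longleftrightarrow> inn H \<xi> x \<noteq> 0"
proof
  have xc: "x \<in> carr H" using x by (simp add: unit_vectors_def)
  assume "ray H x \<in> cdom (proj_chart H \<xi>)"
  then obtain y where y: "ray H x = ray H y" "y \<in> unit_vectors H" "inn H \<xi> y \<noteq> 0"
    by (auto simp: proj_chart_def)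
  then obtain c where "cmod c = 1" "x = smul H c y" using ray_eqD xc by blast
  moreover have "y \<in> carr H" using y by (simp add: unit_vectors_def)
  ultimately show "inn H \<xi> x \<noteq> 0" using y xi by auto
next
  assume "inn H \<xi> x \<noteq> 0"
  then show "ray H x \<in> cdom (proj_chart H \<xi>)" using x by (auto simp: proj_chart_def)
qed

lemma normalize:
  assumes "w \<in> carr H" "w \<noteq> vzero H"
  shows "smul H (of_real (1 / hnorm H w)) w \<in> unit_vectors H" "hnorm H w > 0"
proof -
  show p: "hnorm H w > 0" using assms n_nonneg n_eq_0 by (metis less_eq_real_def)
  then show "smul H (of_real (1 / hnorm H w)) w \<in> unit_vectors H"
    using assms by (simp add: unit_vectors_def n_smul norm_divide)
qed

end

text \<open>The remainder after the first-order Taylor expansion of the inverse at \<open>a\<close>,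
  in closed form.\<close>

lemma taylor_inverse:
  fixes a b :: complex
  assumes "a \<noteq> 0" "a + b \<noteq> 0"
  shows "inverse (a + b) - inverse a + b / a\<^sup>2 = b\<^sup>2 / (a\<^sup>2 * (a + b))"
proof -
  have "inverse (a + b) * (a\<^sup>2 * (a + b)) = a\<^sup>2" "inverse a * (a\<^sup>2 * (a + b)) = a * (a + b)"
    "b / a\<^sup>2 * (a\<^sup>2 * (a + b)) = b * (a + b)"
    using assms by (simp_all add: power2_eq_square)
  then have "(inverse (a + b) - inverse a + b / a\<^sup>2) * (a\<^sup>2 * (a + b)) = a\<^sup>2 - a * (a + b) + b * (a + b)"
    by (simp only: left_diff_distrib distrib_right[of _ "b / a\<^sup>2"])
  also have "\<dots> = b\<^sup>2" by (simp add: algebra_simps power2_eq_square)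
  finally show ?thesis using assms by (simp add: eq_divide_eq)
qed

text \<open>The form of the charts in \<open>pure_state_fiber\<close>, with \<open>R\<close> the map
  to rays.\<close>

definition pullback_chart :: "'p set \<Rightarrow> ('p \<Rightarrow> 'h set) \<Rightarrow> ('h set, 'h) chart \<Rightarrow> ('p, 'h) chart" where
  "pullback_chart F R b = \<lparr>cdom = {p \<in> F. R p \<in> cdom b}, cmap = cmap b \<circ> R, cmodel = cmodel b, cmetric = cmetric b\<rparr>"

text \<open>
  In the charts at \<open>\<xi>\<close> and \<open>\<eta>\<close> the map \<open>f\<close>, which is induced by the unitary \<open>u\<close>, reads
  \<open>z \<mapsto> u(\<xi> + z) / \<langle>\<eta>|u(\<xi> + z)\<rangle> - \<eta>\<close>.
\<close>

locale unitary_chart_map =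
  H: hilbert_space H + K: hilbert_space K
  for H :: "'h hilbert" and K :: "'k hilbert" +
  fixes u :: "'h \<Rightarrow> 'k" and F :: "'p set" and R :: "'p \<Rightarrow> 'h set"
    and F' :: "'q set" and R' :: "'q \<Rightarrow> 'k set" and f :: "'p \<Rightarrow> 'q" and \<xi> :: 'h and \<eta> :: 'k
  assumes u: "unitary_map H K u"
    and R_ray: "p \<in> F \<Longrightarrow> \<exists>x\<in>unit_vectors H. R p = ray H x"
    and R_surj: "x \<in> unit_vectors H \<Longrightarrow> \<exists>p\<in>F. R p = ray H x"
    and f_closed: "p \<in> F \<Longrightarrow> f p \<in> F'"
    and R_f: "\<lbrakk>p \<in> F; x \<in> unit_vectors H; R p = ray H x\<rbrakk> \<Longrightarrow> R' (f p) = ray K (u x)"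
    and xi: "\<xi> \<in> unit_vectors H" and eta: "\<eta> \<in> unit_vectors K"
begin

abbreviation "c1 \<equiv> pullback_chart F R (proj_chart H \<xi>)"
abbreviation "c2 \<equiv> pullback_chart F' R' (proj_chart K \<eta>)"

lemma xi_carr [simp]: "\<xi> \<in> carr H" "\<eta> \<in> carr K" and xi_norm: "hnorm H \<xi> = 1" "hnorm K \<eta> = 1"
  using xi eta by (auto simp: unit_vectors_def)

lemma xi_self [simp]: "inn H \<xi> \<xi> = 1" "inn K \<eta> \<eta> = 1"
  using H.form.s_self[of \<xi>] K.form.s_self[of \<eta>] xi_norm by simp_all

lemma u_closed [simp]: "x \<in> carr H \<Longrightarrow> u x \<in> carr K"
  by (rule unitary_closed[OF u])

lemmas u_simps = unitary_add[OF u] unitary_smul[OF u] unitary_vdiff[OF u H.hilbert_space_axioms]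

lemma u_unit: "x \<in> unit_vectors H \<Longrightarrow> u x \<in> unit_vectors K"
  by (simp add: unit_vectors_def unitary_hnorm[OF u])

text \<open>For a point of the chart domain, the representative of its ray on the affine hyperplane
  \<langle>\<xi>|w\<rangle> = 1.\<close>

definition lift :: "'p \<Rightarrow> 'h" where
  "lift p = vadd H (cmap c1 p) \<xi>"

lemma chart_sel [simp]: "cmodel c1 = orth_compl H \<xi>" "cmodel c2 = orth_compl K \<eta>"
  "cmetric c1 = fubini_study H" "cmetric c2 = fubini_study K"
  by (simp_all add: pullback_chart_def proj_chart_def)

lemma chart_point:
  assumes p: "p \<in> cdom c1" and fp: "f p \<in> cdom c2"
  shows "lift p \<in> carr H" "inn H \<xi> (lift p) = 1" "cmap c1 p = vdiff H (lift p) \<xi>"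
    "inn K \<eta> (u (lift p)) \<noteq> 0"
    "cmap c2 (f p) = vdiff K (smul K (inverse (inn K \<eta> (u (lift p)))) (u (lift p))) \<eta>"
proof -
  have pF: "p \<in> F" and Rp: "R p \<in> cdom (proj_chart H \<xi>)" using p by (auto simp: pullback_chart_def)
  obtain x where x: "x \<in> unit_vectors H" "R p = ray H x" using R_ray[OF pF] by blast
  have xc [simp]: "x \<in> carr H" using x by (simp add: unit_vectors_def)
  have ne: "inn H \<xi> x \<noteq> 0" using Rp x H.ray_in_chart_iff[OF x(1), of \<xi>] by simp
  have Rf: "R' (f p) = ray K (u x)" by (rule R_f[OF pF x])
  have ne2: "inn K \<eta> (u x) \<noteq> 0"
    using fp Rf K.ray_in_chart_iff[OF u_unit[OF x(1)], of \<eta>] by (simp add: pullback_chart_def)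
  have cm: "cmap c1 p = vdiff H (smul H (inverse (inn H \<xi> x)) x) \<xi>"
    by (simp add: pullback_chart_def proj_chart_def x H.proj_chart_map_ray)
  have l: "lift p = smul H (inverse (inn H \<xi> x)) x" by (simp add: lift_def cm)
  show "lift p \<in> carr H" "inn H \<xi> (lift p) = 1" "cmap c1 p = vdiff H (lift p) \<xi>"
    using ne by (simp_all add: l cm)
  show "inn K \<eta> (u (lift p)) \<noteq> 0" using ne ne2 by (simp add: l u_simps)
  have "smul K (inverse (inn K \<eta> (u (lift p)))) (u (lift p)) = smul K (inverse (inn K \<eta> (u x))) (u x)"
  proof -
    have "inverse (inn K \<eta> (u (lift p))) * inverse (inn H \<xi> x) = inverse (inn K \<eta> (u x))"
      using ne ne2 by (simp add: l u_simps)
    moreover have "u (lift p) = smul K (inverse (inn H \<xi> x)) (u x)" by (simp add: l u_simps)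
    ultimately show ?thesis using K.smul_smul[of "u x"] by (metis u_closed xc)
  qed
  then show "cmap c2 (f p) = vdiff K (smul K (inverse (inn K \<eta> (u (lift p)))) (u (lift p))) \<eta>"
    by (simp add: pullback_chart_def proj_chart_def Rf K.proj_chart_map_ray)
qed

lemma chart_surj:
  assumes w: "w \<in> carr H" "inn H \<xi> w = 1" "inn K \<eta> (u w) \<noteq> 0"
  shows "\<exists>q\<in>cdom c1. f q \<in> cdom c2 \<and> lift q = w \<and> cmap c1 q = vdiff H w \<xi>"
proof -
  have "w \<noteq> vzero H" using w(2) by auto
  then have y: "smul H (of_real (1 / hnorm H w)) w \<in> unit_vectors H" and wp: "hnorm H w > 0"
    using H.normalize[OF w(1)] by auto
  let ?y = "smul H (of_real (1 / hnorm H w)) w"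
  obtain q where q: "q \<in> F" "R q = ray H ?y" using R_surj[OF y] by blast
  have Rf: "R' (f q) = ray K (u ?y)" by (rule R_f[OF q(1) y q(2)])
  have 1: "q \<in> cdom c1"
    using q H.ray_in_chart_iff[OF y, of \<xi>] w wp by (simp add: pullback_chart_def)
  have 2: "f q \<in> cdom c2"
    using f_closed[OF q(1)] Rf K.ray_in_chart_iff[OF u_unit[OF y], of \<eta>] w wp
    by (simp add: pullback_chart_def u_simps)
  have cm: "cmap c1 q = vdiff H w \<xi>"
    using w wp by (simp add: pullback_chart_def proj_chart_def q H.proj_chart_map_ray H.smul_smul)
  then have "lift q = w" using w by (simp add: lift_def)
  then show ?thesis using 1 2 cm by blast
qed

text \<open>The derivative at \<open>lift p\<close> of w \<mapsto> u w / \<langle>\<eta>|u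
  w\<rangle>, by the quotient rule.\<close>

definition tangent :: "'p \<Rightarrow> 'h \<Rightarrow> 'k" where
  "tangent p h = (let \<alpha> = inn K \<eta> (u (lift p)) in
     vdiff K (smul K (inverse \<alpha>) (u h)) (smul K (inn K \<eta> (u h) / \<alpha>\<^sup>2) (u (lift p))))"

context
  fixes p
  assumes p: "p \<in> cdom c1" and fp: "f p \<in> cdom c2"
begin

abbreviation "\<alpha> \<equiv> inn K \<eta> (u (lift p))"

lemmas lift_p [simp] = chart_point(1,2)[OF p fp] and alpha [simp] = chart_point(4)[OF p fp]

lemma tangent_eq:
  "tangent p h = vdiff K (smul K (inverse \<alpha>) (u h)) (smul K (inn K \<eta> (u h) / \<alpha>\<^sup>2) (u (lift p)))"
  by (simp add: tangent_def Let_def)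

lemma tangent_closed [simp]: "h \<in> carr H \<Longrightarrow> tangent p h \<in> carr K"
  by (simp add: tangent_eq)

lemma tangent_orth [simp]: "h \<in> carr H \<Longrightarrow> inn K \<eta> (tangent p h) = 0"
  by (simp add: tangent_eq power2_eq_square field_simps)

lemma tangent_bounded_linear: "bounded_linear_map (orth_compl H \<xi>) (orth_compl K \<eta>) (tangent p)"
  unfolding bounded_linear_map_def
proof (intro conjI exI ballI)
  show "linear_map (orth_compl H \<xi>) (orth_compl K \<eta>) (tangent p)"
    unfolding linear_map_def
  proof (intro conjI ballI allI)
    fix x y assume "x \<in> carr (orth_compl H \<xi>)" "y \<in> carr (orth_compl H \<xi>)"
    then show "tangent p (vadd (orth_compl H \<xi>) x y) = vadd (orth_compl K \<eta>) (tangent p x) (tangent p y)"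
      by (simp, intro K.inn_ext) (simp_all add: tangent_eq u_simps algebra_simps add_divide_distrib)
  next
    fix c x assume "x \<in> carr (orth_compl H \<xi>)"
    then show "tangent p (smul (orth_compl H \<xi>) c x) = smul (orth_compl K \<eta>) c (tangent p x)"
      by (simp, intro K.inn_ext) (simp_all add: tangent_eq u_simps algebra_simps)
  qed simp
  fix h assume "h \<in> carr (orth_compl H \<xi>)"
  then have h [simp]: "h \<in> carr H" by simp
  have "hnorm K (tangent p h) \<le> inverse (cmod \<alpha>) * hnorm H h + cmod (inn K \<eta> (u h)) / (cmod \<alpha>)\<^sup>2 * hnorm H (lift p)"
    using K.n_diff_le[of "smul K (inverse \<alpha>) (u h)" "smul K (inn K \<eta> (u h) / \<alpha>\<^sup>2) (u (lift p))"]
    by (simp add: tangent_eq K.n_smul unitary_hnorm[OF u] norm_inverse norm_divide norm_power)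
  also have "cmod (inn K \<eta> (u h)) \<le> hnorm H h"
    using K.form.cauchy_schwarz[of \<eta> "u h"] by (simp add: xi_norm unitary_hnorm[OF u])
  then have "cmod (inn K \<eta> (u h)) / (cmod \<alpha>)\<^sup>2 * hnorm H (lift p) \<le> hnorm H h / (cmod \<alpha>)\<^sup>2 * hnorm H (lift p)"
    by (intro mult_right_mono divide_right_mono) (auto simp: H.n_nonneg)
  finally show "hnorm (orth_compl K \<eta>) (tangent p h) \<le>
      (inverse (cmod \<alpha>) + hnorm H (lift p) / (cmod \<alpha>)\<^sup>2) * hnorm (orth_compl H \<xi>) h"
    by (simp add: algebra_simps)
qed

text \<open>The factors 2 come from |\<alpha> + b| \<ge> |\<alpha>|/2, where b = \<langle>\<eta>|u
  h\<rangle>, valid for increments \<open>h\<close> of norm at most |\<alpha>|/2.\<close>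

definition remainder_bound :: real where
  "remainder_bound = 2 / (cmod \<alpha>)\<^sup>2 + 2 * hnorm H (lift p) / (cmod \<alpha>)^3"

lemma remainder_bound_nonneg: "remainder_bound \<ge> 0"
  by (simp add: remainder_bound_def H.n_nonneg)

text \<open>In the remainder the coefficient of \<open>u h\<close> is 1/(\<alpha> + b) - 1/\<alpha>,
  of first order in b = \<langle>\<eta>|u h\<rangle>, and that of \<open>u (lift p)\<close> is the
  Taylor remainder, of second order. As |b| is at most the norm of \<open>h\<close>, both terms are
  quadratic in \<open>h\<close>.\<close>

lemma remainder:
  assumes h [simp]: "h \<in> carr H" and small: "hnorm H h \<le> cmod \<alpha> / 2"
  defines "w \<equiv> vadd H (lift p) h"
  shows "inn K \<eta> (u w) \<noteq> 0"
    "hnorm K (vdiff K (vdiff K (vdiff K (smul K (inverse (inn K \<eta> (u w))) (u w)) \<eta>)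
       (vdiff K (smul K (inverse \<alpha>) (u (lift p))) \<eta>)) (tangent p h)) \<le> remainder_bound * (hnorm H h)\<^sup>2"
proof -
  let ?a = \<alpha> and ?b = "inn K \<eta> (u h)"
  have b: "cmod ?b \<le> hnorm H h"
    using K.form.cauchy_schwarz[of \<eta> "u h"] by (simp add: xi_norm unitary_hnorm[OF u])
  have w [simp]: "w \<in> carr H" by (simp add: w_def)
  have ab: "inn K \<eta> (u w) = ?a + ?b" by (simp add: w_def u_simps)
  have "cmod ?a \<le> cmod (?a + ?b) + cmod ?b" using norm_triangle_ineq4[of "?a + ?b" ?b] by simp
  then have half: "cmod ?a / 2 \<le> cmod (?a + ?b)" using b small by linarith
  have a0: "cmod ?a > 0" by simp
  then have ab0: "?a + ?b \<noteq> 0" using half by auto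
  then show "inn K \<eta> (u w) \<noteq> 0" by (simp add: ab)
  let ?r = "vadd K (smul K (- ?b / (?a * (?a + ?b))) (u h)) (smul K (?b\<^sup>2 / (?a\<^sup>2 * (?a + ?b))) (u (lift p)))"
  have eq: "vdiff K (vdiff K (vdiff K (smul K (inverse (?a + ?b)) (u w)) \<eta>)
       (vdiff K (smul K (inverse ?a) (u (lift p))) \<eta>)) (tangent p h) = ?r"
  proof (rule K.inn_ext)
    fix v assume v: "v \<in> carr K"
    have 1: "inverse (?a + ?b) - inverse ?a = - ?b / (?a * (?a + ?b))"
      using ab0 alpha by (simp add: field_simps)
    have 2: "inverse (?a + ?b) - inverse ?a + ?b / ?a\<^sup>2 = ?b\<^sup>2 / (?a\<^sup>2 * (?a + ?b))"
      using ab0 alpha by (intro taylor_inverse)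
    have "inn K v (vdiff K (vdiff K (vdiff K (smul K (inverse (?a + ?b)) (u w)) \<eta>)
       (vdiff K (smul K (inverse ?a) (u (lift p))) \<eta>)) (tangent p h)) =
       (inverse (?a + ?b) - inverse ?a) * inn K v (u h) +
       (inverse (?a + ?b) - inverse ?a + ?b / ?a\<^sup>2) * inn K v (u (lift p))"
      using v by (simp add: tangent_eq w_def u_simps algebra_simps)
    then show "inn K v (vdiff K (vdiff K (vdiff K (smul K (inverse (?a + ?b)) (u w)) \<eta>)
       (vdiff K (smul K (inverse ?a) (u (lift p))) \<eta>)) (tangent p h)) = inn K v ?r"
      unfolding 2 unfolding 1 using v by simp
  qed auto
  have "hnorm K ?r \<le> cmod ?b / (cmod ?a * cmod (?a + ?b)) * hnorm H h +
      (cmod ?b)\<^sup>2 / ((cmod ?a)\<^sup>2 * cmod (?a + ?b)) * hnorm H (lift p)"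
    using K.n_triangle[of "smul K (- ?b / (?a * (?a + ?b))) (u h)" "smul K (?b\<^sup>2 / (?a\<^sup>2 * (?a + ?b))) (u (lift p))"]
    by (simp add: K.n_smul unitary_hnorm[OF u] norm_divide norm_mult norm_power)
  also have "\<dots> \<le> hnorm H h / (cmod ?a * (cmod ?a / 2)) * hnorm H h +
      (hnorm H h)\<^sup>2 / ((cmod ?a)\<^sup>2 * (cmod ?a / 2)) * hnorm H (lift p)"
    using b half a0 by (intro add_mono mult_right_mono frac_le power_mono mult_left_mono) (auto simp: H.n_nonneg)
  also have "\<dots> = remainder_bound * (hnorm H h)\<^sup>2"
    using a0 by (simp add: remainder_bound_def field_simps power2_eq_square power3_eq_cube)
  finally show "hnorm K (vdiff K (vdiff K (vdiff K (smul K (inverse (inn K \<eta> (u w))) (u w)) \<eta>)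
       (vdiff K (smul K (inverse \<alpha>) (u (lift p))) \<eta>)) (tangent p h)) \<le> remainder_bound * (hnorm H h)\<^sup>2"
    unfolding ab eq .
qed

text \<open>Serves both existence and uniqueness of the derivative. Of the two bounds on the
  increment, one keeps the denominator away from 0 and the other absorbs the quadratic
  remainder.\<close>

lemma remainder_small:
  assumes "\<epsilon> > 0"
  shows "\<exists>\<delta>>0. \<forall>h\<in>carr H. hnorm H h < \<delta> \<longrightarrow> inn K \<eta> (u (vadd H (lift p) h)) \<noteq> 0 \<and>
    hnorm K (vdiff K (vdiff K (vdiff K (smul K (inverse (inn K \<eta> (u (vadd H (lift p) h)))) (u (vadd H (lift p) h))) \<eta>)
       (cmap c2 (f p))) (tangent p h)) \<le> \<epsilon> * hnorm H h"
proof (intro exI[of _ "min (cmod \<alpha> / 2) (\<epsilon> / (remainder_bound + 1))"] conjI ballI impI)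
  have rb: "remainder_bound + 1 > 0" using remainder_bound_nonneg by linarith
  then show "0 < min (cmod \<alpha> / 2) (\<epsilon> / (remainder_bound + 1))" using assms by simp
  fix h assume h: "h \<in> carr H" and "hnorm H h < min (cmod \<alpha> / 2) (\<epsilon> / (remainder_bound + 1))"
  then have s: "hnorm H h \<le> cmod \<alpha> / 2" and e: "hnorm H h * (remainder_bound + 1) \<le> \<epsilon>"
    using rb by (auto simp: field_simps)
  show "inn K \<eta> (u (vadd H (lift p) h)) \<noteq> 0" by (rule remainder(1)[OF h s])
  have "remainder_bound * (hnorm H h)\<^sup>2 \<le> (hnorm H h * (remainder_bound + 1)) * hnorm H h"
    using H.n_nonneg[OF h] by (simp add: power2_eq_square algebra_simps)
  also have "\<dots> \<le> \<epsilon> * hnorm H h" using e H.n_nonneg[OF h] by (intro mult_right_mono)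
  finally show "hnorm K (vdiff K (vdiff K (vdiff K (smul K (inverse (inn K \<eta> (u (vadd H (lift p) h)))) (u (vadd H (lift p) h))) \<eta>)
       (cmap c2 (f p))) (tangent p h)) \<le> \<epsilon> * hnorm H h"
    using remainder(2)[OF h s] unfolding chart_point(5)[OF p fp] by linarith
qed

lemma tangent_derivative: "chart_derivative c1 c2 f p (tangent p)"
  unfolding chart_derivative_def chart_sel orth_compl_sel
proof (intro conjI allI impI)
  show "bounded_linear_map (orth_compl H \<xi>) (orth_compl K \<eta>) (tangent p)" by (rule tangent_bounded_linear)
  fix \<epsilon> :: real assume "\<epsilon> > 0"
  from remainder_small[OF this] obtain \<delta> where d: "\<delta> > 0"
    and r: "\<And>h. \<lbrakk>h \<in> carr H; hnorm H h < \<delta>\<rbrakk> \<Longrightarrow> inn K \<eta> (u (vadd H (lift p) h)) \<noteq> 0 \<and>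
    hnorm K (vdiff K (vdiff K (vdiff K (smul K (inverse (inn K \<eta> (u (vadd H (lift p) h)))) (u (vadd H (lift p) h))) \<eta>)
       (cmap c2 (f p))) (tangent p h)) \<le> \<epsilon> * hnorm H h"
    by blast
  have "\<exists>q\<in>cdom c1. f q \<in> cdom c2 \<and> cmap c1 q = vadd H (cmap c1 p) h \<and>
      hnorm K (vdiff K (vdiff K (cmap c2 (f q)) (cmap c2 (f p))) (tangent p h)) \<le> \<epsilon> * hnorm H h"
    if h: "h \<in> carr H" "inn H \<xi> h = 0" and hs: "hnorm H h < \<delta>" for h
  proof -
    let ?w = "vadd H (lift p) h"
    have w: "?w \<in> carr H" "inn H \<xi> ?w = 1" "inn K \<eta> (u ?w) \<noteq> 0" using h r[OF h(1) hs] by auto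
    obtain q where q: "q \<in> cdom c1" "f q \<in> cdom c2" "lift q = ?w" "cmap c1 q = vdiff H ?w \<xi>"
      using chart_surj[OF w] by blast
    have "vdiff H ?w \<xi> = vadd H (cmap c1 p) h"
      unfolding chart_point(3)[OF p fp] by (rule H.inn_ext) (use h in auto)
    moreover have "hnorm K (vdiff K (vdiff K (cmap c2 (f q)) (cmap c2 (f p))) (tangent p h)) \<le> \<epsilon> * hnorm H h"
      using r[OF h(1) hs] unfolding chart_point(5)[OF q(1,2)] q(3) by blast
    ultimately show ?thesis using q by (intro bexI[of _ q]) auto
  qed
  then show "\<exists>\<delta>>0. \<forall>h\<in>{v \<in> carr H. inn H \<xi> v = 0}. hnorm H h < \<delta> \<longrightarrow>
      (\<exists>q\<in>cdom c1. f q \<in> cdom c2 \<and> cmap c1 q = vadd H (cmap c1 p) h \<and>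
      hnorm K (vdiff K (vdiff K (cmap c2 (f q)) (cmap c2 (f p))) (tangent p h)) \<le> \<epsilon> * hnorm H h)"
    using d by blast
qed

text \<open>\<open>holomorphic_kaehler_isometry\<close> speaks of every chart derivative, so the
  metric has to be compared for an arbitrary \<open>L\<close>. Estimating \<open>L\<close> and
  \<open>tangent p\<close> at a small multiple of \<open>h\<close> identifies them.\<close>

lemma derivative_unique:
  assumes L: "chart_derivative c1 c2 f p L" and h: "h \<in> carr (orth_compl H \<xi>)"
  shows "L h = tangent p h"
proof -
  have hc [simp]: "h \<in> carr H" and hxi: "inn H \<xi> h = 0" using h by auto
  have Ll: "linear_map (orth_compl H \<xi>) (orth_compl K \<eta>) L"
    using L by (simp add: chart_derivative_def bounded_linear_map_def)
  have Lc [simp]: "L v \<in> carr K" if "v \<in> carr H" "inn H \<xi> v = 0" for v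
    using linear_map_closed[OF Ll, of v] that by simp
  have Ls: "L (smul H s h) = smul K s (L h)" for s
    using linear_map_smul[OF Ll h] by simp
  have Ts: "tangent p (smul H s h) = smul K s (tangent p h)" for s
    using linear_map_smul[of "orth_compl H \<xi>" "orth_compl K \<eta>" "tangent p" h s] tangent_bounded_linear h
    by (simp add: bounded_linear_map_def)
  have cl: "cmap c1 p = vdiff H (lift p) \<xi>" and cl2: "cmap c2 (f p) \<in> carr K"
    using chart_point[OF p fp] by simp_all
  have key: "hnorm K (vdiff K (L h) (tangent p h)) \<le> \<epsilon> * (2 * hnorm H h)" if e: "\<epsilon> > 0" for \<epsilon>
  proof -
    from L e obtain \<delta>1 where d1: "\<delta>1 > 0"
      and q1: "\<And>h. \<lbrakk>h \<in> carr H; inn H \<xi> h = 0; hnorm H h < \<delta>1\<rbrakk> \<Longrightarrow>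
        \<exists>q\<in>cdom c1. f q \<in> cdom c2 \<and> cmap c1 q = vadd H (cmap c1 p) h \<and>
          hnorm K (vdiff K (vdiff K (cmap c2 (f q)) (cmap c2 (f p))) (L h)) \<le> \<epsilon> * hnorm H h"
      unfolding chart_derivative_def chart_sel orth_compl_sel by blast
    from remainder_small[OF e] obtain \<delta>2 where d2: "\<delta>2 > 0"
      and r: "\<And>h. \<lbrakk>h \<in> carr H; hnorm H h < \<delta>2\<rbrakk> \<Longrightarrow>
        hnorm K (vdiff K (vdiff K (vdiff K (smul K (inverse (inn K \<eta> (u (vadd H (lift p) h)))) (u (vadd H (lift p) h))) \<eta>)
       (cmap c2 (f p))) (tangent p h)) \<le> \<epsilon> * hnorm H h"
      by blast
    \<comment> \<open>Puts s times the norm of \<open>h\<close> below both radii; the summand 1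
      covers h = 0.\<close>
    define s where "s = min \<delta>1 \<delta>2 / (2 * (hnorm H h + 1))"
    have h1: "hnorm H h + 1 > 0" using H.n_nonneg[OF hc] by linarith
    have s: "s > 0" using d1 d2 h1 by (simp add: s_def)
    let ?h = "smul H (of_real s) h"
    have hn: "hnorm H ?h = s * hnorm H h" using s by (simp add: H.n_smul)
    have "s * hnorm H h < s * (2 * (hnorm H h + 1))"
      using s H.n_nonneg[OF hc] by (intro mult_strict_left_mono) auto
    also have "\<dots> = min \<delta>1 \<delta>2" using h1 by (simp add: s_def)
    finally have sm: "hnorm H ?h < \<delta>1" "hnorm H ?h < \<delta>2" using hn by auto
    have hxi': "inn H \<xi> ?h = 0" using hxi by simp
    have hc': "?h \<in> carr H" by simp
    obtain q where q: "q \<in> cdom c1" "f q \<in> cdom c2" "cmap c1 q = vadd H (cmap c1 p) ?h"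
      and qe: "hnorm K (vdiff K (vdiff K (cmap c2 (f q)) (cmap c2 (f p))) (L ?h)) \<le> \<epsilon> * hnorm H ?h"
      using q1[OF hc' hxi' sm(1)] by blast
    have lq: "lift q = vadd H (lift p) ?h"
      unfolding lift_def q(3) by (rule H.inn_ext) (simp_all add: cl)
    have cq: "cmap c2 (f q) \<in> carr K" using chart_point[OF q(1,2)] by simp
    let ?d = "vdiff K (cmap c2 (f q)) (cmap c2 (f p))"
    have te: "hnorm K (vdiff K ?d (tangent p ?h)) \<le> \<epsilon> * hnorm H ?h"
      using r[OF hc' sm(2)] unfolding chart_point(5)[OF q(1,2)] lq .
    have "s * hnorm K (vdiff K (L h) (tangent p h)) = hnorm K (vdiff K (L ?h) (tangent p ?h))"
      using s hxi by (simp add: Ls Ts K.smul_diff[symmetric] K.n_smul)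
    also have "\<dots> \<le> hnorm K (vdiff K (L ?h) ?d) + hnorm K (vdiff K ?d (tangent p ?h))"
      using cq cl2 hxi by (intro K.n_diff_triangle) auto
    also have "hnorm K (vdiff K (L ?h) ?d) = hnorm K (vdiff K ?d (L ?h))"
      using cq cl2 hxi by (intro K.n_diff_commute) auto
    finally have "s * hnorm K (vdiff K (L h) (tangent p h)) \<le> s * (\<epsilon> * (2 * hnorm H h))"
      using qe te hn by (simp add: algebra_simps)
    then show ?thesis using s by simp
  qed
  show ?thesis
  proof (rule K.eq_by_small)
    fix e :: real assume "e > 0"
    then have e': "e / (2 * hnorm H h + 1) > 0" using H.n_nonneg[OF hc] by simp
    have "hnorm K (vdiff K (L h) (tangent p h)) \<le> e / (2 * hnorm H h + 1) * (2 * hnorm H h)" by (rule key[OF e'])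
    also have "\<dots> \<le> e / (2 * hnorm H h + 1) * (2 * hnorm H h + 1)" using e' by (intro mult_left_mono) auto
    also have "\<dots> = e" using H.n_nonneg[OF hc] by simp
    finally show "hnorm K (vdiff K (L h) (tangent p h)) \<le> e" .
  qed (use hxi in auto)
qed

text \<open>In terms of the lift z the metric is the homogeneous form 2(\<langle>v|w\<rangle>/|z|^2
  - \<langle>v|z\<rangle>\<langle>z|w\<rangle>/|z|^4). It does not change when multiples of z are
  added to v and w, or when z, v and w are scaled by one factor; the tangent map differs from
  \<open>u\<close> in exactly this way.\<close>

lemma tangent_isometry:
  assumes v: "v \<in> carr (orth_compl H \<xi>)" and w: "w \<in> carr (orth_compl H \<xi>)"
  shows "fubini_study K (cmap c2 (f p)) (tangent p v) (tangent p w) = fubini_study H (cmap c1 p) v w"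
proof -
  have vc [simp]: "v \<in> carr H" "w \<in> carr H" and vo: "inn H \<xi> v = 0" "inn H \<xi> w = 0" using v w by auto
  have vo': "inn H v \<xi> = 0" using vo H.inn_commute[of \<xi> v] by simp
  let ?z = "lift p" and ?a = \<alpha>
  define N where "N = (hnorm H ?z)\<^sup>2"
  have N: "inn H ?z ?z = of_real N" unfolding N_def by (rule H.form.s_self) simp
  have zx: "inn H ?z \<xi> = 1" using H.inn_commute[of \<xi> ?z] by simp
  have N1: "1 + (hnorm H (cmap c1 p))\<^sup>2 = N"
  proof -
    have "(hnorm H (vdiff H ?z \<xi>))\<^sup>2 = N - 1"
      by (simp add: H.hnorm_sq N zx)
    then show ?thesis by (simp add: chart_point(3)[OF p fp])
  qed
  have Npos: "N > 0" using N1 zero_le_power2[of "hnorm H (cmap c1 p)"] by linarith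
  let ?Z = "cmap c2 (f p)"
  have Z: "?Z = vdiff K (smul K (inverse ?a) (u ?z)) \<eta>" by (rule chart_point(5)[OF p fp])
  have ze: "inn K (u ?z) \<eta> = cnj ?a" using K.inn_commute[of \<eta> "u ?z"] by simp
  have aa: "?a * cnj ?a = of_real ((cmod ?a)\<^sup>2)" by (rule complex_norm_square[symmetric])
  define A where "A = (cmod ?a)\<^sup>2"
  have Apos: "A > 0" by (simp add: A_def)
  have N2: "1 + (hnorm K ?Z)\<^sup>2 = N / A"
  proof -
    have "inn K ?Z ?Z = inverse (?a * cnj ?a) * of_real N - 1"
      by (simp add: Z unitary_inn[OF u] N ze field_simps)
    then have "inn K ?Z ?Z = of_real (N / A - 1)"
      unfolding aa A_def by (simp add: field_simps del: of_real_power)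
    then have "Re (inn K ?Z ?Z) = N / A - 1" by simp
    then show ?thesis using K.hnorm_sq[of ?Z] by (simp add: Z)
  qed
  \<comment> \<open>\<open>tangent p v\<close> is u v - bv u z scaled by 1/\<alpha>: a shift along u
    z, followed by the scaling that the lift undergoes.\<close>
  define bv where "bv = inn K \<eta> (u v) / ?a"
  define bw where "bw = inn K \<eta> (u w) / ?a"
  have tv: "tangent p v = smul K (inverse ?a) (vdiff K (u v) (smul K bv (u ?z)))"
    by (rule K.inn_ext) (simp_all add: tangent_eq bv_def power2_eq_square field_simps)
  have tw: "tangent p w = smul K (inverse ?a) (vdiff K (u w) (smul K bw (u ?z)))"
    by (rule K.inn_ext) (simp_all add: tangent_eq bw_def power2_eq_square field_simps)
  let ?p = "inn H v ?z" and ?r = "inn H ?z w"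
  have ia: "cnj (inverse ?a) * inverse ?a = of_real (1 / A)"
    using aa unfolding A_def by (simp add: field_simps del: of_real_power)
  have 1: "inn K (tangent p v) (tangent p w) =
      of_real (1 / A) * (inn H v w - ?p * bw - cnj bv * ?r + of_real N * cnj bv * bw)"
    unfolding ia[symmetric] by (simp add: tv tw unitary_inn[OF u] N algebra_simps)
  have tve: "inn K (tangent p v) \<eta> = 0" using K.inn_commute[of \<eta> "tangent p v"] by simp
  have twe: "inn K \<eta> (tangent p w) = 0" by simp
  have 2: "inn K (tangent p v) ?Z = of_real (1 / A) * (?p - cnj bv * of_real N)"
  proof -
    have "inn K (tangent p v) ?Z = inn K (tangent p v) (smul K (inverse ?a) (u ?z))"
      using tve by (simp add: Z)
    then show ?thesis
      unfolding ia[symmetric] by (simp add: tv unitary_inn[OF u] N algebra_simps)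
  qed
  have 3: "inn K ?Z (tangent p w) = of_real (1 / A) * (?r - bw * of_real N)"
  proof -
    have "inn K ?Z (tangent p w) = inn K (smul K (inverse ?a) (u ?z)) (tangent p w)"
      using twe by (simp add: Z)
    then show ?thesis
      unfolding ia[symmetric] by (simp add: tw unitary_inn[OF u] N algebra_simps)
  qed
  have 4: "inn H v (cmap c1 p) = ?p" "inn H (cmap c1 p) w = ?r"
    using vo vo' by (simp_all add: chart_point(3)[OF p fp])
  have "inn K (tangent p v) (tangent p w) / of_real (N / A)
      - inn K (tangent p v) ?Z * inn K ?Z (tangent p w) / of_real ((N / A)\<^sup>2)
      = inn H v w / of_real N - ?p * ?r / of_real (N\<^sup>2)"
    unfolding 1 2 3 using Npos Apos by (simp add: field_simps power2_eq_square)
  then show ?thesis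
    unfolding fubini_study_def N1 N2 4 by simp
qed

end

end

section \<open>Isomorphisms of pure state bundles\<close>

text \<open>Interface between the analysis and the bundles. For C*-algebras it comes from the GNS
  construction, for the quotient from the corresponding facts about \<open>A\<close>.\<close>

locale pure_state_alg = star_alg B for B :: "'b cstar" +
  assumes pure_vecstate: "\<omega> \<in> pure_states B \<Longrightarrow>
      \<exists>(\<pi> :: 'b std_rep) x. irreducible_rep B \<pi> \<and> x \<in> unit_vectors (rspace \<pi>) \<and> \<omega> = vecstate B \<pi> x"
    and vecstate_pure: "\<lbrakk>irreducible_rep B (\<pi> :: 'b std_rep); x \<in> unit_vectors (rspace \<pi>)\<rbrakk> \<Longrightarrow>
      vecstate B \<pi> x \<in> pure_states B"
begin

lemma pure_extensional: "\<omega> \<in> pure_states B \<Longrightarrow> \<omega> \<in> extensional (carr B)"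
  by (simp add: pure_states_def state_def)

lemma vecstate_smul:
  assumes r: "representation B \<pi>" and x: "x \<in> carr (rspace \<pi>)" and c: "cmod c = 1"
  shows "vecstate B \<pi> (smul (rspace \<pi>) c x) = vecstate B \<pi> x"
proof -
  interpret H: hilbert_space "rspace \<pi>" by (rule rep_hilbert[OF r])
  have "c * cnj c = 1" using c by (simp add: complex_norm_square[symmetric])
  then show ?thesis
    using x by (auto simp: vecstate_def fun_eq_iff restrict_def rep_vec_smul[OF r] rep_closed[OF r]
        mult.assoc[symmetric] mult.commute)
qed

lemma vecstate_of_ray:
  assumes irr: "irreducible_rep B (\<pi> :: 'b std_rep)" and x: "x \<in> unit_vectors (rspace \<pi>)"
    and y: "y \<in> unit_vectors (rspace \<pi>)" and eq: "ray (rspace \<pi>) x = ray (rspace \<pi>) y"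
  shows "vecstate B \<pi> x = vecstate B \<pi> y"
proof -
  note r = irr_rep[OF irr]
  interpret H: hilbert_space "rspace \<pi>" by (rule rep_hilbert[OF r])
  have xy: "x \<in> carr (rspace \<pi>)" "y \<in> carr (rspace \<pi>)" using x y by (auto simp: unit_vectors_def)
  obtain c where "cmod c = 1" "x = smul (rspace \<pi>) c y" using H.ray_eqD[OF eq xy(1)] by blast
  then show ?thesis using vecstate_smul[OF r xy(2)] by simp
qed

lemma ray_of_state_vecstate:
  assumes irr: "irreducible_rep B (\<pi> :: 'b std_rep)" and x: "x \<in> unit_vectors (rspace \<pi>)"
  shows "ray_of_state B \<pi> (vecstate B \<pi> x) = ray (rspace \<pi>) x"
proof -
  note r = irr_rep[OF irr]
  interpret H: hilbert_space "rspace \<pi>" by (rule rep_hilbert[OF r])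
  let ?P = "\<lambda>y. y \<in> unit_vectors (rspace \<pi>) \<and> (\<forall>a\<in>carr B. vecstate B \<pi> x a = inn (rspace \<pi>) y (rop \<pi> a y))"
  define y where "y = (SOME y. ?P y)"
  have "?P x" using x by (simp add: vecstate_def)
  then have y: "?P y" unfolding y_def by (rule someI[of ?P])
  then have "vecstate B \<pi> x = vecstate B \<pi> y"
    by (auto simp: vecstate_def fun_eq_iff restrict_def)
  then obtain c where c: "cmod c = 1" "y = smul (rspace \<pi>) c x"
    using vecstate_ray[OF irr x] y by blast
  have "x \<in> carr (rspace \<pi>)" using x by (simp add: unit_vectors_def)
  then have "ray (rspace \<pi>) y = ray (rspace \<pi>) x" using H.ray_smul c by simp
  then show ?thesis by (simp add: ray_of_state_def y_def[symmetric])
qed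

text \<open>Every representation in the class describes the whole fiber, since an intertwiner moves
  the vector; so charts coming from different representatives live over the same points.\<close>

lemma fiber_points:
  assumes irr: "irreducible_rep B (\<pi> :: 'b std_rep)"
  shows "{\<omega> \<in> pure_states B. gns_class B \<omega> = irrep_class B \<pi>} = vecstate B \<pi> ` unit_vectors (rspace \<pi>)"
proof
  show "vecstate B \<pi> ` unit_vectors (rspace \<pi>) \<subseteq> {\<omega> \<in> pure_states B. gns_class B \<omega> = irrep_class B \<pi>}"
    using vecstate_pure[OF irr] gns_class_vecstate[OF irr] by auto
  show "{\<omega> \<in> pure_states B. gns_class B \<omega> = irrep_class B \<pi>} \<subseteq> vecstate B \<pi> ` unit_vectors (rspace \<pi>)"
  proof clarify
    fix \<omega> assume w: "\<omega> \<in> pure_states B" and cl: "gns_class B \<omega> = irrep_class B \<pi>"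
    obtain \<sigma> :: "'b std_rep" and x where s: "irreducible_rep B \<sigma>" "x \<in> unit_vectors (rspace \<sigma>)" "\<omega> = vecstate B \<sigma> x"
      using pure_vecstate[OF w] by blast
    then have "irrep_class B \<sigma> = irrep_class B \<pi>" using gns_class_vecstate cl by metis
    then obtain u where u: "intertwines B \<sigma> \<pi> u"
      using irrep_class_eq_iff[OF s(1) irr] by (auto simp: unitarily_equivalent_iff)
    have xc: "x \<in> carr (rspace \<sigma>)" using s by (simp add: unit_vectors_def)
    have "u x \<in> unit_vectors (rspace \<pi>)"
      using s(2) unitary_closed[OF intertwines_unitary[OF u] xc] unitary_hnorm[OF intertwines_unitary[OF u] xc]
      by (simp add: unit_vectors_def)
    moreover have "\<omega> = vecstate B \<pi> (u x)"
      using intertwines_vecstate[OF u irr_rep[OF s(1)] xc] s(3) by simp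
    ultimately show "\<omega> \<in> vecstate B \<pi> ` unit_vectors (rspace \<pi>)" by blast
  qed
qed

lemma spectrumE:
  assumes "c \<in> spectrum B"
  obtains \<pi> where "irreducible_rep B \<pi>" "c = irrep_class B \<pi>"
  using assms by (auto simp: spectrum_def)

lemma class_mem:
  assumes "c \<in> spectrum B" "\<pi> \<in> c"
  shows "irreducible_rep B \<pi>" "c = irrep_class B \<pi>"
proof -
  obtain \<sigma> where s: "irreducible_rep B \<sigma>" "c = irrep_class B \<sigma>" using assms(1) by (rule spectrumE)
  show irr: "irreducible_rep B \<pi>" using assms(2) s by (simp add: irrep_class_def)
  have "unitarily_equivalent B \<sigma> \<pi>" using assms(2) s by (simp add: irrep_class_def)
  then show "c = irrep_class B \<pi>" using irrep_class_eq_iff[OF s(1) irr] s(2) by blast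
qed

lemma class_self: "irreducible_rep B \<pi> \<Longrightarrow> \<pi> \<in> irrep_class B \<pi>"
  by (simp add: irrep_class_def equiv_refl irr_rep)

lemma class_spectrum: "irreducible_rep B \<pi> \<Longrightarrow> irrep_class B \<pi> \<in> spectrum B"
  by (auto simp: spectrum_def)

lemma rep_ker_equiv:
  assumes "unitarily_equivalent B \<pi> \<sigma>" "representation B \<pi>" "representation B \<sigma>"
  shows "rep_ker B \<pi> \<subseteq> rep_ker B \<sigma>"
proof
  fix a assume a: "a \<in> rep_ker B \<pi>"
  then have ac: "a \<in> carr B" by (simp add: rep_ker_def)
  obtain u where u: "intertwines B \<pi> \<sigma> u" using assms(1) by (auto simp: unitarily_equivalent_iff)
  note U = intertwines_unitary[OF u] and I = unitary_inv_into[OF intertwines_unitary[OF u] rep_hilbert[OF assms(2)]]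
  have "rop \<sigma> a y = vzero (rspace \<sigma>)" if y: "y \<in> carr (rspace \<sigma>)" for y
  proof -
    let ?x = "inv_into (carr (rspace \<pi>)) u y"
    have x: "?x \<in> carr (rspace \<pi>)" using unitary_closed[OF I(1) y] .
    have "rop \<sigma> a y = u (rop \<pi> a ?x)" using intertwines_rop[OF u ac x] I(3)[OF y] by simp
    also have "rop \<pi> a ?x = vzero (rspace \<pi>)" using a x by (simp add: rep_ker_def)
    finally show ?thesis using unitary_zero[OF U rep_hilbert[OF assms(2)] rep_hilbert[OF assms(3)]] by simp
  qed
  then show "a \<in> rep_ker B \<sigma>" using ac by (simp add: rep_ker_def)
qed

text \<open>Removes the choice in \<open>class_ker\<close>: equivalent representations have the same
  kernel.\<close>

lemma class_ker_eq:
  assumes irr: "irreducible_rep B \<pi>"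
  shows "class_ker B (irrep_class B \<pi>) = rep_ker B \<pi>"
proof -
  define \<sigma> where "\<sigma> = (SOME \<sigma>. \<sigma> \<in> irrep_class B \<pi>)"
  have "\<sigma> \<in> irrep_class B \<pi>" unfolding \<sigma>_def by (rule someI) (rule class_self[OF irr])
  then have s: "irreducible_rep B \<sigma>" "unitarily_equivalent B \<pi> \<sigma>" by (simp_all add: irrep_class_def)
  have "rep_ker B \<sigma> = rep_ker B \<pi>"
    using rep_ker_equiv[OF s(2) irr_rep[OF irr] irr_rep[OF s(1)]]
      rep_ker_equiv[OF equiv_sym[OF s(2) irr_rep[OF irr]] irr_rep[OF s(1)] irr_rep[OF irr]] by blast
  then show ?thesis by (simp add: class_ker_def \<sigma>_def[symmetric])
qed

lemma class_ker_primitive: "c \<in> spectrum B \<Longrightarrow> class_ker B c \<in> primitive_ideals B"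
  by (erule spectrumE) (auto simp: class_ker_eq primitive_ideals_def)

lemma carr_not_in_ker: "c \<in> spectrum B \<Longrightarrow> \<not> carr B \<subseteq> class_ker B c"
proof (erule spectrumE)
  fix \<pi> assume irr: "irreducible_rep B \<pi>" and c: "c = irrep_class B \<pi>"
  show "\<not> carr B \<subseteq> class_ker B c"
    using irr_nonzero[OF irr] unfolding c class_ker_eq[OF irr] by (auto simp: nonzero_on_def rep_ker_def)
qed

section \<open>The Jacobson topology and the w*-topology\<close>

lemma openin_jacobson:
  assumes "S \<subseteq> carr B"
  shows "openin (jacobson_topology B) {c \<in> spectrum B. \<not> S \<subseteq> class_ker B c}"
proof -
  let ?U = "primitive_ideals B - {P \<in> primitive_ideals B. S \<subseteq> P}"
  have "openin (hull_kernel_topology B) ?U"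
    unfolding hull_kernel_topology_def using assms by (intro topology_generated_by_Basis) auto
  moreover have "{c \<in> spectrum B. \<not> S \<subseteq> class_ker B c} = class_ker B -` ?U \<inter> spectrum B"
    using class_ker_primitive by auto
  ultimately show ?thesis
    unfolding jacobson_topology_def openin_pullback_topology by blast
qed

text \<open>The whole spectrum is the open set belonging to S = \<open>carr B\<close>, because
  irreducible representations do not vanish.\<close>

lemma topspace_jacobson [simp]: "topspace (jacobson_topology B) = spectrum B"
proof
  show "topspace (jacobson_topology B) \<subseteq> spectrum B"
    by (auto simp: jacobson_topology_def topspace_pullback_topology)
  have "openin (jacobson_topology B) {c \<in> spectrum B. \<not> carr B \<subseteq> class_ker B c}"
    by (rule openin_jacobson) simp
  then have "{c \<in> spectrum B. \<not> carr B \<subseteq> class_ker B c} \<subseteq> topspace (jacobson_topology B)"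
    by (rule openin_subset)
  then show "spectrum B \<subseteq> topspace (jacobson_topology B)" using carr_not_in_ker by auto
qed

lemma continuous_map_jacobson:
  assumes sp: "\<And>x. x \<in> topspace T \<Longrightarrow> f x \<in> spectrum B"
    and op: "\<And>S. S \<subseteq> carr B \<Longrightarrow> openin T {x \<in> topspace T. \<not> S \<subseteq> class_ker B (f x)}"
  shows "continuous_map T (jacobson_topology B) f"
  unfolding jacobson_topology_def
proof (rule continuous_map_pullback')
  show "continuous_map T (hull_kernel_topology B) (class_ker B \<circ> f)"
    unfolding hull_kernel_topology_def
  proof (rule continuous_on_generated_topo)
    fix U assume "U \<in> {primitive_ideals B - {P \<in> primitive_ideals B. S \<subseteq> P} |S. S \<subseteq> carr B}"
    then obtain S where S: "S \<subseteq> carr B" "U = primitive_ideals B - {P \<in> primitive_ideals B. S \<subseteq> P}" by auto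
    have "(class_ker B \<circ> f) -` U \<inter> topspace T = {x \<in> topspace T. \<not> S \<subseteq> class_ker B (f x)}"
      using class_ker_primitive sp by (auto simp: S)
    then show "openin T ((class_ker B \<circ> f) -` U \<inter> topspace T)" using op[OF S(1)] by simp
  next
    show "(class_ker B \<circ> f) ` topspace T \<subseteq> \<Union> {primitive_ideals B - {P \<in> primitive_ideals B. S \<subseteq> P} |S. S \<subseteq> carr B}"
    proof clarsimp
      fix x assume "x \<in> topspace T"
      then have "class_ker B (f x) \<in> primitive_ideals B - {P \<in> primitive_ideals B. carr B \<subseteq> P}"
        using sp class_ker_primitive carr_not_in_ker by auto
      then show "\<exists>X. (\<exists>S. X = primitive_ideals B - {P \<in> primitive_ideals B. S \<subseteq> P} \<and> S \<subseteq> carr B) \<and> class_ker B (f x) \<in> X"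
        by (intro exI[of _ "primitive_ideals B - {P \<in> primitive_ideals B. carr B \<subseteq> P}"]) auto
    qed
  qed
  show "topspace T \<subseteq> f -` spectrum B" using sp by auto
qed

lemma topspace_pure_state [simp]: "topspace (pure_state_topology B) = pure_states B"
proof -
  have "pure_states B \<subseteq> extensional (carr B)" using pure_extensional by blast
  then show ?thesis by (auto simp: pure_state_topology_def PiE_def)
qed

lemma continuous_map_eval: "a \<in> carr B \<Longrightarrow> continuous_map (pure_state_topology B) euclidean (\<lambda>\<omega>. \<omega> a)"
  unfolding pure_state_topology_def
  by (intro continuous_map_from_subtopology continuous_map_product_projection)

lemma continuous_map_pure_state:
  assumes f: "\<And>x. x \<in> topspace T \<Longrightarrow> f x \<in> pure_states B"
    and ev: "\<And>a. a \<in> carr B \<Longrightarrow> continuous_map T euclidean (\<lambda>x. f x a)"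
  shows "continuous_map T (pure_state_topology B) f"
  unfolding pure_state_topology_def continuous_map_in_subtopology continuous_map_componentwise
  using f ev pure_extensional by auto

lemma fiber_sel:
  "points (pure_state_fiber B c) = {\<omega> \<in> pure_states B. gns_class B \<omega> = c}"
  "atlas (pure_state_fiber B c) = {pullback_chart {\<omega> \<in> pure_states B. gns_class B \<omega> = c} (ray_of_state B \<pi>)
      (proj_chart (rspace \<pi>) \<xi>) |\<pi> \<xi>. \<pi> \<in> c \<and> \<xi> \<in> unit_vectors (rspace \<pi>)}"
  unfolding pure_state_fiber_def Let_def pullback_chart_def projective_space_def
  by auto

end

text \<open>A relation instead of a map, since the two cases run in opposite directions: for the
  ideal \<open>G\<close> is the graph of the inclusion into \<open>A\<close>, for the quotient the
  converse of the graph of the quotient map.\<close>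

locale bundle_pair = B: pure_state_alg B + A: pure_state_alg A
  for B :: "'b cstar" and A :: "'a cstar" +
  fixes G :: "('b \<times> 'a) set" and U :: "'a std_rep set set"
  assumes G_carr: "(b, a) \<in> G \<Longrightarrow> b \<in> carr B \<and> a \<in> carr A"
    and G_onto: "b \<in> carr B \<Longrightarrow> \<exists>a. (b, a) \<in> G"
    and U_spectrum: "U \<subseteq> spectrum A"
begin

text \<open>The unitary is there because standard representations of the quotient and of
  \<open>A\<close> act on spaces of different types; for an ideal the identity serves as
  witness.\<close>

definition related :: "'b std_rep \<Rightarrow> 'a std_rep \<Rightarrow> (('b \<Rightarrow> complex) \<Rightarrow> ('a \<Rightarrow> complex)) \<Rightarrow> bool" where
  "related \<sigma> \<pi> u \<longleftrightarrow> irreducible_rep B \<sigma> \<and> irreducible_rep A \<pi> \<and> irrep_class A \<pi> \<in> U \<and>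
     unitary_map (rspace \<sigma>) (rspace \<pi>) u \<and>
     (\<forall>(b, a)\<in>G. \<forall>x\<in>carr (rspace \<sigma>). u (rop \<sigma> b x) = rop \<pi> a (u x))"

lemma related_irr: "related \<sigma> \<pi> u \<Longrightarrow> irreducible_rep B \<sigma>" "related \<sigma> \<pi> u \<Longrightarrow> irreducible_rep A \<pi>"
  and related_U: "related \<sigma> \<pi> u \<Longrightarrow> irrep_class A \<pi> \<in> U"
  and related_unitary: "related \<sigma> \<pi> u \<Longrightarrow> unitary_map (rspace \<sigma>) (rspace \<pi>) u"
  and related_rop: "\<lbrakk>related \<sigma> \<pi> u; (b, a) \<in> G; x \<in> carr (rspace \<sigma>)\<rbrakk> \<Longrightarrow> u (rop \<sigma> b x) = rop \<pi> a (u x)"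
  by (auto simp: related_def)

lemma related_hilbert: "related \<sigma> \<pi> u \<Longrightarrow> hilbert_space (rspace \<sigma>)" "related \<sigma> \<pi> u \<Longrightarrow> hilbert_space (rspace \<pi>)"
  using related_irr irr_rep rep_hilbert by blast+

lemma related_inv:
  assumes "related \<sigma> \<pi> u"
  defines "w \<equiv> inv_into (carr (rspace \<sigma>)) u"
  shows "unitary_map (rspace \<pi>) (rspace \<sigma>) w" "\<And>x. x \<in> carr (rspace \<sigma>) \<Longrightarrow> w (u x) = x"
    "\<And>y. y \<in> carr (rspace \<pi>) \<Longrightarrow> u (w y) = y"
    "\<And>b a y. \<lbrakk>(b, a) \<in> G; y \<in> carr (rspace \<pi>)\<rbrakk> \<Longrightarrow> w (rop \<pi> a y) = rop \<sigma> b (w y)"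
proof -
  note U = related_unitary[OF assms(1)]
  note I = unitary_inv_into[OF U related_hilbert(1)[OF assms(1)], folded w_def]
  show "unitary_map (rspace \<pi>) (rspace \<sigma>) w" "\<And>x. x \<in> carr (rspace \<sigma>) \<Longrightarrow> w (u x) = x"
    "\<And>y. y \<in> carr (rspace \<pi>) \<Longrightarrow> u (w y) = y" by (rule I; assumption)+
  fix b a y assume ba: "(b, a) \<in> G" and y: "y \<in> carr (rspace \<pi>)"
  have wy: "w y \<in> carr (rspace \<sigma>)" using unitary_closed[OF I(1) y] .
  have "w (rop \<pi> a y) = w (u (rop \<sigma> b (w y)))"
    using related_rop[OF assms(1) ba wy] I(3)[OF y] by simp
  then show "w (rop \<pi> a y) = rop \<sigma> b (w y)"
    using I(2) rep_closed[OF irr_rep[OF related_irr(1)[OF assms(1)]] _ wy] G_carr[OF ba] by simp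
qed

lemma related_ker:
  assumes r: "related \<sigma> \<pi> u" and ba: "(b, a) \<in> G"
  shows "b \<in> rep_ker B \<sigma> \<longleftrightarrow> a \<in> rep_ker A \<pi>"
proof -
  note s = irr_rep[OF related_irr(1)[OF r]] and p = irr_rep[OF related_irr(2)[OF r]]
  note U = related_unitary[OF r] and I = related_inv[OF r]
  have c: "b \<in> carr B" "a \<in> carr A" using G_carr[OF ba] by auto
  have z: "u (vzero (rspace \<sigma>)) = vzero (rspace \<pi>)"
    "inv_into (carr (rspace \<sigma>)) u (vzero (rspace \<pi>)) = vzero (rspace \<sigma>)"
    using unitary_zero[OF U rep_hilbert[OF s] rep_hilbert[OF p]]
      unitary_zero[OF I(1) rep_hilbert[OF p] rep_hilbert[OF s]] by auto
  show ?thesis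
  proof
    assume b: "b \<in> rep_ker B \<sigma>"
    have "rop \<pi> a y = vzero (rspace \<pi>)" if y: "y \<in> carr (rspace \<pi>)" for y
    proof -
      have "inv_into (carr (rspace \<sigma>)) u (rop \<pi> a y) = vzero (rspace \<sigma>)"
        using b unitary_closed[OF I(1) y] by (simp add: I(4)[OF ba y] rep_ker_def)
      then show ?thesis using I(3)[OF rep_closed[OF p c(2) y]] z by simp
    qed
    then show "a \<in> rep_ker A \<pi>" using c by (simp add: rep_ker_def)
  next
    assume a: "a \<in> rep_ker A \<pi>"
    have "rop \<sigma> b x = vzero (rspace \<sigma>)" if x: "x \<in> carr (rspace \<sigma>)" for x
    proof -
      have "u (rop \<sigma> b x) = vzero (rspace \<pi>)"
        using a unitary_closed[OF U x] by (simp add: related_rop[OF r ba x] rep_ker_def)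
      then show ?thesis using I(2)[OF rep_closed[OF s c(1) x]] z by simp
    qed
    then show "b \<in> rep_ker B \<sigma>" using c by (simp add: rep_ker_def)
  qed
qed

end

text \<open>
  A correspondence \<open>G\<close> between two algebras that carries over to irreducible representations, pure
  states and topologies induces an isomorphism of bundles: the inclusion of an ideal and the
  quotient map are the two instances.
\<close>

locale bundle_iso = bundle_pair B A G U
  for B :: "'b cstar" and A :: "'a cstar" and G U +
  assumes lift_irrep: "irreducible_rep B \<sigma> \<Longrightarrow> \<exists>\<pi> u. related \<sigma> \<pi> u"
    and lower_irrep: "\<lbrakk>irreducible_rep A \<pi>; irrep_class A \<pi> \<in> U\<rbrakk> \<Longrightarrow> \<exists>\<sigma> u. related \<sigma> \<pi> u"
    and extend_intertwiner: "\<lbrakk>irreducible_rep A \<pi>; irrep_class A \<pi> \<in> U; irreducible_rep A \<pi>'; irrep_class A \<pi>' \<in> U;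
        unitary_map (rspace \<pi>) (rspace \<pi>') v;
        \<And>b a x. \<lbrakk>(b, a) \<in> G; x \<in> carr (rspace \<pi>)\<rbrakk> \<Longrightarrow> v (rop \<pi> a x) = rop \<pi>' a (v x)\<rbrakk>
        \<Longrightarrow> intertwines A \<pi> \<pi>' v"
    and extension_continuous: "\<lbrakk>a \<in> carr A;
        \<And>\<omega>. \<omega> \<in> pure_states B \<Longrightarrow> \<Psi> \<omega> \<in> pure_states A;
        \<And>\<omega> b a. \<lbrakk>\<omega> \<in> pure_states B; (b, a) \<in> G\<rbrakk> \<Longrightarrow> \<Psi> \<omega> a = \<omega> b\<rbrakk>
        \<Longrightarrow> continuous_map (pure_state_topology B) euclidean (\<lambda>\<omega>. \<Psi> \<omega> a)"
    and lower_hull: "S \<subseteq> carr A \<Longrightarrow>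
        \<exists>T\<subseteq>carr B. \<forall>\<sigma> \<pi> u. related \<sigma> \<pi> u \<longrightarrow> (S \<subseteq> rep_ker A \<pi> \<longleftrightarrow> T \<subseteq> rep_ker B \<sigma>)"
begin

text \<open>The intertwiner conjugated by the two unitaries is compatible with all elements of
  \<open>A\<close> that occur in \<open>G\<close>, and \<open>extend_intertwiner\<close> upgrades
  this to the whole of \<open>A\<close>.\<close>

lemma related_conj:
  assumes r: "related \<sigma> \<pi> u" and r': "related \<sigma>' \<pi>' u'" and w: "intertwines B \<sigma> \<sigma>' w"
  shows "intertwines A \<pi> \<pi>' (\<lambda>y. u' (w (inv_into (carr (rspace \<sigma>)) u y)))"
proof (rule extend_intertwiner[OF related_irr(2)[OF r] related_U[OF r] related_irr(2)[OF r'] related_U[OF r']])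
  note I = related_inv[OF r] and W = intertwines_unitary[OF w] and U' = related_unitary[OF r']
  show "unitary_map (rspace \<pi>) (rspace \<pi>') (\<lambda>y. u' (w (inv_into (carr (rspace \<sigma>)) u y)))"
    by (intro unitary_comp[OF unitary_comp[OF I(1) W] U'])
  fix b a x assume ba: "(b, a) \<in> G" and x: "x \<in> carr (rspace \<pi>)"
  let ?i = "inv_into (carr (rspace \<sigma>)) u"
  have ix: "?i x \<in> carr (rspace \<sigma>)" by (rule unitary_closed[OF I(1) x])
  have wx: "w (?i x) \<in> carr (rspace \<sigma>')" by (rule unitary_closed[OF W ix])
  have b: "b \<in> carr B" using G_carr[OF ba] by simp
  show "u' (w (?i (rop \<pi> a x))) = rop \<pi>' a (u' (w (?i x)))"
    unfolding I(4)[OF ba x] intertwines_rop[OF w b ix] related_rop[OF r' ba wx] ..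
qed

lemma related_conj_back:
  assumes r: "related \<sigma> \<pi> u" and r': "related \<sigma>' \<pi>' u'" and v: "intertwines A \<pi> \<pi>' v"
  shows "intertwines B \<sigma> \<sigma>' (\<lambda>x. inv_into (carr (rspace \<sigma>')) u' (v (u x)))"
  unfolding intertwines_def
proof (intro conjI ballI)
  note I' = related_inv[OF r'] and V = intertwines_unitary[OF v] and U = related_unitary[OF r]
  show "unitary_map (rspace \<sigma>) (rspace \<sigma>') (\<lambda>x. inv_into (carr (rspace \<sigma>')) u' (v (u x)))"
    by (intro unitary_comp[OF unitary_comp[OF U V] I'(1)])
  fix b x assume b: "b \<in> carr B" and x: "x \<in> carr (rspace \<sigma>)"
  obtain a where ba: "(b, a) \<in> G" using G_onto[OF b] by blast
  have a: "a \<in> carr A" using G_carr[OF ba] by simp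
  have ux: "u x \<in> carr (rspace \<pi>)" by (rule unitary_closed[OF U x])
  have vx: "v (u x) \<in> carr (rspace \<pi>')" by (rule unitary_closed[OF V ux])
  show "inv_into (carr (rspace \<sigma>')) u' (v (u (rop \<sigma> b x))) = rop \<sigma>' b (inv_into (carr (rspace \<sigma>')) u' (v (u x)))"
    unfolding related_rop[OF r ba x] intertwines_rop[OF v a ux] I'(4)[OF ba vx] ..
qed

text \<open>Makes the map of spectra both well defined and injective.\<close>

lemma related_class_iff:
  assumes r: "related \<sigma> \<pi> u" and r': "related \<sigma>' \<pi>' u'"
  shows "irrep_class B \<sigma> = irrep_class B \<sigma>' \<longleftrightarrow> irrep_class A \<pi> = irrep_class A \<pi>'"
  using related_conj[OF r r'] related_conj_back[OF r r']
  unfolding B.irrep_class_eq_iff[OF related_irr(1)[OF r] related_irr(1)[OF r']]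
    A.irrep_class_eq_iff[OF related_irr(2)[OF r] related_irr(2)[OF r']] unitarily_equivalent_iff
  by blast

lemma related_transfer:
  assumes r: "related \<sigma> \<pi> u" and s: "intertwines B \<sigma>' \<sigma> w" "irreducible_rep B \<sigma>'"
    and p: "intertwines A \<pi> \<pi>' v" "irreducible_rep A \<pi>'"
  shows "related \<sigma>' \<pi>' (\<lambda>x. v (u (w x)))"
  unfolding related_def
proof (intro conjI ballI)
  have "irrep_class A \<pi> = irrep_class A \<pi>'"
    using A.irrep_class_eq_iff[OF related_irr(2)[OF r] p(2)] p(1) by (auto simp: unitarily_equivalent_iff)
  then show "irrep_class A \<pi>' \<in> U" using related_U[OF r] by simp
  note W = intertwines_unitary[OF s(1)] and V = intertwines_unitary[OF p(1)] and U = related_unitary[OF r]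
  show "unitary_map (rspace \<sigma>') (rspace \<pi>') (\<lambda>x. v (u (w x)))"
    by (rule unitary_comp[OF unitary_comp[OF W U] V])
  fix ba assume "ba \<in> G"
  then obtain b a where ba: "ba = (b, a)" "(b, a) \<in> G" by (cases ba) auto
  have c: "b \<in> carr B" "a \<in> carr A" using G_carr[OF ba(2)] by auto
  have "v (u (w (rop \<sigma>' b x))) = rop \<pi>' a (v (u (w x)))" if x: "x \<in> carr (rspace \<sigma>')" for x
    unfolding intertwines_rop[OF s(1) c(1) x] related_rop[OF r ba(2) unitary_closed[OF W x]]
      intertwines_rop[OF p(1) c(2) unitary_closed[OF U unitary_closed[OF W x]]] ..
  then show "case ba of (b, a) \<Rightarrow> \<forall>x\<in>carr (rspace \<sigma>'). v (u (w (rop \<sigma>' b x))) = rop \<pi>' a (v (u (w x)))"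
    by (simp add: ba(1))
qed (use s p in auto)

section \<open>The map of spectra\<close>

definition base_map :: "'b std_rep set \<Rightarrow> 'a std_rep set" where
  "base_map c = irrep_class A (SOME \<pi>. \<exists>\<sigma>\<in>c. \<exists>u. related \<sigma> \<pi> u)"

lemma base_map_eq:
  assumes r: "related \<sigma> \<pi> u"
  shows "base_map (irrep_class B \<sigma>) = irrep_class A \<pi>"
proof -
  define \<pi>' where "\<pi>' = (SOME \<pi>. \<exists>\<sigma>'\<in>irrep_class B \<sigma>. \<exists>u. related \<sigma>' \<pi> u)"
  have "\<exists>\<sigma>'\<in>irrep_class B \<sigma>. \<exists>u. related \<sigma>' \<pi>' u"
    unfolding \<pi>'_def by (rule someI[of _ \<pi>]) (use r B.class_self[OF related_irr(1)[OF r]] in blast)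
  then obtain \<sigma>' u' where s: "\<sigma>' \<in> irrep_class B \<sigma>" and r': "related \<sigma>' \<pi>' u'" by blast
  have "irrep_class B \<sigma> = irrep_class B \<sigma>'"
    by (rule B.class_mem(2)[OF B.class_spectrum[OF related_irr(1)[OF r]] s])
  then have "irrep_class A \<pi> = irrep_class A \<pi>'" using related_class_iff[OF r r'] by blast
  moreover have "base_map (irrep_class B \<sigma>) = irrep_class A \<pi>'" unfolding base_map_def \<pi>'_def ..
  ultimately show ?thesis by simp
qed

lemma base_map_bij: "bij_betw base_map (spectrum B) U"
  unfolding bij_betw_def
proof
  show "inj_on base_map (spectrum B)"
  proof (rule inj_onI)
    fix c c' assume c: "c \<in> spectrum B" and c': "c' \<in> spectrum B" and eq: "base_map c = base_map c'"
    obtain \<sigma> where s: "irreducible_rep B \<sigma>" "c = irrep_class B \<sigma>" using c by (rule B.spectrumE)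
    obtain \<sigma>' where s': "irreducible_rep B \<sigma>'" "c' = irrep_class B \<sigma>'" using c' by (rule B.spectrumE)
    obtain \<pi> u where r: "related \<sigma> \<pi> u" using lift_irrep[OF s(1)] by blast
    obtain \<pi>' u' where r': "related \<sigma>' \<pi>' u'" using lift_irrep[OF s'(1)] by blast
    show "c = c'"
      using eq related_class_iff[OF r r'] by (simp add: s s' base_map_eq[OF r] base_map_eq[OF r'])
  qed
  show "base_map ` spectrum B = U"
  proof
    show "base_map ` spectrum B \<subseteq> U"
    proof clarify
      fix c assume "c \<in> spectrum B"
      then obtain \<sigma> where s: "irreducible_rep B \<sigma>" "c = irrep_class B \<sigma>" by (rule B.spectrumE)
      obtain \<pi> u where r: "related \<sigma> \<pi> u" using lift_irrep[OF s(1)] by blast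
      show "base_map c \<in> U" using related_U[OF r] by (simp add: s base_map_eq[OF r])
    qed
    show "U \<subseteq> base_map ` spectrum B"
    proof
      fix c assume c: "c \<in> U"
      then obtain \<pi> where p: "irreducible_rep A \<pi>" "c = irrep_class A \<pi>"
        using U_spectrum A.spectrumE by blast
      then obtain \<sigma> u where r: "related \<sigma> \<pi> u" using lower_irrep[of \<pi>] c by blast
      show "c \<in> base_map ` spectrum B"
        using base_map_eq[OF r] p B.class_spectrum[OF related_irr(1)[OF r]] by (metis imageI)
    qed
  qed
qed

section \<open>The map of pure states\<close>

definition state_map :: "('b \<Rightarrow> complex) \<Rightarrow> 'a \<Rightarrow> complex" where
  "state_map \<omega> = (SOME \<rho>. \<exists>\<sigma> \<pi> u x. related \<sigma> \<pi> u \<and> x \<in> unit_vectors (rspace \<sigma>) \<and>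
     \<omega> = vecstate B \<sigma> x \<and> \<rho> = vecstate A \<pi> (u x))"

lemma unit_carr: "x \<in> unit_vectors H \<Longrightarrow> x \<in> carr H"
  by (simp add: unit_vectors_def)

lemma unitary_unit: "\<lbrakk>unitary_map H K u; x \<in> unit_vectors H\<rbrakk> \<Longrightarrow> u x \<in> unit_vectors K"
  by (simp add: unit_vectors_def unitary_closed unitary_hnorm)

text \<open>Independence of the choices: two descriptions of one state as a vector state are linked
  by an intertwiner that takes one vector to the other, and \<open>related_conj\<close> carries it
  over to \<open>A\<close>.\<close>

lemma state_map_eq:
  assumes r: "related \<sigma> \<pi> u" and x: "x \<in> unit_vectors (rspace \<sigma>)"
  shows "state_map (vecstate B \<sigma> x) = vecstate A \<pi> (u x)"
proof -
  let ?P = "\<lambda>\<rho>. \<exists>\<sigma>' \<pi> u x'. related \<sigma>' \<pi> u \<and> x' \<in> unit_vectors (rspace \<sigma>') \<and>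
     vecstate B \<sigma> x = vecstate B \<sigma>' x' \<and> \<rho> = vecstate A \<pi> (u x')"
  have "?P (state_map (vecstate B \<sigma> x))"
    unfolding state_map_def by (rule someI[of ?P]) (use r x in blast)
  then obtain \<sigma>' \<pi>' u' x' where r': "related \<sigma>' \<pi>' u'" and x': "x' \<in> unit_vectors (rspace \<sigma>')"
    and eq: "vecstate B \<sigma> x = vecstate B \<sigma>' x'" and st: "state_map (vecstate B \<sigma> x) = vecstate A \<pi>' (u' x')"
    by blast
  note s = irr_rep[OF related_irr(1)[OF r]] and s' = irr_rep[OF related_irr(1)[OF r']]
  interpret H: hilbert_space "rspace \<sigma>" by (rule rep_hilbert[OF s])
  interpret H': hilbert_space "rspace \<sigma>'" by (rule rep_hilbert[OF s'])
  have xn: "x \<noteq> vzero (rspace \<sigma>)" "x' \<noteq> vzero (rspace \<sigma>')" using x x' by (auto simp: unit_vectors_def)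
  obtain w where w: "intertwines B \<sigma> \<sigma>' w" "w x = x'"
    using B.vecstate_intertwiner[OF s s' unit_carr[OF x] unit_carr[OF x']
      B.rep_cyclic[OF related_irr(1)[OF r] unit_carr[OF x] xn(1)]
      B.rep_cyclic[OF related_irr(1)[OF r'] unit_carr[OF x'] xn(2)] eq] by blast
  have ux: "u x \<in> carr (rspace \<pi>)" by (rule unitary_closed[OF related_unitary[OF r] unit_carr[OF x]])
  have "vecstate A \<pi>' (u' (w (inv_into (carr (rspace \<sigma>)) u (u x)))) = vecstate A \<pi> (u x)"
    by (rule intertwines_vecstate[OF related_conj[OF r r' w(1)] irr_rep[OF related_irr(2)[OF r]] ux])
  then show ?thesis using st w(2) related_inv(2)[OF r unit_carr[OF x]] by simp
qed

lemma pure_related: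
  assumes "\<omega> \<in> pure_states B"
  shows "\<exists>\<sigma> \<pi> u x. related \<sigma> \<pi> u \<and> x \<in> unit_vectors (rspace \<sigma>) \<and> \<omega> = vecstate B \<sigma> x"
  using B.pure_vecstate[OF assms] lift_irrep by blast

lemma state_map_pure:
  assumes w: "\<omega> \<in> pure_states B"
  shows "state_map \<omega> \<in> pure_states A" "gns_class A (state_map \<omega>) = base_map (gns_class B \<omega>)"
    "gns_class A (state_map \<omega>) \<in> U" "\<And>b a. (b, a) \<in> G \<Longrightarrow> state_map \<omega> a = \<omega> b"
proof -
  obtain \<sigma> \<pi> u x where r: "related \<sigma> \<pi> u" and x: "x \<in> unit_vectors (rspace \<sigma>)" and wx: "\<omega> = vecstate B \<sigma> x"
    using pure_related[OF w] by blast
  have ux: "u x \<in> unit_vectors (rspace \<pi>)" by (rule unitary_unit[OF related_unitary[OF r] x])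
  have eq: "state_map \<omega> = vecstate A \<pi> (u x)" unfolding wx by (rule state_map_eq[OF r x])
  show "state_map \<omega> \<in> pure_states A" unfolding eq by (rule A.vecstate_pure[OF related_irr(2)[OF r] ux])
  have cl: "gns_class A (state_map \<omega>) = irrep_class A \<pi>"
    unfolding eq by (rule A.gns_class_vecstate[OF related_irr(2)[OF r] ux])
  show "gns_class A (state_map \<omega>) \<in> U" using cl related_U[OF r] by simp
  show "gns_class A (state_map \<omega>) = base_map (gns_class B \<omega>)"
    unfolding cl unfolding wx B.gns_class_vecstate[OF related_irr(1)[OF r] x] base_map_eq[OF r] ..
  fix b a assume ba: "(b, a) \<in> G"
  have c: "b \<in> carr B" "a \<in> carr A" using G_carr[OF ba] by auto
  show "state_map \<omega> a = \<omega> b"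
    using c unfolding eq unfolding wx
    by (simp add: vecstate_def related_rop[OF r ba unit_carr[OF x], symmetric]
        unitary_inn[OF related_unitary[OF r]] unit_carr[OF x] rep_closed[OF irr_rep[OF related_irr(1)[OF r]]])
qed

definition total_image :: "('a \<Rightarrow> complex) set" where
  "total_image = {\<rho> \<in> pure_states A. gns_class A \<rho> \<in> U}"

lemma state_map_bij: "bij_betw state_map (pure_states B) total_image"
  unfolding bij_betw_def
proof
  show "inj_on state_map (pure_states B)"
  proof (rule inj_onI)
    fix \<omega> \<omega>' assume w: "\<omega> \<in> pure_states B" "\<omega>' \<in> pure_states B" and eq: "state_map \<omega> = state_map \<omega>'"
    show "\<omega> = \<omega>'"
    proof (rule extensionalityI[OF B.pure_extensional[OF w(1)] B.pure_extensional[OF w(2)]])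
      fix b assume "b \<in> carr B"
      then obtain a where "(b, a) \<in> G" using G_onto by blast
      then show "\<omega> b = \<omega>' b" using state_map_pure(4)[OF w(1)] state_map_pure(4)[OF w(2)] eq by metis
    qed
  qed
  show "state_map ` pure_states B = total_image"
  proof
    show "state_map ` pure_states B \<subseteq> total_image"
      using state_map_pure by (auto simp: total_image_def)
    show "total_image \<subseteq> state_map ` pure_states B"
    proof
      fix \<rho> assume "\<rho> \<in> total_image"
      then have rp: "\<rho> \<in> pure_states A" and rU: "gns_class A \<rho> \<in> U" by (auto simp: total_image_def)
      obtain \<pi> :: "'a std_rep" and y where p: "irreducible_rep A \<pi>" "y \<in> unit_vectors (rspace \<pi>)" "\<rho> = vecstate A \<pi> y"
        using A.pure_vecstate[OF rp] by blast
      then have "irrep_class A \<pi> \<in> U" using A.gns_class_vecstate rU by metis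
      then obtain \<sigma> u where r: "related \<sigma> \<pi> u" using lower_irrep[OF p(1)] by blast
      let ?x = "inv_into (carr (rspace \<sigma>)) u y"
      have x: "?x \<in> unit_vectors (rspace \<sigma>)" by (rule unitary_unit[OF related_inv(1)[OF r] p(2)])
      have "state_map (vecstate B \<sigma> ?x) = \<rho>"
        using state_map_eq[OF r x] related_inv(3)[OF r unit_carr[OF p(2)]] p(3) by simp
      then show "\<rho> \<in> state_map ` pure_states B" using B.vecstate_pure[OF related_irr(1)[OF r] x] by blast
    qed
  qed
qed

text \<open>Continuity of the inverse is formal, as the inverse evaluates a state at a related
  element; the forward direction is \<open>extension_continuous\<close>.\<close>

lemma state_map_homeomorphic:
  "homeomorphic_map (pure_state_topology B) (subtopology (pure_state_topology A) total_image) state_map"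
proof -
  let ?g = "inv_into (pure_states B) state_map"
  have ti: "total_image \<subseteq> pure_states A" by (auto simp: total_image_def)
  note bij = state_map_bij
  have g: "?g \<rho> \<in> pure_states B" "state_map (?g \<rho>) = \<rho>" if "\<rho> \<in> total_image" for \<rho>
    using that bij by (auto simp: bij_betw_def inv_into_into f_inv_into_f)
  have "continuous_map (pure_state_topology B) (pure_state_topology A) state_map"
    by (rule A.continuous_map_pure_state)
      (use state_map_pure extension_continuous[of _ state_map] in auto)
  then have 1: "continuous_map (pure_state_topology B) (subtopology (pure_state_topology A) total_image) state_map"
    using state_map_pure by (auto simp: continuous_map_in_subtopology total_image_def)
  have 2: "continuous_map (subtopology (pure_state_topology A) total_image) (pure_state_topology B) ?g"
  proof (rule B.continuous_map_pure_state)
    fix b assume "b \<in> carr B"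
    then obtain a where ba: "(b, a) \<in> G" using G_onto by blast
    have "continuous_map (subtopology (pure_state_topology A) total_image) euclidean (\<lambda>\<rho>. \<rho> a)"
      using G_carr[OF ba] by (intro continuous_map_from_subtopology A.continuous_map_eval) simp
    then show "continuous_map (subtopology (pure_state_topology A) total_image) euclidean (\<lambda>\<rho>. ?g \<rho> b)"
    proof (rule continuous_map_eq)
      fix \<rho> assume "\<rho> \<in> topspace (subtopology (pure_state_topology A) total_image)"
      then have "\<rho> \<in> total_image" by simp
      then show "\<rho> a = ?g \<rho> b" using g state_map_pure(4)[OF g(1) ba] by metis
    qed
  qed (use g in auto)
  have "homeomorphic_maps (pure_state_topology B) (subtopology (pure_state_topology A) total_image) state_map ?g"
    unfolding homeomorphic_maps_def using 1 2 g bij by (auto simp: bij_betw_def)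
  then show ?thesis by (auto simp: homeomorphic_map_maps)
qed

lemma class_ker_related:
  assumes r: "related \<sigma> \<pi> u"
  shows "class_ker B (irrep_class B \<sigma>) = rep_ker B \<sigma>" "class_ker A (base_map (irrep_class B \<sigma>)) = rep_ker A \<pi>"
  using B.class_ker_eq[OF related_irr(1)[OF r]] A.class_ker_eq[OF related_irr(2)[OF r]]
  by (simp_all add: base_map_eq[OF r])

text \<open>Both directions compare hulls: \<open>lower_hull\<close> provides the set needed for
  \<open>base_map\<close>, the image under \<open>G\<close> the one for its inverse.\<close>

lemma base_map_homeomorphic:
  "homeomorphic_map (jacobson_topology B) (subtopology (jacobson_topology A) U) base_map"
proof -
  let ?g = "inv_into (spectrum B) base_map"
  note bij = base_map_bij
  have g: "?g c \<in> spectrum B" "base_map (?g c) = c" if "c \<in> U" for c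
    using that bij by (auto simp: bij_betw_def inv_into_into f_inv_into_f)
  have bm: "base_map c \<in> U" if "c \<in> spectrum B" for c using that bij by (auto simp: bij_betw_def)
  have rel: "\<exists>\<sigma> \<pi> u. related \<sigma> \<pi> u \<and> c = irrep_class B \<sigma>" if "c \<in> spectrum B" for c
    using B.spectrumE[OF that] lift_irrep by metis
  have "continuous_map (jacobson_topology B) (jacobson_topology A) base_map"
  proof (rule A.continuous_map_jacobson)
    fix S assume "S \<subseteq> carr A"
    then obtain T where T: "T \<subseteq> carr B"
      and eq: "\<And>\<sigma> \<pi> u. related \<sigma> \<pi> u \<Longrightarrow> S \<subseteq> rep_ker A \<pi> \<longleftrightarrow> T \<subseteq> rep_ker B \<sigma>"
      using lower_hull by metis
    have "S \<subseteq> class_ker A (base_map c) \<longleftrightarrow> T \<subseteq> class_ker B c" if c: "c \<in> spectrum B" for c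
    proof -
      obtain \<sigma> \<pi> u where "related \<sigma> \<pi> u" "c = irrep_class B \<sigma>" using rel[OF c] by blast
      then show ?thesis using class_ker_related eq by metis
    qed
    then have "{c \<in> topspace (jacobson_topology B). \<not> S \<subseteq> class_ker A (base_map c)} = {c \<in> spectrum B. \<not> T \<subseteq> class_ker B c}"
      by auto
    then show "openin (jacobson_topology B) {c \<in> topspace (jacobson_topology B). \<not> S \<subseteq> class_ker A (base_map c)}"
      using B.openin_jacobson[OF T] by simp
  qed (use bm U_spectrum in auto)
  then have 1: "continuous_map (jacobson_topology B) (subtopology (jacobson_topology A) U) base_map"
    using bm by (auto simp: continuous_map_in_subtopology)
  have 2: "continuous_map (subtopology (jacobson_topology A) U) (jacobson_topology B) ?g"
  proof (rule B.continuous_map_jacobson)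
    fix S assume S: "S \<subseteq> carr B"
    define T where "T = {a. \<exists>b\<in>S. (b, a) \<in> G}"
    have T: "T \<subseteq> carr A" using G_carr by (auto simp: T_def)
    have "S \<subseteq> class_ker B (?g c) \<longleftrightarrow> T \<subseteq> class_ker A c" if c: "c \<in> U" for c
    proof -
      obtain \<sigma> \<pi> u where r: "related \<sigma> \<pi> u" and gc: "?g c = irrep_class B \<sigma>" using rel[OF g(1)[OF c]] by blast
      have k: "class_ker B (?g c) = rep_ker B \<sigma>" "class_ker A c = rep_ker A \<pi>"
        using class_ker_related[OF r] g(2)[OF c] gc by simp_all
      show ?thesis
        unfolding k T_def
      proof
        assume *: "S \<subseteq> rep_ker B \<sigma>"
        show "{a. \<exists>b\<in>S. (b, a) \<in> G} \<subseteq> rep_ker A \<pi>" using * related_ker[OF r] by blast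
      next
        assume *: "{a. \<exists>b\<in>S. (b, a) \<in> G} \<subseteq> rep_ker A \<pi>"
        show "S \<subseteq> rep_ker B \<sigma>"
        proof
          fix b assume b: "b \<in> S"
          then obtain a where "(b, a) \<in> G" using G_onto S by blast
          then show "b \<in> rep_ker B \<sigma>" using * b related_ker[OF r] by blast
        qed
      qed
    qed
    then have "{c \<in> topspace (subtopology (jacobson_topology A) U). \<not> S \<subseteq> class_ker B (?g c)} =
        U \<inter> {c \<in> spectrum A. \<not> T \<subseteq> class_ker A c}"
      by auto
    then show "openin (subtopology (jacobson_topology A) U)
        {c \<in> topspace (subtopology (jacobson_topology A) U). \<not> S \<subseteq> class_ker B (?g c)}"
      using A.openin_jacobson[OF T] by (auto simp: openin_subtopology_Int2)
  qed (use g in auto)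
  have "homeomorphic_maps (jacobson_topology B) (subtopology (jacobson_topology A) U) base_map ?g"
    unfolding homeomorphic_maps_def using 1 2 g bij by (auto simp: bij_betw_def)
  then show ?thesis by (auto simp: homeomorphic_map_maps)
qed

text \<open>The atlases contain charts from all representatives, so the state map has to be
  described in every pair of charts. The unitary depends on \<sigma> and \<pi>, the state map does
  not.\<close>

lemma fiber_charts:
  assumes c: "c \<in> spectrum B" and s: "\<sigma> \<in> c" and p: "\<pi> \<in> base_map c"
    and xi: "\<xi> \<in> unit_vectors (rspace \<sigma>)" and eta: "\<eta> \<in> unit_vectors (rspace \<pi>)"
  defines "F \<equiv> {\<omega> \<in> pure_states B. gns_class B \<omega> = c}"
    and "F' \<equiv> {\<omega> \<in> pure_states A. gns_class A \<omega> = base_map c}"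
  shows "\<exists>u. unitary_chart_map (rspace \<sigma>) (rspace \<pi>) u F (ray_of_state B \<sigma>) F' (ray_of_state A \<pi>) state_map \<xi> \<eta>"
    "\<exists>u. unitary_chart_map (rspace \<pi>) (rspace \<sigma>) u F' (ray_of_state A \<pi>) F (ray_of_state B \<sigma>)
       (inv_into F state_map) \<eta> \<xi>"
    "bij_betw state_map F F'"
proof -
  have si: "irreducible_rep B \<sigma>" and sc: "c = irrep_class B \<sigma>" using B.class_mem[OF c s] by auto
  have bmU: "base_map c \<in> U" using c base_map_bij by (auto simp: bij_betw_def)
  then have bms: "base_map c \<in> spectrum A" using U_spectrum by blast
  have pi: "irreducible_rep A \<pi>" and pc: "base_map c = irrep_class A \<pi>" using A.class_mem[OF bms p] by auto
  obtain \<pi>0 u0 where r0: "related \<sigma> \<pi>0 u0" using lift_irrep[OF si] by blast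
  have "irrep_class A \<pi>0 = irrep_class A \<pi>" using base_map_eq[OF r0] sc pc by simp
  then obtain v where v: "intertwines A \<pi>0 \<pi> v"
    using A.irrep_class_eq_iff[OF related_irr(2)[OF r0] pi] by (auto simp: unitarily_equivalent_iff)
  \<comment> \<open>Some representation is related to \<sigma>; following its unitary by an
    equivalence reaches the given \<pi>.\<close>
  define u where "u x = v (u0 x)" for x
  have r: "related \<sigma> \<pi> u"
    using related_transfer[OF r0 intertwines_id[OF irr_rep[OF si]] si v pi] by (simp add: u_def[abs_def])
  have F: "F = vecstate B \<sigma> ` unit_vectors (rspace \<sigma>)"
    unfolding F_def sc by (rule B.fiber_points[OF si])
  have F': "F' = vecstate A \<pi> ` unit_vectors (rspace \<pi>)"
    unfolding F'_def pc by (rule A.fiber_points[OF pi])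
  have rayB: "ray_of_state B \<sigma> (vecstate B \<sigma> x) = ray (rspace \<sigma>) x" if "x \<in> unit_vectors (rspace \<sigma>)" for x
    by (rule B.ray_of_state_vecstate[OF si that])
  have rayA: "ray_of_state A \<pi> (vecstate A \<pi> x) = ray (rspace \<pi>) x" if "x \<in> unit_vectors (rspace \<pi>)" for x
    by (rule A.ray_of_state_vecstate[OF pi that])
  note U = related_unitary[OF r] and I = related_inv[OF r]
  let ?w = "inv_into (carr (rspace \<sigma>)) u"
  have inj: "inj_on state_map F"
    using state_map_bij inj_on_subset[of state_map "pure_states B" F] by (auto simp: F_def bij_betw_def)
  have inv: "inv_into F state_map (vecstate A \<pi> y) = vecstate B \<sigma> (?w y)" "vecstate B \<sigma> (?w y) \<in> F"
    if y: "y \<in> unit_vectors (rspace \<pi>)" for y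
  proof -
    have wy: "?w y \<in> unit_vectors (rspace \<sigma>)" by (rule unitary_unit[OF I(1) y])
    then show mem: "vecstate B \<sigma> (?w y) \<in> F" by (simp add: F)
    have "state_map (vecstate B \<sigma> (?w y)) = vecstate A \<pi> y"
      using state_map_eq[OF r wy] I(3)[OF unit_carr[OF y]] by simp
    then show "inv_into F state_map (vecstate A \<pi> y) = vecstate B \<sigma> (?w y)"
      using inv_into_f_f[OF inj mem] by simp
  qed
  show "bij_betw state_map F F'"
    unfolding bij_betw_def
  proof (intro conjI inj)
    show "state_map ` F = F'"
    proof
      show "state_map ` F \<subseteq> F'" using state_map_eq[OF r] unitary_unit[OF U] by (auto simp: F F')
      show "F' \<subseteq> state_map ` F"
      proof
        fix \<rho> assume "\<rho> \<in> F'"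
        then obtain y where y: "y \<in> unit_vectors (rspace \<pi>)" "\<rho> = vecstate A \<pi> y" by (auto simp: F')
        have "state_map (vecstate B \<sigma> (?w y)) = \<rho>"
          using state_map_eq[OF r unitary_unit[OF I(1) y(1)]] I(3)[OF unit_carr[OF y(1)]] y(2) by simp
        then show "\<rho> \<in> state_map ` F" using inv(2)[OF y(1)] by blast
      qed
    qed
  qed
  have H: "hilbert_space (rspace \<sigma>)" and K: "hilbert_space (rspace \<pi>)" using related_hilbert[OF r] by auto
  have "unitary_chart_map (rspace \<sigma>) (rspace \<pi>) u F (ray_of_state B \<sigma>) F' (ray_of_state A \<pi>) state_map \<xi> \<eta>"
    unfolding unitary_chart_map_def unitary_chart_map_axioms_def
  proof (intro conjI allI impI H K U xi eta)
    fix q assume q: "q \<in> F"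
    then obtain y where y: "y \<in> unit_vectors (rspace \<sigma>)" "q = vecstate B \<sigma> y" by (auto simp: F)
    then show "\<exists>x\<in>unit_vectors (rspace \<sigma>). ray_of_state B \<sigma> q = ray (rspace \<sigma>) x" using rayB by blast
    show "state_map q \<in> F'" using state_map_eq[OF r y(1)] unitary_unit[OF U y(1)] y(2) by (simp add: F')
    fix x assume x: "x \<in> unit_vectors (rspace \<sigma>)" and "ray_of_state B \<sigma> q = ray (rspace \<sigma>) x"
    then have "ray (rspace \<sigma>) x = ray (rspace \<sigma>) y" using rayB[OF y(1)] y(2) by simp
    then have "q = vecstate B \<sigma> x" using B.vecstate_of_ray[OF si x y(1)] y(2) by simp
    then show "ray_of_state A \<pi> (state_map q) = ray (rspace \<pi>) (u x)"
      using state_map_eq[OF r x] rayA[OF unitary_unit[OF U x]] by simp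
  next
    fix x assume x: "x \<in> unit_vectors (rspace \<sigma>)"
    then show "\<exists>q\<in>F. ray_of_state B \<sigma> q = ray (rspace \<sigma>) x" using rayB by (auto simp: F)
  qed
  then show "\<exists>u. unitary_chart_map (rspace \<sigma>) (rspace \<pi>) u F (ray_of_state B \<sigma>) F' (ray_of_state A \<pi>) state_map \<xi> \<eta>"
    by blast
  have "unitary_chart_map (rspace \<pi>) (rspace \<sigma>) ?w F' (ray_of_state A \<pi>) F (ray_of_state B \<sigma>) (inv_into F state_map) \<eta> \<xi>"
    unfolding unitary_chart_map_def unitary_chart_map_axioms_def
  proof (intro conjI allI impI H K I(1) xi eta)
    fix q assume q: "q \<in> F'"
    then obtain y where y: "y \<in> unit_vectors (rspace \<pi>)" "q = vecstate A \<pi> y" by (auto simp: F')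
    then show "\<exists>x\<in>unit_vectors (rspace \<pi>). ray_of_state A \<pi> q = ray (rspace \<pi>) x" using rayA by blast
    show "inv_into F state_map q \<in> F" using inv[OF y(1)] y(2) by simp
    fix x assume x: "x \<in> unit_vectors (rspace \<pi>)" and "ray_of_state A \<pi> q = ray (rspace \<pi>) x"
    then have "ray (rspace \<pi>) x = ray (rspace \<pi>) y" using rayA[OF y(1)] y(2) by simp
    then have "q = vecstate A \<pi> x" using A.vecstate_of_ray[OF pi x y(1)] y(2) by simp
    then show "ray_of_state B \<sigma> (inv_into F state_map q) = ray (rspace \<sigma>) (?w x)"
      using inv[OF x] rayB[OF unitary_unit[OF I(1) x]] by simp
  next
    fix x assume x: "x \<in> unit_vectors (rspace \<pi>)"
    then show "\<exists>q\<in>F'. ray_of_state A \<pi> q = ray (rspace \<pi>) x" using rayA by (auto simp: F')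
  qed
  then show "\<exists>u. unitary_chart_map (rspace \<pi>) (rspace \<sigma>) u F' (ray_of_state A \<pi>) F (ray_of_state B \<sigma>)
       (inv_into F state_map) \<eta> \<xi>" by blast
qed

lemma fiber_isometry:
  assumes c: "c \<in> spectrum B"
  shows "holomorphic_kaehler_isometry (pure_state_fiber B c) (pure_state_fiber A (base_map c)) state_map"
proof -
  let ?F = "{\<omega> \<in> pure_states B. gns_class B \<omega> = c}" and ?F' = "{\<omega> \<in> pure_states A. gns_class A \<omega> = base_map c}"
  obtain \<sigma>0 where s0: "irreducible_rep B \<sigma>0" "c = irrep_class B \<sigma>0" using c by (rule B.spectrumE)
  then have s0c: "\<sigma>0 \<in> c" using B.class_self by blast
  obtain \<pi>0 u0 where r0: "related \<sigma>0 \<pi>0 u0" using lift_irrep[OF s0(1)] by blast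
  have p0c: "\<pi>0 \<in> base_map c" using A.class_self[OF related_irr(2)[OF r0]] by (simp add: s0(2) base_map_eq[OF r0])
  \<comment> \<open>Bijectivity is stated in \<open>fiber_charts\<close> for a pair of charts, so
    one such pair has to exist.\<close>
  obtain \<xi>0 \<eta>0 where "\<xi>0 \<in> unit_vectors (rspace \<sigma>0)" "\<eta>0 \<in> unit_vectors (rspace \<pi>0)"
    using B.irr_nontrivial[OF s0(1)] A.irr_nontrivial[OF related_irr(2)[OF r0]] by blast
  then have bij: "bij_betw state_map ?F ?F'" using fiber_charts(3)[OF c s0c p0c] by blast
  show ?thesis
    unfolding holomorphic_kaehler_isometry_def holomorphic_map_def B.fiber_sel A.fiber_sel
  proof (intro conjI ballI allI impI)
    show "bij_betw state_map ?F ?F'" by (rule bij)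
    show "state_map p \<in> ?F'" if "p \<in> ?F" for p using that bij by (rule bij_betw_apply[rotated])
    show "inv_into ?F state_map p \<in> ?F" if "p \<in> ?F'" for p
      using that bij_betw_inv_into[OF bij] by (rule bij_betw_apply[rotated])
  next
    fix p c1 c2
    assume "c1 \<in> {pullback_chart ?F (ray_of_state B \<pi>) (proj_chart (rspace \<pi>) \<xi>) |\<pi> \<xi>. \<pi> \<in> c \<and> \<xi> \<in> unit_vectors (rspace \<pi>)}"
      and "c2 \<in> {pullback_chart ?F' (ray_of_state A \<pi>) (proj_chart (rspace \<pi>) \<xi>) |\<pi> \<xi>. \<pi> \<in> base_map c \<and> \<xi> \<in> unit_vectors (rspace \<pi>)}"
      and d: "p \<in> cdom c1 \<and> state_map p \<in> cdom c2"
    then obtain \<sigma> \<xi> \<pi> \<eta> where s: "\<sigma> \<in> c" "\<xi> \<in> unit_vectors (rspace \<sigma>)" "\<pi> \<in> base_map c" "\<eta> \<in> unit_vectors (rspace \<pi>)"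
      and cc: "c1 = pullback_chart ?F (ray_of_state B \<sigma>) (proj_chart (rspace \<sigma>) \<xi>)"
        "c2 = pullback_chart ?F' (ray_of_state A \<pi>) (proj_chart (rspace \<pi>) \<eta>)"
      by blast
    obtain u where "unitary_chart_map (rspace \<sigma>) (rspace \<pi>) u ?F (ray_of_state B \<sigma>) ?F' (ray_of_state A \<pi>) state_map \<xi> \<eta>"
      using fiber_charts(1)[OF c s(1,3,2,4)] by blast
    then interpret unitary_chart_map "rspace \<sigma>" "rspace \<pi>" u ?F "ray_of_state B \<sigma>" ?F' "ray_of_state A \<pi>" state_map \<xi> \<eta> .
    show "\<exists>L. chart_derivative c1 c2 state_map p L"
      using tangent_derivative d unfolding cc by blast
  next
    fix p c1 c2
    assume "c1 \<in> {pullback_chart ?F' (ray_of_state A \<pi>) (proj_chart (rspace \<pi>) \<xi>) |\<pi> \<xi>. \<pi> \<in> base_map c \<and> \<xi> \<in> unit_vectors (rspace \<pi>)}"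
      and "c2 \<in> {pullback_chart ?F (ray_of_state B \<pi>) (proj_chart (rspace \<pi>) \<xi>) |\<pi> \<xi>. \<pi> \<in> c \<and> \<xi> \<in> unit_vectors (rspace \<pi>)}"
      and d: "p \<in> cdom c1 \<and> inv_into ?F state_map p \<in> cdom c2"
    then obtain \<sigma> \<xi> \<pi> \<eta> where s: "\<sigma> \<in> c" "\<xi> \<in> unit_vectors (rspace \<sigma>)" "\<pi> \<in> base_map c" "\<eta> \<in> unit_vectors (rspace \<pi>)"
      and cc: "c2 = pullback_chart ?F (ray_of_state B \<sigma>) (proj_chart (rspace \<sigma>) \<xi>)"
        "c1 = pullback_chart ?F' (ray_of_state A \<pi>) (proj_chart (rspace \<pi>) \<eta>)"
      by blast
    obtain u where "unitary_chart_map (rspace \<pi>) (rspace \<sigma>) u ?F' (ray_of_state A \<pi>) ?F (ray_of_state B \<sigma>)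
        (inv_into ?F state_map) \<eta> \<xi>"
      using fiber_charts(2)[OF c s(1,3,2,4)] by blast
    then interpret unitary_chart_map "rspace \<pi>" "rspace \<sigma>" u ?F' "ray_of_state A \<pi>" ?F "ray_of_state B \<sigma>"
        "inv_into ?F state_map" \<eta> \<xi> .
    show "\<exists>L. chart_derivative c1 c2 (inv_into ?F state_map) p L"
      using tangent_derivative d unfolding cc by blast
  next
    fix p c1 c2 L v w
    assume "c1 \<in> {pullback_chart ?F (ray_of_state B \<pi>) (proj_chart (rspace \<pi>) \<xi>) |\<pi> \<xi>. \<pi> \<in> c \<and> \<xi> \<in> unit_vectors (rspace \<pi>)}"
      and "c2 \<in> {pullback_chart ?F' (ray_of_state A \<pi>) (proj_chart (rspace \<pi>) \<xi>) |\<pi> \<xi>. \<pi> \<in> base_map c \<and> \<xi> \<in> unit_vectors (rspace \<pi>)}"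
      and d: "p \<in> cdom c1 \<and> state_map p \<in> cdom c2 \<and> chart_derivative c1 c2 state_map p L"
      and v: "v \<in> carr (cmodel c1)" and w: "w \<in> carr (cmodel c1)"
    then obtain \<sigma> \<xi> \<pi> \<eta> where s: "\<sigma> \<in> c" "\<xi> \<in> unit_vectors (rspace \<sigma>)" "\<pi> \<in> base_map c" "\<eta> \<in> unit_vectors (rspace \<pi>)"
      and cc: "c1 = pullback_chart ?F (ray_of_state B \<sigma>) (proj_chart (rspace \<sigma>) \<xi>)"
        "c2 = pullback_chart ?F' (ray_of_state A \<pi>) (proj_chart (rspace \<pi>) \<eta>)"
      by blast
    obtain u where "unitary_chart_map (rspace \<sigma>) (rspace \<pi>) u ?F (ray_of_state B \<sigma>) ?F' (ray_of_state A \<pi>) state_map \<xi> \<eta>"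
      using fiber_charts(1)[OF c s(1,3,2,4)] by blast
    then interpret M: unitary_chart_map "rspace \<sigma>" "rspace \<pi>" u ?F "ray_of_state B \<sigma>" ?F' "ray_of_state A \<pi>" state_map \<xi> \<eta> .
    have pd: "p \<in> cdom M.c1" "state_map p \<in> cdom M.c2" and L: "chart_derivative M.c1 M.c2 state_map p L"
      using d unfolding cc by auto
    have v': "v \<in> carr (orth_compl (rspace \<sigma>) \<xi>)" and w': "w \<in> carr (orth_compl (rspace \<sigma>) \<xi>)"
      using v w unfolding cc M.chart_sel by auto
    show "cmetric c2 (cmap c2 (state_map p)) (L v) (L w) = cmetric c1 (cmap c1 p) v w"
      unfolding cc M.chart_sel M.derivative_unique[OF pd L v'] M.derivative_unique[OF pd L w']
      by (rule M.tangent_isometry[OF pd v' w'])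
  qed
qed

theorem bundle_isomorphic: "uniformly_kaehler_isomorphic (ukb B) (restrict_bundle (ukb A) U)"
  unfolding uniformly_kaehler_isomorphic_def uniform_kaehler_isomorphism_def
proof (intro exI conjI ballI)
  have ti: "{e \<in> topspace (total (ukb A)). proj (ukb A) e \<in> U} = total_image"
    by (simp add: ukb_def total_image_def)
  show "homeomorphic_map (total (ukb B)) (total (restrict_bundle (ukb A) U)) state_map"
    using state_map_homeomorphic by (simp add: restrict_bundle_def ukb_def total_image_def)
  show "homeomorphic_map (base (ukb B)) (base (restrict_bundle (ukb A) U)) base_map"
    using base_map_homeomorphic by (simp add: restrict_bundle_def ukb_def)
  show "proj (restrict_bundle (ukb A) U) (state_map e) = base_map (proj (ukb B) e)"
    if "e \<in> topspace (total (ukb B))" for e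
    using that state_map_pure(2) by (simp add: restrict_bundle_def ukb_def)
  show "holomorphic_kaehler_isometry (fiber (ukb B) x) (fiber (restrict_bundle (ukb A) U) (base_map x)) state_map"
    if "x \<in> topspace (base (ukb B))" for x
    using that fiber_isometry by (simp add: restrict_bundle_def ukb_def)
qed

end

section \<open>The bundle of a closed ideal\<close>

lemma cstar_pure_state_alg:
  assumes "cstar_algebra A"
  shows "pure_state_alg A"
proof -
  interpret cstar_algebra A by fact
  show ?thesis
    by unfold_locales (rule pure_state_vector irreducible_vecstate_pure; assumption)+
qed

text \<open>The support condition does not depend on the representative, since the kernel is an
  invariant of the class.\<close>

lemma (in pure_state_alg) spectrum_supp_iff:
  assumes irr: "irreducible_rep B \<pi>" and I: "I \<subseteq> carr B"
  shows "irrep_class B \<pi> \<in> spectrum_supp B I \<longleftrightarrow> \<not> I \<subseteq> rep_ker B \<pi>"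
proof -
  have nz: "nonzero_on I \<sigma> \<longleftrightarrow> \<not> I \<subseteq> rep_ker B \<sigma>" for \<sigma> :: "'b std_rep"
    using I by (auto simp: nonzero_on_def rep_ker_def)
  show ?thesis
  proof
    assume "irrep_class B \<pi> \<in> spectrum_supp B I"
    then obtain \<sigma> where "irrep_class B \<pi> = irrep_class B \<sigma>" "irreducible_rep B \<sigma>" "nonzero_on I \<sigma>"
      by (auto simp: spectrum_supp_def)
    then show "\<not> I \<subseteq> rep_ker B \<pi>" using class_ker_eq irr nz by metis
  next
    assume "\<not> I \<subseteq> rep_ker B \<pi>"
    then show "irrep_class B \<pi> \<in> spectrum_supp B I" using irr nz by (auto simp: spectrum_supp_def)
  qed
qed

context cstar_algebra
begin

lemma ideal_restrict_rep:
  assumes I: "closed_ideal A I" and r: "representation A \<pi>"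
  shows "representation (ideal_algebra A I) \<pi>"
  using r ideal_carr[OF I] by (auto simp: representation_def)

text \<open>For a closed \<open>I\<close>-invariant \<open>W\<close> the complement of \<pi>(I)W is
  invariant under \<open>A\<close>. If it is zero, \<open>W\<close> is everything, because \<pi>(I)W
  is contained in \<open>W\<close>. If it is everything, \<pi>(I) annihilates \<open>W\<close>, so
  \<open>W\<close> is orthogonal to \<pi>(I)H, which is total because \<pi>(I) is nonzero.\<close>

lemma ideal_restrict_irr:
  assumes I: "closed_ideal A I" and irr: "irreducible_rep A \<pi>" and nz: "\<not> I \<subseteq> rep_ker A \<pi>"
  shows "irreducible_rep (ideal_algebra A I) \<pi>"
proof -
  let ?H = "rspace \<pi>"
  note r = irr_rep[OF irr] and IA = ideal_carr[OF I]
  interpret H: hilbert_space ?H by (rule rep_hilbert[OF r])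
  note [simp] = rep_closed[OF r]
  have Im: "mul A a i \<in> I" "mul A i a \<in> I" if "a \<in> carr A" "i \<in> I" for a i
    using I that by (auto simp: closed_ideal_def)
  have Is: "star A i \<in> I" if "i \<in> I" for i by (rule ideal_star[OF I that])
  have nz': "nonzero_on I \<pi>" using nz IA by (auto simp: nonzero_on_def rep_ker_def)
  then obtain i0 w0 where i0: "i0 \<in> I" "w0 \<in> carr ?H" "rop \<pi> i0 w0 \<noteq> vzero ?H"
    by (auto simp: nonzero_on_def)
  have "W = {vzero ?H} \<or> W = carr ?H"
    if W: "subspace_of ?H W" "closedin (norm_topology ?H (hnorm ?H)) W" and inv: "\<forall>a\<in>I. rop \<pi> a ` W \<subseteq> W" for W
  proof -
    have Wc: "w \<in> carr ?H" if "w \<in> W" for w using W(1) that by (auto simp: subspace_of_def)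
    have Winv: "rop \<pi> i w \<in> W" if "i \<in> I" "w \<in> W" for i w using inv that by blast
    define S where "S = {rop \<pi> i w |i w. i \<in> I \<and> w \<in> W}"
    have S: "S \<subseteq> carr ?H" using IA Wc by (auto simp: S_def)
    have Sinv: "rop \<pi> a ` perp ?H S \<subseteq> perp ?H S" if a: "a \<in> carr A" for a
    proof
      fix y assume "y \<in> rop \<pi> a ` perp ?H S"
      then obtain v where v: "v \<in> perp ?H S" and y: "y = rop \<pi> a v" by auto
      have vc: "v \<in> carr ?H" using v by (simp add: perp_def)
      have "inn ?H (rop \<pi> i w) y = 0" if i: "i \<in> I" and w: "w \<in> W" for i w
      proof -
        have "inn ?H (rop \<pi> i w) y = inn ?H (rop \<pi> (mul A (star A a) i) w) v"
          using rep_star[OF r a, of "rop \<pi> i w" v] rep_mul[OF r, of "star A a" i w] a IA[OF i] Wc[OF w] vc y by simp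
        also have "rop \<pi> (mul A (star A a) i) w \<in> S" using Im(1)[of "star A a" i] a i w by (auto simp: S_def)
        then have "inn ?H (rop \<pi> (mul A (star A a) i) w) v = 0" using v by (simp add: perp_def)
        finally show ?thesis .
      qed
      then show "y \<in> perp ?H S" using a vc y by (auto simp: perp_def S_def)
    qed
    have "perp ?H S = {vzero ?H} \<or> perp ?H S = carr ?H"
      by (rule irr_dichotomy[OF irr H.perp_subspace[OF S] H.perp_closed[OF S] Sinv])
    then show ?thesis
    proof
      assume P: "perp ?H S = {vzero ?H}"
      have "z \<in> W" if z: "z \<in> carr ?H" for z
      proof -
        obtain p where p: "p \<in> W" "vdiff ?H z p \<in> perp ?H W" using H.projection[OF W z] by blast
        then have "vdiff ?H z p \<in> perp ?H S" using Winv by (auto simp: perp_def S_def)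
        then have "vdiff ?H z p = vzero ?H" using P by blast
        then show ?thesis using p(1) z Wc[OF p(1)] by (simp add: H.diff_eq_zero)
      qed
      then show ?thesis using Wc by blast
    next
      assume P: "perp ?H S = carr ?H"
      have zero: "rop \<pi> i w = vzero ?H" if i: "i \<in> I" and w: "w \<in> W" for i w
      proof -
        have s: "rop \<pi> i w \<in> S" using i w by (auto simp: S_def)
        then have "rop \<pi> i w \<in> perp ?H S" using S P by blast
        then have "inn ?H (rop \<pi> i w) (rop \<pi> i w) = 0" using s by (simp add: perp_def)
        then show ?thesis using H.inn_definite S s by blast
      qed
      define T where "T = {rop \<pi> i w |i w. i \<in> I \<and> w \<in> carr ?H}"
      have T: "T \<subseteq> carr ?H" using IA by (auto simp: T_def)
      have Tinv: "rop \<pi> a ` perp ?H T \<subseteq> perp ?H T" if a: "a \<in> carr A" for a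
      proof
        fix y assume "y \<in> rop \<pi> a ` perp ?H T"
        then obtain v where v: "v \<in> perp ?H T" and y: "y = rop \<pi> a v" by auto
        have vc: "v \<in> carr ?H" using v by (simp add: perp_def)
        have "inn ?H (rop \<pi> i w) y = 0" if i: "i \<in> I" and w: "w \<in> carr ?H" for i w
        proof -
          have "inn ?H (rop \<pi> i w) y = inn ?H (rop \<pi> (mul A (star A a) i) w) v"
            using rep_star[OF r a, of "rop \<pi> i w" v] rep_mul[OF r, of "star A a" i w] a IA[OF i] w vc y by simp
          also have "rop \<pi> (mul A (star A a) i) w \<in> T" using Im(1)[of "star A a" i] a i w by (auto simp: T_def)
          then have "inn ?H (rop \<pi> (mul A (star A a) i) w) v = 0" using v by (simp add: perp_def)
          finally show ?thesis .
        qed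
        then show "y \<in> perp ?H T" using a vc y by (auto simp: perp_def T_def)
      qed
      have "rop \<pi> i0 w0 \<in> T" using i0 by (auto simp: T_def)
      then have "rop \<pi> i0 w0 \<notin> perp ?H T"
        using i0(3) H.inn_definite[of "rop \<pi> i0 w0"] i0 IA by (auto simp: perp_def)
      then have "perp ?H T \<noteq> carr ?H" using i0 IA by auto
      then have PT: "perp ?H T = {vzero ?H}"
        using irr_dichotomy[OF irr H.perp_subspace[OF T] H.perp_closed[OF T] Tinv] by blast
      have "w = vzero ?H" if w: "w \<in> W" for w
      proof -
        have "inn ?H (rop \<pi> i v) w = 0" if i: "i \<in> I" and v: "v \<in> carr ?H" for i v
          using rep_adjoint[OF r IA[OF i] v Wc[OF w]] zero[OF Is[OF i] w] v by simp
        then have "w \<in> perp ?H T" using Wc[OF w] by (auto simp: perp_def T_def)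
        then show ?thesis using PT by blast
      qed
      then show ?thesis using W(1) by (auto simp: subspace_of_def)
    qed
  qed
  then show ?thesis
    using ideal_restrict_rep[OF I r] nz' by (auto simp: irreducible_rep_def)
qed

text \<open>\<open>module_rep\<close> is applied to the orbit of a unit vector under
  \<open>I\<close> and to the corresponding vector functional. Subspaces invariant under
  \<open>A\<close> are invariant under \<open>I\<close>, so irreducibility is inherited.\<close>

lemma ideal_extend_irr:
  assumes I: "closed_ideal A I" and irr: "irreducible_rep (ideal_algebra A I) \<sigma>"
  shows "\<exists>\<pi>. irreducible_rep A \<pi> \<and> rspace \<pi> = rspace \<sigma> \<and>
     (\<forall>i\<in>I. \<forall>x\<in>carr (rspace \<sigma>). rop \<pi> i x = rop \<sigma> i x)"
proof -
  let ?H = "rspace \<sigma>"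
  interpret J: cstar_algebra "ideal_algebra A I" by (rule ideal_cstar[OF I])
  note s = irr_rep[OF irr] and IA [simp] = ideal_carr[OF I]
  interpret H: hilbert_space ?H by (rule rep_hilbert[OF s])
  obtain x where x: "x \<in> unit_vectors ?H" using J.irr_nontrivial[OF irr] by blast
  have xc [simp]: "x \<in> carr ?H" and xn: "x \<noteq> vzero ?H" using x by (auto simp: unit_vectors_def)
  have sc [simp]: "rop \<sigma> i y \<in> carr ?H" if "i \<in> I" "y \<in> carr ?H" for i y
    using rep_closed[OF s] that by simp
  define L where "L i = rop \<sigma> i x" for i
  define f where "f i = inn ?H x (rop \<sigma> i x)" for i
  have Im: "mul A a i \<in> I" if "a \<in> carr A" "i \<in> I" for a i
    using I that by (simp add: closed_ideal_def)
  have Is [simp]: "star A i \<in> I" if "i \<in> I" for i by (rule ideal_star[OF I that])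
  have "J.positive_on I f" using J.rep_positive[OF s xc] by (simp add: f_def[abs_def])
  then have f: "positive_on I f" by (simp add: positive_on_def J.positive_on_def)
  have L: "linear_map (ideal_algebra A I) ?H L" unfolding L_def[abs_def] by (rule rep_vec_linear[OF s xc])
  have t: "H.total (L ` I)" using J.rep_cyclic[OF irr xc xn] by (simp add: L_def[abs_def])
  have Lf: "inn ?H (L c) (L d) = f (mul A (star A c) d)" if "c \<in> I" "d \<in> I" for c d
    using that J.rep_adjoint[OF s, of c x "rop \<sigma> d x"] rep_mul[OF s, of "star A c" d x]
    by (simp add: L_def f_def)
  obtain \<pi> where p: "rspace \<pi> = ?H" "representation A \<pi>"
    and pL: "\<And>a c. \<lbrakk>a \<in> carr A; c \<in> I\<rbrakk> \<Longrightarrow> rop \<pi> a (L c) = L (mul A a c)"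
    using module_rep[OF I H.hilbert_space_axioms L t f Lf] by blast
  have pc [simp]: "rop \<pi> a y \<in> carr ?H" if "a \<in> carr A" "y \<in> carr ?H" for a y
    using rep_closed[OF p(2) that(1)] that(2) by (simp add: p(1))
  \<comment> \<open>\<open>module_rep\<close> prescribes the operators on the orbit only; since
    \<open>I\<close> contains adjoints and the orbit is total, agreement with \<sigma> follows
    everywhere.\<close>
  have eq: "rop \<pi> i y = rop \<sigma> i y" if i: "i \<in> I" and y: "y \<in> carr ?H" for i y
  proof (rule H.total_ext[OF t])
    fix w assume "w \<in> L ` I"
    then obtain c where c: "c \<in> I" "w = L c" by auto
    have Lc: "L c \<in> carr ?H" using c by (simp add: L_def)
    have "inn ?H w (rop \<pi> i y) = inn ?H (rop \<pi> (star A i) (L c)) y"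
      using rep_star[OF p(2) IA[OF i], of "L c" y] Lc y c by (simp add: p(1))
    also have "\<dots> = inn ?H (L (mul A (star A i) c)) y" using i c by (simp add: pL)
    also have "\<dots> = inn ?H (rop \<sigma> (star A i) (L c)) y"
      using i c rep_mul[OF s, of "star A i" c x] by (simp add: L_def)
    also have "\<dots> = inn ?H w (rop \<sigma> i y)"
      using rep_star[OF s, of i "L c" y] i c Lc y by simp
    finally show "inn ?H w (rop \<pi> i y) = inn ?H w (rop \<sigma> i y)" .
  qed (use i y in \<open>auto simp: L_def\<close>)
  have "irreducible_rep A \<pi>"
    unfolding irreducible_rep_def
  proof (intro conjI allI impI)
    show "representation A \<pi>" by (rule p(2))
    obtain i w where "i \<in> I" "w \<in> carr ?H" "rop \<sigma> i w \<noteq> vzero ?H"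
      using irr_nonzero[OF irr] by (auto simp: nonzero_on_def)
    then show "nonzero_on (carr A) \<pi>" using eq IA by (auto simp: nonzero_on_def p(1) intro!: bexI[of _ i] bexI[of _ w])
    fix W assume W: "subspace_of (rspace \<pi>) W \<and> closedin (norm_topology (rspace \<pi>) (hnorm (rspace \<pi>))) W \<and>
        (\<forall>a\<in>carr A. rop \<pi> a ` W \<subseteq> W)"
    have "rop \<sigma> i ` W \<subseteq> W" if i: "i \<in> carr (ideal_algebra A I)" for i
    proof -
      have "W \<subseteq> carr ?H" using W by (simp add: subspace_of_def p(1))
      then have "rop \<sigma> i ` W = rop \<pi> i ` W" using eq i by (auto simp: subset_iff)
      then show ?thesis using W IA i by simp
    qed
    then show "W = {vzero (rspace \<pi>)} \<or> W = carr (rspace \<pi>)"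
      using irr_dichotomy[OF irr, of W] W by (simp add: p(1))
  qed
  then show ?thesis using p(1) eq by blast
qed

text \<open>For the vector \<open>x\<close> of the state, \<open>nrm A e \<le> 1\<close> gives |x -
  \<pi>(e)x|^2 \<le> 2 - 2 Re \<open>\<rho> e\<close>, and \<pi>(a) enlarges this difference by at
  most the norm of \<open>a\<close>.\<close>

lemma pure_approx_unit:
  assumes w: "\<rho> \<in> pure_states A" and a: "a \<in> carr A" and e: "e \<in> carr A" "nrm A e \<le> 1"
  shows "cmod (\<rho> a - \<rho> (mul A a e)) \<le> nrm A a * sqrt (2 - 2 * Re (\<rho> e))"
proof -
  obtain \<pi> :: "'a std_rep" and x where irr: "irreducible_rep A \<pi>" and x: "x \<in> unit_vectors (rspace \<pi>)"
    and wx: "\<rho> = vecstate A \<pi> x" using pure_state_vector[OF w] by blast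
  let ?H = "rspace \<pi>"
  note r = irr_rep[OF irr]
  interpret H: hilbert_space ?H by (rule rep_hilbert[OF r])
  have xc [simp]: "x \<in> carr ?H" and x1: "hnorm ?H x = 1" using x by (auto simp: unit_vectors_def)
  note [simp] = rep_closed[OF r]
  let ?d = "vdiff ?H x (rop \<pi> e x)"
  have "\<rho> a - \<rho> (mul A a e) = inn ?H x (rop \<pi> a ?d)"
    using a e by (simp add: wx vecstate_def rep_mul[OF r] linear_map_diff[OF H.complex_vector_space_axioms rep_linear[OF r]])
  also have "cmod \<dots> \<le> hnorm ?H x * hnorm ?H (rop \<pi> a ?d)"
    using a e by (intro H.form.cauchy_schwarz) auto
  also have "\<dots> \<le> nrm A a * hnorm ?H ?d"
    using rep_contraction[OF r a, of ?d] e x1 by simp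
  also have "hnorm ?H ?d \<le> sqrt (2 - 2 * Re (\<rho> e))"
  proof -
    have "hnorm ?H (rop \<pi> e x) \<le> 1" using rep_contraction[OF r e(1) xc] e(2) x1 by simp
    then have "(hnorm ?H (rop \<pi> e x))\<^sup>2 \<le> 1" using e H.n_nonneg[of "rop \<pi> e x"] by (simp add: power_le_one)
    moreover have "(hnorm ?H ?d)\<^sup>2 = (hnorm ?H x)\<^sup>2 - 2 * Re (inn ?H x (rop \<pi> e x)) + (hnorm ?H (rop \<pi> e x))\<^sup>2"
      using e H.inn_commute[of x "rop \<pi> e x"] by (simp add: H.hnorm_sq)
    ultimately have "(hnorm ?H ?d)\<^sup>2 \<le> 2 - 2 * Re (\<rho> e)" using x1 e by (simp add: wx vecstate_def)
    then show ?thesis by (rule real_le_rsqrt)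
  qed
  then have "nrm A a * hnorm ?H ?d \<le> nrm A a * sqrt (2 - 2 * Re (\<rho> e))"
    using n_nonneg[OF a] by (rule mult_left_mono)
  finally show ?thesis .
qed

end

lemma continuous_map_euclideanI:
  fixes f :: "'x \<Rightarrow> 'm::metric_space"
  assumes "\<And>x \<epsilon>. \<lbrakk>x \<in> topspace X; \<epsilon> > 0\<rbrakk> \<Longrightarrow> \<exists>U. openin X U \<and> x \<in> U \<and> (\<forall>y\<in>U. dist (f x) (f y) < \<epsilon>)"
  shows "continuous_map X euclidean f"
proof -
  have "continuous_map X Met_TC.mtopology f"
    unfolding Met_TC.continuous_map_to_metric
  proof (intro ballI allI impI)
    fix x and \<epsilon> :: real assume x: "x \<in> topspace X" and e: "\<epsilon> > 0"
    obtain U where "openin X U \<and> x \<in> U \<and> (\<forall>y\<in>U. dist (f x) (f y) < \<epsilon>)" using assms[OF x e] ..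
    then show "\<exists>U. openin X U \<and> x \<in> U \<and> (\<forall>y\<in>U. f y \<in> Met_TC.mball (f x) \<epsilon>)"
      by (intro exI[of _ U]) auto
  qed
  then show ?thesis by simp
qed

lemma ideal_bundle_iso:
  assumes A: "cstar_algebra A" and I: "closed_ideal A I"
  shows "bundle_iso (ideal_algebra A I) A {(i, i) |i. i \<in> I} (spectrum_supp A I)"
proof -
  let ?J = "ideal_algebra A I" and ?G = "{(i, i) |i. i \<in> I}"
  interpret A: cstar_algebra A by fact
  interpret J: cstar_algebra ?J by (rule A.ideal_cstar[OF I])
  interpret PA: pure_state_alg A by (rule cstar_pure_state_alg[OF A])
  interpret PJ: pure_state_alg ?J by (rule cstar_pure_state_alg) (rule J.cstar_algebra_axioms)
  have IA: "I \<subseteq> carr A" using A.ideal_carr[OF I] by blast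
  interpret P: bundle_pair ?J A ?G "spectrum_supp A I"
    by unfold_locales (use IA in \<open>auto simp: spectrum_supp_def spectrum_def\<close>)
  note supp = PA.spectrum_supp_iff[OF _ IA]
  have Im: "mul A a i \<in> I" if "a \<in> carr A" "i \<in> I" for a i
    using I that by (simp add: closed_ideal_def)
  have range_total: "hilbert_space.total (rspace \<pi>) {rop \<pi> i w |i w. i \<in> I \<and> w \<in> carr (rspace \<pi>)}"
    if "irreducible_rep A \<pi>" "irrep_class A \<pi> \<in> spectrum_supp A I" for \<pi>
    using J.rep_range_total[OF A.ideal_restrict_irr[OF I that(1)]] supp that by simp
  show ?thesis
  proof (unfold_locales)
    fix \<sigma> :: "'a std_rep" assume s: "irreducible_rep ?J \<sigma>"
    obtain \<pi> where p: "irreducible_rep A \<pi>" "rspace \<pi> = rspace \<sigma>"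
      and eq: "\<And>i x. \<lbrakk>i \<in> I; x \<in> carr (rspace \<sigma>)\<rbrakk> \<Longrightarrow> rop \<pi> i x = rop \<sigma> i x"
      using A.ideal_extend_irr[OF I s] by blast
    obtain i w where "i \<in> I" "w \<in> carr (rspace \<sigma>)" "rop \<sigma> i w \<noteq> vzero (rspace \<sigma>)"
      using irr_nonzero[OF s] by (auto simp: nonzero_on_def)
    then have "\<not> I \<subseteq> rep_ker A \<pi>" using eq p(2) by (auto simp: rep_ker_def)
    then have "irrep_class A \<pi> \<in> spectrum_supp A I" using supp[OF p(1)] by simp
    then have "P.related \<sigma> \<pi> (\<lambda>x. x)"
      using s p eq unitary_id[OF rep_hilbert[OF irr_rep[OF s]]] by (auto simp: P.related_def)
    then show "\<exists>\<pi> u. P.related \<sigma> \<pi> u" by blast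
  next
    fix \<pi> :: "'a std_rep" assume p: "irreducible_rep A \<pi>" "irrep_class A \<pi> \<in> spectrum_supp A I"
    have "irreducible_rep ?J \<pi>" using A.ideal_restrict_irr[OF I p(1)] supp[OF p(1)] p(2) by simp
    then have "P.related \<pi> \<pi> (\<lambda>x. x)"
      using p unitary_id[OF rep_hilbert[OF irr_rep[OF p(1)]]] by (auto simp: P.related_def)
    then show "\<exists>\<sigma> u. P.related \<sigma> \<pi> u" by blast
  next
    fix \<pi> \<pi>' :: "'a std_rep" and v
    assume p: "irreducible_rep A \<pi>" "irrep_class A \<pi> \<in> spectrum_supp A I" and p': "irreducible_rep A \<pi>'"
      and v: "unitary_map (rspace \<pi>) (rspace \<pi>') v"
      and eq: "\<And>b a x. \<lbrakk>(b, a) \<in> ?G; x \<in> carr (rspace \<pi>)\<rbrakk> \<Longrightarrow> v (rop \<pi> a x) = rop \<pi>' a (v x)"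
    note r = irr_rep[OF p(1)] and r' = irr_rep[OF p']
    have eqI: "v (rop \<pi> i x) = rop \<pi>' i (v x)" if "i \<in> I" "x \<in> carr (rspace \<pi>)" for i x
      using eq[of i i x] that by simp
    \<comment> \<open>Intertwining is known for \<open>I\<close> only. On the total set \<pi>(I)H it
      extends to \<open>star A a\<close>, because \<open>mul A (star A a) i\<close> lies in
      \<open>I\<close>.\<close>
    have "v (rop \<pi> a x) = rop \<pi>' a (v x)" if a: "a \<in> carr A" and x: "x \<in> carr (rspace \<pi>)" for a x
    proof (rule A.intertwine_on_total[OF r r' v range_total[OF p] _ a _ x])
      show "{rop \<pi> i w |i w. i \<in> I \<and> w \<in> carr (rspace \<pi>)} \<subseteq> carr (rspace \<pi>)"
        using rep_closed[OF r] IA by auto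
      fix y assume "y \<in> {rop \<pi> i w |i w. i \<in> I \<and> w \<in> carr (rspace \<pi>)}"
      then obtain i w where i: "i \<in> I" and w: "w \<in> carr (rspace \<pi>)" and y: "y = rop \<pi> i w" by auto
      have iA: "i \<in> carr A" using i IA by blast
      have a': "star A a \<in> carr A" using a by simp
      have "v (rop \<pi> (star A a) y) = v (rop \<pi> (mul A (star A a) i) w)"
        by (simp add: y rep_mul[OF r a' iA w])
      also have "\<dots> = rop \<pi>' (mul A (star A a) i) (v w)" by (rule eqI[OF Im[OF a' i] w])
      also have "\<dots> = rop \<pi>' (star A a) (rop \<pi>' i (v w))" by (rule rep_mul[OF r' a' iA unitary_closed[OF v w]])
      also have "rop \<pi>' i (v w) = v y" unfolding y by (rule eqI[OF i w, symmetric])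
      finally show "v (rop \<pi> (star A a) y) = rop \<pi>' (star A a) (v y)" .
    qed
    then show "intertwines A \<pi> \<pi>' v" using v by (simp add: intertwines_def)
  next
    fix a and \<Psi> :: "('a \<Rightarrow> complex) \<Rightarrow> 'a \<Rightarrow> complex"
    assume a: "a \<in> carr A" and pure: "\<And>\<omega>. \<omega> \<in> pure_states ?J \<Longrightarrow> \<Psi> \<omega> \<in> pure_states A"
      and ext: "\<And>\<omega> b a. \<lbrakk>\<omega> \<in> pure_states ?J; (b, a) \<in> ?G\<rbrakk> \<Longrightarrow> \<Psi> \<omega> a = \<omega> b"
    show "continuous_map (pure_state_topology ?J) euclidean (\<lambda>\<omega>. \<Psi> \<omega> a)"
    proof (rule continuous_map_euclideanI)
      fix \<omega>0 and \<epsilon> :: real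
      assume "\<omega>0 \<in> topspace (pure_state_topology ?J)" and eps: "\<epsilon> > 0"
      then have w0: "\<omega>0 \<in> pure_states ?J" by simp
      define k where "k = nrm A a + 1"
      have k: "k > 0" "nrm A a \<le> k" using A.n_nonneg[OF a] by (auto simp: k_def)
      \<comment> \<open>Chosen to make k sqrt (2\<delta>) equal to \<epsilon>/3.\<close>
      define \<delta> where "\<delta> = (\<epsilon> / (3 * k))\<^sup>2 / 2"
      have d: "\<delta> > 0" "sqrt (2 * \<delta>) = \<epsilon> / (3 * k)" using eps k by (auto simp: \<delta>_def real_sqrt_abs)
      \<comment> \<open>One element \<open>e\<close>, chosen for the base point, serves all states
        near it, because Re \<open>\<omega> e\<close> > 1 - \<delta> is an open condition.\<close>
      obtain e where e: "e \<in> I" "nrm A e \<le> 1" "Re (\<omega>0 e) > 1 - \<delta>"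
        using J.state_approx[OF J.pure_state[OF w0] d(1)] by auto
      have eA: "e \<in> carr A" and ae: "mul A a e \<in> I" using e IA Im[OF a] by auto
      have est: "cmod (\<Psi> \<omega> a - \<omega> (mul A a e)) \<le> \<epsilon> / 3"
        if w: "\<omega> \<in> pure_states ?J" and we: "Re (\<omega> e) > 1 - \<delta>" for \<omega>
      proof -
        have "cmod (\<Psi> \<omega> a - \<omega> (mul A a e)) \<le> nrm A a * sqrt (2 - 2 * Re (\<omega> e))"
          using A.pure_approx_unit[OF pure[OF w] a eA e(2)] ext[OF w] e(1) ae by auto
        also have "\<dots> \<le> k * sqrt (2 * \<delta>)"
        proof (rule mult_mono)
          have "Re (\<omega> e) \<le> 1"
            using J.state_bound[OF J.pure_state[OF w], of e] e complex_Re_le_cmod[of "\<omega> e"] by simp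
          then show "0 \<le> sqrt (2 - 2 * Re (\<omega> e))" by simp
        qed (use k we in auto)
        also have "\<dots> = \<epsilon> / 3" using k d(2) by simp
        finally show ?thesis .
      qed
      define W1 where "W1 = {\<omega> \<in> pure_states ?J. Re (\<omega> e) \<in> {1 - \<delta><..}}"
      define W2 where "W2 = {\<omega> \<in> pure_states ?J. \<omega> (mul A a e) \<in> ball (\<omega>0 (mul A a e)) (\<epsilon> / 3)}"
      have "continuous_map (pure_state_topology ?J) euclidean (Re \<circ> (\<lambda>\<omega>. \<omega> e))"
      proof (rule continuous_map_compose)
        show "continuous_map (pure_state_topology ?J) euclidean (\<lambda>\<omega>. \<omega> e)"
          by (rule PJ.continuous_map_eval) (simp add: e)
        show "continuous_map euclidean euclidean Re" by (simp add: continuous_on_Re)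
      qed
      then have "openin (pure_state_topology ?J) {\<omega> \<in> topspace (pure_state_topology ?J). (Re \<circ> (\<lambda>\<omega>. \<omega> e)) \<omega> \<in> {1 - \<delta><..}}"
        by (rule openin_continuous_map_preimage) (simp add: open_greaterThan)
      then have o1: "openin (pure_state_topology ?J) W1" by (simp add: W1_def)
      have "continuous_map (pure_state_topology ?J) euclidean (\<lambda>\<omega>. \<omega> (mul A a e))"
        by (rule PJ.continuous_map_eval) (simp add: ae)
      then have "openin (pure_state_topology ?J)
          {\<omega> \<in> topspace (pure_state_topology ?J). \<omega> (mul A a e) \<in> ball (\<omega>0 (mul A a e)) (\<epsilon> / 3)}"
        by (rule openin_continuous_map_preimage) simp
      then have o2: "openin (pure_state_topology ?J) W2" by (simp add: W2_def)
      have "dist (\<Psi> \<omega>0 a) (\<Psi> \<omega> a) < \<epsilon>" if w: "\<omega> \<in> W1 \<inter> W2" for \<omega>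
      proof -
        have wp: "\<omega> \<in> pure_states ?J" and we: "Re (\<omega> e) > 1 - \<delta>"
          and wd: "dist (\<omega>0 (mul A a e)) (\<omega> (mul A a e)) < \<epsilon> / 3"
          using w by (auto simp: W1_def W2_def)
        have "dist (\<Psi> \<omega>0 a) (\<Psi> \<omega> a) \<le> dist (\<Psi> \<omega>0 a) (\<omega>0 (mul A a e)) +
            dist (\<omega>0 (mul A a e)) (\<omega> (mul A a e)) + dist (\<Psi> \<omega> a) (\<omega> (mul A a e))"
          using dist_triangle[of "\<Psi> \<omega>0 a" "\<Psi> \<omega> a" "\<omega>0 (mul A a e)"]
            dist_triangle2[of "\<omega>0 (mul A a e)" "\<Psi> \<omega> a" "\<omega> (mul A a e)"] by linarith
        then show ?thesis using est[OF w0 e(3)] est[OF wp we] wd by (simp add: dist_norm)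
      qed
      moreover have "\<omega>0 \<in> W1 \<inter> W2" using w0 e eps by (simp add: W1_def W2_def)
      ultimately show "\<exists>U. openin (pure_state_topology ?J) U \<and> \<omega>0 \<in> U \<and> (\<forall>\<omega>\<in>U. dist (\<Psi> \<omega>0 a) (\<Psi> \<omega> a) < \<epsilon>)"
        using openin_Int[OF o1 o2] by blast
    qed
  next
    fix S assume S: "S \<subseteq> carr A"
    \<comment> \<open>For \<pi> nonzero on \<open>I\<close>, killing all products
      \<open>mul A s i\<close> already means killing \<open>S\<close>, because \<pi>(I)H is
      total.\<close>
    let ?T = "{mul A s i |s i. s \<in> S \<and> i \<in> I}"
    have T: "?T \<subseteq> I" using Im S by auto
    have "S \<subseteq> rep_ker A \<pi> \<longleftrightarrow> ?T \<subseteq> rep_ker ?J \<sigma>" if rel: "P.related \<sigma> \<pi> u" for \<sigma> \<pi> u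
    proof -
      have irr: "irreducible_rep A \<pi>" and cl: "irrep_class A \<pi> \<in> spectrum_supp A I"
        using P.related_irr[OF rel] P.related_U[OF rel] by auto
      note r = irr_rep[OF irr]
      let ?H = "rspace \<pi>"
      interpret H: hilbert_space ?H by (rule rep_hilbert[OF r])
      note [simp] = rep_closed[OF r]
      have "?T \<subseteq> rep_ker ?J \<sigma> \<longleftrightarrow> ?T \<subseteq> rep_ker A \<pi>"
        using P.related_ker[OF rel] T by blast
      also have "\<dots> \<longleftrightarrow> S \<subseteq> rep_ker A \<pi>"
      proof
        assume *: "S \<subseteq> rep_ker A \<pi>"
        show "?T \<subseteq> rep_ker A \<pi>"
        proof
          fix b assume "b \<in> ?T"
          then obtain s i where s: "s \<in> S" and i: "i \<in> I" and b: "b = mul A s i" by auto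
          have c: "s \<in> carr A" "i \<in> carr A" using s i S IA by auto
          have "rop \<pi> b y = vzero ?H" if y: "y \<in> carr ?H" for y
            using * s rep_closed[OF r c(2) y] by (auto simp: b rep_mul[OF r c y] rep_ker_def)
          then show "b \<in> rep_ker A \<pi>" using c by (simp add: rep_ker_def b)
        qed
      next
        assume *: "?T \<subseteq> rep_ker A \<pi>"
        show "S \<subseteq> rep_ker A \<pi>"
        proof
          fix s assume s: "s \<in> S"
          then have sA: "s \<in> carr A" using S by blast
          \<comment> \<open>Adjoints first: the operator of \<open>s\<close> vanishes on \<pi>(I)H,
            so every value of the operator of \<open>star A s\<close> is orthogonal to this total
            set.\<close>
          have z: "rop \<pi> (star A s) y = vzero ?H" if y: "y \<in> carr ?H" for y
          proof (rule H.total_ext[OF range_total[OF irr cl]])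
            fix w assume "w \<in> {rop \<pi> i w |i w. i \<in> I \<and> w \<in> carr ?H}"
            then obtain i v where i: "i \<in> I" and v: "v \<in> carr ?H" and w: "w = rop \<pi> i v" by auto
            have iA: "i \<in> carr A" using i IA by blast
            have "mul A s i \<in> rep_ker A \<pi>" using * s i by blast
            then have "rop \<pi> s w = vzero ?H" using v rep_mul[OF r sA iA v] by (simp add: rep_ker_def w)
            then show "inn ?H w (rop \<pi> (star A s) y) = inn ?H w (vzero ?H)"
              using A.rep_adjoint[OF r sA, of w y] v iA y by (simp add: w)
          qed (use IA sA y in auto)
          have "rop \<pi> s y = vzero ?H" if y: "y \<in> carr ?H" for y
            by (rule H.inn_ext) (use y sA z A.rep_adjoint[OF r, of "star A s"] rep_star[OF r sA, symmetric] in auto)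
          then show "s \<in> rep_ker A \<pi>" using sA by (simp add: rep_ker_def)
        qed
      qed
      finally show ?thesis ..
    qed
    then show "\<exists>T\<subseteq>carr ?J. \<forall>\<sigma> \<pi> u. P.related \<sigma> \<pi> u \<longrightarrow> (S \<subseteq> rep_ker A \<pi> \<longleftrightarrow> T \<subseteq> rep_ker ?J \<sigma>)"
      using T by (intro exI[of _ ?T]) simp
  qed
qed

section \<open>The bundle of a quotient\<close>

lemma Sup_eq_one_iff:
  fixes S :: "real set"
  assumes "S \<noteq> {}"
  shows "bdd_above S \<and> Sup S = 1 \<longleftrightarrow> (\<forall>s\<in>S. s \<le> 1) \<and> (\<forall>\<epsilon>>0. \<exists>s\<in>S. s > 1 - \<epsilon>)"
proof
  assume *: "bdd_above S \<and> Sup S = 1"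
  then have "\<forall>s\<in>S. s \<le> 1" using cSup_upper by metis
  moreover have "\<exists>s\<in>S. s > 1 - \<epsilon>" if "\<epsilon> > 0" for \<epsilon>
    using less_cSupD[OF assms, of "1 - \<epsilon>"] * that by auto
  ultimately show "(\<forall>s\<in>S. s \<le> 1) \<and> (\<forall>\<epsilon>>0. \<exists>s\<in>S. s > 1 - \<epsilon>)" by blast
next
  assume *: "(\<forall>s\<in>S. s \<le> 1) \<and> (\<forall>\<epsilon>>0. \<exists>s\<in>S. s > 1 - \<epsilon>)"
  then have b: "bdd_above S" by (auto simp: bdd_above_def)
  have "1 \<le> Sup S"
  proof (rule field_le_epsilon)
    fix e :: real assume "e > 0"
    then obtain s where "s \<in> S" "s > 1 - e" using * by blast
    then show "1 \<le> Sup S + e" using cSup_upper[OF _ b, of s] by linarith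
  qed
  moreover have "Sup S \<le> 1" using * assms by (intro cSup_least) auto
  ultimately show "bdd_above S \<and> Sup S = 1" using b by simp
qed

text \<open>The bundle of the quotient is reached from \<open>A\<close>: representations and states
  of \<open>Q\<close> are pulled back to those of \<open>A\<close> that vanish on
  \<open>I\<close>.\<close>

locale quotient_cstar = cstar_algebra A for A :: "'a cstar" +
  fixes I :: "'a set"
  assumes I: "closed_ideal A I"
begin

abbreviation "Q \<equiv> quotient_algebra A I"
abbreviation "q \<equiv> coset A I"

lemma I_carr [simp]: "i \<in> I \<Longrightarrow> i \<in> carr A"
  by (rule ideal_carr[OF I])

lemma I_ops [simp]: "vzero A \<in> I" "\<lbrakk>i \<in> I; j \<in> I\<rbrakk> \<Longrightarrow> vadd A i j \<in> I" "i \<in> I \<Longrightarrow> smul A c i \<in> I"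
  "\<lbrakk>i \<in> I; j \<in> I\<rbrakk> \<Longrightarrow> vdiff A i j \<in> I"
  "\<lbrakk>a \<in> carr A; i \<in> I\<rbrakk> \<Longrightarrow> mul A a i \<in> I" "\<lbrakk>a \<in> carr A; i \<in> I\<rbrakk> \<Longrightarrow> mul A i a \<in> I" "i \<in> I \<Longrightarrow> star A i \<in> I"
  using I ideal_star[OF I] by (auto simp: closed_ideal_def subspace_of_def vdiff_def)

lemma coset_mem_iff: "\<lbrakk>a \<in> carr A\<rbrakk> \<Longrightarrow> x \<in> q a \<longleftrightarrow> x \<in> carr A \<and> vdiff A x a \<in> I"
proof
  assume a: "a \<in> carr A" and "x \<in> carr A \<and> vdiff A x a \<in> I"
  then have "x = vadd A a (vdiff A x a)" "vdiff A x a \<in> I"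
    using add_commute[of a "vdiff A x a"] by auto
  then show "x \<in> q a" unfolding coset_def by blast
qed (auto simp: coset_def)

lemma coset_self: "a \<in> carr A \<Longrightarrow> a \<in> q a"
  by (simp add: coset_mem_iff)

lemma coset_eq_iff: "\<lbrakk>a \<in> carr A; b \<in> carr A\<rbrakk> \<Longrightarrow> q a = q b \<longleftrightarrow> vdiff A a b \<in> I"
proof
  assume a: "a \<in> carr A" and b: "b \<in> carr A"
  show "q a = q b \<Longrightarrow> vdiff A a b \<in> I" using coset_self[OF a] coset_mem_iff[OF b] by simp
  assume d: "vdiff A a b \<in> I"
  have d': "vdiff A b a \<in> I" using I_ops(3)[OF d, of "-1"] neg_diff[OF a b] by simp
  have "x \<in> q b" if "x \<in> q a" for x
    using that d a b I_ops(2)[of "vdiff A x a" "vdiff A a b"] by (simp add: coset_mem_iff diff_diff_add)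
  moreover have "x \<in> q a" if "x \<in> q b" for x
    using that d' a b I_ops(2)[of "vdiff A x b" "vdiff A b a"] by (simp add: coset_mem_iff diff_diff_add)
  ultimately show "q a = q b" by blast
qed

lemma coset_eqI: "\<lbrakk>a \<in> carr A; x \<in> q a\<rbrakk> \<Longrightarrow> q x = q a"
  by (simp add: coset_mem_iff coset_eq_iff)

text \<open>All cosets in the unions that define the quotient operations coincide, so each union is
  a single coset.\<close>

lemma coset_cong:
  assumes "a \<in> carr A" "b \<in> carr A" "x \<in> q a" "y \<in> q b"
  shows "q (vadd A x y) = q (vadd A a b)" "q (smul A c x) = q (smul A c a)"
    "q (mul A x y) = q (mul A a b)" "q (star A x) = q (star A a)"
proof -
  have x: "x \<in> carr A" "vdiff A x a \<in> I" and y: "y \<in> carr A" "vdiff A y b \<in> I"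
    using assms by (simp_all add: coset_mem_iff)
  show "q (vadd A x y) = q (vadd A a b)"
    using assms(1,2) x y by (simp add: coset_eq_iff diff_add_add)
  show "q (smul A c x) = q (smul A c a)"
    using assms(1,2) x y by (simp add: coset_eq_iff smul_diff[symmetric])
  show "q (star A x) = q (star A a)"
    using assms(1,2) x y by (simp add: coset_eq_iff star_diff[symmetric])
  have "vdiff A (mul A x y) (mul A a b) = vadd A (mul A (vdiff A x a) y) (mul A a (vdiff A y b))"
    using assms(1,2) x y by (simp add: mul_diff_left mul_diff_right diff_diff_add)
  then show "q (mul A x y) = q (mul A a b)"
    using assms(1,2) x y by (simp add: coset_eq_iff)
qed

lemma quotient_carr: "carr Q = q ` carr A"
  by (simp add: quotient_algebra_def)

lemma quotient_zero: "vzero Q = q (vzero A)"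
  by (simp add: quotient_algebra_def)

lemma quotient_closed [simp]: "a \<in> carr A \<Longrightarrow> q a \<in> carr Q"
  by (simp add: quotient_carr)

lemma quotient_add: "\<lbrakk>a \<in> carr A; b \<in> carr A\<rbrakk> \<Longrightarrow> vadd Q (q a) (q b) = q (vadd A a b)"
proof -
  assume a: "a \<in> carr A" and b: "b \<in> carr A"
  have "vadd Q (q a) (q b) = (\<Union>x\<in>q a. \<Union>y\<in>q b. q (vadd A x y))" by (simp add: quotient_algebra_def)
  also have "\<dots> = q (vadd A a b)"
    by (intro SUP_eq_const coset_cong(1) a b) (use coset_self[OF a] coset_self[OF b] in auto)
  finally show ?thesis .
qed

lemma quotient_mul: "\<lbrakk>a \<in> carr A; b \<in> carr A\<rbrakk> \<Longrightarrow> mul Q (q a) (q b) = q (mul A a b)"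
proof -
  assume a: "a \<in> carr A" and b: "b \<in> carr A"
  have "mul Q (q a) (q b) = (\<Union>x\<in>q a. \<Union>y\<in>q b. q (mul A x y))" by (simp add: quotient_algebra_def)
  also have "\<dots> = q (mul A a b)"
    by (intro SUP_eq_const coset_cong(3) a b) (use coset_self[OF a] coset_self[OF b] in auto)
  finally show ?thesis .
qed

lemma quotient_smul: "a \<in> carr A \<Longrightarrow> smul Q c (q a) = q (smul A c a)"
proof -
  assume a: "a \<in> carr A"
  have "smul Q c (q a) = (\<Union>x\<in>q a. q (smul A c x))" by (simp add: quotient_algebra_def)
  also have "\<dots> = q (smul A c a)"
    by (intro SUP_eq_const coset_cong(2)[OF a a _ coset_self[OF a]]) (use coset_self[OF a] in auto)
  finally show ?thesis .
qed

lemma quotient_star: "a \<in> carr A \<Longrightarrow> star Q (q a) = q (star A a)"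
proof -
  assume a: "a \<in> carr A"
  have "star Q (q a) = (\<Union>x\<in>q a. q (star A x))" by (simp add: quotient_algebra_def)
  also have "\<dots> = q (star A a)"
    by (intro SUP_eq_const coset_cong(4)[OF a a _ coset_self[OF a]]) (use coset_self[OF a] in auto)
  finally show ?thesis .
qed

lemmas quotient_ops = quotient_add quotient_mul quotient_smul quotient_star quotient_zero

lemma quotient_star_alg: "star_alg Q"
proof unfold_locales
  fix x y z c d assume "x \<in> carr Q" "y \<in> carr Q" "z \<in> carr Q"
  then obtain a b e where "x = q a" "y = q b" "z = q e" "a \<in> carr A" "b \<in> carr A" "e \<in> carr A"
    by (auto simp: quotient_carr)
  then show "vadd Q (vadd Q x y) z = vadd Q x (vadd Q y z)" by (simp add: quotient_ops add_assoc)
next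
  fix x y c assume "x \<in> carr Q" "y \<in> carr Q"
  then obtain a b where "x = q a" "y = q b" "a \<in> carr A" "b \<in> carr A"
    by (auto simp: quotient_carr)
  then show "vadd Q x y \<in> carr Q" "vadd Q x y = vadd Q y x" "mul Q x y \<in> carr Q"
    "smul Q c (vadd Q x y) = vadd Q (smul Q c x) (smul Q c y)"
    by (simp_all add: quotient_ops smul_add_right) (simp add: add_commute)
next
  fix x c d assume "x \<in> carr Q"
  then obtain a where "x = q a" "a \<in> carr A" by (auto simp: quotient_carr)
  then show "smul Q c x \<in> carr Q" "vadd Q x (vzero Q) = x" "vadd Q x (smul Q (- 1) x) = vzero Q"
    "smul Q (c + d) x = vadd Q (smul Q c x) (smul Q d x)" "smul Q c (smul Q d x) = smul Q (c * d) x"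
    "smul Q 1 x = x" "star Q x \<in> carr Q" "star Q (star Q x) = x"
    by (simp_all add: quotient_ops add_neg smul_add_left smul_smul)
qed (simp add: quotient_zero)

sublocale Q: star_alg Q
  by (rule quotient_star_alg)

lemma quotient_norm_le: "a \<in> carr A \<Longrightarrow> nrm Q (q a) \<le> nrm A a"
proof -
  assume a: "a \<in> carr A"
  have "bdd_below (nrm A ` q a)" using a by (intro bdd_belowI2[of _ 0]) (simp add: coset_mem_iff nrm_nonneg)
  then show ?thesis using coset_self[OF a] by (simp add: quotient_algebra_def cINF_lower)
qed

lemma quotient_norm_approx:
  assumes a: "a \<in> carr A" and e: "e > 0"
  shows "\<exists>x\<in>carr A. q x = q a \<and> nrm A x < nrm Q (q a) + e"
proof -
  have "Inf (nrm A ` q a) < nrm Q (q a) + e" using e by (simp add: quotient_algebra_def)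
  then obtain x where "x \<in> q a" "nrm A x < nrm Q (q a) + e"
    using cInf_lessD[of "nrm A ` q a"] coset_self[OF a] by blast
  then show ?thesis using coset_eqI[OF a] coset_mem_iff[OF a] by blast
qed

lemma zero_coset: "i \<in> I \<Longrightarrow> q i = vzero Q"
  by (simp add: quotient_zero coset_eq_iff)

text \<open>The two representations share their Hilbert space, so at most one of them has the
  standard type of its algebra; \<open>std_rep_exists\<close> moves the other one when
  necessary.\<close>

definition over :: "('a set, 'h) rep \<Rightarrow> ('a, 'h) rep \<Rightarrow> bool" where
  "over \<sigma> \<pi> \<longleftrightarrow> rspace \<sigma> = rspace \<pi> \<and> (\<forall>a\<in>carr A. \<forall>x\<in>carr (rspace \<pi>). rop \<sigma> (q a) x = rop \<pi> a x)"

lemma over_space: "over \<sigma> \<pi> \<Longrightarrow> rspace \<sigma> = rspace \<pi>"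
  and over_rop: "\<lbrakk>over \<sigma> \<pi>; a \<in> carr A; x \<in> carr (rspace \<pi>)\<rbrakk> \<Longrightarrow> rop \<sigma> (q a) x = rop \<pi> a x"
  by (auto simp: over_def)

lemma over_rep_iff:
  assumes o: "over \<sigma> \<pi>"
  shows "representation Q \<sigma> \<longleftrightarrow> representation A \<pi>"
proof (cases "hilbert_space (rspace \<pi>)")
  case True
  interpret H: hilbert_space "rspace \<pi>" by fact
  have b: "bounded_linear_map (rspace \<pi>) (rspace \<pi>) (rop \<sigma> (q a)) \<longleftrightarrow> bounded_linear_map (rspace \<pi>) (rspace \<pi>) (rop \<pi> a)"
    if "a \<in> carr A" for a
    using over_rop[OF o that] by (simp add: bounded_linear_map_def linear_map_def cong: conj_cong)
  have c: "rop \<pi> b x \<in> carr (rspace \<pi>)"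
    if "\<forall>a\<in>carr A. bounded_linear_map (rspace \<pi>) (rspace \<pi>) (rop \<pi> a)" "b \<in> carr A" "x \<in> carr (rspace \<pi>)" for b x
    using that by (simp add: bounded_linear_map_def linear_map_def)
  show ?thesis
  proof
    assume r: "representation Q \<sigma>"
    have bd: "\<forall>a\<in>carr A. bounded_linear_map (rspace \<pi>) (rspace \<pi>) (rop \<pi> a)"
      using rep_bounded[OF r] b by (simp add: over_space[OF o])
    show "representation A \<pi>"
      unfolding representation_def
    proof (intro conjI ballI allI True)
      fix a assume a: "a \<in> carr A"
      show "bounded_linear_map (rspace \<pi>) (rspace \<pi>) (rop \<pi> a)" using bd a by blast
      fix x assume x: "x \<in> carr (rspace \<pi>)"
      note x' = x[folded over_space[OF o]]
      show "rop \<pi> (smul A c a) x = smul (rspace \<pi>) c (rop \<pi> a x)" for c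
        using rep_smul[OF r quotient_closed[OF a] x', of c] a x by (simp add: quotient_ops over_rop[OF o] over_space[OF o])
      show "inn (rspace \<pi>) (rop \<pi> (star A a) x) y = inn (rspace \<pi>) x (rop \<pi> a y)" if y: "y \<in> carr (rspace \<pi>)" for y
        using rep_star[OF r quotient_closed[OF a] x' y[folded over_space[OF o]]] a x y
        by (simp add: quotient_ops over_rop[OF o] over_space[OF o])
      fix b assume b: "b \<in> carr A"
      show "rop \<pi> (vadd A a b) x = vadd (rspace \<pi>) (rop \<pi> a x) (rop \<pi> b x)"
        using rep_add[OF r quotient_closed[OF a] quotient_closed[OF b] x'] a b x
        by (simp add: quotient_ops over_rop[OF o] over_space[OF o])
      show "rop \<pi> (mul A a b) x = rop \<pi> a (rop \<pi> b x)"
        using rep_mul[OF r quotient_closed[OF a] quotient_closed[OF b] x'] a b x c[OF bd b x]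
        by (simp add: quotient_ops over_rop[OF o] over_space[OF o])
    qed
  next
    assume r: "representation A \<pi>"
    have bd: "\<forall>a\<in>carr A. bounded_linear_map (rspace \<pi>) (rspace \<pi>) (rop \<pi> a)" using rep_bounded[OF r] by blast
    show "representation Q \<sigma>"
      unfolding representation_def quotient_carr ball_simps over_space[OF o]
    proof (intro conjI ballI allI True)
      fix a assume a: "a \<in> carr A"
      show "bounded_linear_map (rspace \<pi>) (rspace \<pi>) (rop \<sigma> (q a))" using bd a b by blast
      fix x assume x: "x \<in> carr (rspace \<pi>)"
      show "rop \<sigma> (smul Q c (q a)) x = smul (rspace \<pi>) c (rop \<sigma> (q a) x)" for c
        using a x by (simp add: quotient_ops over_rop[OF o] rep_smul[OF r])
      show "inn (rspace \<pi>) (rop \<sigma> (star Q (q a)) x) y = inn (rspace \<pi>) x (rop \<sigma> (q a) y)" if y: "y \<in> carr (rspace \<pi>)" for y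
        using a x y by (simp add: quotient_ops over_rop[OF o] rep_star[OF r])
      fix b assume b: "b \<in> carr A"
      show "rop \<sigma> (vadd Q (q a) (q b)) x = vadd (rspace \<pi>) (rop \<sigma> (q a) x) (rop \<sigma> (q b) x)"
        using a b x by (simp add: quotient_ops over_rop[OF o] rep_add[OF r])
      show "rop \<sigma> (mul Q (q a) (q b)) x = rop \<sigma> (q a) (rop \<sigma> (q b) x)"
        using a b x c[OF bd b x] by (simp add: quotient_ops over_rop[OF o] rep_mul[OF r])
    qed
  qed
next
  case False
  then show ?thesis by (simp add: representation_def over_space[OF o])
qed

lemma over_irr_iff:
  assumes o: "over \<sigma> \<pi>"
  shows "irreducible_rep Q \<sigma> \<longleftrightarrow> irreducible_rep A \<pi>"
proof -
  have n: "nonzero_on (carr Q) \<sigma> \<longleftrightarrow> nonzero_on (carr A) \<pi>"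
    using over_rop[OF o] by (auto simp: nonzero_on_def quotient_carr over_space[OF o])
  have "(\<forall>X\<in>carr Q. rop \<sigma> X ` W \<subseteq> W) \<longleftrightarrow> (\<forall>a\<in>carr A. rop \<pi> a ` W \<subseteq> W)"
    if "W \<subseteq> carr (rspace \<pi>)" for W
  proof -
    have "rop \<sigma> (q a) ` W = rop \<pi> a ` W" if "a \<in> carr A" for a
      using that over_rop[OF o that] \<open>W \<subseteq> carr (rspace \<pi>)\<close> by (auto simp: subset_iff image_iff)
    then show ?thesis by (auto simp: quotient_carr)
  qed
  then have i: "subspace_of (rspace \<pi>) W \<and> C \<and> (\<forall>X\<in>carr Q. rop \<sigma> X ` W \<subseteq> W) \<longleftrightarrow>
     subspace_of (rspace \<pi>) W \<and> C \<and> (\<forall>a\<in>carr A. rop \<pi> a ` W \<subseteq> W)" for W C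
    by (cases "W \<subseteq> carr (rspace \<pi>)") (simp_all add: subspace_of_def)
  show ?thesis
    unfolding irreducible_rep_def over_rep_iff[OF o] n over_space[OF o] i ..
qed

lemma over_pull: "over \<sigma> \<lparr>rspace = rspace \<sigma>, rop = (\<lambda>a. rop \<sigma> (q a))\<rparr>"
  by (simp add: over_def)

lemma over_kills:
  assumes o: "over \<sigma> \<pi>" and r: "representation A \<pi>"
  shows "I \<subseteq> rep_ker A \<pi>"
proof
  fix i assume i: "i \<in> I"
  have s: "representation Q \<sigma>" using over_rep_iff[OF o] r by simp
  interpret H: hilbert_space "rspace \<pi>" by (rule rep_hilbert[OF r])
  have "rop \<pi> i x = vzero (rspace \<pi>)" if x: "x \<in> carr (rspace \<pi>)" for x
  proof -
    \<comment> \<open>The zero coset is written as 0 times itself, so that linearity of \<sigma>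
      applies.\<close>
    have "rop \<pi> i x = rop \<sigma> (smul Q 0 (q i)) x"
      using over_rop[OF o, of i x] i x by (simp add: zero_coset)
    also have "\<dots> = vzero (rspace \<pi>)"
      using rep_smul[OF s quotient_closed, of i x 0] rep_closed[OF s quotient_closed, of i x] i x
      by (simp add: over_space[OF o])
    finally show ?thesis .
  qed
  then show "i \<in> rep_ker A \<pi>" using i by (simp add: rep_ker_def)
qed

lemma over_descend:
  assumes r: "representation A \<pi>" and k: "I \<subseteq> rep_ker A \<pi>"
  shows "\<exists>\<sigma>. over \<sigma> \<pi>"
proof -
  interpret H: hilbert_space "rspace \<pi>" by (rule rep_hilbert[OF r])
  let ?s = "\<lambda>X. SOME a. a \<in> X"
  have "rop \<pi> (?s (q a)) x = rop \<pi> a x" if a: "a \<in> carr A" and x: "x \<in> carr (rspace \<pi>)" for a x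
  proof -
    have "?s (q a) \<in> q a" by (rule someI[of "\<lambda>y. y \<in> q a" a]) (rule coset_self[OF a])
    then have b: "?s (q a) \<in> carr A" and d: "vdiff A (?s (q a)) a \<in> I" using a by (simp_all add: coset_mem_iff)
    have "rop \<pi> (?s (q a)) x = rop \<pi> (vadd A (vdiff A (?s (q a)) a) a) x" using a b by simp
    also have "\<dots> = vadd (rspace \<pi>) (rop \<pi> (vdiff A (?s (q a)) a) x) (rop \<pi> a x)"
      by (rule rep_add[OF r _ a x]) (use a b in simp)
    also have "rop \<pi> (vdiff A (?s (q a)) a) x = vzero (rspace \<pi>)" using k d x by (auto simp: rep_ker_def)
    finally show ?thesis using rep_closed[OF r a x] by simp
  qed
  then show ?thesis by (intro exI[of _ "\<lparr>rspace = rspace \<pi>, rop = (\<lambda>X. rop \<pi> (?s X))\<rparr>"]) (simp add: over_def)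
qed

section \<open>States of the quotient\<close>

definition pull :: "('a set \<Rightarrow> complex) \<Rightarrow> 'a \<Rightarrow> complex" where
  "pull \<omega> = (\<lambda>a\<in>carr A. \<omega> (q a))"

lemma pull_vecstate: "over \<sigma> \<pi> \<Longrightarrow> x \<in> carr (rspace \<pi>) \<Longrightarrow> pull (vecstate Q \<sigma> x) = vecstate A \<pi> x"
  by (auto simp: pull_def vecstate_def fun_eq_iff over_rop over_space)

lemma pull_inj:
  assumes "\<omega> \<in> extensional (carr Q)" "\<omega>' \<in> extensional (carr Q)" "pull \<omega> = pull \<omega>'"
  shows "\<omega> = \<omega>'"
proof (rule extensionalityI[OF assms(1,2)])
  fix X assume "X \<in> carr Q"
  then obtain a where a: "a \<in> carr A" "X = q a" by (auto simp: quotient_carr)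
  then show "\<omega> X = \<omega>' X" using fun_cong[OF assms(3), of a] by (simp add: pull_def)
qed

text \<open>Replaces the supremum by two quantified conditions that can be compared along
  \<open>q\<close>. It is stated for an arbitrary \<open>B\<close> so as to cover \<open>A\<close>
  and \<open>Q\<close>, and its side condition excludes a supremum over the empty set.\<close>

lemma state_iff:
  "state B \<omega> \<longleftrightarrow> \<omega> \<in> extensional (carr B) \<and>
     (\<forall>a\<in>carr B. \<forall>b\<in>carr B. \<omega> (vadd B a b) = \<omega> a + \<omega> b) \<and> (\<forall>c. \<forall>a\<in>carr B. \<omega> (smul B c a) = c * \<omega> a) \<and>
     (\<forall>a\<in>carr B. \<omega> (mul B (star B a) a) \<in> \<real>\<^sub>\<ge>\<^sub>0) \<and>
     (\<forall>a\<in>carr B. nrm B a \<le> 1 \<longrightarrow> cmod (\<omega> a) \<le> 1) \<and>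
     (\<forall>\<epsilon>>0. \<exists>a\<in>carr B. nrm B a \<le> 1 \<and> cmod (\<omega> a) > 1 - \<epsilon>)"
  if "\<exists>a\<in>carr B. nrm B a \<le> 1"
proof -
  let ?S = "{cmod (\<omega> a) |a. a \<in> carr B \<and> nrm B a \<le> 1}"
  have "?S \<noteq> {}" using that by blast
  note * = Sup_eq_one_iff[OF this]
  have "(\<forall>s\<in>?S. s \<le> 1) \<and> (\<forall>\<epsilon>>0. \<exists>s\<in>?S. s > 1 - \<epsilon>) \<longleftrightarrow>
     (\<forall>a\<in>carr B. nrm B a \<le> 1 \<longrightarrow> cmod (\<omega> a) \<le> 1) \<and>
     (\<forall>\<epsilon>>0. \<exists>a\<in>carr B. nrm B a \<le> 1 \<and> cmod (\<omega> a) > 1 - \<epsilon>)" by blast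
  then show ?thesis unfolding state_def using * by (simp del: not_less)
qed

text \<open>The quotient map sends the unit ball into the unit ball, and a coset of norm at most 1
  has representatives of norm below 1 + d for every d > 0; so the norm conditions on both sides
  agree.\<close>

lemma pull_state_iff:
  assumes ext: "\<omega> \<in> extensional (carr Q)"
  shows "state A (pull \<omega>) \<longleftrightarrow> state Q \<omega>"
proof -
  have zA: "\<exists>a\<in>carr A. nrm A a \<le> 1" by (rule bexI[of _ "vzero A"]) simp_all
  have zQ: "\<exists>X\<in>carr Q. nrm Q X \<le> 1"
    by (rule bexI[of _ "q (vzero A)"]) (use quotient_norm_le[of "vzero A"] in simp_all)
  have pull: "pull \<omega> a = \<omega> (q a)" if "a \<in> carr A" for a using that by (simp add: pull_def)
  show ?thesis
  proof
    assume s: "state A (pull \<omega>)"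
    have le: "cmod (\<omega> (q a)) \<le> nrm Q (q a)" if a: "a \<in> carr A" for a
    proof (rule field_le_epsilon)
      fix e :: real assume "e > 0"
      then obtain x where x: "x \<in> carr A" "q x = q a" "nrm A x < nrm Q (q a) + e"
        using quotient_norm_approx[OF a] by blast
      then show "cmod (\<omega> (q a)) \<le> nrm Q (q a) + e" using state_bound[OF s x(1)] by (simp add: pull)
    qed
    show "state Q \<omega>"
      unfolding state_iff[OF zQ] quotient_carr ball_simps bex_simps
    proof (intro conjI ballI allI impI)
      show "\<omega> \<in> extensional (q ` carr A)" using ext by (simp add: quotient_carr)
      fix a assume a: "a \<in> carr A"
      show "\<omega> (vadd Q (q a) (q b)) = \<omega> (q a) + \<omega> (q b)" if b: "b \<in> carr A" for b
        using state_add[OF s a b] a b by (simp add: quotient_ops pull)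
      show "\<omega> (smul Q c (q a)) = c * \<omega> (q a)" for c
        using state_smul[OF s a, of c] a by (simp add: quotient_ops pull)
      show "\<omega> (mul Q (star Q (q a)) (q a)) \<in> \<real>\<^sub>\<ge>\<^sub>0"
        using state_positive[OF s] a by (simp add: quotient_ops positive_on_def pull)
      show "cmod (\<omega> (q a)) \<le> 1" if "nrm Q (q a) \<le> 1" using le[OF a] that by simp
    next
      fix \<epsilon> :: real assume "\<epsilon> > 0"
      then obtain e where e: "e \<in> carr A" "nrm A e \<le> 1" "Re (pull \<omega> e) > 1 - \<epsilon>" using state_approx[OF s] by blast
      then show "\<exists>x\<in>carr A. nrm Q (q x) \<le> 1 \<and> 1 - \<epsilon> < cmod (\<omega> (q x))"
        using quotient_norm_le[OF e(1)] complex_Re_le_cmod[of "pull \<omega> e"] by (intro bexI[of _ e]) (auto simp: pull)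
    qed
  next
    assume s: "state Q \<omega>"
    note s' = s[unfolded state_iff[OF zQ]]
    show "state A (pull \<omega>)"
      unfolding state_iff[OF zA]
    proof (intro conjI ballI allI impI)
      show "pull \<omega> \<in> extensional (carr A)" by (simp add: pull_def)
      fix a assume a: "a \<in> carr A"
      show "pull \<omega> (vadd A a b) = pull \<omega> a + pull \<omega> b" if b: "b \<in> carr A" for b
        using s' a b by (simp add: pull quotient_add[symmetric])
      show "pull \<omega> (smul A c a) = c * pull \<omega> a" for c
        using s' a by (simp add: pull quotient_smul[symmetric])
      show "pull \<omega> (mul A (star A a) a) \<in> \<real>\<^sub>\<ge>\<^sub>0"
        using s' a by (simp add: pull quotient_mul[symmetric] quotient_star[symmetric])
      show "cmod (pull \<omega> a) \<le> 1" if "nrm A a \<le> 1"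
        using s' a that quotient_norm_le[OF a] by (simp add: pull)
    next
      fix \<epsilon> :: real assume e: "\<epsilon> > 0"
      \<comment> \<open>A representative of norm below 1 + d is scaled by 1/(1 + d), and (1 - d)/(1
        + d) \<ge> 1 - 2d \<ge> 1 - \<epsilon>.\<close>
      define d where "d = min (\<epsilon> / 2) 1"
      have d: "d > 0" "d \<le> \<epsilon> / 2" "d \<le> 1" using e by (auto simp: d_def)
      obtain X where X: "X \<in> carr Q" "nrm Q X \<le> 1" "cmod (\<omega> X) > 1 - d" using s' d by blast
      obtain a where a: "a \<in> carr A" "X = q a" using X(1) by (auto simp: quotient_carr)
      obtain x where x: "x \<in> carr A" "q x = q a" "nrm A x < nrm Q (q a) + d"
        using quotient_norm_approx[OF a(1) d(1)] by blast
      let ?y = "smul A (of_real (1 / (1 + d))) x"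
      have d1: "1 + d > 0" using d by simp
      have y: "?y \<in> carr A" using x by simp
      have c: "cmod (of_real (1 / (1 + d))) = 1 / (1 + d)" using d1 by (simp only: norm_of_real) simp
      have "nrm A ?y \<le> 1" using x X a d1 by (simp add: n_smul c del: of_real_divide of_real_add)
      moreover have "cmod (pull \<omega> ?y) > 1 - \<epsilon>"
      proof -
        have "pull \<omega> ?y = of_real (1 / (1 + d)) * \<omega> X"
          using s' x a X(1) by (simp add: pull quotient_smul[symmetric])
        then have "cmod (pull \<omega> ?y) = cmod (\<omega> X) / (1 + d)" using d1 by (simp add: norm_mult c del: of_real_divide of_real_add)
        moreover have "(1 - d) / (1 + d) < cmod (\<omega> X) / (1 + d)" using X(3) d1 by (intro divide_strict_right_mono) auto
        moreover have "1 - \<epsilon> \<le> (1 - d) / (1 + d)"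
        proof -
          have "(1 - \<epsilon>) * (1 + d) \<le> (1 - 2 * d) * (1 + d)" using d by (intro mult_right_mono) auto
          also have "\<dots> \<le> 1 - d" using d by (simp add: algebra_simps)
          finally show ?thesis using d1 by (simp add: pos_le_divide_eq)
        qed
        ultimately show ?thesis by linarith
      qed
      ultimately show "\<exists>a\<in>carr A. nrm A a \<le> 1 \<and> 1 - \<epsilon> < cmod (pull \<omega> a)" using y by blast
    qed
  qed
qed

lemma descend_state:
  assumes s: "state A \<rho>" and k: "\<And>i. i \<in> I \<Longrightarrow> \<rho> i = 0"
  shows "\<exists>\<omega>. state Q \<omega> \<and> \<rho> = pull \<omega>"
proof -
  define \<omega> where "\<omega> = (\<lambda>X\<in>carr Q. \<rho> (SOME a. a \<in> X))"
  have "\<omega> (q a) = \<rho> a" if a: "a \<in> carr A" for a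
  proof -
    let ?b = "SOME b. b \<in> q a"
    have "?b \<in> q a" by (rule someI[of "\<lambda>y. y \<in> q a" a]) (rule coset_self[OF a])
    then have b: "?b \<in> carr A" and d: "vdiff A ?b a \<in> I" using a by (simp_all add: coset_mem_iff)
    then have "\<rho> ?b = \<rho> a" using k[OF d] state_diff[OF s b a] by simp
    then show ?thesis using a by (simp add: \<omega>_def)
  qed
  then have "\<rho> = pull \<omega>" using s by (auto simp: pull_def fun_eq_iff state_def extensional_def)
  moreover have "\<omega> \<in> extensional (carr Q)" by (simp add: \<omega>_def)
  ultimately show ?thesis using s pull_state_iff by blast
qed

text \<open>A convex decomposition of a pulled back state consists again of pulled back states,
  because its members vanish on \<open>I\<close>.\<close>

lemma pull_pure_iff:
  assumes ext: "\<omega> \<in> extensional (carr Q)"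
  shows "pull \<omega> \<in> pure_states A \<longleftrightarrow> \<omega> \<in> pure_states Q"
proof
  assume p: "pull \<omega> \<in> pure_states A"
  then have "state A (pull \<omega>)" by (simp add: pure_states_def)
  then have s: "state Q \<omega>" using pull_state_iff[OF ext] by simp
  have ind: "\<phi> = \<omega> \<and> \<psi> = \<omega>" if st: "state Q \<phi>" "state Q \<psi>" and t: "0 < t" "t < (1::real)"
    and eq: "\<forall>X\<in>carr Q. \<omega> X = of_real t * \<phi> X + of_real (1 - t) * \<psi> X" for \<phi> \<psi> t
  proof -
    have e: "\<phi> \<in> extensional (carr Q)" "\<psi> \<in> extensional (carr Q)" using st by (auto simp: state_def)
    have "state A (pull \<phi>)" "state A (pull \<psi>)" using st pull_state_iff e by auto
    moreover have "\<forall>a\<in>carr A. pull \<omega> a = of_real t * pull \<phi> a + of_real (1 - t) * pull \<psi> a"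
      using eq by (simp add: pull_def)
    ultimately have "pull \<phi> = pull \<omega> \<and> pull \<psi> = pull \<omega>" using p t unfolding pure_states_def by blast
    then show ?thesis using pull_inj[OF e(1) ext] pull_inj[OF e(2) ext] by blast
  qed
  then show "\<omega> \<in> pure_states Q" using s unfolding pure_states_def by blast
next
  assume p: "\<omega> \<in> pure_states Q"
  then have sQ: "state Q \<omega>" by (simp add: pure_states_def)
  then have s: "state A (pull \<omega>)" using pull_state_iff[OF ext] by simp
  \<comment> \<open>At \<open>mul A (star A i) i\<close> two nonnegative numbers with positive
    weights add up to 0, so \<phi> vanishes there; \<open>state_square_bound\<close> passes to
    \<open>i\<close> itself.\<close>
  have kill: "\<phi> i = 0" if st: "state A \<phi>" "state A \<psi>" and t: "0 < t" "t < (1::real)"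
    and eq: "\<forall>a\<in>carr A. pull \<omega> a = of_real t * \<phi> a + of_real (1 - t) * \<psi> a" and i: "i \<in> I" for \<phi> \<psi> t i
  proof -
    let ?h = "mul A (star A i) i"
    have h: "?h \<in> I" "?h \<in> carr A" using i by simp_all
    have "pull \<omega> ?h = \<omega> (smul Q 0 (q ?h))" using h by (simp add: pull_def zero_coset)
    also have "\<dots> = 0" using sQ h by (simp add: state_def del: Q.zero_simps)
    finally have "of_real t * \<phi> ?h + of_real (1 - t) * \<psi> ?h = 0" using eq h(2) by simp
    then have "Re (of_real t * \<phi> ?h + of_real (1 - t) * \<psi> ?h) = 0" by (simp only: zero_complex.sel)
    then have "0 = t * Re (\<phi> ?h) + (1 - t) * Re (\<psi> ?h)" by simp
    moreover have "Re (\<phi> ?h) \<ge> 0" "Re (\<psi> ?h) \<ge> 0"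
      using st i by (auto simp: state_def complex_nonneg_Reals_iff)
    ultimately have "Re (\<phi> ?h) = 0" using t
      by (smt (verit, best) mult_nonneg_nonneg mult_pos_pos)
    then show ?thesis using state_square_bound[OF st(1), of i] i by simp
  qed
  have ind: "\<phi> = pull \<omega> \<and> \<psi> = pull \<omega>" if st: "state A \<phi>" "state A \<psi>" and t: "0 < t" "t < (1::real)"
    and eq: "\<forall>a\<in>carr A. pull \<omega> a = of_real t * \<phi> a + of_real (1 - t) * \<psi> a" for \<phi> \<psi> t
  proof -
    obtain \<phi>' where f: "state Q \<phi>'" "\<phi> = pull \<phi>'" using descend_state[OF st(1) kill[OF st t eq]] by blast
    have eq': "\<forall>a\<in>carr A. pull \<omega> a = of_real (1 - t) * \<psi> a + of_real (1 - (1 - t)) * \<phi> a"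
      using eq by (simp add: add.commute)
    obtain \<psi>' where g: "state Q \<psi>'" "\<psi> = pull \<psi>'"
      using descend_state[OF st(2) kill[OF st(2,1) _ _ eq']] t by auto
    have "\<forall>X\<in>carr Q. \<omega> X = of_real t * \<phi>' X + of_real (1 - t) * \<psi>' X"
      using eq by (auto simp: quotient_carr f(2) g(2) pull_def)
    then have "\<phi>' = \<omega> \<and> \<psi>' = \<omega>" using p f(1) g(1) t unfolding pure_states_def by blast
    then show ?thesis using f g by blast
  qed
  then show "pull \<omega> \<in> pure_states A" using s unfolding pure_states_def by blast
qed

text \<open>For j = ib in \<open>I\<close> the squared norm of \<pi>(j)y is the value of the vector
  state at \<open>mul A (star A j) j\<close>, hence 0. So \<pi>(I) kills the orbit of
  \<open>y\<close>, which is total.\<close>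

lemma kills_of_vanishing:
  assumes irr: "irreducible_rep A \<pi>" and y: "y \<in> unit_vectors (rspace \<pi>)"
    and k: "\<And>i. i \<in> I \<Longrightarrow> vecstate A \<pi> y i = 0"
  shows "I \<subseteq> rep_ker A \<pi>"
proof
  let ?H = "rspace \<pi>"
  note r = irr_rep[OF irr]
  interpret H: hilbert_space ?H by (rule rep_hilbert[OF r])
  have yc [simp]: "y \<in> carr ?H" and yn: "y \<noteq> vzero ?H" using y by (auto simp: unit_vectors_def)
  note [simp] = rep_closed[OF r]
  have z: "rop \<pi> i (rop \<pi> b y) = vzero ?H" if i: "i \<in> I" and b: "b \<in> carr A" for i b
  proof -
    let ?j = "mul A i b"
    have j: "?j \<in> I" "?j \<in> carr A" using i b by simp_all
    have "inn ?H (rop \<pi> ?j y) (rop \<pi> ?j y) = vecstate A \<pi> y (mul A (star A ?j) ?j)"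
      using j by (simp add: vecstate_def rep_adjoint[OF r] rep_mul[OF r j(2)] rep_mul[OF r _ j(2)])
    also have "\<dots> = 0" using k[of "mul A (star A ?j) ?j"] j by simp
    finally have "rop \<pi> ?j y = vzero ?H" using j H.inn_definite by simp
    then show ?thesis using i b by (simp add: rep_mul[OF r])
  qed
  fix i assume i: "i \<in> I"
  have "rop \<pi> i v = vzero ?H" if v: "v \<in> carr ?H" for v
  proof (rule H.total_ext[OF rep_cyclic[OF irr yc yn]])
    fix w assume "w \<in> (\<lambda>a. rop \<pi> a y) ` carr A"
    then obtain b where b: "b \<in> carr A" "w = rop \<pi> b y" by auto
    have "inn ?H w (rop \<pi> i v) = inn ?H (rop \<pi> (star A i) w) v"
      using i b v by (simp add: rep_star[OF r])
    also have "rop \<pi> (star A i) w = vzero ?H" using z[of "star A i" b] i b by simp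
    finally show "inn ?H w (rop \<pi> i v) = inn ?H w (vzero ?H)" using v b by simp
  qed (use i v in auto)
  then show "i \<in> rep_ker A \<pi>" using i by (simp add: rep_ker_def)
qed

text \<open>A pure state of \<open>Q\<close> pulls back to a vector state of an irreducible \<pi> of
  \<open>A\<close>. As this state vanishes on \<open>I\<close>, so does \<pi>, which therefore
  descends.\<close>

lemma quotient_pure_state_alg: "pure_state_alg Q"
proof unfold_locales
  fix \<omega> assume w: "\<omega> \<in> pure_states Q"
  then have s: "state Q \<omega>" and ext: "\<omega> \<in> extensional (carr Q)" by (auto simp: pure_states_def state_def)
  have "pull \<omega> \<in> pure_states A" using pull_pure_iff[OF ext] w by simp
  then obtain \<pi> :: "'a std_rep" and y where p: "irreducible_rep A \<pi>" "y \<in> unit_vectors (rspace \<pi>)"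
    and eq: "pull \<omega> = vecstate A \<pi> y" using pure_state_vector by blast
  have yc: "y \<in> carr (rspace \<pi>)" using p by (simp add: unit_vectors_def)
  have "pull \<omega> i = 0" if i: "i \<in> I" for i
  proof -
    have "pull \<omega> i = \<omega> (smul Q 0 (q i))" using i by (simp add: pull_def zero_coset)
    also have "\<dots> = 0" using s i by (simp add: state_def del: Q.zero_simps)
    finally show ?thesis .
  qed
  then have "I \<subseteq> rep_ker A \<pi>" using kills_of_vanishing[OF p] by (simp add: eq)
  then obtain \<sigma>0 where o: "over \<sigma>0 \<pi>" using over_descend[OF irr_rep[OF p(1)]] by blast
  have i0: "irreducible_rep Q \<sigma>0" using over_irr_iff[OF o] p(1) by simp
  \<comment> \<open>The descended representation still acts on the space of \<pi>, which has the
    standard type for \<open>A\<close>; an equivalent one of the standard type for \<open>Q\<close>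
    is needed.\<close>
  obtain \<sigma> :: "'a set std_rep" where sg: "irreducible_rep Q \<sigma>" "unitarily_equivalent Q \<sigma>0 \<sigma>"
    using Q.std_rep_exists[OF i0] by blast
  obtain u where u: "intertwines Q \<sigma>0 \<sigma> u" using sg(2) by (auto simp: unitarily_equivalent_iff)
  have y0: "y \<in> carr (rspace \<sigma>0)" using yc over_space[OF o] by simp
  have "vecstate Q \<sigma>0 y = \<omega>"
    by (rule pull_inj[OF _ ext]) (simp_all add: pull_vecstate[OF o yc] eq, simp add: vecstate_def)
  then have "\<omega> = vecstate Q \<sigma> (u y)" using intertwines_vecstate[OF u irr_rep[OF i0] y0] by simp
  moreover have "u y \<in> unit_vectors (rspace \<sigma>)"
    using p(2) y0 unitary_closed[OF intertwines_unitary[OF u] y0] unitary_hnorm[OF intertwines_unitary[OF u] y0]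
    by (simp add: unit_vectors_def over_space[OF o])
  ultimately show "\<exists>(\<pi> :: 'a set std_rep) x. irreducible_rep Q \<pi> \<and> x \<in> unit_vectors (rspace \<pi>) \<and> \<omega> = vecstate Q \<pi> x"
    using sg(1) by blast
next
  fix \<sigma> :: "'a set std_rep" and x assume s: "irreducible_rep Q \<sigma>" and x: "x \<in> unit_vectors (rspace \<sigma>)"
  let ?\<pi> = "\<lparr>rspace = rspace \<sigma>, rop = (\<lambda>a. rop \<sigma> (q a))\<rparr>"
  note o = over_pull[of \<sigma>]
  have p: "irreducible_rep A ?\<pi>" using over_irr_iff[OF o] s by simp
  have xc: "x \<in> carr (rspace ?\<pi>)" using x by (simp add: unit_vectors_def)
  have "vecstate A ?\<pi> x \<in> pure_states A" using irreducible_vecstate_pure[OF p] x by simp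
  then have "pull (vecstate Q \<sigma> x) \<in> pure_states A" using pull_vecstate[OF o xc] by simp
  then show "vecstate Q \<sigma> x \<in> pure_states Q" using pull_pure_iff[of "vecstate Q \<sigma> x"] by (simp add: vecstate_def)
qed

text \<open>Every element of \<open>A\<close> occurs in the relation, so intertwiners and
  evaluations transfer directly, and the hull of a set corresponds to that of its image under
  \<open>q\<close>.\<close>

lemma quotient_bundle_iso: "bundle_iso Q A {(q a, a) |a. a \<in> carr A} (spectrum A - spectrum_supp A I)"
proof -
  let ?G = "{(q a, a) |a. a \<in> carr A}" and ?U = "spectrum A - spectrum_supp A I"
  interpret PA: pure_state_alg A by (rule cstar_pure_state_alg) (rule cstar_algebra_axioms)
  interpret PQ: pure_state_alg Q by (rule quotient_pure_state_alg)
  interpret P: bundle_pair Q A ?G ?U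
    by unfold_locales (auto simp: quotient_carr)
  have IA: "I \<subseteq> carr A" by auto
  have U: "irrep_class A \<pi> \<in> ?U \<longleftrightarrow> I \<subseteq> rep_ker A \<pi>" if "irreducible_rep A \<pi>" for \<pi>
    using PA.spectrum_supp_iff[OF that IA] PA.class_spectrum[OF that] by blast
  show ?thesis
  proof unfold_locales
    fix \<sigma> :: "'a set std_rep" assume s: "irreducible_rep Q \<sigma>"
    let ?\<pi> = "\<lparr>rspace = rspace \<sigma>, rop = (\<lambda>a. rop \<sigma> (q a))\<rparr>"
    note o = over_pull[of \<sigma>]
    have p: "irreducible_rep A ?\<pi>" using over_irr_iff[OF o] s by simp
    obtain \<pi> :: "'a std_rep" where pi: "irreducible_rep A \<pi>" "unitarily_equivalent A ?\<pi> \<pi>"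
      using std_rep_exists[OF p] by blast
    obtain u where u: "intertwines A ?\<pi> \<pi> u" using pi(2) by (auto simp: unitarily_equivalent_iff)
    have "I \<subseteq> rep_ker A \<pi>"
      using over_kills[OF o irr_rep[OF p]] PA.rep_ker_equiv[OF pi(2) irr_rep[OF p] irr_rep[OF pi(1)]] by blast
    then have "irrep_class A \<pi> \<in> ?U" using U[OF pi(1)] by simp
    then have "P.related \<sigma> \<pi> u"
      using s pi(1) intertwines_unitary[OF u] intertwines_rop[OF u] by (auto simp: P.related_def)
    then show "\<exists>\<pi> u. P.related \<sigma> \<pi> u" by blast
  next
    fix \<pi> :: "'a std_rep" assume p: "irreducible_rep A \<pi>" and c: "irrep_class A \<pi> \<in> ?U"
    then have k: "I \<subseteq> rep_ker A \<pi>" using U by simp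
    obtain \<sigma>0 where o: "over \<sigma>0 \<pi>" using over_descend[OF irr_rep[OF p] k] by blast
    have i0: "irreducible_rep Q \<sigma>0" using over_irr_iff[OF o] p by simp
    obtain \<sigma> :: "'a set std_rep" where s: "irreducible_rep Q \<sigma>" "unitarily_equivalent Q \<sigma>0 \<sigma>"
      using Q.std_rep_exists[OF i0] by blast
    obtain w where w: "intertwines Q \<sigma> \<sigma>0 w"
      using equiv_sym[OF s(2) irr_rep[OF i0]] by (auto simp: unitarily_equivalent_iff)
    have W: "unitary_map (rspace \<sigma>) (rspace \<pi>) w" using intertwines_unitary[OF w] over_space[OF o] by simp
    have "P.related \<sigma> \<pi> w"
      using s(1) p c W intertwines_rop[OF w] over_rop[OF o] unitary_closed[OF W] by (auto simp: P.related_def)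
    then show "\<exists>\<sigma> u. P.related \<sigma> \<pi> u" by blast
  next
    fix \<pi> \<pi>' :: "'a std_rep" and v
    assume v: "unitary_map (rspace \<pi>) (rspace \<pi>') v"
      and eq: "\<And>b a x. \<lbrakk>(b, a) \<in> ?G; x \<in> carr (rspace \<pi>)\<rbrakk> \<Longrightarrow> v (rop \<pi> a x) = rop \<pi>' a (v x)"
    have "v (rop \<pi> a x) = rop \<pi>' a (v x)" if "a \<in> carr A" "x \<in> carr (rspace \<pi>)" for a x
      using eq[of "q a" a x] that by auto
    then show "intertwines A \<pi> \<pi>' v" using v by (simp add: intertwines_def)
  next
    fix a and \<Psi> :: "('a set \<Rightarrow> complex) \<Rightarrow> 'a \<Rightarrow> complex"
    assume a: "a \<in> carr A" and ext: "\<And>\<omega> b a. \<lbrakk>\<omega> \<in> pure_states Q; (b, a) \<in> ?G\<rbrakk> \<Longrightarrow> \<Psi> \<omega> a = \<omega> b"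
    have "continuous_map (pure_state_topology Q) euclidean (\<lambda>\<omega>. \<omega> (q a))"
      by (rule PQ.continuous_map_eval) (simp add: a)
    then show "continuous_map (pure_state_topology Q) euclidean (\<lambda>\<omega>. \<Psi> \<omega> a)"
    proof (rule continuous_map_eq)
      fix \<omega> assume "\<omega> \<in> topspace (pure_state_topology Q)"
      then show "\<omega> (q a) = \<Psi> \<omega> a" using ext[of \<omega> "q a" a] a by auto
    qed
  next
    fix S assume S: "S \<subseteq> carr A"
    have "S \<subseteq> rep_ker A \<pi> \<longleftrightarrow> q ` S \<subseteq> rep_ker Q \<sigma>" if r: "P.related \<sigma> \<pi> u" for \<sigma> \<pi> u
      using P.related_ker[OF r, of "q _" _] S by blast
    then show "\<exists>T\<subseteq>carr Q. \<forall>\<sigma> \<pi> u. P.related \<sigma> \<pi> u \<longrightarrow> (S \<subseteq> rep_ker A \<pi> \<longleftrightarrow> T \<subseteq> rep_ker Q \<sigma>)"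
      using S by (intro exI[of _ "q ` S"]) (auto simp: quotient_carr)
  qed
qed

end

theorem proposition2p5:
  fixes A :: "'a cstar" and I :: "'a set"
  assumes "cstar_algebra A" and "closed_ideal A I"
  shows "uniformly_kaehler_isomorphic (ukb (ideal_algebra A I))
           (restrict_bundle (ukb A) (spectrum_supp A I)) \<and>
         uniformly_kaehler_isomorphic (ukb (quotient_algebra A I))
           (restrict_bundle (ukb A) (spectrum A - spectrum_supp A I))"
proof
  show "uniformly_kaehler_isomorphic (ukb (ideal_algebra A I)) (restrict_bundle (ukb A) (spectrum_supp A I))"
    by (rule bundle_iso.bundle_isomorphic[OF ideal_bundle_iso[OF assms]])
  have "quotient_cstar A I" using assms by (simp add: quotient_cstar_def quotient_cstar_axioms_def)
  then show "uniformly_kaehler_isomorphic (ukb (quotient_algebra A I))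
      (restrict_bundle (ukb A) (spectrum A - spectrum_supp A I))"
    by (rule bundle_iso.bundle_isomorphic[OF quotient_cstar.quotient_bundle_iso])
qed

end
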